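(* Let $\mathcal V$ be a minimal enclosure of the local channel $\mathfrak L$ with $\sum_{\underline k\in V}\mathrm{Tr}(A(\mathcal V)\rho(\underline k))>0$, let $\tau_0$ be the unique invariant state of $\mathfrak L$ supported on $\mathcal V$, and let $\mathbb P'_\rho$ be the probability measure associated with $\mathcal V$ and $\rho$, with expectation $\mathbb E'_\rho$. Define $$m=\sum_{i=1}^v\mathrm{Tr}(L_i\tau_0L_i^* )\,s_i\in\mathbb R^d$$ and let $D$ be the unique symmetric matrix satisfying $\langle u,Du\rangle=\lambda''_u-(\lambda'_u)^2$ for every $u\in\mathbb R^d$. Then, under $\mathbb P'_\rho$, $$\frac{(X_n-X_0)-nm}{\sqrt n}\longrightarrow\mathcal N(0,D)\quad\text{in law as }n\to\infty,$$ where $\mathcal N(0,D)$ is the centered (possibly degenerate) Gaussian measure with covariance $D$. Moreover $$\left|\frac{\mathbb E'_\rho[X_n-X_0]}{n}-m\right|=O\left(\frac1n\right).$$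
   Context: **Walk.** $V\subset\mathbb R^d$ is a locally finite lattice containing $0$, positively generated by a finite set $S=\{s_1,\dots,s_v\}\neq\{0\}$. $\mathfrak h$ is a finite-dimensional complex Hilbert space, $B(\mathfrak h)$ its bounded operators, $L^1(\mathfrak h)$ its trace-class operators. $L_1,\dots,L_v\in B(\mathfrak h)$ satisfy $\sum_i L_i^*L_i=1_{\mathfrak h}$. The local channel is $\mathfrak L(\sigma)=\sum_{i=1}^v L_i\sigma L_i^*$ on $L^1(\mathfrak h)$, with dual $\mathfrak L^*(x)=\sum_i L_i^*xL_i$ on $B(\mathfrak h)$. The initial state is $\rho=\sum_{\underline k\in V}\rho(\underline k)\otimes|\underline k\rangle\langle\underline k|$ with $\rho(\underline k)\ge 0$ in $L^1(\mathfrak h)$ and $\sum_{\underline k}\mathrm{Tr}\,\rho(\underline k)=1$. **Quantum trajectory.** Let $J=\{1,\dots,v\}$, $\Omega=V\times J^{\mathbb N}$ with the $\sigma$-algebra $\mathcal F$ generated by cylinder sets, and $\mathcal F_n$ the $\sigma$-algebra generated by the $V$-coordinate and the first $n$ $J$-coordinates. $\mathbb P_\rho$ is the unique probability on $(\Omega,\mathcal F)$ with $\mathbb P_\rho(\{\underline k\}\times J^{\mathbb N})=\mathrm{Tr}\,\rho(\underline k)$ and $\mathbb P_\rho(\{(\underline k,j_1,\dots,j_n)\}\times J^{\mathbb N})=\mathrm{Tr}(L_{j_n}\cdots L_{j_1}\rho(\underline k)L_{j_1}^*\cdots L_{j_n}^* )$; $\mathbb E_\rho$ is its expectation. For $\omega=(\underline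 k,j_1,j_2,\dots)$: $X_0=\underline k$, $X_{n+1}=X_n+s_{j_{n+1}}$, and ($\mathbb P_\rho$-a.s.) $\rho_0=\rho(\underline k)/\mathrm{Tr}\,\rho(\underline k)$, $\rho_{n+1}=L_{j_{n+1}}\rho_nL_{j_{n+1}}^*/\mathrm{Tr}(L_{j_{n+1}}\rho_nL_{j_{n+1}}^* )$. **Enclosures.** A subspace $\mathcal V\subset\mathfrak h$ is an enclosure for $\mathfrak L$ if for every positive $\omega\in L^1(\mathfrak h)$, $\mathrm{supp}(\omega)\subset\mathcal V$ implies $\mathrm{supp}(\mathfrak L(\omega))\subset\mathcal V$ (support of a positive operator $=\ker^\perp$). A minimal enclosure is a nonzero enclosure containing no enclosures other than $\{0\}$ and itself; it is the support of a unique invariant state of $\mathfrak L$. With $p_{\mathcal V}$ the orthogonal projection onto $\mathcal V$, the absorption operator is $A(\mathcal V)=\lim_{n\to\infty}\mathfrak L^{*n}(p_{\mathcal V})$, and $\tilde p_{\mathcal V}$ is the orthogonal projection onto $\mathrm{supp}(A(\mathcal V))$. **The measure $\mathbb P'_\rho$.** $Y_n=\mathrm{Tr}(A(\mathcal V)\rho_n)$ is a bounded positive $\mathbb P_\rho$-martingale with a.s. and $L^1$ limit $Y_\infty$; $\mathbb E_\rho[Y_0]=\sum_{\underline k}\mathrm{Tr}(A(\mathcal V)\rho(\underline k))$. When this is $>0$, $\mathbb P'_\rho$ is defined by $\frac{d\mathbb P'_\rho}{d\mathbb P_\rho}=Y_\infty/\mathbb E_\rho[Y_0]$, equivalently its density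 on $\mathcal F_n$ is $Y_n/\mathbb E_\rho[Y_0]$. **Spectral data.** For $u\in\mathbb R^d$, $\lambda_u$ is the spectral radius of $\tilde{\mathfrak L}_u(\sigma)=\sum_{i=1}^v e^{u\cdot s_i}\,\tilde p_{\mathcal V}L_i\tilde p_{\mathcal V}\,\sigma\,\tilde p_{\mathcal V}L_i^*\tilde p_{\mathcal V}$ on $L^1(\mathfrak h)$ (it is smooth in $u$ near $0$), and $\lambda'_u=\frac{d}{dt}\lambda_{tu}|_{t=0}$, $\lambda''_u=\frac{d^2}{dt^2}\lambda_{tu}|_{t=0}$. *)

theory Defs
  imports "HOL-Probability.Probability" "HOL-Library.Landau_Symbols"
begin

text \<open>
  The local Hilbert space is \<open>complex ^ 'n\<close>, operators on it are matrices \<open>complex ^ 'n ^ 'n\<close>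
  (in finite dimension every operator is bounded and trace class), the walk takes place in
  \<open>real ^ 'd\<close>, and the index set \<open>{1,\<dots>,v}\<close> is the finite type \<open>'j\<close>.
\<close>

section \<open>Operators on a finite-dimensional Hilbert space\<close>

definition cinner :: "complex ^ 'n \<Rightarrow> complex ^ 'n \<Rightarrow> complex" where
  "cinner x y = (\<Sum>i\<in>UNIV. cnj (x $ i) * y $ i)"

definition dagger :: "complex ^ 'n ^ 'n \<Rightarrow> complex ^ 'n ^ 'n" where
  "dagger A = (\<chi> i j. cnj (A $ j $ i))"

definition positive_op :: "complex ^ 'n ^ 'n \<Rightarrow> bool" where
  "positive_op A \<longleftrightarrow> (\<forall>x. cinner x (A *v x) \<in> \<real> \<and> 0 \<le> Re (cinner x (A *v x)))"

definition supp :: "complex ^ 'n ^ 'n \<Rightarrow> (complex ^ 'n) set" where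
  "supp A = {x. \<forall>y. A *v y = 0 \<longrightarrow> cinner y x = 0}"

definition orth_proj :: "(complex ^ 'n) set \<Rightarrow> complex ^ 'n ^ 'n" where
  "orth_proj W = (THE P. P ** P = P \<and> dagger P = P \<and> range ((*v) P) = W)"

text \<open>The product \<open>mat z ** \<sigma>\<close> is the complex scalar multiple \<open>z \<sigma>\<close>.\<close>

definition superop_spectrum :: "(complex ^ 'n ^ 'n \<Rightarrow> complex ^ 'n ^ 'n) \<Rightarrow> complex set" where
  "superop_spectrum T = {z. \<not> bij (\<lambda>\<sigma>. mat z ** \<sigma> - T \<sigma>)}"

definition superop_spectral_radius :: "(complex ^ 'n ^ 'n \<Rightarrow> complex ^ 'n ^ 'n) \<Rightarrow> real" where
  "superop_spectral_radius T = (SUP z\<in>superop_spectrum T. cmod z)"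

section \<open>The lattice and the local channel\<close>

definition locally_finite_lattice :: "(real ^ 'd) set \<Rightarrow> bool" where
  "locally_finite_lattice V \<longleftrightarrow>
     0 \<in> V \<and> (\<forall>x\<in>V. \<forall>y\<in>V. x - y \<in> V) \<and> (\<forall>r. finite (V \<inter> cball 0 r))"

definition positively_generated :: "(real ^ 'd) set \<Rightarrow> ('j::finite \<Rightarrow> real ^ 'd) \<Rightarrow> bool" where
  "positively_generated V s \<longleftrightarrow>
     V = range (\<lambda>c :: 'j \<Rightarrow> nat. \<Sum>j\<in>UNIV. real (c j) *\<^sub>R s j)"

definition channel ::
  "('j::finite \<Rightarrow> complex ^ 'n ^ 'n) \<Rightarrow> complex ^ 'n ^ 'n \<Rightarrow> complex ^ 'n ^ 'n" where
  "channel L \<sigma> = (\<Sum>j\<in>UNIV. L j ** \<sigma> ** dagger (L j))"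

definition dual_channel ::
  "('j::finite \<Rightarrow> complex ^ 'n ^ 'n) \<Rightarrow> complex ^ 'n ^ 'n \<Rightarrow> complex ^ 'n ^ 'n" where
  "dual_channel L x = (\<Sum>j\<in>UNIV. dagger (L j) ** x ** L j)"

text \<open>The state \<open>\<Sum>k\<in>V. \<rho>(k) \<otimes> |k><k|\<close> is represented by its family of blocks \<open>\<rho>(k)\<close>.\<close>

definition initial_state :: "(real ^ 'd) set \<Rightarrow> (real ^ 'd \<Rightarrow> complex ^ 'n ^ 'n) \<Rightarrow> bool" where
  "initial_state V \<rho> \<longleftrightarrow>
     (\<forall>k\<in>V. positive_op (\<rho> k)) \<and> ((\<lambda>k. trace (\<rho> k)) has_sum 1) V"

section \<open>Enclosures\<close>

definition enclosure :: "('j::finite \<Rightarrow> complex ^ 'n ^ 'n) \<Rightarrow> (complex ^ 'n) set \<Rightarrow> bool" where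
  "enclosure L W \<longleftrightarrow> vec.subspace W \<and>
     (\<forall>\<omega>. positive_op \<omega> \<longrightarrow> supp \<omega> \<subseteq> W \<longrightarrow> supp (channel L \<omega>) \<subseteq> W)"

definition minimal_enclosure :: "('j::finite \<Rightarrow> complex ^ 'n ^ 'n) \<Rightarrow> (complex ^ 'n) set \<Rightarrow> bool" where
  "minimal_enclosure L W \<longleftrightarrow> enclosure L W \<and> W \<noteq> {0} \<and>
     (\<forall>U. enclosure L U \<longrightarrow> U \<subseteq> W \<longrightarrow> U = {0} \<or> U = W)"

definition invariant_state_on ::
  "('j::finite \<Rightarrow> complex ^ 'n ^ 'n) \<Rightarrow> (complex ^ 'n) set \<Rightarrow> complex ^ 'n ^ 'n" where
  "invariant_state_on L W =
     (THE \<tau>. positive_op \<tau> \<and> trace \<tau> = 1 \<and> channel L \<tau> = \<tau> \<and> supp \<tau> \<subseteq> W)"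

definition absorption :: "('j::finite \<Rightarrow> complex ^ 'n ^ 'n) \<Rightarrow> (complex ^ 'n) set \<Rightarrow> complex ^ 'n ^ 'n" where
  "absorption L W = lim (\<lambda>n. (dual_channel L ^^ n) (orth_proj W))"

section \<open>Quantum trajectories\<close>

text \<open>
  A point of \<open>V \<times> J\<^sup>\<nat>\<close> is a pair \<open>(k, w)\<close>; sequences are indexed from 0, so \<open>w n\<close> is the
  coordinate $j_{n+1}$.  As \<open>V\<close> is countable, the product $\sigma$-algebra is the one generated
  by the cylinder sets.
\<close>

definition traj_space :: "(real ^ 'd) set \<Rightarrow> ((real ^ 'd) \<times> (nat \<Rightarrow> 'j::finite)) measure" where
  "traj_space V = count_space V \<Otimes>\<^sub>M (\<Pi>\<^sub>M i\<in>UNIV. count_space UNIV)"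

definition cylinder :: "real ^ 'd \<Rightarrow> 'j list \<Rightarrow> ((real ^ 'd) \<times> (nat \<Rightarrow> 'j)) set" where
  "cylinder k js = {(x, w). x = k \<and> (\<forall>i<length js. w i = js ! i)}"

text \<open>\<open>word_op L [j1, \<dots>, jn]\<close> is the product \<open>L jn ** \<dots> ** L j1\<close>.\<close>

primrec word_op :: "('j \<Rightarrow> complex ^ 'n ^ 'n) \<Rightarrow> 'j list \<Rightarrow> complex ^ 'n ^ 'n" where
  "word_op L [] = mat 1"
| "word_op L (j # js) = word_op L js ** L j"

definition traj_measure ::
  "(real ^ 'd) set \<Rightarrow> ('j::finite \<Rightarrow> complex ^ 'n ^ 'n) \<Rightarrow> (real ^ 'd \<Rightarrow> complex ^ 'n ^ 'n)
     \<Rightarrow> ((real ^ 'd) \<times> (nat \<Rightarrow> 'j)) measure" where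
  "traj_measure V L \<rho> = (THE P. prob_space P \<and> sets P = sets (traj_space V) \<and>
     (\<forall>k\<in>V. \<forall>js. measure P (cylinder k js) =
        Re (trace (word_op L js ** \<rho> k ** dagger (word_op L js)))))"

primrec position :: "('j \<Rightarrow> real ^ 'd) \<Rightarrow> nat \<Rightarrow> (real ^ 'd) \<times> (nat \<Rightarrow> 'j) \<Rightarrow> real ^ 'd" where
  "position s 0 \<omega> = fst \<omega>"
| "position s (Suc n) \<omega> = position s n \<omega> + s (snd \<omega> n)"

text \<open>Where the trace vanishes (a null event for the trajectory measure) this is the zero matrix.\<close>

definition normalize_op :: "complex ^ 'n ^ 'n \<Rightarrow> complex ^ 'n ^ 'n" where
  "normalize_op \<sigma> = (1 / Re (trace \<sigma>)) *\<^sub>R \<sigma>"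

primrec traj_state ::
  "('j \<Rightarrow> complex ^ 'n ^ 'n) \<Rightarrow> (real ^ 'd \<Rightarrow> complex ^ 'n ^ 'n) \<Rightarrow> nat
     \<Rightarrow> (real ^ 'd) \<times> (nat \<Rightarrow> 'j) \<Rightarrow> complex ^ 'n ^ 'n" where
  "traj_state L \<rho> 0 \<omega> = normalize_op (\<rho> (fst \<omega>))"
| "traj_state L \<rho> (Suc n) \<omega> =
     normalize_op (L (snd \<omega> n) ** traj_state L \<rho> n \<omega> ** dagger (L (snd \<omega> n)))"

definition absorption_mart ::
  "('j::finite \<Rightarrow> complex ^ 'n ^ 'n) \<Rightarrow> (real ^ 'd \<Rightarrow> complex ^ 'n ^ 'n) \<Rightarrow> (complex ^ 'n) set
     \<Rightarrow> nat \<Rightarrow> (real ^ 'd) \<times> (nat \<Rightarrow> 'j) \<Rightarrow> real" where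
  "absorption_mart L \<rho> W n \<omega> = Re (trace (absorption L W ** traj_state L \<rho> n \<omega>))"

text \<open>The measure $\mathbb P'_\rho$, with density $Y_\infty / \mathbb E_\rho[Y_0]$.\<close>

definition absorbed_measure ::
  "(real ^ 'd) set \<Rightarrow> ('j::finite \<Rightarrow> complex ^ 'n ^ 'n) \<Rightarrow> (real ^ 'd \<Rightarrow> complex ^ 'n ^ 'n)
     \<Rightarrow> (complex ^ 'n) set \<Rightarrow> ((real ^ 'd) \<times> (nat \<Rightarrow> 'j)) measure" where
  "absorbed_measure V L \<rho> W = density (traj_measure V L \<rho>)
     (\<lambda>\<omega>. ennreal (lim (\<lambda>n. absorption_mart L \<rho> W n \<omega>) /
        (\<integral>\<omega>'. absorption_mart L \<rho> W 0 \<omega>' \<partial>traj_measure V L \<rho>)))"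

section \<open>Spectral data, drift and diffusion matrix\<close>

definition tilted_channel ::
  "('j::finite \<Rightarrow> real ^ 'd) \<Rightarrow> ('j \<Rightarrow> complex ^ 'n ^ 'n) \<Rightarrow> (complex ^ 'n) set
     \<Rightarrow> real ^ 'd \<Rightarrow> complex ^ 'n ^ 'n \<Rightarrow> complex ^ 'n ^ 'n" where
  "tilted_channel s L W u \<sigma> = (let p = orth_proj (supp (absorption L W)) in
     \<Sum>j\<in>UNIV. exp (u \<bullet> s j) *\<^sub>R (p ** L j ** p ** \<sigma> ** p ** dagger (L j) ** p))"

definition tilted_radius ::
  "('j::finite \<Rightarrow> real ^ 'd) \<Rightarrow> ('j \<Rightarrow> complex ^ 'n ^ 'n) \<Rightarrow> (complex ^ 'n) set
     \<Rightarrow> real ^ 'd \<Rightarrow> real" where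
  "tilted_radius s L W u = superop_spectral_radius (tilted_channel s L W u)"

definition drift ::
  "('j::finite \<Rightarrow> real ^ 'd) \<Rightarrow> ('j \<Rightarrow> complex ^ 'n ^ 'n) \<Rightarrow> (complex ^ 'n) set \<Rightarrow> real ^ 'd" where
  "drift s L W =
     (\<Sum>j\<in>UNIV. Re (trace (L j ** invariant_state_on L W ** dagger (L j))) *\<^sub>R s j)"

definition diffusion_matrix ::
  "('j::finite \<Rightarrow> real ^ 'd) \<Rightarrow> ('j \<Rightarrow> complex ^ 'n ^ 'n) \<Rightarrow> (complex ^ 'n) set
     \<Rightarrow> real ^ 'd ^ 'd" where
  "diffusion_matrix s L W = (THE D. transpose D = D \<and>
     (\<forall>u. u \<bullet> (D *v u) = (deriv ^^ 2) (\<lambda>t. tilted_radius s L W (t *\<^sub>R u)) 0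
                          - (deriv (\<lambda>t. tilted_radius s L W (t *\<^sub>R u)) 0)\<^sup>2))"

section \<open>Gaussian measures and convergence in law\<close>

definition std_gaussian :: "(real ^ 'd) measure" where
  "std_gaussian = density lborel (\<lambda>z. ennreal (\<Prod>i\<in>UNIV. std_normal_density (z $ i)))"

text \<open>
  The law of \<open>B Z\<close> with \<open>Z\<close> standard Gaussian depends on \<open>B\<close> only through its covariance
  \<open>B ** transpose B\<close>; such a \<open>B\<close> exists for every symmetric positive semidefinite \<open>D\<close>,
  singular or not.
\<close>

definition gaussian :: "real ^ 'd ^ 'd \<Rightarrow> (real ^ 'd) measure" where
  "gaussian D = distr std_gaussian borel ((*v) (SOME B :: real ^ 'd ^ 'd. B ** transpose B = D))"

text \<open>The library's \<open>weak_conv_m\<close> covers measures on the real line only.\<close>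

definition weakly_converges ::
  "(nat \<Rightarrow> 'a::topological_space measure) \<Rightarrow> 'a measure \<Rightarrow> bool" where
  "weakly_converges M N \<longleftrightarrow>
     (\<forall>f :: 'a \<Rightarrow> real. continuous_on UNIV f \<longrightarrow> bounded (range f) \<longrightarrow>
        (\<lambda>n. \<integral>x. f x \<partial>M n) \<longlonglongrightarrow> (\<integral>x. f x \<partial>N))"

end

theory Submission
  imports Defs
begin

text \<open>
Conditioning on absorption is a Doob transform by the fixed point \<open>A\<close> of the dual channel, so the
characteristic function of \<open>X\<^sub>n - X\<^sub>0\<close> is an average of \<open>Tr (A st)\<close> along the tilted channel, with \<open>st\<close> the
unnormalised state. Every fixed point of the dual compressed to the support of \<open>A\<close> is a multiple of
\<open>A\<close>; hence the Poisson equations for \<open>1 - L\<^sup>*\<close> have solutions \<open>A1\<close>, \<open>A2\<close> such that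
\<open>A + i t A1 - t\<^sup>2/2 A2\<close> is an eigenvector of the tilted dual up to \<open>O(t\<^sup>3)\<close>. Iterating \<open>n\<close> times at
\<open>t = 1/sqrt n\<close> gives the Gaussian limit, and telescoping \<open>A1\<close> gives the estimate of the mean. The same
correctors compute the first two derivatives of the spectral radius: a positive perturbed eigenvector is
built from a bordered operator and the intermediate value theorem, and positivity identifies its
eigenvalue with the spectral radius.
\<close>

section \<open>Perturbation of positive eigenvectors\<close>

text \<open>The channel on an enclosure may be periodic: other eigenvalues of modulus one can occur
  and powers of the channel need not converge. No spectral gap is therefore used anywhere.
  Simplicity of the eigenvalue 1 makes one minus the dual channel invertible modulo its kernel, and
  both the correctors and the perturbed eigenvectors live on that alone.

  The weight is A rather than the projection onto the enclosure because the initial state may sit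
  partly in the transient part. A is harmonic there and strictly positive on its own support, which
  allows it to be compared with the trace.

  Two tilts occur, an imaginary one for the characteristic function and a real one for the spectral
  radius that defines D. No analytic continuation links them: both lead to the same equation for A1,
  and solvability of the equation for A2 forces its constant to be the second derivative of the
  spectral radius. Nonnegativity of D is read off from the boundedness of characteristic
  functions.\<close>

locale tilted_pair =
  fixes K T :: "'j::finite \<Rightarrow> 'a::euclidean_space \<Rightarrow> 'a" and a :: "'j \<Rightarrow> real" and A \<tau> :: 'a
  assumes linK: "linear (K j)" and linT: "linear (T j)"
    and adj: "K j x \<bullet> y = x \<bullet> T j y"
    and fixA: "(\<Sum>j\<in>UNIV. K j A) = A" and fixtau: "(\<Sum>j\<in>UNIV. T j \<tau>) = \<tau>"
    and Atau: "A \<bullet> \<tau> = 1"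
    and simple: "(\<Sum>j\<in>UNIV. K j x) = x \<Longrightarrow> x \<bullet> \<tau> = 0 \<Longrightarrow> x = 0"
begin

definition S :: "real \<Rightarrow> 'a \<Rightarrow> 'a" where
  "S t x = (\<Sum>j\<in>UNIV. exp (t * a j) *\<^sub>R K j x)"

text \<open>Bordering \<open>z - S t\<close> by a rank-one term keeps it invertible even where z is
  an eigenvalue. A solution of \<open>N t z x = A\<close> with x \<bullet> \<tau> = 1 satisfies
  \<open>S t x = z x\<close>, so finding an eigenpair becomes a linear system plus one scalar
  equation in z.\<close>

definition N :: "real \<Rightarrow> real \<Rightarrow> 'a \<Rightarrow> 'a" where
  "N t z x = z *\<^sub>R x - S t x + (x \<bullet> \<tau>) *\<^sub>R A"

lemma linear_S: "linear (S t)"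
  unfolding S_def by (intro linear_compose_sum ballI linear_compose_scale_right linK)

lemma linear_N: "linear (N t z)"
  by (rule linearI)
     (simp_all add: N_def linear_add[OF linear_S] linear_scale[OF linear_S] inner_add_left algebra_simps)

lemma S_0: "S 0 x = (\<Sum>j\<in>UNIV. K j x)"
  by (simp add: S_def)

lemma S_tau: "S 0 x \<bullet> \<tau> = x \<bullet> \<tau>"
proof -
  have "S 0 x \<bullet> \<tau> = (\<Sum>j\<in>UNIV. x \<bullet> T j \<tau>)" by (simp add: S_0 inner_sum_left adj)
  then show ?thesis by (simp add: inner_sum_right[symmetric] fixtau)
qed

text \<open>\<tau> is fixed by the adjoint, so pairing with \<tau> removes \<open>1 - S 0\<close>
  and leaves x \<bullet> \<tau>. A kernel vector is thus fixed and orthogonal to \<tau>, which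
  \<open>simple\<close> allows only for 0.\<close>

lemma inj_N: "inj (N 0 1)"
proof (rule linear_injective_0[OF linear_N, THEN iffD2], safe)
  fix x assume h: "N 0 1 x = 0"
  have "N 0 1 x \<bullet> \<tau> = x \<bullet> \<tau>"
    by (simp add: N_def inner_add_left inner_diff_left S_tau Atau)
  then have "x \<bullet> \<tau> = 0" using h by simp
  then show "x = 0" using h simple[of x] by (simp add: N_def S_0)
qed

lemma K_bounded: obtains k where "k > 0" "\<And>j x. norm (K j x) \<le> k * norm x"
proof -
  have "\<forall>j. \<exists>B>0. \<forall>x. norm (K j x) \<le> B * norm x"
    using linear_bounded_pos[OF linK] by metis
  then obtain B where B: "\<And>j. B j > 0" "\<And>j x. norm (K j x) \<le> B j * norm x" by metis
  have "norm (K j x) \<le> (\<Sum>j\<in>UNIV. B j) * norm x" for j x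
  proof -
    have "B j \<le> (\<Sum>j\<in>UNIV. B j)" using B(1) by (intro member_le_sum) (auto intro: less_imp_le)
    then show ?thesis using B(2)[of j x] by (meson mult_right_mono norm_ge_zero order_trans)
  qed
  moreover have "(\<Sum>j\<in>UNIV. B j) > 0" using B(1) by (intro sum_pos) auto
  ultimately show ?thesis using that by blast
qed

definition dev :: "real \<Rightarrow> real \<Rightarrow> real" where
  "dev t s = (\<Sum>j\<in>UNIV. \<bar>exp (t * a j) - exp (s * a j)\<bar>)"

lemma dev_tendsto: "((\<lambda>t. dev t s) \<longlongrightarrow> 0) (at s within U)"
proof -
  have "((\<lambda>t. dev t s) \<longlongrightarrow> (\<Sum>j\<in>(UNIV::'j set). \<bar>exp (s * a j) - exp (s * a j)\<bar>)) (at s within U)"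
    unfolding dev_def by (intro tendsto_intros)
  then show ?thesis by simp
qed

lemma S_diff: assumes "\<And>j x. norm (K j x) \<le> k * norm x"
  shows "norm (S t x - S s x) \<le> dev t s * (k * norm x)"
proof -
  have "S t x - S s x = (\<Sum>j\<in>UNIV. (exp (t * a j) - exp (s * a j)) *\<^sub>R K j x)"
    by (simp add: S_def sum_subtractf scaleR_left_diff_distrib)
  also have "norm \<dots> \<le> (\<Sum>j\<in>UNIV. \<bar>exp (t * a j) - exp (s * a j)\<bar> * (k * norm x))"
    by (intro sum_norm_le) (auto intro!: mult_left_mono assms)
  finally show ?thesis by (simp add: dev_def sum_distrib_right)
qed

text \<open>In finite dimension injectivity at (0, 1) comes with a lower bound, and half of it
  survives in a neighbourhood. This uniform bound does the work of continuity of the inverse from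
  here on.\<close>

lemma N_lower_bound:
  obtains c e where "c > 0" "e > 0" "e < 1"
    "\<And>t z x. \<bar>t\<bar> < e \<Longrightarrow> \<bar>z - 1\<bar> < e \<Longrightarrow> c * norm x \<le> norm (N t z x)"
proof -
  obtain c where c: "c > 0" "\<And>x. c * norm x \<le> norm (N 0 1 x)"
    using linear_inj_bounded_below_pos[OF linear_N inj_N] by blast
  obtain k where k: "k > 0" "\<And>j x. norm (K j x) \<le> k * norm x" using K_bounded by blast
  have "\<forall>\<^sub>F t in at 0. dev t 0 < c / (4 * k)"
    using dev_tendsto[of 0 UNIV] c k by (intro order_tendstoD(2)) auto
  then obtain d where d: "d > 0" "\<And>t. t \<noteq> 0 \<Longrightarrow> \<bar>t\<bar> < d \<Longrightarrow> dev t 0 < c / (4 * k)"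
    by (auto simp: eventually_at dist_real_def)
  have d': "dev t 0 < c / (4 * k)" if "\<bar>t\<bar> < d" for t
    using d(2)[of t] that c k by (cases "t = 0") (auto simp: dev_def)
  \<comment> \<open>The change of tilt and the change of z each cost at most c/4, which leaves c/2.
    The cap 1/2 keeps z positive.\<close>
  define e where "e = min (min d (c/4)) (1/2)"
  have "c/2 * norm x \<le> norm (N t z x)" if h: "\<bar>t\<bar> < e" "\<bar>z - 1\<bar> < e" for t z x
  proof -
    have "N 0 1 x = N t z x + (S t x - S 0 x) + (1 - z) *\<^sub>R x"
      by (simp add: N_def algebra_simps)
    then have "norm (N 0 1 x) \<le> norm (N t z x) + norm (S t x - S 0 x) + norm ((1 - z) *\<^sub>R x)"
      by (metis norm_triangle_le add_mono norm_triangle_ineq order_refl)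
    also have "norm (S t x - S 0 x) \<le> c / (4 * k) * (k * norm x)"
      using S_diff[OF k(2), of t x 0] d'[of t] h k unfolding e_def
      by (smt (verit) mult_right_mono norm_ge_zero zero_le_mult_iff)
    also have "c / (4 * k) * (k * norm x) = c/4 * norm x" using k by simp
    also have "norm ((1 - z) *\<^sub>R x) \<le> c/4 * norm x"
    proof -
      have "\<bar>1 - z\<bar> \<le> c/4" using h unfolding e_def by linarith
      then show ?thesis using mult_right_mono[of "\<bar>1 - z\<bar>" "c/4" "norm x"] by simp
    qed
    finally show ?thesis using c(2)[of x] by (simp add: field_simps)
  qed
  moreover have "c/2 > 0" "e > 0" "e < 1" using c d by (auto simp: e_def)
  ultimately show ?thesis using that by blast
qed

text \<open>At t = 0 the solution of \<open>N 0 z x = A\<close> is A / z, whose pairing with \<tau>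
  is 1 / z and crosses 1 at z = 1. The crossing persists for small t, and the intermediate value
  theorem supplies z = l t in place of an implicit function theorem.\<close>

lemma left_eigenvector:
  obtains \<delta> C l X where "\<delta> > 0" "\<And>t. \<bar>t\<bar> < \<delta> \<Longrightarrow> S t (X t) = l t *\<^sub>R X t"
    "\<And>t. \<bar>t\<bar> < \<delta> \<Longrightarrow> X t \<bullet> \<tau> = 1" "\<And>t. \<bar>t\<bar> < \<delta> \<Longrightarrow> norm (X t) \<le> C"
    "l 0 = 1" "X 0 = A" "isCont l 0" "\<And>s. \<bar>s\<bar> < \<delta> \<Longrightarrow> isCont l s \<Longrightarrow> isCont X s"
proof -
  obtain c e where ce: "c > 0" "e > 0" "e < 1"
    "\<And>t z x. \<bar>t\<bar> < e \<Longrightarrow> \<bar>z - 1\<bar> < e \<Longrightarrow> c * norm x \<le> norm (N t z x)" using N_lower_bound by blast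
  obtain k where k: "k > 0" "\<And>j x. norm (K j x) \<le> k * norm x" using K_bounded by blast
  define R where "R t z = (SOME x. N t z x = A)" for t z
  have R: "N t z (R t z) = A" if "\<bar>t\<bar> < e" "\<bar>z - 1\<bar> < e" for t z
  proof -
    have "inj (N t z)"
      using ce(4)[OF that] ce(1)
      by (intro linear_injective_0[OF linear_N, THEN iffD2]) (metis mult_le_0_iff norm_le_zero_iff norm_zero not_less)
    then have "surj (N t z)" by (rule linear_inj_imp_surj[OF linear_N])
    then have "\<exists>x. N t z x = A" by (metis surjD)
    then show ?thesis unfolding R_def by (rule someI_ex)
  qed
  \<comment> \<open>Joint continuity of the solution: the old solution inserted into the new system
    leaves a residual tending to 0, and the lower bound on \<open>N\<close> turns the residual into
    an error bound.\<close>
  have Rcont: "((\<lambda>x. R (f x) (g x)) \<longlongrightarrow> R t0 z0) F"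
    if fg: "(f \<longlongrightarrow> t0) F" "(g \<longlongrightarrow> z0) F" and t0: "\<bar>t0\<bar> < e" "\<bar>z0 - 1\<bar> < e"
      for f g :: "real \<Rightarrow> real" and F t0 z0
  proof -
    have ev: "\<forall>\<^sub>F x in F. \<bar>f x\<bar> < e \<and> \<bar>g x - 1\<bar> < e"
    proof (rule eventually_conj)
      have "((\<lambda>x. \<bar>f x\<bar>) \<longlongrightarrow> \<bar>t0\<bar>) F" by (intro tendsto_intros fg)
      then show "\<forall>\<^sub>F x in F. \<bar>f x\<bar> < e" using t0(1) by (rule order_tendstoD(2))
      have "((\<lambda>x. \<bar>g x - 1\<bar>) \<longlongrightarrow> \<bar>z0 - 1\<bar>) F" by (intro tendsto_intros fg)
      then show "\<forall>\<^sub>F x in F. \<bar>g x - 1\<bar> < e" using t0(2) by (rule order_tendstoD(2))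
    qed
    have "((\<lambda>x. N (f x) (g x) (R t0 z0)) \<longlongrightarrow> N t0 z0 (R t0 z0)) F"
      unfolding N_def S_def by (intro tendsto_intros fg)
    then have "((\<lambda>x. norm (A - N (f x) (g x) (R t0 z0)) / c) \<longlongrightarrow> norm (A - N t0 z0 (R t0 z0)) / c) F"
      using ce by (intro tendsto_intros) auto
    then have lim: "((\<lambda>x. norm (A - N (f x) (g x) (R t0 z0)) / c) \<longlongrightarrow> 0) F" using R[OF t0] by simp
    have "\<forall>\<^sub>F x in F. norm (R (f x) (g x) - R t0 z0) \<le> norm (A - N (f x) (g x) (R t0 z0)) / c"
      using ev
    proof eventually_elim
      case (elim x)
      then have "c * norm (R (f x) (g x) - R t0 z0) \<le> norm (N (f x) (g x) (R (f x) (g x) - R t0 z0))"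
        using ce by blast
      also have "\<dots> = norm (A - N (f x) (g x) (R t0 z0))"
        using R elim by (simp add: linear_diff[OF linear_N])
      finally show ?case using ce by (simp add: field_simps)
    qed
    then have "((\<lambda>x. R (f x) (g x) - R t0 z0) \<longlongrightarrow> 0) F"
      by (rule Lim_null_comparison[OF _ lim])
    then show ?thesis by (simp add: LIM_zero_iff)
  qed
  define g where "g t z = R t z \<bullet> \<tau>" for t z
  have R0: "R 0 z = A /\<^sub>R z" if "\<bar>z - 1\<bar> < e" for z
  proof -
    have z: "z > 0" using that ce by auto
    have "N 0 z (A /\<^sub>R z) = A"
      using z by (simp add: N_def linear_scale[OF linear_S] S_0 fixA Atau)
    moreover have "N 0 z (R 0 z) = A" using R that ce by auto
    ultimately have "c * norm (R 0 z - A /\<^sub>R z) \<le> 0"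
      using ce(4)[of 0 z "R 0 z - A /\<^sub>R z"] that ce by (simp add: linear_diff[OF linear_N])
    then show ?thesis using ce by (simp add: mult_le_0_iff)
  qed
  \<comment> \<open>Half of e keeps the bracket from 1 - h to 1 + h strictly inside the region where
    \<open>N\<close> is invertible.\<close>
  define h where "h = e/2"
  have h: "h > 0" "h < e" "h < 1" using ce by (auto simp: h_def)
  have gl: "((\<lambda>t. g t z) \<longlongrightarrow> 1/z) (at 0)" if "\<bar>z - 1\<bar> < e" for z
  proof -
    have "((\<lambda>t. g t z) \<longlongrightarrow> g 0 z) (at 0)"
      unfolding g_def using ce that by (intro tendsto_intros Rcont) auto
    then show ?thesis using that by (simp add: g_def R0 Atau divide_inverse)
  qed
  have "\<forall>\<^sub>F t in at 0. g t (1 - h) > 1 \<and> g t (1 + h) < 1"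
  proof (rule eventually_conj)
    show "\<forall>\<^sub>F t in at 0. g t (1 - h) > 1"
      by (rule order_tendstoD(1)[OF gl]) (use h in auto)
    show "\<forall>\<^sub>F t in at 0. g t (1 + h) < 1"
      by (rule order_tendstoD(2)[OF gl]) (use h in auto)
  qed
  then obtain d where d: "d > 0" "\<And>t. t \<noteq> 0 \<Longrightarrow> \<bar>t\<bar> < d \<Longrightarrow> g t (1 - h) > 1 \<and> g t (1 + h) < 1"
    by (auto simp: eventually_at dist_real_def)
  define \<delta> where "\<delta> = min d e"
  have ex: "\<exists>z. \<bar>z - 1\<bar> < e \<and> g t z = 1" if t: "\<bar>t\<bar> < \<delta>" for t
  proof (cases "t = 0")
    case True
    then show ?thesis using R0[of 1] ce by (intro exI[of _ 1]) (simp add: g_def Atau)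
  next
    case False
    then have b: "g t (1 - h) > 1" "g t (1 + h) < 1" using d t by (auto simp: \<delta>_def)
    have "isCont (\<lambda>z. g t z) z" if "1 - h \<le> z" "z \<le> 1 + h" for z
      unfolding g_def isCont_def
      by (intro tendsto_intros Rcont) (use t that h in \<open>auto simp: \<delta>_def\<close>)
    then have "\<exists>z\<ge>1 - h. z \<le> 1 + h \<and> g t z = 1"
      using b h by (intro IVT2) auto
    then obtain z where "1 - h \<le> z" "z \<le> 1 + h" "g t z = 1" by blast
    then show ?thesis using h by (intro exI[of _ z]) auto
  qed
  \<comment> \<open>The root is a bare choice, so any regularity of \<open>l\<close> in t has to
    come from the eigenvalue equation.\<close>
  define l where "l t = (SOME z. \<bar>z - 1\<bar> < e \<and> g t z = 1)" for t
  have l: "\<bar>l t - 1\<bar> < e" "g t (l t) = 1" if "\<bar>t\<bar> < \<delta>" for t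
    using someI_ex[OF ex[OF that]] by (auto simp: l_def)
  define X where "X t = R t (l t)" for t
  have X1: "X t \<bullet> \<tau> = 1" if "\<bar>t\<bar> < \<delta>" for t using l[OF that] by (simp add: X_def g_def)
  have Xe: "S t (X t) = l t *\<^sub>R X t" if "\<bar>t\<bar> < \<delta>" for t
    using R[of t "l t"] l[OF that] that X1[OF that] by (simp add: N_def X_def \<delta>_def)
  have Xb: "norm (X t) \<le> norm A / c" if "\<bar>t\<bar> < \<delta>" for t
    using ce(4)[of t "l t" "X t"] R[of t "l t"] l[OF that] that ce(1) by (simp add: X_def \<delta>_def field_simps)
  have dpos: "\<delta> > 0" using d ce by (simp add: \<delta>_def)
  have l0: "l 0 = 1"
    using S_tau[of "X 0"] X1[of 0] Xe[of 0] dpos by simp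
  have X0: "X 0 = A" using R0[of 1] ce by (simp add: X_def l0)
  \<comment> \<open>\<open>S 0\<close> preserves the pairing with \<tau>, so l t - 1 is the pairing
    of the increment \<open>S t (X t) - S 0 (X t)\<close> with \<tau>, which is small because X t
    stays bounded.\<close>
  have lb: "\<bar>l t - 1\<bar> \<le> dev t 0 * (k * (norm A / c)) * norm \<tau>" if "\<bar>t\<bar> < \<delta>" for t
  proof -
    have "l t - 1 = (S t (X t) - S 0 (X t)) \<bullet> \<tau>"
      by (simp add: inner_diff_left S_tau Xe[OF that] X1[OF that])
    also have "\<bar>\<dots>\<bar> \<le> norm (S t (X t) - S 0 (X t)) * norm \<tau>" by (rule Cauchy_Schwarz_ineq2)
    also have "\<dots> \<le> dev t 0 * (k * (norm A / c)) * norm \<tau>"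
    proof (intro mult_right_mono norm_ge_zero order_trans[OF S_diff[OF k(2)]] mult_left_mono Xb that)
      show "0 \<le> dev t 0" by (simp add: dev_def sum_nonneg)
    qed (use k in auto)
    finally show ?thesis .
  qed
  have lim0: "((\<lambda>t. dev t 0 * (k * (norm A / c)) * norm \<tau>) \<longlongrightarrow> 0) (at 0)"
    by (intro tendsto_mult_left_zero dev_tendsto)
  have "((\<lambda>t. l t - 1) \<longlongrightarrow> 0) (at 0)"
    by (rule Lim_null_comparison[OF _ lim0]) (use dpos lb in \<open>auto simp: eventually_at dist_real_def intro!: exI[of _ \<delta>]\<close>)
  then have lc: "isCont l 0" by (simp add: isCont_def l0 LIM_zero_iff)
  \<comment> \<open>Away from 0 this is conditional on continuity of \<open>l\<close>; the condition
    is discharged in \<open>eigenvalue_derivatives\<close> by pairing left with right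
    eigenvectors.\<close>
  have Xc: "isCont X s" if "\<bar>s\<bar> < \<delta>" "isCont l s" for s
    unfolding isCont_def X_def
    by (intro Rcont) (use that l in \<open>auto simp: isCont_def \<delta>_def\<close>)
  show ?thesis by (rule that[OF dpos Xe X1 Xb l0 X0 lc Xc])
qed

text \<open>The difference quotient of X is fed to \<open>N 0 1\<close>. The normalisation X t
  \<bullet> \<tau> = 1 removes the border term, the eigenvalue equation makes the image converge to
  \<open>N 0 1 A1\<close>, and the lower bound pulls the convergence back.\<close>

lemma eigenvector_derivative:
  assumes "\<delta> > 0" and eig: "\<And>t. \<bar>t\<bar> < \<delta> \<Longrightarrow> S t (X t) = l t *\<^sub>R X t"
    and X1: "\<And>t. \<bar>t\<bar> < \<delta> \<Longrightarrow> X t \<bullet> \<tau> = 1" and X0: "X 0 = A" and cont: "isCont X 0"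
    and l: "((\<lambda>t. (l t - 1) / t) \<longlongrightarrow> l') (at 0)"
    and A1: "A1 - (\<Sum>j\<in>UNIV. K j A1) = (\<Sum>j\<in>UNIV. a j *\<^sub>R K j A) - l' *\<^sub>R A" "A1 \<bullet> \<tau> = 0"
  shows "(X has_vector_derivative A1) (at 0)"
proof -
  obtain c where c: "c > 0" "\<And>x. c * norm x \<le> norm (N 0 1 x)"
    using linear_inj_bounded_below_pos[OF linear_N inj_N] by blast
  define D where "D t = (1 / t) *\<^sub>R (X t - A)" for t
  define E where "E t = (\<Sum>j\<in>UNIV. ((exp (t * a j) - 1) / t) *\<^sub>R K j (X t)) - ((l t - 1) / t) *\<^sub>R X t" for t
  have ND: "N 0 1 (D t) = E t" if t: "\<bar>t\<bar> < \<delta>" for t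
  proof -
    have "N 0 1 (X t - A) = X t - S 0 (X t)"
      using X1[OF t] by (simp add: N_def linear_diff[OF linear_S] S_0 fixA inner_diff_left Atau)
    also have "\<dots> = (S t (X t) - S 0 (X t)) - (l t - 1) *\<^sub>R X t"
      by (simp add: eig[OF t] algebra_simps)
    also have "S t (X t) - S 0 (X t) = (\<Sum>j\<in>UNIV. (exp (t * a j) - 1) *\<^sub>R K j (X t))"
      by (simp add: S_def sum_subtractf scaleR_left_diff_distrib)
    finally show ?thesis
      unfolding D_def E_def linear_scale[OF linear_N]
      by (simp add: scaleR_right_diff_distrib scaleR_sum_right)
  qed
  have NA1: "N 0 1 A1 = (\<Sum>j\<in>UNIV. a j *\<^sub>R K j A) - l' *\<^sub>R A"
    using A1 by (simp add: N_def S_0)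
  have e: "((\<lambda>t. (exp (t * a j) - 1) / t) \<longlongrightarrow> a j) (at 0)" for j
  proof -
    have "((\<lambda>t. exp (t * a j)) has_real_derivative a j) (at 0)"
      by (auto intro!: derivative_eq_intros)
    then show ?thesis by (simp add: has_field_derivative_iff)
  qed
  have Xl: "(X \<longlongrightarrow> A) (at 0)" using cont by (simp add: isCont_def X0)
  have KX: "((\<lambda>t. K j (X t)) \<longlongrightarrow> K j A) (at 0)" for j
    by (rule bounded_linear.tendsto[OF linear_conv_bounded_linear[THEN iffD1, OF linK] Xl])
  have "(E \<longlongrightarrow> N 0 1 A1) (at 0)"
    unfolding E_def NA1 by (intro tendsto_intros e KX l Xl)
  then have "((\<lambda>t. norm (E t - N 0 1 A1) / c) \<longlongrightarrow> norm (N 0 1 A1 - N 0 1 A1) / c) (at 0)"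
    using c by (intro tendsto_intros) auto
  then have lim: "((\<lambda>t. norm (E t - N 0 1 A1) / c) \<longlongrightarrow> 0) (at 0)" by simp
  have b: "norm (D t - A1) \<le> norm (E t - N 0 1 A1) / c" if "\<bar>t\<bar> < \<delta>" for t
    using c(2)[of "D t - A1"] c(1) ND[OF that] by (simp add: linear_diff[OF linear_N] field_simps)
  have "((\<lambda>t. D t - A1) \<longlongrightarrow> 0) (at 0)"
    by (rule Lim_null_comparison[OF _ lim])
       (use b \<open>\<delta> > 0\<close> in \<open>auto simp: eventually_at dist_real_def intro!: exI[of _ \<delta>]\<close>)
  then have "((\<lambda>t. norm (D t - A1)) \<longlongrightarrow> 0) (at 0)" by (rule tendsto_norm_zero)
  moreover have "\<forall>\<^sub>F t in at 0. norm (D t - A1) = norm (X (0 + t) - X 0 - t *\<^sub>R A1) / norm t"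
  proof (rule eventually_at_topological[THEN iffD2], intro exI[of _ UNIV] conjI ballI impI)
    fix t :: real assume t: "t \<noteq> 0"
    have "X (0 + t) - X 0 - t *\<^sub>R A1 = t *\<^sub>R (D t - A1)"
      using t by (simp add: D_def X0 scaleR_right_diff_distrib)
    then show "norm (D t - A1) = norm (X (0 + t) - X 0 - t *\<^sub>R A1) / norm t" using t by simp
  qed auto
  ultimately have "((\<lambda>t. norm (X (0 + t) - X 0 - t *\<^sub>R A1) / norm t) \<longlongrightarrow> 0) (at 0)"
    by (rule Lim_transform_eventually)
  then show ?thesis
    by (simp add: has_vector_derivative_def has_derivative_at bounded_linear_scaleR_left)
qed

end

text \<open>The setting is symmetric, so right eigenvectors cost no extra proof. Simplicity
  transfers because a fixed vector of the dual that is orthogonal to A is orthogonal to the range of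
  the surjective \<open>N 0 1\<close>, hence to itself.\<close>

lemma (in tilted_pair) dual: "tilted_pair T K \<tau> A"
proof (rule tilted_pair.intro)
  show "linear (K j)" "linear (T j)" for j by (fact linK linT)+
  show "T j x \<bullet> y = x \<bullet> K j y" for j and x y :: 'a using adj[of j y x] by (simp add: inner_commute)
  show "(\<Sum>j\<in>UNIV. T j \<tau>) = \<tau>" "(\<Sum>j\<in>UNIV. K j A) = A" "\<tau> \<bullet> A = 1"
    using fixA fixtau Atau by (simp_all add: inner_commute)
  fix x :: 'a assume h: "(\<Sum>j\<in>UNIV. T j x) = x" "x \<bullet> A = 0"
  have "surj (N 0 1)" by (rule linear_inj_imp_surj[OF linear_N inj_N])
  then obtain y where y: "N 0 1 y = x" by (metis surjD)
  have "S 0 y \<bullet> x = y \<bullet> x"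
    using h by (simp add: S_0 inner_sum_left adj inner_sum_right[symmetric])
  then have "N 0 1 y \<bullet> x = 0"
    using h by (simp add: N_def inner_add_left inner_diff_left inner_commute[of A x])
  then show "x = 0" using y by simp
qed

text \<open>A left eigenvector at t paired with a right one at s expresses l t - l s through the
  weights. This gives continuity, then the derivative on a whole neighbourhood; that formula is
  differentiated once more at 0, where the derivatives of the eigenvectors are the
  correctors.\<close>

lemma (in tilted_pair) eigenvalue_derivatives:
  obtains \<delta> l X where "\<delta> > 0" "\<And>t. \<bar>t\<bar> < \<delta> \<Longrightarrow> S t (X t) = l t *\<^sub>R X t"
    "isCont X 0" "X 0 = A"
    "\<And>t. \<bar>t\<bar> < \<delta> \<Longrightarrow> \<exists>y. y \<noteq> 0 \<and> (\<Sum>j\<in>UNIV. exp (t * a j) *\<^sub>R T j y) = l t *\<^sub>R y"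
    "l 0 = 1" "isCont l 0" "\<And>t. \<bar>t\<bar> < \<delta> \<Longrightarrow> l differentiable (at t)"
    "deriv l 0 = (\<Sum>j\<in>UNIV. a j * (K j A \<bullet> \<tau>))"
    "\<And>A1. A1 - (\<Sum>j\<in>UNIV. K j A1) = (\<Sum>j\<in>UNIV. a j *\<^sub>R K j A) - deriv l 0 *\<^sub>R A \<Longrightarrow> A1 \<bullet> \<tau> = 0 \<Longrightarrow>
       (deriv l has_real_derivative ((\<Sum>j\<in>UNIV. (a j)\<^sup>2 * (K j A \<bullet> \<tau>)) + 2 * (\<Sum>j\<in>UNIV. a j * (K j A1 \<bullet> \<tau>)))) (at 0)"
proof -
  interpret dual: tilted_pair T K a \<tau> A by (rule dual)
  obtain d1 C1 l X where X: "d1 > 0" "\<And>t. \<bar>t\<bar> < d1 \<Longrightarrow> S t (X t) = l t *\<^sub>R X t"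
    "\<And>t. \<bar>t\<bar> < d1 \<Longrightarrow> X t \<bullet> \<tau> = 1" "\<And>t. \<bar>t\<bar> < d1 \<Longrightarrow> norm (X t) \<le> C1"
    "l 0 = 1" "X 0 = A" "isCont l 0" "\<And>s. \<bar>s\<bar> < d1 \<Longrightarrow> isCont l s \<Longrightarrow> isCont X s"
    by (rule left_eigenvector) blast
  obtain d2 C2 l2 Y where Y: "d2 > 0" "\<And>t. \<bar>t\<bar> < d2 \<Longrightarrow> dual.S t (Y t) = l2 t *\<^sub>R Y t"
    "\<And>t. \<bar>t\<bar> < d2 \<Longrightarrow> Y t \<bullet> A = 1" "\<And>t. \<bar>t\<bar> < d2 \<Longrightarrow> norm (Y t) \<le> C2"
    "l2 0 = 1" "Y 0 = \<tau>" "isCont l2 0" "\<And>s. \<bar>s\<bar> < d2 \<Longrightarrow> isCont l2 s \<Longrightarrow> isCont Y s"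
    by (rule dual.left_eigenvector) blast
  have SS: "S t x \<bullet> y = x \<bullet> dual.S t y" for t x y
    by (simp add: S_def dual.S_def inner_sum_left inner_sum_right adj)
  \<comment> \<open>The pairing is divided by with two different parameters, so it has to be
    controlled jointly in both.\<close>
  have lim: "((\<lambda>p::real \<times> real. X (fst p) \<bullet> Y (snd p)) \<longlongrightarrow> 1) (at (0, 0))"
  proof -
    have "isCont X 0" "isCont Y 0" using X(1,7,8) Y(1,7,8) by auto
    then have "((\<lambda>p::real\<times>real. X (fst p)) \<longlongrightarrow> X 0) (at (0, 0))" "((\<lambda>p::real\<times>real. Y (snd p)) \<longlongrightarrow> Y 0) (at (0, 0))"
      using isCont_tendsto_compose[where g = X, OF _ tendsto_fst[OF tendsto_ident_at[of "(0::real, 0::real)" UNIV]]]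
        isCont_tendsto_compose[where g = Y, OF _ tendsto_snd[OF tendsto_ident_at[of "(0::real, 0::real)" UNIV]]] by simp_all
    then show ?thesis using tendsto_inner[of "\<lambda>p::real\<times>real. X (fst p)" A "at (0,0)" "\<lambda>p. Y (snd p)" \<tau>]
      by (simp add: X(6) Y(6) Atau)
  qed
  then have "\<forall>\<^sub>F p in at (0, 0). X (fst p) \<bullet> Y (snd p) > 1/2" by (rule order_tendstoD) simp
  then obtain d3 where d3: "d3 > 0"
    "\<And>p. p \<noteq> (0, 0) \<Longrightarrow> dist p (0, 0) < d3 \<Longrightarrow> X (fst p) \<bullet> Y (snd p) > 1/2"
    unfolding eventually_at by blast
  define \<delta> where "\<delta> = min (min d1 d2) (d3 / 2)"
  have dpos: "\<delta> > 0" using X Y d3 by (simp add: \<delta>_def)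
  have XY: "X t \<bullet> Y s > 1/2" if "\<bar>t\<bar> < \<delta>" "\<bar>s\<bar> < \<delta>" for t s
  proof (cases "(t, s) = (0, 0)")
    case True then show ?thesis using X(6) Y(6) Atau by simp
  next
    case False
    have "dist (t, s) (0, 0) \<le> \<bar>t\<bar> + \<bar>s\<bar>"
      using norm_Pair_le[of t s] by (simp add: dist_norm)
    then show ?thesis using d3(2)[of "(t, s)"] that False by (simp add: \<delta>_def)
  qed
  \<comment> \<open>Left and right eigenvalues were chosen independently; a nonzero pairing forces
    them to agree.\<close>
  have ll: "l2 t = l t" if "\<bar>t\<bar> < \<delta>" for t
  proof -
    have "l t * (X t \<bullet> Y t) = l2 t * (X t \<bullet> Y t)"
      using SS[of t "X t" "Y t"] X(2)[of t] Y(2)[of t] that by (simp add: \<delta>_def)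
    then show ?thesis using XY[OF that that] by simp
  qed
  have pair: "(l t - l s) * (X t \<bullet> Y s) = (\<Sum>j\<in>UNIV. (exp (t * a j) - exp (s * a j)) * (K j (X t) \<bullet> Y s))"
    if "\<bar>t\<bar> < \<delta>" "\<bar>s\<bar> < \<delta>" for t s
  proof -
    have "(l t - l s) * (X t \<bullet> Y s) = (S t (X t) - S s (X t)) \<bullet> Y s"
      using SS[of s "X t" "Y s"] X(2)[of t] Y(2)[of s] that ll[OF that(2)]
      by (simp add: \<delta>_def inner_diff_left algebra_simps)
    then show ?thesis
      by (simp add: S_def inner_diff_left inner_sum_left sum_subtractf left_diff_distrib)
  qed
  obtain k where k: "k > 0" "\<And>j x. norm (K j x) \<le> k * norm x" using K_bounded by blast
  have near: "\<forall>\<^sub>F t in at s. \<bar>t\<bar> < \<delta>" if "\<bar>s\<bar> < \<delta>" for s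
    by (rule order_tendstoD(2)[of _ "\<bar>s\<bar>"]) (use that in \<open>auto intro!: tendsto_intros\<close>)
  have lc: "isCont l s" if s: "\<bar>s\<bar> < \<delta>" for s
  proof -
    have "\<bar>l t - l s\<bar> \<le> 2 * (dev t s * (k * C1) * norm (Y s))" if t: "\<bar>t\<bar> < \<delta>" for t
    proof -
      have "(1/2) * \<bar>l t - l s\<bar> \<le> \<bar>l t - l s\<bar> * (X t \<bullet> Y s)"
        using XY[OF t s] mult_right_mono[of "1/2" "X t \<bullet> Y s" "\<bar>l t - l s\<bar>"] by (simp add: mult.commute)
      also have "\<dots> = \<bar>(l t - l s) * (X t \<bullet> Y s)\<bar>" using XY[OF t s] by (simp add: abs_mult)
      also have "\<dots> = \<bar>(S t (X t) - S s (X t)) \<bullet> Y s\<bar>"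
        unfolding pair[OF t s] by (simp add: S_def inner_diff_left inner_sum_left sum_subtractf left_diff_distrib)
      also have "\<dots> \<le> norm (S t (X t) - S s (X t)) * norm (Y s)" by (rule Cauchy_Schwarz_ineq2)
      also have "\<dots> \<le> dev t s * (k * C1) * norm (Y s)"
      proof (intro mult_right_mono norm_ge_zero order_trans[OF S_diff[OF k(2)]] mult_left_mono X(4))
        show "0 \<le> dev t s" by (simp add: dev_def sum_nonneg)
      qed (use k t in \<open>auto simp: \<delta>_def\<close>)
      finally show ?thesis by simp
    qed
    then have ev: "\<forall>\<^sub>F t in at s. norm (l t - l s) \<le> 2 * (dev t s * (k * C1) * norm (Y s))"
      by (intro eventually_mono[OF near[OF s]]) simp
    have "((\<lambda>t. 2 * (dev t s * (k * C1) * norm (Y s))) \<longlongrightarrow> 0) (at s)"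
      by (intro tendsto_mult_right_zero tendsto_mult_left_zero dev_tendsto)
    then have "((\<lambda>t. l t - l s) \<longlongrightarrow> 0) (at s)" by (rule Lim_null_comparison[OF ev])
    then show ?thesis by (simp add: isCont_def LIM_zero_iff)
  qed
  have Xc: "isCont X s" if "\<bar>s\<bar> < \<delta>" for s using X(8)[of s] lc[OF that] that by (simp add: \<delta>_def)
  define G where "G s = (\<Sum>j\<in>UNIV. a j * exp (s * a j) * (K j (X s) \<bullet> Y s))" for s
  have limK: "((\<lambda>t. K j (f t)) \<longlongrightarrow> K j x) F" if "(f \<longlongrightarrow> x) F" for j f x and F :: "real filter"
    by (rule bounded_linear.tendsto[OF linear_conv_bounded_linear[THEN iffD1, OF linK] that])
  have dl: "(l has_real_derivative G s / (X s \<bullet> Y s)) (at s)" if s: "\<bar>s\<bar> < \<delta>" for s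
  proof -
    have e: "((\<lambda>t. (exp (t * a j) - exp (s * a j)) / (t - s)) \<longlongrightarrow> a j * exp (s * a j)) (at s)" for j
    proof -
      have "((\<lambda>t. exp (t * a j)) has_real_derivative a j * exp (s * a j)) (at s)"
        by (auto intro!: derivative_eq_intros)
      then show ?thesis by (simp add: has_field_derivative_iff)
    qed
    have X': "(X \<longlongrightarrow> X s) (at s)" using Xc[OF s] by (simp add: isCont_def)
    have nz: "X s \<bullet> Y s \<noteq> 0" using XY[OF s s] by simp
    have "((\<lambda>t. (\<Sum>j\<in>UNIV. (exp (t * a j) - exp (s * a j)) / (t - s) * (K j (X t) \<bullet> Y s)) / (X t \<bullet> Y s))
       \<longlongrightarrow> (\<Sum>j\<in>UNIV. a j * exp (s * a j) * (K j (X s) \<bullet> Y s)) / (X s \<bullet> Y s)) (at s)"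
      by (intro tendsto_intros e limK X' nz)
    moreover have "\<forall>\<^sub>F t in at s. (\<Sum>j\<in>UNIV. (exp (t * a j) - exp (s * a j)) / (t - s) * (K j (X t) \<bullet> Y s)) / (X t \<bullet> Y s)
        = (l t - l s) / (t - s)"
      using near[OF s]
    proof eventually_elim
      case (elim t)
      have "(\<Sum>j\<in>UNIV. (exp (t * a j) - exp (s * a j)) / (t - s) * (K j (X t) \<bullet> Y s))
         = (\<Sum>j\<in>UNIV. (exp (t * a j) - exp (s * a j)) * (K j (X t) \<bullet> Y s)) / (t - s)"
        by (simp add: sum_divide_distrib)
      also have "\<dots> = (l t - l s) * (X t \<bullet> Y s) / (t - s)" by (simp only: pair[OF elim s])
      finally show ?case using XY[OF elim s] by simp
    qed
    ultimately show ?thesis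
      unfolding has_field_derivative_iff G_def by (rule Lim_transform_eventually)
  qed
  have derivl: "deriv l s = G s / (X s \<bullet> Y s)" if "\<bar>s\<bar> < \<delta>" for s
    using dl[OF that] by (rule DERIV_imp_deriv)
  have l': "deriv l 0 = (\<Sum>j\<in>UNIV. a j * (K j A \<bullet> \<tau>))"
    using derivl[of 0] dpos by (simp add: G_def X(6) Y(6) Atau)
  have second: "(deriv l has_real_derivative ((\<Sum>j\<in>UNIV. (a j)\<^sup>2 * (K j A \<bullet> \<tau>)) + 2 * (\<Sum>j\<in>UNIV. a j * (K j A1 \<bullet> \<tau>)))) (at 0)"
    if A1: "A1 - (\<Sum>j\<in>UNIV. K j A1) = (\<Sum>j\<in>UNIV. a j *\<^sub>R K j A) - deriv l 0 *\<^sub>R A" "A1 \<bullet> \<tau> = 0" for A1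
  proof -
    have dl0: "((\<lambda>t. (l t - 1) / t) \<longlongrightarrow> deriv l 0) (at 0)"
      using dl[of 0] derivl[of 0] dpos X(5) by (simp add: has_field_derivative_iff)
    \<comment> \<open>The dual corrector, which is to be the derivative of the right eigenvector at
      0. Its border term drops out because the right-hand side is orthogonal to A.\<close>
    have "surj (dual.N 0 1)" by (rule linear_inj_imp_surj[OF dual.linear_N dual.inj_N])
    then obtain B1 where B1': "dual.N 0 1 B1 = (\<Sum>j\<in>UNIV. a j *\<^sub>R T j \<tau>) - deriv l 0 *\<^sub>R \<tau>" by (metis surjD)
    have tA: "(\<Sum>j\<in>UNIV. a j *\<^sub>R T j \<tau>) \<bullet> A = deriv l 0"
      unfolding l' by (simp add: inner_sum_left adj) (simp add: inner_commute)
    have "B1 \<bullet> A = dual.N 0 1 B1 \<bullet> A"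
      by (simp add: dual.N_def inner_add_left inner_diff_left dual.S_tau dual.Atau)
    also have "\<dots> = 0" unfolding B1' by (simp add: inner_diff_left tA dual.Atau)
    finally have B1A: "B1 \<bullet> A = 0" .
    then have B1: "B1 - (\<Sum>j\<in>UNIV. T j B1) = (\<Sum>j\<in>UNIV. a j *\<^sub>R T j \<tau>) - deriv l 0 *\<^sub>R \<tau>"
      using B1' by (simp add: dual.N_def dual.S_0)
    have expd: "((\<lambda>t. (exp (t * a j) - 1) / t) \<longlongrightarrow> a j) (at 0)" for j
    proof -
      have "((\<lambda>t. exp (t * a j)) has_real_derivative a j) (at 0)"
        by (auto intro!: derivative_eq_intros)
      then show ?thesis by (simp add: has_field_derivative_iff)
    qed
    have dX: "(X has_vector_derivative A1) (at 0)"
    proof (rule eigenvector_derivative[OF dpos _ _ X(6) Xc dl0 A1])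
      show "S t (X t) = l t *\<^sub>R X t" "X t \<bullet> \<tau> = 1" if "\<bar>t\<bar> < \<delta>" for t
        using X(2,3)[of t] that by (simp_all add: \<delta>_def)
    qed (simp add: dpos)
    have dY: "(Y has_vector_derivative B1) (at 0)"
    proof (rule dual.eigenvector_derivative[OF dpos _ _ Y(6) Y(8) dl0 B1 B1A])
      show "dual.S t (Y t) = l t *\<^sub>R Y t" "Y t \<bullet> A = 1" if "\<bar>t\<bar> < \<delta>" for t
        using Y(2,3)[of t] ll[OF that] that by (simp_all add: \<delta>_def)
    qed (simp_all add: Y(1,7))
    have dK: "((\<lambda>s. K j (X s) \<bullet> Y s) has_real_derivative (K j A1 \<bullet> \<tau> + K j A \<bullet> B1)) (at 0)" for j
    proof -
      have KX: "((\<lambda>s. K j (X s)) has_vector_derivative K j A1) (at 0)"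
        by (rule bounded_linear.has_vector_derivative[OF linear_conv_bounded_linear[THEN iffD1, OF linK] dX])
      then show ?thesis
        using bounded_bilinear.has_vector_derivative[OF bounded_bilinear_inner KX dY]
        by (simp add: has_real_derivative_iff_has_vector_derivative X(6) Y(6) add.commute)
    qed
    \<comment> \<open>Both summands vanish by the normalisations of A1 and B1, so the denominator
      contributes nothing to the second derivative.\<close>
    have dXY: "((\<lambda>s. X s \<bullet> Y s) has_real_derivative (A1 \<bullet> \<tau> + A \<bullet> B1)) (at 0)"
      using bounded_bilinear.has_vector_derivative[OF bounded_bilinear_inner dX dY]
      by (simp add: has_real_derivative_iff_has_vector_derivative X(6) Y(6) add.commute)
    have dG: "(G has_real_derivative (\<Sum>j\<in>UNIV. (a j)\<^sup>2 * (K j A \<bullet> \<tau>) + a j * (K j A1 \<bullet> \<tau> + K j A \<bullet> B1))) (at 0)"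
      unfolding G_def
      by (rule derivative_eq_intros dK refl)+ (simp add: X(6) Y(6) power2_eq_square algebra_simps)
    \<comment> \<open>Moving \<open>1 - S 0\<close> across the pairing exchanges the two correctors,
      so the mixed terms coincide. Hence the factor 2, and B1 disappears from the result.\<close>
    have cross: "(\<Sum>j\<in>UNIV. a j * (K j A \<bullet> B1)) = (\<Sum>j\<in>UNIV. a j * (K j A1 \<bullet> \<tau>))"
    proof -
      have "(\<Sum>j\<in>UNIV. a j * (K j A \<bullet> B1)) = ((\<Sum>j\<in>UNIV. a j *\<^sub>R K j A) - deriv l 0 *\<^sub>R A) \<bullet> B1"
        using B1A by (simp add: inner_sum_left inner_diff_left inner_commute[of A B1])
      also have "\<dots> = A1 \<bullet> (B1 - (\<Sum>j\<in>UNIV. T j B1))"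
        unfolding A1(1)[symmetric] by (simp add: inner_diff_left inner_diff_right inner_sum_left inner_sum_right adj)
      also have "\<dots> = (\<Sum>j\<in>UNIV. a j * (K j A1 \<bullet> \<tau>))"
        unfolding B1 by (simp add: inner_diff_right inner_sum_right adj A1(2))
      finally show ?thesis .
    qed
    have "((\<lambda>s. G s / (X s \<bullet> Y s)) has_real_derivative
        (\<Sum>j\<in>UNIV. (a j)\<^sup>2 * (K j A \<bullet> \<tau>) + a j * (K j A1 \<bullet> \<tau> + K j A \<bullet> B1))) (at 0)"
      using DERIV_divide[OF dG dXY] B1A A1(2) Atau by (simp add: X(6) Y(6) inner_commute)
    moreover have "\<forall>\<^sub>F s in nhds 0. G s / (X s \<bullet> Y s) = deriv l s"
      using derivl dpos by (auto simp: eventually_nhds_metric dist_real_def intro!: exI[of _ \<delta>])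
    ultimately have "(deriv l has_real_derivative
        (\<Sum>j\<in>UNIV. (a j)\<^sup>2 * (K j A \<bullet> \<tau>) + a j * (K j A1 \<bullet> \<tau> + K j A \<bullet> B1))) (at 0)"
      by (subst (asm) DERIV_cong_ev[OF refl _ refl]) auto
    then show ?thesis
      by (simp add: sum.distrib distrib_left cross)
  qed
  show ?thesis
  proof (rule that[of \<delta> X l])
    show "\<exists>y. y \<noteq> 0 \<and> (\<Sum>j\<in>UNIV. exp (t * a j) *\<^sub>R T j y) = l t *\<^sub>R y" if "\<bar>t\<bar> < \<delta>" for t
    proof (intro exI[of _ "Y t"] conjI)
      show "Y t \<noteq> 0" using XY[OF that that] by auto
      show "(\<Sum>j\<in>UNIV. exp (t * a j) *\<^sub>R T j (Y t)) = l t *\<^sub>R Y t"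
        using Y(2)[of t] ll[OF that] that by (simp add: dual.S_def \<delta>_def)
    qed
    show "l differentiable (at t)" if "\<bar>t\<bar> < \<delta>" for t
      using dl[OF that] by (auto simp: real_differentiable_def)
    show "isCont X 0" using Xc dpos by simp
    show "S t (X t) = l t *\<^sub>R X t" if "\<bar>t\<bar> < \<delta>" for t using X(2)[of t] that by (simp add: \<delta>_def)
  qed (fact dpos X(5,6,7) l' second)+
qed

section \<open>Weak convergence and Gaussian measures\<close>

lemma prod_Basis_vec: "(\<Prod>b\<in>(Basis :: (real ^ 'd) set). f b) = (\<Prod>i\<in>UNIV. f (axis i 1))"
proof -
  have "(Basis :: (real ^ 'd) set) = range (\<lambda>i. axis i 1)" by (auto simp: Basis_vec_def)
  moreover have "inj (\<lambda>i::'d. axis i 1 :: real ^ 'd)" by (auto simp: inj_on_def axis_eq_axis)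
  ultimately show ?thesis by (metis (mono_tags, lifting) prod.reindex_cong)
qed

lemma integral_lborel_prod:
  fixes h :: "'a::euclidean_space \<Rightarrow> real \<Rightarrow> complex"
  assumes "\<And>b. b \<in> Basis \<Longrightarrow> integrable lborel (h b)"
  shows "(\<integral>x. (\<Prod>b\<in>Basis. h b (x \<bullet> b)) \<partial>lborel) = (\<Prod>b\<in>Basis. \<integral>x. h b x \<partial>lborel)"
proof -
  interpret product_sigma_finite "\<lambda>b::'a. lborel :: real measure" by standard
  have [measurable]: "b \<in> Basis \<Longrightarrow> h b \<in> borel_measurable borel" for b
    using borel_measurable_integrable[OF assms[of b]] by simp
  have "(\<integral>x. (\<Prod>b\<in>Basis. h b (x \<bullet> b)) \<partial>lborel)
      = (\<integral>f. (\<Prod>b\<in>Basis. h b ((\<Sum>c\<in>Basis. f c *\<^sub>R c) \<bullet> b)) \<partial>(\<Pi>\<^sub>M b\<in>(Basis::'a set). lborel))"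
    by (subst lborel_eq, subst integral_distr) auto
  also have "\<dots> = (\<integral>f. (\<Prod>b\<in>Basis. h b (f b)) \<partial>(\<Pi>\<^sub>M b\<in>(Basis::'a set). lborel))"
    by (intro Bochner_Integration.integral_cong refl prod.cong) simp
  also have "\<dots> = (\<Prod>b\<in>Basis. \<integral>x. h b x \<partial>lborel)"
    by (rule product_integral_prod) (auto simp: assms)
  finally show ?thesis .
qed

definition gauss_density :: "real ^ 'd \<Rightarrow> real" where
  "gauss_density z = (\<Prod>i\<in>UNIV. std_normal_density (z $ i))"

lemma gauss_density_measurable [measurable]: "gauss_density \<in> borel_measurable borel"
  unfolding gauss_density_def by measurable

lemma gauss_density_nonneg: "gauss_density z \<ge> 0"
  by (simp add: gauss_density_def prod_nonneg)

text \<open>The normalising constant stays the value at 0: it enters the smoothing formula only as a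
  common factor and is never evaluated.\<close>

lemma gauss_density_eq:
  fixes z :: "real ^ 'd"
  shows "gauss_density z = gauss_density (0 :: real ^ 'd) * exp (- (norm z)\<^sup>2 / 2)"
proof -
  have "(norm z)\<^sup>2 = (\<Sum>i\<in>UNIV. (z $ i)\<^sup>2)"
    by (simp only: power2_norm_eq_inner inner_vec_def) (simp add: power2_eq_square)
  then have "exp (- (norm z)\<^sup>2 / 2) = (\<Prod>i\<in>(UNIV::'d set). exp (- (z $ i)\<^sup>2 / 2))"
    by (simp add: exp_sum[symmetric] sum_negf sum_divide_distrib)
  then show ?thesis
    by (simp add: gauss_density_def normal_density_def prod_dividef power_divide)
qed

lemma std_gaussian_eq: "std_gaussian = density lborel (\<lambda>z. ennreal (gauss_density z))"
  by (simp add: std_gaussian_def gauss_density_def)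

lemma sets_std_gaussian [measurable_cong, simp]: "sets std_gaussian = sets borel"
  by (simp add: std_gaussian_eq)

lemma space_std_gaussian [simp]: "space std_gaussian = UNIV"
  by (simp add: std_gaussian_eq)

lemma prob_space_std_gaussian: "prob_space (std_gaussian :: (real ^ 'd) measure)"
proof
  have "emeasure std_gaussian (space (std_gaussian :: (real ^ 'd) measure)) = (\<integral>\<^sup>+z. ennreal (gauss_density (z :: real ^ 'd)) \<partial>lborel)"
    by (simp add: std_gaussian_eq emeasure_density)
  also have "\<dots> = (\<integral>\<^sup>+z. (\<Prod>b\<in>Basis. ennreal (std_normal_density (z \<bullet> b))) \<partial>(lborel :: (real ^ 'd) measure))"
    by (intro nn_integral_cong) (simp add: prod_Basis_vec gauss_density_def prod_ennreal inner_axis)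
  also have "\<dots> = (\<Prod>b\<in>(Basis :: (real ^ 'd) set). \<integral>\<^sup>+x. ennreal (std_normal_density x) \<partial>lborel)"
    by (rule nn_integral_lborel_prod) auto
  also have "(\<integral>\<^sup>+x. ennreal (std_normal_density x) \<partial>lborel) = 1"
  proof -
    interpret prob_space std_normal_distribution by (simp add: prob_space_normal_density)
    show ?thesis using emeasure_space_1 by (simp add: emeasure_density)
  qed
  finally show "emeasure std_gaussian (space (std_gaussian :: (real ^ 'd) measure)) = 1" by simp
qed

lemma integral_std_gaussian:
  fixes f :: "real ^ 'd \<Rightarrow> 'b::{banach, second_countable_topology}"
  assumes "f \<in> borel_measurable borel"
  shows "(\<integral>z. f z \<partial>std_gaussian) = (\<integral>z. gauss_density z *\<^sub>R f z \<partial>lborel)"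
  unfolding std_gaussian_eq by (rule integral_density) (use assms gauss_density_nonneg in auto)

lemma char_std_gaussian:
  fixes u :: "real ^ 'd"
  shows "(\<integral>z. iexp (u \<bullet> z) \<partial>std_gaussian) = exp (- (norm u)\<^sup>2 / 2)"
proof -
  define h where "h b x = complex_of_real (std_normal_density x) * iexp ((u \<bullet> b) * x)" for b x
  have int: "integrable lborel (h b)" for b
  proof (rule Bochner_Integration.integrable_bound[where f = "std_normal_density"])
    show "h b \<in> borel_measurable lborel" unfolding h_def by measurable
  qed (auto simp: h_def norm_mult)
  have hint: "(\<integral>x. h b x \<partial>lborel) = exp (- (u \<bullet> b)\<^sup>2 / 2)" for b
  proof -
    have "(\<integral>x. h b x \<partial>lborel) = (\<integral>x. iexp ((u \<bullet> b) * x) \<partial>std_normal_distribution)"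
      by (subst integral_density) (simp_all add: h_def[abs_def] scaleR_conv_of_real)
    also have "\<dots> = char std_normal_distribution (u \<bullet> b)" by (simp add: char_def)
    finally show ?thesis by (simp add: char_std_normal_distribution)
  qed
  have "(\<integral>z. iexp (u \<bullet> z) \<partial>std_gaussian) = (\<integral>z. gauss_density z *\<^sub>R iexp (u \<bullet> z) \<partial>lborel)"
    by (rule integral_std_gaussian) measurable
  also have "\<dots> = (\<integral>z. (\<Prod>b\<in>Basis. h b (z \<bullet> b)) \<partial>lborel)"
  proof (intro Bochner_Integration.integral_cong refl)
    fix z :: "real ^ 'd"
    have "(\<Prod>b\<in>Basis. h b (z \<bullet> b)) = (\<Prod>i\<in>UNIV. complex_of_real (std_normal_density (z $ i))) * (\<Prod>i\<in>UNIV. iexp (u $ i * z $ i))"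
      by (simp add: prod_Basis_vec h_def inner_axis prod.distrib)
    also have "(\<Prod>i\<in>UNIV. iexp (u $ i * z $ i)) = iexp (u \<bullet> z)"
      by (simp add: exp_sum[symmetric] inner_vec_def sum_distrib_left)
    finally show "gauss_density z *\<^sub>R iexp (u \<bullet> z) = (\<Prod>b\<in>Basis. h b (z \<bullet> b))"
      by (simp add: gauss_density_def scaleR_conv_of_real)
  qed
  also have "\<dots> = (\<Prod>b\<in>Basis. complex_of_real (exp (- (u \<bullet> b)\<^sup>2 / 2)))"
    by (simp add: integral_lborel_prod int hint)
  also have "\<dots> = exp (- (norm u)\<^sup>2 / 2)"
  proof -
    have "(norm u)\<^sup>2 = (\<Sum>b\<in>Basis. (u \<bullet> b)\<^sup>2)" 
      by (simp only: power2_norm_eq_inner euclidean_inner[of u u]) (simp add: power2_eq_square)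
    then show ?thesis by (simp add: of_real_prod[symmetric] exp_sum[symmetric] sum_negf sum_divide_distrib del: of_real_prod)
  qed
  finally show ?thesis by simp
qed

section \<open>Square roots of positive semidefinite matrices and general Gaussians\<close>

lemma psd_sqrt_exists:
  fixes D :: "real ^ 'd ^ 'd"
  assumes "transpose D = D" "\<And>u. 0 \<le> u \<bullet> (D *v u)"
  shows "\<exists>B :: real ^ 'd ^ 'd. B ** transpose B = D"
proof -
  define q where "q D u = (\<Sum>k\<in>UNIV. \<Sum>l\<in>UNIV. u k * D k l * u l)" for D :: "'d \<Rightarrow> 'd \<Rightarrow> real" and u
  \<comment> \<open>Cholesky elimination: I holds the indices whose rows may still be nonzero, and
    each step removes one of them by subtracting a rank-one term. The columns of B outside I vanish,
    so the new column can be added without interference.\<close>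
  have main: "\<exists>B :: 'd \<Rightarrow> 'd \<Rightarrow> real. (\<forall>i k. i \<notin> I \<longrightarrow> B k i = 0) \<and> (\<forall>k l. D k l = (\<Sum>i\<in>UNIV. B k i * B l i))"
    if "finite I" "\<And>k l. D k l = D l k" "\<And>u. 0 \<le> q D u" "\<And>i k. i \<notin> I \<Longrightarrow> D i k = 0" for I D
    using that
  proof (induction I arbitrary: D)
    case empty
    then show ?case by (intro exI[of _ "\<lambda>_ _. 0"]) simp
  next
    case (insert i I)
    \<comment> \<open>The form as a quadratic polynomial in a shift of coordinate i; the rest of the
      step evaluates it at chosen shifts.\<close>
    have expand: "q D (\<lambda>k. u k + (if k = i then t else 0)) = q D u + 2 * t * (\<Sum>k\<in>UNIV. D i k * u k) + t\<^sup>2 * D i i" for u t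
    proof -
      have "q D (\<lambda>k. u k + (if k = i then t else 0)) = q D u + (\<Sum>k\<in>UNIV. \<Sum>l\<in>UNIV. (if k = i then t else 0) * D k l * u l)
         + (\<Sum>k\<in>UNIV. \<Sum>l\<in>UNIV. u k * D k l * (if l = i then t else 0))
         + (\<Sum>k\<in>UNIV. \<Sum>l\<in>UNIV. (if k = i then t else 0) * D k l * (if l = i then t else 0))"
        by (simp add: q_def sum.distrib[symmetric] algebra_simps)
      also have "(\<Sum>k\<in>UNIV. \<Sum>l\<in>UNIV. (if k = i then t else 0) * D k l * u l) = t * (\<Sum>k\<in>UNIV. D i k * u k)"
        by (subst sum.swap) (simp add: if_distrib[of "\<lambda>x. x * _"] sum_distrib_left mult.assoc cong: if_cong)
      also have "(\<Sum>k\<in>UNIV. \<Sum>l\<in>UNIV. u k * D k l * (if l = i then t else 0)) = t * (\<Sum>k\<in>UNIV. D i k * u k)"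
        by (simp add: if_distrib[of "\<lambda>x. _ * x"] sum_distrib_left insert.prems(1)[of _ i] mult_ac cong: if_cong)
      also have "(\<Sum>k\<in>UNIV. \<Sum>l\<in>UNIV. (if k = i then t else 0) * D k l * (if l = i then t else 0)) = t\<^sup>2 * D i i"
      proof -
        have "(\<Sum>l\<in>UNIV. (if k = i then t else 0) * D k l * (if l = i then t else 0)) = (if k = i then t\<^sup>2 * D i i else 0)" for k
          by (cases "k = i") (simp_all add: if_distrib[of "\<lambda>x. _ * x"] power2_eq_square mult_ac cong: if_cong)
        then show ?thesis by simp
      qed
      finally show ?thesis by simp
    qed
    show ?case
    proof (cases "D i i = 0")
      case True
      have "D i k = 0" for k
      proof (rule ccontr)
        assume nz: "D i k \<noteq> 0"
        define e where "e l = (if l = k then 1 else 0 :: real)" for l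
        have s: "(\<Sum>l\<in>UNIV. D i l * e l) = D i k"
          by (simp add: e_def if_distrib[of "\<lambda>x. _ * x"] cong: if_cong)
        \<comment> \<open>With a zero pivot the form is affine in the shift, and this shift makes it
          equal to -1.\<close>
        have "0 \<le> q D (\<lambda>l. e l + (if l = i then - (q D e + 1) / (2 * D i k) else 0))" by (rule insert.prems)
        also have "\<dots> = -1" unfolding expand s using nz True by (simp add: field_simps)
        finally show False by simp
      qed
      then have "\<And>k l. k \<notin> I \<Longrightarrow> D k l = 0" using insert.prems(3) by (metis insert_iff)
      then obtain B where "\<forall>i k. i \<notin> I \<longrightarrow> B k i = 0" "\<forall>k l. D k l = (\<Sum>i\<in>UNIV. B k i * B l i)"
        using insert.IH[of D] insert.prems by metis
      then show ?thesis by (intro exI[of _ B]) auto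
    next
      case False
      \<comment> \<open>Schur complement of the pivot.\<close>
      define D' where "D' k l = D k l - D i k * D i l / D i i" for k l
      have "D i i \<ge> 0"
      proof -
        have "0 \<le> q D (\<lambda>k. 0 + (if k = i then 1 else 0))" by (rule insert.prems)
        also have "\<dots> = D i i" by (subst expand) (simp add: q_def)
        finally show ?thesis .
      qed
      then have pos: "D i i > 0" using False by simp
      have D'q: "0 \<le> q D' u" for u
      proof -
        define w where "w = (\<Sum>k\<in>UNIV. D i k * u k)"
        have "q D' u = q D u - (\<Sum>k\<in>UNIV. \<Sum>l\<in>UNIV. (D i k * u k) * (D i l * u l)) / D i i"
          by (simp add: q_def D'_def sum_subtractf[symmetric] sum_divide_distrib algebra_simps)
        also have "(\<Sum>k\<in>UNIV. \<Sum>l\<in>UNIV. (D i k * u k) * (D i l * u l)) = w\<^sup>2"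
          by (simp add: w_def power2_eq_square sum_product)
        \<comment> \<open>The form of the Schur complement is the original form at the minimising
          shift of coordinate i, hence nonnegative.\<close>
        also have "q D u - w\<^sup>2 / D i i = q D (\<lambda>k. u k + (if k = i then - w / D i i else 0))"
          unfolding expand w_def[symmetric] using False by (simp add: field_simps power2_eq_square)
        finally show ?thesis using insert.prems(2) by simp
      qed
      have D'0: "D' k l = 0" if "k \<notin> I" for k l
        using insert.prems(3)[of k l] insert.prems(3)[of k i] insert.prems(1)[of i k] insert.hyps that False
        by (cases "k = i") (auto simp: D'_def)
      have D's: "D' k l = D' l k" for k l using insert.prems(1)[of k l] by (simp add: D'_def mult.commute)
      obtain B where B: "\<forall>i k. i \<notin> I \<longrightarrow> B k i = 0" "\<forall>k l. D' k l = (\<Sum>i\<in>UNIV. B k i * B l i)"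
        using insert.IH[OF D's D'q D'0] by blast
      define B' where "B' k j = (if j = i then D i k / sqrt (D i i) else B k j)" for k j
      have "D k l = (\<Sum>j\<in>UNIV. B' k j * B' l j)" for k l
      proof -
        have "(\<Sum>j\<in>UNIV. B' k j * B' l j) = (\<Sum>j\<in>UNIV. B k j * B l j + (if j = i then D i k * D i l / D i i else 0))"
          using pos B(1) insert.hyps(2) by (intro sum.cong) (auto simp: B'_def)
        also have "\<dots> = D' k l + D i k * D i l / D i i" using B(2) by (simp add: sum.distrib)
        finally show ?thesis by (simp add: D'_def)
      qed
      then show ?thesis using B(1) by (intro exI[of _ B']) (auto simp: B'_def)
    qed
  qed
  have qq: "q (\<lambda>k l. D $ k $ l) u = (\<chi> k. u k) \<bullet> (D *v (\<chi> k. u k))" for u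
    by (simp add: q_def inner_vec_def matrix_vector_mult_def sum_distrib_left mult.assoc)
  have sym: "D $ k $ l = D $ l $ k" for k l using assms(1) by (metis transpose_def vec_lambda_beta)
  have "\<exists>B :: 'd \<Rightarrow> 'd \<Rightarrow> real. (\<forall>i k. i \<notin> UNIV \<longrightarrow> B k i = 0) \<and> (\<forall>k l. D $ k $ l = (\<Sum>i\<in>UNIV. B k i * B l i))"
    by (rule main) (simp_all add: qq assms(2), rule sym)
  then obtain B :: "'d \<Rightarrow> 'd \<Rightarrow> real" where B: "\<forall>k l. D $ k $ l = (\<Sum>i\<in>UNIV. B k i * B l i)" by blast
  then have "(\<chi> k i. B k i) ** transpose (\<chi> k i. B k i) = D"
    by (simp add: matrix_matrix_mult_def transpose_def vec_eq_iff)
  then show ?thesis by blast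
qed

text \<open>Legitimises the choice inside \<open>gaussian\<close>: a square root B exists, and the
  characteristic function sees it only through its product with the transpose.\<close>

lemma char_gaussian:
  fixes D :: "real ^ 'd ^ 'd"
  assumes "transpose D = D" "\<And>u. 0 \<le> u \<bullet> (D *v u)"
  shows "prob_space (gaussian D)" "sets (gaussian D) = sets borel"
    "(\<integral>z. iexp (u \<bullet> z) \<partial>gaussian D) = exp (- (u \<bullet> (D *v u)) / 2)"
proof -
  interpret G: prob_space "std_gaussian :: (real ^ 'd) measure" by (rule prob_space_std_gaussian)
  define B where "B = (SOME B :: real ^ 'd ^ 'd. B ** transpose B = D)"
  have B: "B ** transpose B = D" unfolding B_def by (rule someI_ex[OF psd_sqrt_exists[OF assms]])
  have [measurable]: "(*v) B \<in> borel_measurable borel"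
    by (intro borel_measurable_continuous_onI linear_continuous_on) (simp add: linear_conv_bounded_linear[symmetric])
  have g: "gaussian D = distr std_gaussian borel ((*v) B)" by (simp add: gaussian_def B_def)
  show "prob_space (gaussian D)" unfolding g by (rule G.prob_space_distr) simp
  show "sets (gaussian D) = sets borel" by (simp add: g)
  have "(\<integral>z. iexp (u \<bullet> z) \<partial>gaussian D) = (\<integral>z. iexp (u \<bullet> (B *v z)) \<partial>std_gaussian)"
    unfolding g by (subst integral_distr) simp_all
  also have "\<dots> = (\<integral>z. iexp ((transpose B *v u) \<bullet> z) \<partial>std_gaussian)"
    by (simp add: dot_lmul_matrix[symmetric])
  also have "\<dots> = exp (- (norm (transpose B *v u))\<^sup>2 / 2)" by (rule char_std_gaussian)
  also have "(norm (transpose B *v u))\<^sup>2 = u \<bullet> (D *v u)"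
    unfolding power2_norm_eq_inner B[symmetric]
    by (simp add: dot_lmul_matrix matrix_vector_mul_assoc[symmetric])
  finally show "(\<integral>z. iexp (u \<bullet> z) \<partial>gaussian D) = exp (- (u \<bullet> (D *v u)) / 2)" by simp
qed

section \<open>Levy continuity in several dimensions by Gaussian smoothing\<close>

lemma char_function_smoothing:
  fixes M :: "(real ^ 'd) measure"
  assumes "prob_space M" "sets M = sets borel" "\<sigma> > 0"
  shows "complex_of_real (\<integral>x. exp (- (norm (y - x))\<^sup>2 / (2 * \<sigma>\<^sup>2)) \<partial>M)
    = (\<integral>z. iexp (- (z \<bullet> y) / \<sigma>) * (\<integral>x. iexp (((1 / \<sigma>) *\<^sub>R z) \<bullet> x) \<partial>M) \<partial>std_gaussian)"
proof -
  interpret M: prob_space M by fact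
  interpret G: prob_space "std_gaussian :: (real ^ 'd) measure" by (rule prob_space_std_gaussian)
  interpret pair_prob_space "std_gaussian :: (real ^ 'd) measure" M ..
  note [measurable_cong] = assms(2)
  have int: "integrable (std_gaussian \<Otimes>\<^sub>M M) (\<lambda>(z, x). iexp (z \<bullet> (x - y) / \<sigma>))"
  proof (rule P.integrable_const_bound[where B = 1])
    show "(\<lambda>(z, x). iexp (z \<bullet> (x - y) / \<sigma>)) \<in> borel_measurable (std_gaussian \<Otimes>\<^sub>M M)"
      unfolding split_beta by measurable
  qed auto
  \<comment> \<open>The Gaussian kernel is itself the characteristic function of a standard Gaussian
    z, taken at (x - y) / \<sigma>. Fubini then moves the integral against M onto its characteristic
    function.\<close>
  have "complex_of_real (\<integral>x. exp (- (norm (y - x))\<^sup>2 / (2 * \<sigma>\<^sup>2)) \<partial>M)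
      = (\<integral>x. complex_of_real (exp (- (norm ((1 / \<sigma>) *\<^sub>R (x - y)))\<^sup>2 / 2)) \<partial>M)"
    using assms(3)
    by (subst integral_complex_of_real[symmetric]) (simp add: power_mult_distrib power_divide norm_minus_commute mult.commute)
  also have "\<dots> = (\<integral>x. (\<integral>z. iexp (z \<bullet> (x - y) / \<sigma>) \<partial>std_gaussian) \<partial>M)"
    by (simp only: char_std_gaussian[symmetric]) (simp add: inner_commute)
  also have "\<dots> = (\<integral>z. (\<integral>x. iexp (z \<bullet> (x - y) / \<sigma>) \<partial>M) \<partial>std_gaussian)"
    by (rule Fubini_integral[OF int])
  also have "\<dots> = (\<integral>z. iexp (- (z \<bullet> y) / \<sigma>) * (\<integral>x. iexp (((1 / \<sigma>) *\<^sub>R z) \<bullet> x) \<partial>M) \<partial>std_gaussian)"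
  proof (intro Bochner_Integration.integral_cong refl)
    fix z :: "real ^ 'd"
    have "iexp (z \<bullet> (x - y) / \<sigma>) = iexp (- (z \<bullet> y) / \<sigma>) * iexp (((1 / \<sigma>) *\<^sub>R z) \<bullet> x)" for x
      by (simp add: exp_add[symmetric] inner_diff_right diff_divide_distrib algebra_simps)
    then show "(\<integral>x. iexp (z \<bullet> (x - y) / \<sigma>) \<partial>M) = iexp (- (z \<bullet> y) / \<sigma>) * (\<integral>x. iexp (((1 / \<sigma>) *\<^sub>R z) \<bullet> x) \<partial>M)"
      by simp
  qed
  finally show ?thesis .
qed

text \<open>The substitution y = x + \<sigma> z moves x from the argument of f into the kernel, so
  that smoothing the function becomes smoothing the measure.\<close>

lemma gaussian_average_eq:
  fixes f :: "real ^ 'd \<Rightarrow> real"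
  assumes [measurable]: "f \<in> borel_measurable borel" and "\<sigma> > 0"
  shows "(\<integral>z. f (x + \<sigma> *\<^sub>R z) \<partial>std_gaussian)
    = (gauss_density (0 :: real ^ 'd) / \<sigma> ^ CARD('d)) * (\<integral>y. f y * exp (- (norm (y - x))\<^sup>2 / (2 * \<sigma>\<^sup>2)) \<partial>lborel)"
proof -
  have "(\<integral>y. f y * exp (- (norm (y - x))\<^sup>2 / (2 * \<sigma>\<^sup>2)) \<partial>lborel)
     = (\<integral>z. \<bar>\<sigma>\<bar> ^ DIM(real ^ 'd) *\<^sub>R (f (x + \<sigma> *\<^sub>R z) * exp (- (norm (x + \<sigma> *\<^sub>R z - x))\<^sup>2 / (2 * \<sigma>\<^sup>2))) \<partial>lborel)"
    using assms(2)
    by (subst lborel_affine[of \<sigma> x]) (simp_all add: integral_density integral_distr)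
  also have "\<dots> = \<sigma> ^ CARD('d) * (\<integral>z. f (x + \<sigma> *\<^sub>R z) * exp (- (norm z)\<^sup>2 / 2) \<partial>lborel)"
    using assms(2) by (simp add: power_mult_distrib)
  finally have *: "(\<integral>z. f (x + \<sigma> *\<^sub>R z) * exp (- (norm z)\<^sup>2 / 2) \<partial>lborel)
     = (\<integral>y. f y * exp (- (norm (y - x))\<^sup>2 / (2 * \<sigma>\<^sup>2)) \<partial>lborel) / \<sigma> ^ CARD('d)"
    using assms(2) by simp
  have "(\<integral>z. f (x + \<sigma> *\<^sub>R z) \<partial>std_gaussian) = (\<integral>z. gauss_density z *\<^sub>R f (x + \<sigma> *\<^sub>R z) \<partial>lborel)"
    by (rule integral_std_gaussian) measurable
  also have "\<dots> = (\<integral>z. gauss_density (0 :: real ^ 'd) * (f (x + \<sigma> *\<^sub>R z) * exp (- (norm z)\<^sup>2 / 2)) \<partial>lborel)"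
    by (subst gauss_density_eq) (simp add: mult_ac)
  also have "\<dots> = gauss_density (0 :: real ^ 'd) * (\<integral>z. f (x + \<sigma> *\<^sub>R z) * exp (- (norm z)\<^sup>2 / 2) \<partial>lborel)"
    by (rule integral_mult_right_zero)
  finally show ?thesis unfolding * by simp
qed

text \<open>Up to a constant factor, the smoothed measures have densities that are bounded by 1 and
  determined by characteristic functions, so they converge pointwise. Dominated convergence with
  majorant |f| finishes; tightness does not enter at this stage.\<close>

lemma gaussian_smoothing_converges:
  fixes M :: "nat \<Rightarrow> (real ^ 'd) measure" and f :: "real ^ 'd \<Rightarrow> real"
  assumes M: "\<And>n. prob_space (M n)" "\<And>n. sets (M n) = sets borel"
    and N: "prob_space N" "sets N = sets borel"
    and conv: "\<And>u. (\<lambda>n. \<integral>x. iexp (u \<bullet> x) \<partial>M n) \<longlonglongrightarrow> (\<integral>x. iexp (u \<bullet> x) \<partial>N)"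
    and f: "f \<in> borel_measurable borel" "integrable lborel f" and \<sigma>: "\<sigma> > 0"
  shows "(\<lambda>n. \<integral>x. (\<integral>z. f (x + \<sigma> *\<^sub>R z) \<partial>std_gaussian) \<partial>M n) \<longlonglongrightarrow> (\<integral>x. (\<integral>z. f (x + \<sigma> *\<^sub>R z) \<partial>std_gaussian) \<partial>N)"
proof -
  interpret G: prob_space "std_gaussian :: (real ^ 'd) measure" by (rule prob_space_std_gaussian)
  define K where "K Q y = (\<integral>x. exp (- (norm (y - x))\<^sup>2 / (2 * \<sigma>\<^sup>2)) \<partial>Q)" for Q :: "(real ^ 'd) measure" and y
  have Kmeas: "K Q \<in> borel_measurable borel" if "prob_space Q" "sets Q = sets borel" for Q
  proof -
    interpret Q: prob_space Q by fact
    note [measurable_cong] = that(2)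
    show ?thesis unfolding K_def by measurable
  qed
  have Kb: "\<bar>K Q y\<bar> \<le> 1" if "prob_space Q" "sets Q = sets borel" for Q y
  proof -
    interpret Q: prob_space Q by fact
    note [measurable_cong] = that(2)
    have "integrable Q (\<lambda>x. exp (- (norm (y - x))\<^sup>2 / (2 * \<sigma>\<^sup>2)))"
      by (rule Q.integrable_const_bound[where B = 1]) auto
    then have "K Q y \<le> (\<integral>x. 1 \<partial>Q)" unfolding K_def by (intro integral_mono) auto
    moreover have "K Q y \<ge> 0" unfolding K_def by (intro integral_nonneg_AE) auto
    ultimately show ?thesis by (simp add: Q.prob_space)
  qed
  have Kconv: "(\<lambda>n. K (M n) y) \<longlonglongrightarrow> K N y" for y
  proof -
    have meas: "(\<lambda>z. \<integral>x. iexp (((1 / \<sigma>) *\<^sub>R z) \<bullet> x) \<partial>Q) \<in> borel_measurable borel" if "prob_space Q" "sets Q = sets borel" for Q :: "(real ^ 'd) measure"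
    proof -
      interpret Q: prob_space Q by fact
      note [measurable_cong] = that(2)
      show ?thesis by measurable
    qed
    have nb: "norm (\<integral>x. iexp (((1 / \<sigma>) *\<^sub>R z) \<bullet> x) \<partial>Q) \<le> 1" if "prob_space Q" "sets Q = sets borel" for Q :: "(real ^ 'd) measure" and z
    proof -
      interpret Q: prob_space Q by fact
      have "norm (\<integral>x. iexp (((1 / \<sigma>) *\<^sub>R z) \<bullet> x) \<partial>Q) \<le> (\<integral>x. norm (iexp (((1 / \<sigma>) *\<^sub>R z) \<bullet> x)) \<partial>Q)"
        by (rule integral_norm_bound)
      then show ?thesis by (simp add: Q.prob_space)
    qed
    have "(\<lambda>n. \<integral>z. iexp (- (z \<bullet> y) / \<sigma>) * (\<integral>x. iexp (((1 / \<sigma>) *\<^sub>R z) \<bullet> x) \<partial>M n) \<partial>std_gaussian)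
      \<longlonglongrightarrow> (\<integral>z. iexp (- (z \<bullet> y) / \<sigma>) * (\<integral>x. iexp (((1 / \<sigma>) *\<^sub>R z) \<bullet> x) \<partial>N) \<partial>std_gaussian)"
    proof (rule integral_dominated_convergence[where w = "\<lambda>_. 1"])
      show "(\<lambda>z. iexp (- (z \<bullet> y) / \<sigma>) * (\<integral>x. iexp (((1 / \<sigma>) *\<^sub>R z) \<bullet> x) \<partial>N)) \<in> borel_measurable std_gaussian"
        using meas[OF N] by measurable
      show "(\<lambda>z. iexp (- (z \<bullet> y) / \<sigma>) * (\<integral>x. iexp (((1 / \<sigma>) *\<^sub>R z) \<bullet> x) \<partial>M n)) \<in> borel_measurable std_gaussian" for n
        using meas[OF M] by measurable
      show "AE z in std_gaussian. norm (iexp (- (z \<bullet> y) / \<sigma>) * (\<integral>x. iexp (((1 / \<sigma>) *\<^sub>R z) \<bullet> x) \<partial>M n)) \<le> 1" for n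
        using nb[OF M, of n] by (simp add: norm_mult)
      show "AE z in std_gaussian. (\<lambda>n. iexp (- (z \<bullet> y) / \<sigma>) * (\<integral>x. iexp (((1 / \<sigma>) *\<^sub>R z) \<bullet> x) \<partial>M n))
        \<longlonglongrightarrow> iexp (- (z \<bullet> y) / \<sigma>) * (\<integral>x. iexp (((1 / \<sigma>) *\<^sub>R z) \<bullet> x) \<partial>N)"
      by (intro AE_I2 tendsto_mult_left conv)
  qed simp
    then have "(\<lambda>n. complex_of_real (K (M n) y)) \<longlonglongrightarrow> complex_of_real (K N y)"
      unfolding K_def by (simp only: char_function_smoothing[OF M \<sigma>] char_function_smoothing[OF N \<sigma>])
    then show ?thesis by (simp add: tendsto_of_real_iff)
  qed
  define c where "c = gauss_density (0 :: real ^ 'd) / \<sigma> ^ CARD('d)"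
  have rep: "(\<integral>x. (\<integral>z. f (x + \<sigma> *\<^sub>R z) \<partial>std_gaussian) \<partial>Q) = c * (\<integral>y. f y * K Q y \<partial>lborel)"
    if "prob_space Q" "sets Q = sets borel" for Q
  proof -
    interpret Q: prob_space Q by fact
    interpret pair_sigma_finite "lborel :: (real ^ 'd) measure" Q ..
    note [measurable_cong] = that(2)
    note [measurable] = f(1)
    have int1: "integrable (lborel \<Otimes>\<^sub>M Q) (\<lambda>(y, x). f y)"
    proof (rule Fubini_integrable)
      show "integrable lborel (\<lambda>y. \<integral>x. norm (case (y, x) of (y, x) \<Rightarrow> f y) \<partial>Q)"
        using f(2) by (simp add: Q.prob_space)
    qed (auto simp: split_beta)
    have int: "integrable (lborel \<Otimes>\<^sub>M Q) (\<lambda>(y, x). f y * exp (- (norm (y - x))\<^sup>2 / (2 * \<sigma>\<^sup>2)))"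
      by (rule Bochner_Integration.integrable_bound[OF int1])
         (auto simp: split_beta abs_mult intro!: mult_left_le)
    have "(\<integral>x. (\<integral>z. f (x + \<sigma> *\<^sub>R z) \<partial>std_gaussian) \<partial>Q) = c * (\<integral>x. (\<integral>y. f y * exp (- (norm (y - x))\<^sup>2 / (2 * \<sigma>\<^sup>2)) \<partial>lborel) \<partial>Q)"
      by (simp add: gaussian_average_eq[OF f(1) \<sigma>] c_def)
    also have "(\<integral>x. (\<integral>y. f y * exp (- (norm (y - x))\<^sup>2 / (2 * \<sigma>\<^sup>2)) \<partial>lborel) \<partial>Q)
       = (\<integral>y. (\<integral>x. f y * exp (- (norm (y - x))\<^sup>2 / (2 * \<sigma>\<^sup>2)) \<partial>Q) \<partial>lborel)"
      by (rule Fubini_integral[OF int])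
    finally show ?thesis by (simp add: K_def)
  qed
  have "(\<lambda>n. \<integral>y. f y * K (M n) y \<partial>lborel) \<longlonglongrightarrow> (\<integral>y. f y * K N y \<partial>lborel)"
  proof (rule integral_dominated_convergence[where w = "\<lambda>y. norm (f y)"])
    show "(\<lambda>y. f y * K N y) \<in> borel_measurable lborel" using f(1) Kmeas[OF N] by measurable
    show "(\<lambda>y. f y * K (M n) y) \<in> borel_measurable lborel" for n using f(1) Kmeas[OF M] by measurable
    show "AE y in lborel. norm (f y * K (M n) y) \<le> norm (f y)" for n
      using Kb[OF M] by (auto simp: abs_mult intro!: mult_left_le)
  qed (use f in \<open>auto intro!: tendsto_intros Kconv\<close>)
  then show ?thesis unfolding rep[OF M] rep[OF N] by (intro tendsto_intros)
qed

lemma uniform_continuity_compact_support: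
  fixes f :: "'a::euclidean_space \<Rightarrow> real"
  assumes "continuous_on UNIV f" "\<And>x. norm x \<ge> R \<Longrightarrow> f x = 0" "\<epsilon> > 0"
  obtains \<delta> where "\<delta> > 0" "\<And>x y. dist x y < \<delta> \<Longrightarrow> \<bar>f x - f y\<bar> < \<epsilon>"
proof -
  \<comment> \<open>One unit of margin: points closer than 1 lie either both in the enlarged ball or
    both where f vanishes.\<close>
  have "uniformly_continuous_on (cball 0 (R + 1)) f"
    using assms(1) by (intro compact_uniformly_continuous) (auto intro: continuous_on_subset)
  then obtain d where d: "d > 0" "\<And>x y. x \<in> cball 0 (R + 1) \<Longrightarrow> y \<in> cball 0 (R + 1) \<Longrightarrow> dist y x < d \<Longrightarrow> dist (f y) (f x) < \<epsilon>"
    using assms(3) unfolding uniformly_continuous_on_def by metis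
  have "\<bar>f x - f y\<bar> < \<epsilon>" if h: "dist x y < min d 1" for x y
  proof (cases "norm x \<le> R + 1 \<and> norm y \<le> R + 1")
    case True
    then show ?thesis using d(2)[of y x] h by (simp add: dist_real_def)
  next
    case False
    have "\<bar>norm x - norm y\<bar> < 1" using h norm_triangle_ineq3[of x y] by (simp add: dist_norm)
    then have "norm x \<ge> R" "norm y \<ge> R" using False by auto
    then show ?thesis using assms(2,3) by simp
  qed
  then show ?thesis using d(1) that[of "min d 1"] by simp
qed

text \<open>Smoothing at a small scale moves f uniformly by at most \<epsilon>/4, hence moves its
  integral against any probability measure by no more. This reduces the claim to the smoothed
  case.\<close>

lemma convergence_compact_support:
  fixes M :: "nat \<Rightarrow> (real ^ 'd) measure" and f :: "real ^ 'd \<Rightarrow> real"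
  assumes M: "\<And>n. prob_space (M n)" "\<And>n. sets (M n) = sets borel"
    and N: "prob_space N" "sets N = sets borel"
    and conv: "\<And>u. (\<lambda>n. \<integral>x. iexp (u \<bullet> x) \<partial>M n) \<longlonglongrightarrow> (\<integral>x. iexp (u \<bullet> x) \<partial>N)"
    and f: "continuous_on UNIV f" "\<And>x. norm x \<ge> R \<Longrightarrow> f x = 0"
  shows "(\<lambda>n. \<integral>x. f x \<partial>M n) \<longlonglongrightarrow> (\<integral>x. f x \<partial>N)"
proof (rule LIMSEQ_I)
  fix \<epsilon> :: real assume "\<epsilon> > 0"
  interpret G: prob_space "std_gaussian :: (real ^ 'd) measure" by (rule prob_space_std_gaussian)
  have [measurable]: "f \<in> borel_measurable borel" by (rule borel_measurable_continuous_onI[OF f(1)])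
  have "compact (f ` cball 0 R)" by (intro compact_continuous_image continuous_on_subset[OF f(1)]) auto
  then have "bounded (f ` cball 0 R)" by (rule compact_imp_bounded)
  then obtain C0 where C0: "\<And>x. x \<in> cball 0 R \<Longrightarrow> \<bar>f x\<bar> \<le> C0"
    unfolding bounded_iff real_norm_def by blast
  define C where "C = max C0 0 + 1"
  have C: "C > 0" "\<And>x. \<bar>f x\<bar> \<le> C"
  proof -
    show "C > 0" by (simp add: C_def)
    show "\<bar>f x\<bar> \<le> C" for x using C0[of x] f(2)[of x] by (cases "norm x \<le> R") (auto simp: C_def)
  qed
  obtain \<delta> where \<delta>: "\<delta> > 0" "\<And>x y. dist x y < \<delta> \<Longrightarrow> \<bar>f x - f y\<bar> < \<epsilon> / 8"
    by (rule uniform_continuity_compact_support[where f = f and R = R and \<epsilon> = "\<epsilon> / 8"],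
        rule f(1), rule f(2), assumption, use \<open>\<epsilon> > 0\<close> in simp, blast)
  have "(\<lambda>n. measure std_gaussian {z :: real ^ 'd. norm z \<ge> real n}) \<longlonglongrightarrow> measure std_gaussian (\<Inter>n. {z :: real ^ 'd. norm z \<ge> real n})"
    by (rule G.finite_Lim_measure_decseq) (auto simp: decseq_def)
  moreover have "(\<Inter>n. {z :: real ^ 'd. norm z \<ge> real n}) = {}"
  proof -
    have "\<exists>n. \<not> real n \<le> norm z" for z :: "real ^ 'd"
      using reals_Archimedean2[of "norm z"] by (simp add: not_le)
    then show ?thesis by blast
  qed
  ultimately have "(\<lambda>n. measure std_gaussian {z :: real ^ 'd. norm z \<ge> real n}) \<longlonglongrightarrow> 0" by simp
  then have "\<forall>\<^sub>F n in sequentially. measure std_gaussian {z :: real ^ 'd. norm z \<ge> real n} < \<epsilon> / (16 * C)"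
    by (rule order_tendstoD) (use \<open>\<epsilon> > 0\<close> C in auto)
  then obtain m where m: "measure std_gaussian {z :: real ^ 'd. norm z \<ge> real m} < \<epsilon> / (16 * C)"
    unfolding eventually_sequentially by blast
  \<comment> \<open>Up to radius m the shift \<sigma> z stays below \<delta>; beyond it the Gaussian
    mass is less than \<epsilon>/(16 C), and a deviation of at most 2 C there costs
    \<epsilon>/8.\<close>
  define \<sigma> where "\<sigma> = \<delta> / (real m + 1)"
  have \<sigma>: "\<sigma> > 0" using \<delta> by (simp add: \<sigma>_def)
  define F where "F x = (\<integral>z. f (x + \<sigma> *\<^sub>R z) \<partial>std_gaussian)" for x
  have Fclose: "\<bar>F x - f x\<bar> \<le> \<epsilon> / 4" for x
  proof -
    let ?A = "{z :: real ^ 'd. norm z \<ge> real m}"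
    have i1: "integrable std_gaussian (\<lambda>z. f (x + \<sigma> *\<^sub>R z))"
      by (rule G.integrable_const_bound[where B = C]) (use C in auto)
    have [measurable]: "?A \<in> sets borel" by measurable
    have i2: "integrable std_gaussian (\<lambda>z. \<epsilon> / 8 + 2 * C * indicator ?A z)"
      by (intro Bochner_Integration.integrable_add integrable_mult_right G.integrable_const) (auto simp: G.emeasure_eq_measure)
    have "F x - f x = (\<integral>z. f (x + \<sigma> *\<^sub>R z) - f x \<partial>std_gaussian)"
      using i1 G.prob_space by (simp add: F_def)
    also have "\<bar>\<dots>\<bar> \<le> (\<integral>z. \<bar>f (x + \<sigma> *\<^sub>R z) - f x\<bar> \<partial>std_gaussian)" by (rule integral_abs_bound)
    also have "\<dots> \<le> (\<integral>z. \<epsilon> / 8 + 2 * C * indicator ?A z \<partial>std_gaussian)"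
    proof (rule integral_mono)
      show "integrable std_gaussian (\<lambda>z. \<bar>f (x + \<sigma> *\<^sub>R z) - f x\<bar>)" using i1 by auto
      show "\<bar>f (x + \<sigma> *\<^sub>R z) - f x\<bar> \<le> \<epsilon> / 8 + 2 * C * indicator ?A z" for z
      proof (cases "z \<in> ?A")
        case True
        then show ?thesis using C(2)[of "x + \<sigma> *\<^sub>R z"] C(2)[of x] \<open>\<epsilon> > 0\<close> by (simp add: abs_le_iff)
      next
        case False
        then have "norm z < real m + 1" by auto
        then have "\<sigma> * norm z < \<delta>"
          using \<delta>(1) mult_strict_left_mono[of "norm z" "real m + 1" \<delta>] by (simp add: \<sigma>_def field_simps)
        then have "dist (x + \<sigma> *\<^sub>R z) x < \<delta>" using \<sigma> by (simp add: dist_norm)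
        then show ?thesis using \<delta>(2)[of "x + \<sigma> *\<^sub>R z" x] False by simp
      qed
    qed (rule i2)
    also have "\<dots> = \<epsilon> / 8 + 2 * C * measure std_gaussian ?A"
    proof -
      have "integrable std_gaussian (\<lambda>z. 2 * C * indicator ?A z)"
        by (intro integrable_mult_right) (auto simp: G.emeasure_eq_measure)
      then show ?thesis using G.prob_space by (simp add: Bochner_Integration.integral_add)
    qed
    also have "\<dots> \<le> \<epsilon> / 8 + 2 * C * (\<epsilon> / (16 * C))"
      using m C by (intro add_left_mono mult_left_mono) auto
    also have "\<dots> = \<epsilon> / 4" using C by simp
    finally show ?thesis .
  qed
  have Fmeas: "F \<in> borel_measurable borel" unfolding F_def by measurable
  have FQ: "\<bar>(\<integral>x. F x \<partial>Q) - (\<integral>x. f x \<partial>Q)\<bar> \<le> \<epsilon> / 4" if "prob_space Q" "sets Q = sets borel" for Q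
  proof -
    interpret Q: prob_space Q by fact
    note [measurable_cong] = that(2)
    note [measurable] = Fmeas
    have i: "integrable Q f" by (rule Q.integrable_const_bound[where B = C]) (use C in auto)
    have "\<bar>F x\<bar> \<le> C + \<epsilon> / 4" for x using Fclose[of x] C(2)[of x] by linarith
    then have j: "integrable Q F" by (intro Q.integrable_const_bound[where B = "C + \<epsilon> / 4"]) auto
    have "(\<integral>x. F x \<partial>Q) - (\<integral>x. f x \<partial>Q) = (\<integral>x. F x - f x \<partial>Q)" using i j by simp
    also have "\<bar>\<dots>\<bar> \<le> (\<integral>x. \<bar>F x - f x\<bar> \<partial>Q)" by (rule integral_abs_bound)
    also have "\<dots> \<le> (\<integral>x. \<epsilon> / 4 \<partial>Q)" by (rule integral_mono) (use i j Fclose in auto)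
    finally show ?thesis by (simp add: Q.prob_space)
  qed
  have "integrable lborel f"
  proof -
    have "integrable lborel (\<lambda>x. indicator (cball 0 R) x *\<^sub>R f x)"
      by (rule borel_integrable_compact) (auto intro: continuous_on_subset[OF f(1)])
    moreover have "indicator (cball 0 R) x *\<^sub>R f x = f x" for x using f(2)[of x] by (auto simp: indicator_def)
    ultimately show ?thesis by (simp only:)
  qed
  then have "(\<lambda>n. \<integral>x. F x \<partial>M n) \<longlonglongrightarrow> (\<integral>x. F x \<partial>N)"
    unfolding F_def by (intro gaussian_smoothing_converges M N conv \<sigma>) auto
  from LIMSEQ_D[OF this, of "\<epsilon> / 4"] \<open>\<epsilon> > 0\<close>
  obtain n0 where n0: "\<And>n. n \<ge> n0 \<Longrightarrow> \<bar>(\<integral>x. F x \<partial>M n) - (\<integral>x. F x \<partial>N)\<bar> < \<epsilon> / 4" by auto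
  have "norm ((\<integral>x. f x \<partial>M n) - (\<integral>x. f x \<partial>N)) < \<epsilon>" if "n \<ge> n0" for n
    using n0[OF that] FQ[OF M, of n] FQ[OF N] unfolding real_norm_def by linarith
  then show "\<exists>n0. \<forall>n\<ge>n0. norm ((\<integral>x. f x \<partial>M n) - (\<integral>x. f x \<partial>N)) < \<epsilon>" by blast
qed

text \<open>Tightness is a consequence here: the cutoff has compact support, so its integrals
  converge, and since N gives it almost full mass the measures M n do so from some index on. What f
  has beyond the cutoff is then negligible.\<close>

theorem levy_continuity_vec:
  fixes M :: "nat \<Rightarrow> (real ^ 'd) measure"
  assumes M: "\<And>n. prob_space (M n)" "\<And>n. sets (M n) = sets borel"
    and N: "prob_space N" "sets N = sets borel"
    and conv: "\<And>u. (\<lambda>n. \<integral>x. iexp (u \<bullet> x) \<partial>M n) \<longlonglongrightarrow> (\<integral>x. iexp (u \<bullet> x) \<partial>N)"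
  shows "weakly_converges M N"
  unfolding weakly_converges_def
proof (intro allI impI LIMSEQ_I)
  fix f :: "real ^ 'd \<Rightarrow> real" and \<epsilon> :: real
  assume f: "continuous_on UNIV f" "bounded (range f)" and \<epsilon>: "\<epsilon> > 0"
  obtain B where B: "B > 0" "\<And>x. \<bar>f x\<bar> \<le> B" using f(2) by (auto simp: bounded_pos)
  have [measurable]: "f \<in> borel_measurable borel" by (rule borel_measurable_continuous_onI[OF f(1)])
  interpret N: prob_space N by fact
  note [measurable_cong] = N(2)
  define cut where "cut k x = max 0 (min 1 (real k + 1 - norm x))" for k :: nat and x :: "real ^ 'd"
  have cutc: "continuous_on UNIV (cut k)" for k unfolding cut_def by (intro continuous_intros)
  have [measurable]: "cut k \<in> borel_measurable borel" for k by (rule borel_measurable_continuous_onI[OF cutc])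
  have cut01: "0 \<le> cut k x" "cut k x \<le> 1" for k x by (auto simp: cut_def)
  have "(\<lambda>k. \<integral>x. cut k x \<partial>N) \<longlonglongrightarrow> (\<integral>x. 1 \<partial>N)"
  proof (rule integral_dominated_convergence[where w = "\<lambda>_. 1"])
    have "(\<lambda>k. cut k x) \<longlonglongrightarrow> 1" for x
    proof (rule tendsto_eventually)
      obtain m where "norm x < real m" using reals_Archimedean2 by blast
      then show "\<forall>\<^sub>F k in sequentially. cut k x = 1"
        by (auto simp: eventually_sequentially cut_def intro!: exI[of _ m])
    qed
    then show "AE x in N. (\<lambda>k. cut k x) \<longlonglongrightarrow> 1" by simp
  qed (use cut01 in auto)
  then have "\<forall>\<^sub>F k in sequentially. 1 - \<epsilon> / (8 * B) < (\<integral>x. cut k x \<partial>N)"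
    by (rule order_tendstoD) (use \<epsilon> B N.prob_space in auto)
  then obtain k where k: "1 - \<epsilon> / (8 * B) < (\<integral>x. cut k x \<partial>N)" unfolding eventually_sequentially by blast
  have c1: "(\<lambda>n. \<integral>x. cut k x \<partial>M n) \<longlonglongrightarrow> (\<integral>x. cut k x \<partial>N)"
    by (rule convergence_compact_support[OF M N conv cutc, where R = "real k + 1"]) (auto simp: cut_def)
  have c2: "(\<lambda>n. \<integral>x. f x * cut k x \<partial>M n) \<longlonglongrightarrow> (\<integral>x. f x * cut k x \<partial>N)"
    by (rule convergence_compact_support[OF M N conv, where R = "real k + 1"])
       (auto simp: cut_def intro!: continuous_intros f(1))
  have tail: "\<bar>(\<integral>x. f x \<partial>Q) - (\<integral>x. f x * cut k x \<partial>Q)\<bar> \<le> B * (1 - (\<integral>x. cut k x \<partial>Q))"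
    if "prob_space Q" "sets Q = sets borel" for Q
  proof -
    interpret Q: prob_space Q by fact
    note [measurable_cong] = that(2)
    have i: "integrable Q f" by (rule Q.integrable_const_bound[where B = B]) (use B in auto)
    have j: "integrable Q (cut k)" by (rule Q.integrable_const_bound[where B = 1]) (use cut01 in auto)
    have "\<bar>f x\<bar> * cut k x \<le> B * 1" for x by (intro mult_mono B cut01) (use B in auto)
    then have l: "integrable Q (\<lambda>x. f x * cut k x)"
      by (intro Q.integrable_const_bound[where B = B]) (use cut01 in \<open>auto simp: abs_mult\<close>)
    have "(\<integral>x. f x \<partial>Q) - (\<integral>x. f x * cut k x \<partial>Q) = (\<integral>x. f x - f x * cut k x \<partial>Q)" using i l by simp
    also have "\<bar>\<dots>\<bar> \<le> (\<integral>x. \<bar>f x - f x * cut k x\<bar> \<partial>Q)" by (rule integral_abs_bound)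
    also have "\<dots> \<le> (\<integral>x. B * (1 - cut k x) \<partial>Q)"
    proof (rule integral_mono)
      fix x
      have "\<bar>f x - f x * cut k x\<bar> = \<bar>f x\<bar> * (1 - cut k x)"
      proof -
        have "f x - f x * cut k x = f x * (1 - cut k x)" by (simp add: algebra_simps)
        then show ?thesis using cut01[of k x] by (simp add: abs_mult)
      qed
      also have "\<dots> \<le> B * (1 - cut k x)" using B cut01[of k x] by (intro mult_right_mono) auto
      finally show "\<bar>f x - f x * cut k x\<bar> \<le> B * (1 - cut k x)" .
    qed (use i j l in auto)
    also have "\<dots> = B * (1 - (\<integral>x. cut k x \<partial>Q))" using j by (simp add: Q.prob_space)
    finally show ?thesis .
  qed
  obtain n1 where n1: "\<And>n. n \<ge> n1 \<Longrightarrow> norm ((\<integral>x. cut k x \<partial>M n) - (\<integral>x. cut k x \<partial>N)) < \<epsilon> / (8 * B)"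
    using LIMSEQ_D[OF c1, of "\<epsilon> / (8 * B)"] \<epsilon> B by auto
  obtain n2 where n2: "\<And>n. n \<ge> n2 \<Longrightarrow> norm ((\<integral>x. f x * cut k x \<partial>M n) - (\<integral>x. f x * cut k x \<partial>N)) < \<epsilon> / 4"
    using LIMSEQ_D[OF c2, of "\<epsilon> / 4"] \<epsilon> by auto
  have "norm ((\<integral>x. f x \<partial>M n) - (\<integral>x. f x \<partial>N)) < \<epsilon>" if "n \<ge> max n1 n2" for n
  proof -
    have "1 - (\<integral>x. cut k x \<partial>M n) \<le> 2 * (\<epsilon> / (8 * B))" using n1[of n] k that unfolding real_norm_def by linarith
    then have "B * (1 - (\<integral>x. cut k x \<partial>M n)) \<le> B * (2 * (\<epsilon> / (8 * B)))" using B by (intro mult_left_mono) auto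
    then have t1: "B * (1 - (\<integral>x. cut k x \<partial>M n)) \<le> \<epsilon> / 4" using B by simp
    have "B * (1 - (\<integral>x. cut k x \<partial>N)) \<le> B * (\<epsilon> / (8 * B))" using B k by (intro mult_left_mono) auto
    then have t2: "B * (1 - (\<integral>x. cut k x \<partial>N)) \<le> \<epsilon> / 8" using B by simp
    have "norm ((\<integral>x. f x * cut k x \<partial>M n) - (\<integral>x. f x * cut k x \<partial>N)) < \<epsilon> / 4" using n2 that by simp
    then show ?thesis using tail[OF M, of n] tail[OF N] t1 t2 \<epsilon> unfolding real_norm_def by linarith
  qed
  then show "\<exists>n0. \<forall>n\<ge>n0. norm ((\<integral>x. f x \<partial>M n) - (\<integral>x. f x \<partial>N)) < \<epsilon>" by blast
qed

section \<open>Complex matrices\<close>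

lemma cinner_add_left: "cinner (x + y) z = cinner x z + cinner y z"
  by (simp add: cinner_def sum.distrib[symmetric] algebra_simps)

lemma cinner_add_right: "cinner x (y + z) = cinner x y + cinner x z"
  by (simp add: cinner_def sum.distrib[symmetric] algebra_simps)

lemma cinner_diff_left: "cinner (x - y) z = cinner x z - cinner y z"
  by (simp add: cinner_def sum_subtractf[symmetric] algebra_simps)

lemma cinner_diff_right: "cinner x (y - z) = cinner x y - cinner x z"
  by (simp add: cinner_def sum_subtractf[symmetric] algebra_simps)

lemma cinner_scale_left: "cinner (c *s x) y = cnj c * cinner x y"
  by (simp add: cinner_def sum_distrib_left mult.assoc)

lemma cinner_scale_right: "cinner x (c *s y) = c * cinner x y"
  by (simp add: cinner_def sum_distrib_left algebra_simps)

lemma cinner_scaleR_left: "cinner (c *\<^sub>R x) y = c *\<^sub>R cinner x y"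
  by (simp add: cinner_def scaleR_sum_right)

lemma cinner_scaleR_right: "cinner x (c *\<^sub>R y) = c *\<^sub>R cinner x y"
  by (simp add: cinner_def scaleR_sum_right)

lemma cinner_zero [simp]: "cinner 0 x = 0" "cinner x 0 = 0"
  by (simp_all add: cinner_def)

lemma cinner_commute: "cinner x y = cnj (cinner y x)"
  by (simp add: cinner_def mult.commute)

lemma Re_cinner: "Re (cinner x y) = x \<bullet> y"
  by (simp add: cinner_def inner_vec_def inner_complex_def)

lemma cinner_self: "cinner x x = complex_of_real ((norm x)\<^sup>2)"
  by (rule complex_eqI)
     (simp_all add: Re_cinner power2_norm_eq_inner, simp add: cinner_def mult.commute)

lemma cinner_self_eq_0 [simp]: "cinner x x = 0 \<longleftrightarrow> x = 0"
  by (simp add: cinner_self)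

lemma cinner_dagger: "cinner x (A *v y) = cinner (dagger A *v x) y"
proof -
  have "cinner x (A *v y) = (\<Sum>i\<in>UNIV. \<Sum>j\<in>UNIV. cnj (x $ i) * (A $ i $ j * y $ j))"
    by (simp add: cinner_def matrix_vector_mult_def sum_distrib_left)
  also have "\<dots> = (\<Sum>j\<in>UNIV. \<Sum>i\<in>UNIV. cnj (x $ i) * (A $ i $ j * y $ j))" by (rule sum.swap)
  also have "\<dots> = cinner (dagger A *v x) y"
    by (simp add: cinner_def matrix_vector_mult_def dagger_def sum_distrib_left sum_distrib_right mult_ac)
  finally show ?thesis .
qed

lemma dagger_dagger [simp]: "dagger (dagger A) = A"
  by (simp add: dagger_def vec_eq_iff)

lemma cinner_dagger': "cinner (A *v x) y = cinner x (dagger A *v y)"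
  by (simp add: cinner_dagger)

lemma dagger_mult: "dagger (A ** B) = dagger B ** dagger A"
  by (simp add: dagger_def vec_eq_iff matrix_matrix_mult_def mult.commute)

lemma dagger_add: "dagger (A + B) = dagger A + dagger B"
  by (simp add: dagger_def vec_eq_iff)

lemma dagger_diff: "dagger (A - B) = dagger A - dagger B"
  by (simp add: dagger_def vec_eq_iff)

lemma dagger_scaleR: "dagger (c *\<^sub>R A) = c *\<^sub>R dagger A"
  by (simp add: dagger_def vec_eq_iff)

lemma dagger_zero [simp]: "dagger 0 = 0"
  by (simp add: dagger_def vec_eq_iff)

lemma dagger_sum: "dagger (\<Sum>i\<in>I. f i) = (\<Sum>i\<in>I. dagger (f i))"
  by (induction I rule: infinite_finite_induct) (simp_all add: dagger_add)

lemma dagger_one [simp]: "dagger (mat 1) = mat 1"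
  by (simp add: dagger_def vec_eq_iff mat_def)

lemma linear_dagger: "linear dagger"
  by (rule linearI) (simp_all add: dagger_add dagger_scaleR)

lemma matrix_mult_scaleR_left: "(c *\<^sub>R A) ** (B :: complex ^ 'n ^ 'n) = c *\<^sub>R (A ** B)"
  by (simp add: vec_eq_iff matrix_matrix_mult_def scaleR_sum_right)

lemma matrix_mult_scaleR_right: "A ** (c *\<^sub>R B :: complex ^ 'n ^ 'n) = c *\<^sub>R (A ** B)"
  by (simp add: vec_eq_iff matrix_matrix_mult_def scaleR_sum_right)

lemma matrix_mult_add_left: "(A + B) ** (C :: complex ^ 'n ^ 'n) = A ** C + B ** C"
  by (simp add: vec_eq_iff matrix_matrix_mult_def sum.distrib[symmetric] algebra_simps)

lemma matrix_mult_add_right: "A ** (B + C :: complex ^ 'n ^ 'n) = A ** B + A ** C"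
  by (simp add: vec_eq_iff matrix_matrix_mult_def sum.distrib[symmetric] algebra_simps)

lemma matrix_mult_diff_left: "(A - B) ** (C :: complex ^ 'n ^ 'n) = A ** C - B ** C"
  by (simp add: vec_eq_iff matrix_matrix_mult_def sum_subtractf[symmetric] algebra_simps)

lemma matrix_mult_diff_right: "A ** (B - C :: complex ^ 'n ^ 'n) = A ** B - A ** C"
  by (simp add: vec_eq_iff matrix_matrix_mult_def sum_subtractf[symmetric] algebra_simps)

lemma matrix_mult_zero [simp]: "(0 :: complex ^ 'n ^ 'n) ** A = 0" "A ** (0 :: complex ^ 'n ^ 'n) = 0"
  by (simp_all add: vec_eq_iff matrix_matrix_mult_def)

lemma matrix_mult_sum_left: "(\<Sum>i\<in>I. f i) ** (C :: complex ^ 'n ^ 'n) = (\<Sum>i\<in>I. f i ** C)"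
  by (induction I rule: infinite_finite_induct) (simp_all add: matrix_mult_add_left)

lemma matrix_mult_sum_right: "(C :: complex ^ 'n ^ 'n) ** (\<Sum>i\<in>I. f i) = (\<Sum>i\<in>I. C ** (f i :: complex ^ 'n ^ 'n))"
  by (induction I rule: infinite_finite_induct) (simp_all add: matrix_mult_add_right)

lemma matrix_vector_sum: "(\<Sum>i\<in>I. f i) *v (x :: complex ^ 'n) = (\<Sum>i\<in>I. f i *v x)"
  by (induction I rule: infinite_finite_induct) (simp_all add: matrix_vector_mult_add_rdistrib)

lemma scaleR_matrix_vector: "(c *\<^sub>R A) *v (x :: complex ^ 'n) = c *\<^sub>R (A *v x)"
  by (simp add: vec_eq_iff matrix_vector_mult_def scaleR_sum_right)

lemma cinner_sum_right: "cinner x (\<Sum>i\<in>I. f i) = (\<Sum>i\<in>I. cinner x (f i))"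
  by (induction I rule: infinite_finite_induct) (simp_all add: cinner_add_right)

lemma trace_sum: "trace (\<Sum>i\<in>I. f i :: complex ^ 'n ^ 'n) = (\<Sum>i\<in>I. trace (f i))"
  by (simp add: trace_def) (rule sum.swap)

lemma trace_scaleR: "trace (c *\<^sub>R A :: complex ^ 'n ^ 'n) = c *\<^sub>R trace A"
  by (simp add: trace_def scaleR_sum_right)

lemma trace_dagger: "trace (dagger A) = cnj (trace A)"
  by (simp add: trace_def dagger_def)

text \<open>The Euclidean inner product of the matrix type is the real part of the Hilbert-Schmidt
  product. Through it the trace pairing of observables with states becomes an instance of the
  pairing in \<open>tilted_pair\<close>.\<close>

lemma inner_matrix: "(A :: complex ^ 'n ^ 'n) \<bullet> B = Re (trace (dagger A ** B))"
proof -
  have "A \<bullet> B = (\<Sum>i\<in>UNIV. \<Sum>j\<in>UNIV. Re (cnj (A $ i $ j) * B $ i $ j))"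
    by (simp add: inner_vec_def inner_complex_def)
  also have "\<dots> = (\<Sum>j\<in>UNIV. \<Sum>i\<in>UNIV. Re (cnj (A $ i $ j) * B $ i $ j))" by (rule sum.swap)
  finally show ?thesis by (simp add: trace_def matrix_matrix_mult_def dagger_def)
qed

section \<open>Quadratic forms and positive operators\<close>

definition qform :: "complex ^ 'n ^ 'n \<Rightarrow> complex ^ 'n \<Rightarrow> real" where
  "qform A x = Re (cinner x (A *v x))"

lemma qform_inner: "qform A x = x \<bullet> (A *v x)"
  by (simp add: qform_def Re_cinner)

lemma qform_add: "qform (A + B) x = qform A x + qform B x"
  by (simp add: qform_def matrix_vector_mult_add_rdistrib cinner_add_right)

lemma qform_diff: "qform (A - B) x = qform A x - qform B x"
  by (simp add: qform_def matrix_vector_mult_diff_rdistrib cinner_diff_right)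

lemma qform_scaleR: "qform (c *\<^sub>R A) x = c * qform A x"
  by (simp add: qform_def scaleR_matrix_vector cinner_scaleR_right)

lemma qform_sum: "qform (\<Sum>i\<in>I. f i) x = (\<Sum>i\<in>I. qform (f i) x)"
  by (simp add: qform_def matrix_vector_sum cinner_sum_right)

lemma qform_one: "qform (mat 1) x = (norm x)\<^sup>2"
  by (simp add: qform_def cinner_self)

lemma qform_conj: "qform (dagger B ** A ** B) x = qform A (B *v x)"
  by (simp add: qform_def matrix_vector_mul_assoc[symmetric] cinner_dagger[of x "dagger B"])

text \<open>Polarisation with y and with \<i> y; the second one is what separates the complex case
  from the real one, where skew matrices have zero form.\<close>

lemma zero_form_imp_zero:
  assumes "\<And>x. cinner x (B *v x) = 0"
  shows "B = 0"
proof -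
  have p: "cinner x (B *v y) + cinner y (B *v x) = 0" for x y
    using assms[of "x + y"] assms[of x] assms[of y]
    by (simp add: matrix_vector_right_distrib cinner_add_left cinner_add_right add.commute)
  have "cinner x (B *v y) = 0" for x y
  proof -
    have "B *v (\<i> *s y) = \<i> *s (B *v y)" by (simp add: vector_scalar_commute)
    then have "\<i> * cinner x (B *v y) - \<i> * cinner y (B *v x) = 0"
      using p[of x "\<i> *s y"] by (simp add: cinner_scale_left cinner_scale_right)
    then have "cinner x (B *v y) = cinner y (B *v x)" by (simp add: right_diff_distrib[symmetric])
    then show ?thesis using p[of x y] by simp
  qed
  then have "B *v y = 0" for y using cinner_self_eq_0 by blast
  then show ?thesis by (simp add: matrix_eq)
qed

lemma cinner_hermitian_real:
  assumes "dagger A = A"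
  shows "cinner x (A *v x) = complex_of_real (qform A x)"
proof -
  have "cinner x (A *v x) = cnj (cinner x (A *v x))"
    using cinner_dagger[of x A x] cinner_commute[of "A *v x" x] assms by simp
  then show ?thesis by (simp add: complex_eq_iff qform_def)
qed

text \<open>Hermiticity is automatic: a real-valued form agrees with the form of the adjoint, and a
  vanishing complex form forces the operator to vanish.\<close>

lemma positive_op_iff: "positive_op A \<longleftrightarrow> dagger A = A \<and> (\<forall>x. 0 \<le> qform A x)"
proof
  assume h: "positive_op A"
  have "cinner x ((dagger A - A) *v x) = 0" for x
  proof -
    have "cinner x (dagger A *v x) = cnj (cinner x (A *v x))"
      using cinner_dagger'[of A x x] cinner_commute[of "A *v x" x] by simp
    then show ?thesis
      using h by (simp add: positive_op_def matrix_vector_mult_diff_rdistrib cinner_diff_right Reals_cnj_iff)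
  qed
  then have "dagger A - A = 0" by (rule zero_form_imp_zero)
  then show "dagger A = A \<and> (\<forall>x. 0 \<le> qform A x)"
    using h by (simp add: positive_op_def qform_def)
next
  assume "dagger A = A \<and> (\<forall>x. 0 \<le> qform A x)"
  then show "positive_op A" by (simp add: positive_op_def cinner_hermitian_real)
qed

lemma hermitian_zero:
  assumes "dagger A = A" "\<And>x. qform A x = 0"
  shows "A = 0"
  using assms by (intro zero_form_imp_zero) (simp add: cinner_hermitian_real)

lemma qform_add_vec:
  assumes "dagger A = A"
  shows "qform A (x + y) = qform A x + 2 * Re (cinner x (A *v y)) + qform A y"
proof -
  have "cinner y (A *v x) = cnj (cinner x (A *v y))"
    using cinner_dagger[of y A x] cinner_commute[of "A *v y" x] assms by simp
  then show ?thesis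
    by (simp add: qform_def matrix_vector_right_distrib cinner_add_left cinner_add_right)
qed

lemma qform_scale_vec: "qform A (c *s x) = (cmod c)\<^sup>2 * qform A x"
proof -
  have "cinner (c *s x) (A *v (c *s x)) = (cnj c * c) * cinner x (A *v x)"
    by (simp add: vector_scalar_commute cinner_scale_left cinner_scale_right)
  then show ?thesis by (simp add: qform_def complex_norm_square[symmetric] mult.commute[of "cnj c"])
qed

text \<open>First variation: from a zero of the form, a small move against A x lowers it linearly,
  while the quadratic term is of second order.\<close>

lemma positive_op_zero_vec:
  assumes "positive_op A" "qform A x = 0"
  shows "A *v x = 0"
proof (rule ccontr)
  assume nz: "A *v x \<noteq> 0"
  define y where "y = A *v x"
  have A: "dagger A = A" "\<And>x. 0 \<le> qform A x" using assms(1) by (auto simp: positive_op_iff)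
  have "Re (cinner y (A *v x)) = (norm y)\<^sup>2" by (simp add: y_def cinner_self)
  then have e: "qform A (c *s y + x) = c\<^sup>2 * qform A y + 2 * c * (norm y)\<^sup>2" for c :: real
    using assms(2) by (subst qform_add_vec[OF A(1)]) (simp add: cinner_scale_left qform_scale_vec)
  have "norm y > 0" using nz by (simp add: y_def)
  \<comment> \<open>Small enough for the linear term to win over the quadratic one; the added 1
    avoids a division by zero.\<close>
  define c where "c = - (norm y)\<^sup>2 / (qform A y + 1)"
  have q: "qform A y + 1 > 0" using A(2)[of y] by simp
  have "c\<^sup>2 * qform A y + 2 * c * (norm y)\<^sup>2 = c * (c * qform A y + 2 * (norm y)\<^sup>2)"
    by (simp add: power2_eq_square algebra_simps)
  also have "\<dots> < 0"
  proof (rule mult_neg_pos)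
    show "c < 0" using q \<open>norm y > 0\<close> by (simp add: c_def divide_neg_pos)
    have "- c * qform A y \<le> (norm y)\<^sup>2"
      using q A(2)[of y] by (simp add: c_def field_simps)
    moreover have "(norm y)\<^sup>2 > 0" using \<open>norm y > 0\<close> by simp
    ultimately show "c * qform A y + 2 * (norm y)\<^sup>2 > 0" by linarith
  qed
  finally show False using e[of c] A(2)[of "c *s y + x"] by simp
qed

lemma of_real_scale: "complex_of_real c *s (x :: complex ^ 'n) = c *\<^sub>R x"
  by (simp add: vec_eq_iff scaleR_conv_of_real[where 'a = complex])

section \<open>Rank-one operators and the trace\<close>

definition outer :: "complex ^ 'n \<Rightarrow> complex ^ 'n ^ 'n" where
  "outer x = (\<chi> i j. x $ i * cnj (x $ j))"

lemma outer_vector: "outer x *v y = cinner x y *s x"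
  by (simp add: outer_def vec_eq_iff matrix_vector_mult_def cinner_def sum_distrib_left sum_distrib_right mult_ac)

lemma dagger_outer [simp]: "dagger (outer x) = outer x"
  by (simp add: dagger_def outer_def vec_eq_iff mult.commute)

lemma qform_outer: "qform (outer x) y = (cmod (cinner x y))\<^sup>2"
proof -
  have "cinner y (outer x *v y) = cinner x y * cnj (cinner x y)"
    by (simp add: outer_vector cinner_scale_right cinner_commute[of y x])
  then show ?thesis by (simp add: qform_def complex_norm_square[symmetric])
qed

lemma positive_outer: "positive_op (outer x)"
  by (simp add: positive_op_iff qform_outer)

lemma outer_conj: "B ** outer x ** dagger B = outer (B *v x)"
proof -
  have "(B ** outer x ** dagger B) *v y = outer (B *v x) *v y" for y
    by (simp add: matrix_vector_mul_assoc[symmetric] outer_vector vector_scalar_commute[symmetric] cinner_dagger')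
  then show ?thesis by (simp add: matrix_eq)
qed

lemma trace_outer: "trace (B ** outer x) = cinner x (B *v x)"
proof -
  have "trace (B ** outer x) = (\<Sum>i\<in>UNIV. \<Sum>k\<in>UNIV. cnj (x $ i) * (B $ i $ k * x $ k))"
    by (simp add: trace_def matrix_matrix_mult_def outer_def mult_ac)
  then show ?thesis by (simp add: cinner_def matrix_vector_mult_def sum_distrib_left)
qed

lemma norm_outer: "norm (outer x) = (norm x)\<^sup>2"
proof -
  have "(norm (outer x))\<^sup>2 = Re (trace (outer x ** outer x))"
    by (simp add: power2_norm_eq_inner inner_matrix)
  also have "\<dots> = ((norm x)\<^sup>2)\<^sup>2"
    by (simp add: trace_outer outer_vector cinner_scale_right cinner_self power2_eq_square)
  finally show ?thesis by (rule power2_eq_imp_eq) simp_all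
qed

text \<open>The pivot elimination of \<open>psd_sqrt_exists\<close> over the complex numbers, with I
  containing the basis vectors not yet annihilated. It stands in for the spectral theorem: a trace
  against a positive operator becomes a sum of values of a quadratic form.\<close>

lemma positive_op_decomposition:
  assumes "positive_op A"
  obtains b :: "'n \<Rightarrow> complex ^ 'n" where "(A :: complex ^ 'n ^ 'n) = (\<Sum>i\<in>UNIV. outer (b i))"
proof -
  have "\<exists>b. A = (\<Sum>i\<in>I. outer (b i :: complex ^ 'n))"
    if "finite I" "positive_op A" "\<And>i. i \<notin> I \<Longrightarrow> A *v axis i 1 = 0" for I :: "'n set" and A :: "complex ^ 'n ^ 'n"
    using that
  proof (induction I arbitrary: A)
    case empty
    then have "A $ k $ i = 0" for k i
    proof -
      have "(A *v axis i 1) $ k = A $ k $ i"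
        by (simp add: matrix_vector_mult_def axis_def if_distrib[of "\<lambda>x. _ * x"] cong: if_cong)
      then show ?thesis using empty(2)[of i] by simp
    qed
    then show ?case by (simp add: vec_eq_iff)
  next
    case (insert i I)
    have A: "dagger A = A" "\<And>x. 0 \<le> qform A x" using insert.prems(1) by (auto simp: positive_op_iff)
    define e where "e = (axis i 1 :: complex ^ 'n)"
    show ?case
    proof (cases "qform A e = 0")
      case True
      then have "A *v e = 0" by (rule positive_op_zero_vec[OF insert.prems(1)])
      then have "A *v axis k 1 = 0" if "k \<notin> I" for k using insert.prems(2)[of k] that by (cases "k = i") (auto simp: e_def)
      from insert.IH[OF insert.prems(1) this] obtain b where b: "A = (\<Sum>i\<in>I. outer (b i :: complex ^ 'n))" by blast
      have "A = (\<Sum>k\<in>insert i I. outer ((b(i := 0)) k))"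
      proof -
        have "outer (0 :: complex ^ 'n) = 0" by (simp add: outer_def vec_eq_iff)
        moreover have "(\<Sum>k\<in>I. outer ((b(i := 0)) k)) = A"
          unfolding b using insert.hyps(2) by (intro sum.cong) auto
        ultimately show ?thesis unfolding sum.insert[OF insert.hyps] by simp
      qed
      then show ?thesis by blast
    next
      case False
      then have pos: "qform A e > 0" using A(2)[of e] by simp
      define q where "q = qform A e"
      \<comment> \<open>Scaled so that \<open>outer v\<close> agrees with A on e. The remainder
        annihilates e and everything that A annihilates.\<close>
      define v where "v = (1 / sqrt q) *\<^sub>R (A *v e)"
      have q: "q > 0" using pos by (simp add: q_def)
      have ve: "cinner v x = complex_of_real (1 / sqrt q) * cinner e (A *v x)" for x
        using cinner_dagger[of e A x] A(1) by (simp only: v_def cinner_scaleR_left) (simp add: scaleR_conv_of_real)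
      have P: "positive_op (A - outer v)"
        unfolding positive_op_iff
      proof (intro conjI allI)
        show "dagger (A - outer v) = A - outer v" by (simp add: dagger_diff A(1))
        fix x
        define w where "w = cinner e (A *v x)"
        have "cinner ((- w / q) *s e) (A *v x) = - complex_of_real ((cmod w)\<^sup>2 / q)"
          using complex_norm_square[of w] by (simp only: cinner_scale_left w_def[symmetric]) (simp add: mult.commute)
        \<comment> \<open>The form of A at its minimiser along e; its value there is the form of the
          remainder at x.\<close>
        then have "0 \<le> (cmod (- w / q))\<^sup>2 * q + 2 * (- (cmod w)\<^sup>2 / q) + qform A x"
          using A(2)[of "(- w / q) *s e + x"] unfolding qform_add_vec[OF A(1)] qform_scale_vec by (simp add: q_def)
        also have "\<dots> = qform A x - (cmod w)\<^sup>2 / q"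
          using q by (simp add: norm_divide power_divide power2_eq_square)
        also have "(cmod w)\<^sup>2 / q = qform (outer v) x"
          using q by (simp add: qform_outer ve w_def[symmetric] norm_mult power_divide norm_divide)
        finally show "0 \<le> qform (A - outer v) x" by (simp add: qform_diff)
      qed
      have "(A - outer v) *v axis k 1 = 0" if k: "k \<notin> I" for k
      proof (cases "k = i")
        case True
        have "outer v *v e = complex_of_real (1 / sqrt q * q) *s v"
          by (simp add: outer_vector ve cinner_hermitian_real[OF A(1)] q_def)
        also have "\<dots> = A *v e"
        proof -
          have "complex_of_real (1 / sqrt q * q) *s v = (1 / sqrt q * q) *\<^sub>R v"
            by (rule of_real_scale)
          also have "\<dots> = A *v e" using q by (simp add: v_def real_div_sqrt)
          finally show ?thesis .
        qed
        finally show ?thesis using True by (simp add: matrix_vector_mult_diff_rdistrib e_def)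
      next
        case False
        then have "A *v axis k 1 = 0" using insert.prems(2) k by simp
        then show ?thesis by (simp add: matrix_vector_mult_diff_rdistrib outer_vector ve)
      qed
      from insert.IH[OF P this] obtain b where b: "A - outer v = (\<Sum>i\<in>I. outer (b i :: complex ^ 'n))" by blast
      have "(\<Sum>k\<in>I. outer ((b(i := v)) k)) = A - outer v"
        unfolding b using insert.hyps(2) by (intro sum.cong) auto
      then have "A = (\<Sum>k\<in>insert i I. outer ((b(i := v)) k))"
        unfolding sum.insert[OF insert.hyps] by simp
      then show ?thesis by blast
    qed
  qed
  from this[OF finite_class.finite_UNIV assms] that show ?thesis by blast
qed

lemma positive_sum: "(\<And>i. i \<in> I \<Longrightarrow> positive_op (f i)) \<Longrightarrow> positive_op (\<Sum>i\<in>I. f i)"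
  by (auto simp: positive_op_iff dagger_sum qform_sum intro!: sum_nonneg sum.cong)

lemma positive_scaleR: "positive_op A \<Longrightarrow> 0 \<le> c \<Longrightarrow> positive_op (c *\<^sub>R A)"
  by (simp add: positive_op_iff dagger_scaleR qform_scaleR)

lemma positive_conj: "positive_op A \<Longrightarrow> positive_op (B ** A ** dagger B)"
  using qform_conj[of "dagger B" A] by (simp add: positive_op_iff dagger_mult matrix_mul_assoc)

lemma trace_positive_nonneg:
  fixes \<sigma> :: "complex ^ 'n ^ 'n"
  assumes "positive_op X" "positive_op \<sigma>"
  shows "0 \<le> Re (trace (X ** \<sigma>))"
proof -
  obtain b :: "'n \<Rightarrow> complex ^ 'n" where b: "\<sigma> = (\<Sum>i\<in>UNIV. outer (b i))"
    by (rule positive_op_decomposition[OF assms(2)])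
  have "Re (trace (X ** \<sigma>)) = (\<Sum>i\<in>UNIV. qform X (b i))"
    by (simp add: b matrix_mult_sum_right trace_sum trace_outer qform_def)
  then show ?thesis using assms(1) by (simp add: sum_nonneg positive_op_iff)
qed

text \<open>The Hilbert-Schmidt norm is dominated by the trace norm, so positive trace-preserving
  evolutions stay bounded.\<close>

lemma norm_positive_le_trace:
  fixes \<sigma> :: "complex ^ 'n ^ 'n"
  assumes "positive_op \<sigma>"
  shows "norm \<sigma> \<le> Re (trace \<sigma>)"
proof -
  obtain b :: "'n \<Rightarrow> complex ^ 'n" where b: "\<sigma> = (\<Sum>i\<in>UNIV. outer (b i))"
    by (rule positive_op_decomposition[OF assms])
  have "norm \<sigma> \<le> (\<Sum>i\<in>UNIV. (norm (b i))\<^sup>2)"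
    unfolding b by (rule order_trans[OF norm_sum]) (simp add: norm_outer)
  also have "\<dots> = Re (trace (mat 1 ** \<sigma>))"
    unfolding b by (simp only: matrix_mult_sum_right trace_sum trace_outer) (simp add: cinner_self)
  finally show ?thesis by simp
qed

lemma trace_positive_ge_0: "positive_op \<sigma> \<Longrightarrow> 0 \<le> Re (trace \<sigma>)"
  using norm_positive_le_trace norm_ge_zero order_trans by blast

lemma Im_trace_positive: "positive_op \<sigma> \<Longrightarrow> Im (trace \<sigma>) = 0"
  using trace_dagger[of \<sigma>] by (auto simp: positive_op_iff complex_eq_iff)

lemma abs_trace_le: "\<bar>Re (trace ((X :: complex ^ 'n ^ 'n) ** \<sigma>))\<bar> \<le> norm X * norm \<sigma>"
proof -
  have "norm (dagger X) = norm X"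
  proof -
    have "(norm (dagger X))\<^sup>2 = (norm X)\<^sup>2"
      by (simp only: power2_norm_eq_inner inner_matrix dagger_dagger) (rule arg_cong[OF trace_mul_sym])
    then show ?thesis by simp
  qed
  then show ?thesis using Cauchy_Schwarz_ineq2[of "dagger X" \<sigma>] by (simp add: inner_matrix)
qed

lemma abs_qform_le: "\<bar>qform X x\<bar> \<le> norm X * (norm x)\<^sup>2"
  using abs_trace_le[of X "outer x"] by (simp add: trace_outer qform_def norm_outer)

section \<open>Minimal enclosures\<close>

lemma subspace_real: "vec.subspace (W :: (complex ^ 'n) set) \<Longrightarrow> subspace W"
  unfolding subspace_def vec.subspace_def using of_real_scale by metis

text \<open>Built from the real orthogonal decomposition. Testing against \<i> w as well as w
  upgrades real orthogonality to complex, and uniqueness of the decomposition makes the map complex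
  linear.\<close>

lemma orth_proj_exists:
  assumes W: "vec.subspace (W :: (complex ^ 'n) set)"
  shows "\<exists>P. P ** P = P \<and> dagger P = P \<and> range ((*v) P) = W"
proof -
  have sW: "span W = W" using subspace_real[OF W] by (simp add: span_eq_iff)
  have ex: "\<exists>y. y \<in> W \<and> (\<forall>w\<in>W. cinner (x - y) w = 0)" for x
  proof -
    obtain y z where yz: "y \<in> W" "\<And>w. w \<in> W \<Longrightarrow> orthogonal z w" "x = y + z"
      using orthogonal_subspace_decomp_exists[of W x] unfolding sW by blast
    have "cinner z w = 0" if "w \<in> W" for w
    proof -
      have "\<i> *s w \<in> W" using W that by (simp add: vec.subspace_def)
      then have "Re (cinner z (\<i> *s w)) = 0" "Re (cinner z w) = 0"
        using yz(2) that by (simp_all add: Re_cinner orthogonal_def)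
      then show ?thesis by (simp add: cinner_scale_right complex_eq_iff)
    qed
    then show ?thesis using yz by auto
  qed
  then obtain f where f: "\<And>x. f x \<in> W" "\<And>x w. w \<in> W \<Longrightarrow> cinner (x - f x) w = 0" by metis
  have uniq: "f x = y" if "y \<in> W" "\<And>w. w \<in> W \<Longrightarrow> cinner (x - y) w = 0" for x y
  proof -
    have m: "f x - y \<in> W" using W that(1) f(1) by (simp add: vec.subspace_diff)
    have "cinner (f x - y) (f x - y) = cinner (x - y) (f x - y) - cinner (x - f x) (f x - y)"
      by (simp add: cinner_diff_left)
    then show ?thesis using that(2)[OF m] f(2)[OF m] by simp
  qed
  have lin: "Vector_Spaces.linear (*s) (*s) f"
    unfolding Vector_Spaces.linear_iff
  proof (intro conjI allI vec.vector_space_axioms)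
    show "f (x + y) = f x + f y" for x y
    proof (rule uniq)
      show "f x + f y \<in> W" using W f(1) by (simp add: vec.subspace_add)
      show "cinner (x + y - (f x + f y)) w = 0" if "w \<in> W" for w
        using f(2)[OF that, of x] f(2)[OF that, of y] by (simp add: cinner_diff_left cinner_add_left)
    qed
    show "f (c *s x) = c *s f x" for c x
    proof (rule uniq)
      show "c *s f x \<in> W" using W f(1) by (simp add: vec.subspace_scale)
      show "cinner (c *s x - c *s f x) w = 0" if "w \<in> W" for w
        using f(2)[OF that, of x] by (simp add: cinner_diff_left cinner_scale_left right_diff_distrib[symmetric])
    qed
  qed
  define P where "P = matrix f"
  have P: "P *v x = f x" for x unfolding P_def by (rule matrix_works[OF lin])
  have fW: "f x = x" if "x \<in> W" for x by (rule uniq[OF that]) simp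
  have "P ** P = P" by (simp add: matrix_eq matrix_vector_mul_assoc[symmetric] P fW f(1))
  moreover have "dagger P = P"
  proof -
    have "cinner (dagger P *v x) y = cinner (P *v x) y" for x y
    proof -
      have "cinner (dagger P *v x) y = cinner x (f y)" by (simp add: cinner_dagger' P)
      also have "\<dots> = cinner (f x) (f y)" using f(2)[OF f(1), of x y] by (simp add: cinner_diff_left)
      also have "\<dots> = cinner (f x) y"
        using f(2)[OF f(1), of y x] cinner_commute[of "f x" "y - f y"] by (simp add: cinner_diff_right)
      finally show ?thesis by (simp add: P)
    qed
    then have "cinner (dagger P *v x - P *v x) (dagger P *v x - P *v x) = 0" for x
      by (simp add: cinner_diff_left)
    then show ?thesis by (simp add: matrix_eq)
  qed
  moreover have "range ((*v) P) = W"
  proof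
    show "range ((*v) P) \<subseteq> W" using P f(1) by auto
    show "W \<subseteq> range ((*v) P)" by (metis P fW rangeI subsetI)
  qed
  ultimately show ?thesis by blast
qed

lemma proj_range_iff:
  assumes "P ** P = P" "range ((*v) P) = W"
  shows "x \<in> W \<longleftrightarrow> P *v x = x"
  using assms by (metis (no_types, lifting) imageE matrix_vector_mul_assoc rangeI)

lemma proj_unique:
  assumes "P ** P = P" "dagger P = P" "range ((*v) P) = W"
    and "Q ** Q = Q" "dagger Q = Q" "range ((*v) Q) = W"
  shows "P = (Q :: complex ^ 'n ^ 'n)"
proof -
  have "P ** Q = Q" "Q ** P = P"
  proof -
    have "Q *v x \<in> W" "P *v x \<in> W" for x using assms(3,6) by auto
    then have "P *v (Q *v x) = Q *v x" "Q *v (P *v x) = P *v x" for x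
      using proj_range_iff[OF assms(1,3)] proj_range_iff[OF assms(4,6)] by blast+
    then show "P ** Q = Q" "Q ** P = P" by (simp_all add: matrix_eq matrix_vector_mul_assoc[symmetric])
  qed
  then show ?thesis using dagger_mult[of Q P] assms(2,5) by simp
qed

lemma orth_proj_eqI:
  assumes "P ** P = P" "dagger P = P" "range ((*v) P) = W"
  shows "orth_proj W = P"
  unfolding orth_proj_def by (rule the_equality) (use assms proj_unique in blast)+

lemma orth_proj:
  assumes "vec.subspace (W :: (complex ^ 'n) set)"
  shows "orth_proj W ** orth_proj W = orth_proj W" "dagger (orth_proj W) = orth_proj W"
    "range ((*v) (orth_proj W)) = W" "x \<in> W \<longleftrightarrow> orth_proj W *v x = x" "orth_proj W *v x \<in> W"
proof -
  obtain P where P: "P ** P = P" "dagger P = P" "range ((*v) P) = W"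
    using orth_proj_exists[OF assms] by blast
  have "orth_proj W = P" by (rule orth_proj_eqI[OF P])
  then show "orth_proj W ** orth_proj W = orth_proj W" "dagger (orth_proj W) = orth_proj W"
    "range ((*v) (orth_proj W)) = W" "x \<in> W \<longleftrightarrow> orth_proj W *v x = x" "orth_proj W *v x \<in> W"
    using P proj_range_iff[OF P(1,3)] by auto
qed

lemma subspace_kernel: "vec.subspace {x. A *v (x :: complex ^ 'n) = 0}"
  by (auto simp: vec.subspace_def matrix_vector_right_distrib vector_scalar_commute)

lemma proj_norm: "P ** P = P \<Longrightarrow> dagger P = P \<Longrightarrow> qform P x = (norm (P *v x))\<^sup>2"
  by (metis cinner_dagger' cinner_self Re_complex_of_real matrix_vector_mul_assoc qform_def)

text \<open>The support is the orthogonal complement of the kernel, which makes 1 - R its projection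
  without any diagonalisation.\<close>

lemma supp_eq_range:
  fixes A :: "complex ^ 'n ^ 'n"
  defines "R \<equiv> orth_proj {x. A *v x = 0}"
  shows "x \<in> supp A \<longleftrightarrow> R *v x = 0" "vec.subspace (supp A)" "orth_proj (supp A) = mat 1 - R"
    "A ** R = 0"
proof -
  note R = orth_proj[OF subspace_kernel[of A], folded R_def]
  show iff: "x \<in> supp A \<longleftrightarrow> R *v x = 0" for x
  proof
    assume "x \<in> supp A"
    then have "cinner (R *v x) x = 0" using R(5)[of x] by (simp add: supp_def)
    then have "cinner (R *v x) (R *v x) = 0"
      using R(1,2) by (metis cinner_dagger' matrix_vector_mul_assoc)
    then show "R *v x = 0" by simp
  next
    assume h: "R *v x = 0"
    have "cinner y x = 0" if "A *v y = 0" for y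
    proof -
      have "cinner y x = cinner (R *v y) x" using R(4)[of y] that by simp
      then show ?thesis using h R(2) by (simp add: cinner_dagger')
    qed
    then show "x \<in> supp A" by (simp add: supp_def)
  qed
  have s: "supp A = {x. R *v x = 0}" using iff by blast
  show "vec.subspace (supp A)" unfolding s by (rule subspace_kernel)
  show "orth_proj (supp A) = mat 1 - R"
  proof (rule orth_proj_eqI)
    show "(mat 1 - R) ** (mat 1 - R) = mat 1 - R"
      by (simp add: matrix_mult_diff_left matrix_mult_diff_right R(1))
    show "dagger (mat 1 - R) = mat 1 - R" by (simp add: dagger_diff R(2))
    show "range ((*v) (mat 1 - R)) = supp A"
    proof (intro set_eqI iffI)
      fix x assume "x \<in> range ((*v) (mat 1 - R))"
      then show "x \<in> supp A" unfolding s using R(1)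
        by (auto simp: matrix_vector_mult_diff_rdistrib matrix_vector_mult_diff_distrib matrix_vector_mul_assoc)
    next
      fix x assume "x \<in> supp A"
      then have "x = (mat 1 - R) *v x" unfolding s by (simp add: matrix_vector_mult_diff_rdistrib)
      then show "x \<in> range ((*v) (mat 1 - R))" by blast
    qed
  qed
  show "A ** R = 0"
    using R(5) by (simp add: matrix_eq matrix_vector_mul_assoc[symmetric])
qed

section \<open>Hermitian parts, Kraus maps and the dual channel\<close>

lemma linear_conj: "linear (\<lambda>X. (A :: complex ^ 'n ^ 'n) ** X ** (B :: complex ^ 'n ^ 'n))"
  by (rule linearI)
    (simp_all add: matrix_mult_add_left matrix_mult_add_right matrix_mult_scaleR_left matrix_mult_scaleR_right)

definition herm_part :: "complex ^ 'n ^ 'n \<Rightarrow> complex ^ 'n ^ 'n" where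
  "herm_part X = (1/2) *\<^sub>R (X + dagger X)"

lemma dagger_herm_part [simp]: "dagger (herm_part X) = herm_part X"
  by (simp add: herm_part_def dagger_add dagger_scaleR add.commute)

lemma herm_part_id: "dagger X = X \<Longrightarrow> herm_part X = X"
  by (simp add: herm_part_def scaleR_2[symmetric])

lemma linear_herm_part: "linear herm_part"
  by (rule linearI) (simp_all add: herm_part_def dagger_add dagger_scaleR scaleR_right_distrib algebra_simps)

text \<open>Precomposition with the Hermitian part makes the real multiplicity of an eigenvalue equal to its
  complex multiplicity.\<close>

definition kraus :: "complex ^ 'n ^ 'n \<Rightarrow> complex ^ 'n ^ 'n \<Rightarrow> complex ^ 'n ^ 'n" where
  "kraus M X = M ** herm_part X ** dagger M"

lemma linear_kraus: "linear (kraus M)"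
proof -
  have "kraus M = (\<lambda>X. M ** X ** dagger M) \<circ> herm_part" by (simp add: kraus_def fun_eq_iff)
  then show ?thesis by (simp add: linear_compose[OF linear_herm_part linear_conj])
qed

lemma dagger_kraus [simp]: "dagger (kraus M X) = kraus M X"
  by (simp add: kraus_def dagger_mult matrix_mul_assoc)

lemma inner_hermitian: "dagger X = X \<Longrightarrow> X \<bullet> Y = Re (trace (X ** Y))"
  by (simp add: inner_matrix)

lemma inner_herm_part: "herm_part X \<bullet> Y = X \<bullet> herm_part Y"
proof -
  have "dagger X \<bullet> Y = X \<bullet> dagger Y"
  proof -
    have "dagger X \<bullet> Y = Re (trace (Y ** X))" by (simp add: inner_matrix trace_mul_sym[of X])
    also have "\<dots> = Re (cnj (trace (Y ** X)))" by simp
    also have "\<dots> = X \<bullet> dagger Y" by (simp only: trace_dagger[symmetric] dagger_mult inner_matrix)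
    finally show ?thesis .
  qed
  then show ?thesis by (simp add: herm_part_def inner_add_left inner_add_right)
qed

text \<open>The Hermitian part is self-adjoint for the real inner product, so precomposing with it
  leaves the Kraus maps closed under taking adjoints.\<close>

lemma kraus_adjoint: "kraus (dagger M) X \<bullet> Y = X \<bullet> kraus M Y"
proof -
  have *: "(dagger M ** X' ** M) \<bullet> Y' = X' \<bullet> (M ** Y' ** dagger M)" for X' Y' :: "complex ^ 'a ^ 'a"
    using trace_mul_sym[of "dagger M" "dagger X' ** M ** Y'"]
    by (simp add: inner_matrix dagger_mult matrix_mul_assoc)
  have "kraus (dagger M) X \<bullet> Y = herm_part (dagger M ** herm_part X ** M) \<bullet> Y"
    using dagger_kraus[of "dagger M" X] by (simp add: kraus_def herm_part_id)
  also have "\<dots> = herm_part X \<bullet> (M ** herm_part Y ** dagger M)"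
    by (simp only: inner_herm_part[of _ Y] *)
  also have "\<dots> = X \<bullet> herm_part (kraus M Y)" by (simp add: inner_herm_part kraus_def)
  finally show ?thesis by (simp add: herm_part_id)
qed

lemma channel_iter_dual: "Re (trace (X ** (channel L ^^ n) \<sigma>)) = Re (trace ((dual_channel L ^^ n) X ** \<sigma>))"
proof (induction n arbitrary: X)
  case (Suc n)
  have "trace (X ** channel L \<tau>) = trace (dual_channel L X ** \<tau>)" for X \<tau>
  proof -
    have "trace (X ** (L j ** \<tau> ** dagger (L j))) = trace ((dagger (L j) ** X ** L j) ** \<tau>)" for j
      using trace_mul_sym[of "X ** L j ** \<tau>" "dagger (L j)"] by (simp add: matrix_mul_assoc)
    then show ?thesis
      by (simp add: channel_def dual_channel_def matrix_mult_sum_right matrix_mult_sum_left trace_sum)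
  qed
  then have "Re (trace (X ** (channel L ^^ Suc n) \<sigma>)) = Re (trace (dual_channel L X ** (channel L ^^ n) \<sigma>))" by simp
  also have "\<dots> = Re (trace ((dual_channel L ^^ n) (dual_channel L X) ** \<sigma>))" by (rule Suc.IH)
  finally show ?case by (simp only: funpow_Suc_right o_apply)
qed simp

lemma positive_channel: "positive_op \<sigma> \<Longrightarrow> positive_op (channel L \<sigma>)"
  unfolding channel_def by (intro positive_sum positive_conj)

lemma linear_dual_channel: "linear (dual_channel L)"
  unfolding dual_channel_def by (intro linear_compose_sum ballI linear_conj)

lemma linear_channel: "linear (channel L)"
  unfolding channel_def by (intro linear_compose_sum ballI linear_conj)

lemma continuous_linear_matrix:
  fixes f :: "complex ^ 'n ^ 'n \<Rightarrow> 'b::real_normed_vector"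
  shows "linear f \<Longrightarrow> (g \<longlongrightarrow> x) F \<Longrightarrow> ((\<lambda>n. f (g n)) \<longlongrightarrow> f x) F"
  by (rule bounded_linear.tendsto[OF linear_conv_bounded_linear[THEN iffD1]])

lemma qform_dual: "qform (dual_channel L X) x = (\<Sum>j\<in>UNIV. qform X (L j *v x))"
  by (simp add: dual_channel_def qform_sum qform_conj)

lemma dagger_dual: "dagger X = X \<Longrightarrow> dagger (dual_channel L X) = dual_channel L X"
  by (simp add: dual_channel_def dagger_sum dagger_mult matrix_mul_assoc)

lemma tendsto_qform: "(X \<longlongrightarrow> A) F \<Longrightarrow> ((\<lambda>n. qform (X n) x) \<longlongrightarrow> qform A x) F"
proof -
  have "linear (\<lambda>X. qform X x)" by (rule linearI) (simp_all add: qform_add qform_scaleR)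
  then show "(X \<longlongrightarrow> A) F \<Longrightarrow> ((\<lambda>n. qform (X n) x) \<longlongrightarrow> qform A x) F"
    by (rule bounded_linear.tendsto[OF linear_conv_bounded_linear[THEN iffD1]])
qed

lemma tendsto_trace: "(X \<longlongrightarrow> A) F \<Longrightarrow> ((\<lambda>n. Re (trace (B ** X n))) \<longlongrightarrow> Re (trace (B ** (A :: complex ^ 'n ^ 'n)))) F"
proof -
  have "linear (\<lambda>X. Re (trace (B ** X)))"
    by (rule linearI) (simp_all add: matrix_mult_add_right matrix_mult_scaleR_right trace_add trace_scaleR)
  then show "(X \<longlongrightarrow> A) F \<Longrightarrow> ((\<lambda>n. Re (trace (B ** X n))) \<longlongrightarrow> Re (trace (B ** A))) F"
    by (rule bounded_linear.tendsto[OF linear_conv_bounded_linear[THEN iffD1]])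
qed

lemma hermitian_closed:
  assumes "X \<longlonglongrightarrow> A" "\<And>n. dagger (X n) = X n"
  shows "dagger A = A"
proof (rule LIMSEQ_unique[OF _ assms(1)])
  show "X \<longlonglongrightarrow> dagger A" using continuous_linear_matrix[OF linear_dagger assms(1)] by (simp add: assms(2))
qed

lemma positive_closed:
  assumes "X \<longlonglongrightarrow> A" "\<And>n. positive_op (X n)"
  shows "positive_op A"
  unfolding positive_op_iff
proof (intro conjI allI)
  show "dagger A = A" by (rule hermitian_closed[OF assms(1)]) (use assms(2)[unfolded positive_op_iff] in blast)
  show "0 \<le> qform A x" for x
    by (rule LIMSEQ_le_const[OF tendsto_qform[OF assms(1)]]) (use assms(2)[unfolded positive_op_iff] in blast)
qed

lemma cinner_polarization:
  assumes "dagger A = A"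
  shows "cinner x (A *v y) = Complex ((qform A (x + y) - qform A x - qform A y) / 2)
    ((qform A (\<i> *s x + y) - qform A x - qform A y) / 2)"
proof -
  have "Re (cinner (\<i> *s x) (A *v y)) = Im (cinner x (A *v y))" by (simp add: cinner_scale_left)
  then show ?thesis
    by (simp add: complex_eq_iff qform_add_vec[OF assms] qform_scale_vec)
qed

text \<open>Polarisation writes each matrix entry through finitely many values of the form, so
  monotone convergence of forms is enough for convergence of operators.\<close>

lemma qform_convergent_imp_convergent:
  fixes X :: "nat \<Rightarrow> complex ^ 'n ^ 'n"
  assumes "\<And>n. dagger (X n) = X n" "\<And>x. convergent (\<lambda>n. qform (X n) x)"
  shows "convergent X"
proof -
  obtain q where q: "\<And>x. (\<lambda>n. qform (X n) x) \<longlonglongrightarrow> q x"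
    using assms(2) unfolding convergent_def by metis
  have entry: "X n $ k $ i = cinner (axis k 1) (X n *v axis i 1)" for n k i
    by (simp add: matrix_vector_mult_def cinner_def axis_def if_distrib[of "\<lambda>x. _ * x"] if_distrib[of cnj] if_distrib[of "\<lambda>x. x * _"] cong: if_cong)
  define c where "c k i = Complex ((q (axis k 1 + axis i 1) - q (axis k 1) - q (axis i 1)) / 2)
    ((q (\<i> *s axis k 1 + axis i 1) - q (axis k 1) - q (axis i 1)) / 2)" for k i
  have c: "(\<lambda>n. X n $ k $ i) \<longlonglongrightarrow> c k i" for k i
    unfolding entry cinner_polarization[OF assms(1)] c_def
    by (intro tendsto_Complex tendsto_intros q) simp_all
  have "X \<longlonglongrightarrow> (\<chi> k i. c k i)"
    by (intro vec_tendstoI) (simp add: c)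
  then show ?thesis by (auto simp: convergent_def)
qed

text \<open>Rank-one states test the enclosure property one vector at a time. Conversely a positive
  operator is a sum of rank-one operators whose vectors lie in its support, and each of these is
  moved within W. From here on an enclosure is just a subspace invariant under every
  \<open>L j\<close>.\<close>

lemma enclosure_iff:
  "enclosure L W \<longleftrightarrow> vec.subspace W \<and> (\<forall>j. \<forall>x\<in>W. L j *v x \<in> W)"
proof (intro iffI conjI allI ballI)
  assume e: "enclosure L W"
  then show W: "vec.subspace W" by (simp add: enclosure_def)
  fix j x assume x: "x \<in> W"
  have "supp (outer x) \<subseteq> W"
  proof
    fix y assume y: "y \<in> supp (outer x)"
    \<comment> \<open>The component of y along x; the rest of y lies in the kernel of
      \<open>outer x\<close> and must vanish.\<close>
    define R where "R = (cinner x y / cinner x x) *s x"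
    show "y \<in> W"
    proof (cases "x = 0")
      case True
      then have "outer x *v y = 0" by (simp add: outer_vector)
      then have "cinner y y = 0" using y by (simp add: supp_def)
      then show ?thesis using W by (simp add: vec.subspace_0)
    next
      case False
      have "cinner x (y - R) = 0" using False by (simp add: R_def cinner_diff_right cinner_scale_right)
      then have "cinner (y - R) y = 0" using y by (simp add: supp_def outer_vector)
      moreover have "cinner (y - R) R = 0"
        using \<open>cinner x (y - R) = 0\<close> cinner_commute[of "y - R" x] by (simp add: R_def cinner_scale_right)
      ultimately have "cinner (y - R) (y - R) = 0" by (simp add: cinner_diff_right)
      then have "y = R" by simp
      moreover have "R \<in> W" unfolding R_def using W x by (rule vec.subspace_scale)
      ultimately show ?thesis by simp
    qed
  qed
  then have s: "supp (channel L (outer x)) \<subseteq> W" using e positive_outer[of x] unfolding enclosure_def by blast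
  have "L j *v x \<in> supp (channel L (outer x))"
    unfolding supp_def
  proof (intro CollectI allI impI)
    fix y assume h: "channel L (outer x) *v y = 0"
    have "(\<Sum>j\<in>UNIV. (cmod (cinner (L j *v x) y))\<^sup>2) = qform (channel L (outer x)) y"
      by (simp add: channel_def qform_sum outer_conj qform_outer)
    also have "\<dots> = 0" by (simp add: qform_def h)
    finally have "(cmod (cinner (L j *v x) y))\<^sup>2 = 0" by (simp add: sum_nonneg_eq_0_iff)
    then show "cinner y (L j *v x) = 0" by (subst cinner_commute) simp
  qed
  then show "L j *v x \<in> W" using s by blast
next
  assume h: "vec.subspace W \<and> (\<forall>j. \<forall>x\<in>W. L j *v x \<in> W)"
  define P where "P = orth_proj W"
  note P = orth_proj[OF h[THEN conjunct1], folded P_def]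
  show "enclosure L W"
    unfolding enclosure_def
  proof (intro conjI allI impI)
    fix \<omega> assume w: "positive_op \<omega>" "supp \<omega> \<subseteq> W"
    obtain b :: "'b \<Rightarrow> complex ^ 'b" where b: "\<omega> = (\<Sum>i\<in>UNIV. outer (b i))"
      by (rule positive_op_decomposition[OF w(1)])
    have bW: "b i \<in> W" for i
    proof -
      have "b i \<in> supp \<omega>"
        unfolding supp_def
      proof (intro CollectI allI impI)
        fix y assume y: "\<omega> *v y = 0"
        have "(\<Sum>i\<in>UNIV. (cmod (cinner (b i) y))\<^sup>2) = qform \<omega> y" by (simp add: b qform_sum qform_outer)
        also have "\<dots> = 0" by (simp add: qform_def y)
        finally have "(cmod (cinner (b i) y))\<^sup>2 = 0" by (simp add: sum_nonneg_eq_0_iff)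
        then show "cinner y (b i) = 0" by (subst cinner_commute) simp
      qed
      then show ?thesis using w(2) by blast
    qed
    show "supp (channel L \<omega>) \<subseteq> W"
    proof
      fix x assume x: "x \<in> supp (channel L \<omega>)"
      have "channel L \<omega> *v (x - P *v x) = 0"
      proof -
        have "cinner (L j *v b i) (x - P *v x) = 0" for i j
        proof -
          have "L j *v b i \<in> W" using h bW by blast
          then have "cinner (L j *v b i) (x - P *v x) = cinner (P *v (L j *v b i)) (x - P *v x)"
            using P(4) by simp
          also have "\<dots> = cinner (L j *v b i) (P *v (x - P *v x))" using P(2) by (simp add: cinner_dagger')
          also have "P *v (x - P *v x) = 0"
            using P(1) by (simp add: matrix_vector_mult_diff_distrib matrix_vector_mul_assoc)
          finally show ?thesis by simp
        qed
        then show ?thesis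
          by (simp add: b channel_def matrix_mult_sum_right matrix_mult_sum_left matrix_vector_sum outer_conj outer_vector)
      qed
      then have "cinner (x - P *v x) x = 0" using x by (simp add: supp_def)
      moreover have "cinner (x - P *v x) (P *v x) = 0"
        using P(1,2) by (simp add: cinner_dagger matrix_vector_mult_diff_distrib matrix_vector_mul_assoc)
      ultimately have "cinner (x - P *v x) (x - P *v x) = 0" by (simp add: cinner_diff_right)
      then have "P *v x = x" by simp
      then show "x \<in> W" using P(4) by simp
    qed
  qed (use h in simp)
qed

lemma supp_subset_iff:
  assumes "positive_op \<tau>" "vec.subspace W"
  shows "supp \<tau> \<subseteq> W \<longleftrightarrow> orth_proj W ** \<tau> = \<tau>"
proof -
  define P where "P = orth_proj W"
  note P = orth_proj[OF assms(2), folded P_def]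
  define R where "R = orth_proj {x. \<tau> *v x = 0}"
  note R = orth_proj[OF subspace_kernel[of \<tau>], folded R_def]
  note sR = supp_eq_range[where A = \<tau>, folded R_def]
  have herm: "dagger \<tau> = \<tau>" using assms(1) by (simp add: positive_op_iff)
  have R\<tau>: "R ** \<tau> = 0" using dagger_mult[of \<tau> R] sR(4) R(2) herm by simp
  show ?thesis unfolding P_def[symmetric]
  proof
    assume h: "supp \<tau> \<subseteq> W"
    have "\<tau> *v x \<in> W" for x
      using h sR(1)[of "\<tau> *v x"] R\<tau> by (auto simp: matrix_vector_mul_assoc)
    then show "P ** \<tau> = \<tau>" using P(4) by (simp add: matrix_eq matrix_vector_mul_assoc[symmetric])
  next
    assume h: "P ** \<tau> = \<tau>"
    show "supp \<tau> \<subseteq> W"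
    proof
      fix x assume x: "x \<in> supp \<tau>"
      have "\<tau> ** P = \<tau>" using dagger_mult[of P \<tau>] h P(2) herm by simp
      then have "\<tau> *v (x - P *v x) = 0" by (simp add: matrix_vector_mult_diff_distrib matrix_vector_mul_assoc)
      then have "cinner (x - P *v x) x = 0" using x by (simp add: supp_def)
      moreover have "cinner (x - P *v x) (P *v x) = 0"
        using P(1,2) by (simp add: cinner_dagger matrix_vector_mult_diff_distrib matrix_vector_mul_assoc)
      ultimately have "cinner (x - P *v x) (x - P *v x) = 0" by (simp add: cinner_diff_right)
      then show "x \<in> W" using P(4) by simp
    qed
  qed
qed

lemma continuous_on_matrix_vector: "continuous_on U (\<lambda>x :: complex ^ 'n. (X :: complex ^ 'n ^ 'n) *v x)"
proof -
  have "linear (\<lambda>x :: complex ^ 'n. X *v x)"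
    by (rule linearI) (simp_all add: matrix_vector_right_distrib of_real_scale[symmetric] vector_scalar_commute)
  then show ?thesis by (intro linear_continuous_on) (simp add: linear_conv_bounded_linear)
qed

lemma continuous_on_qform: "continuous_on U (qform X)"
  unfolding qform_inner[abs_def] by (intro continuous_intros continuous_on_matrix_vector)

lemma compact_subspace_sphere: "vec.subspace (W :: (complex ^ 'n) set) \<Longrightarrow> compact (W \<inter> sphere 0 1)"
  by (intro closed_Int_compact closed_subspace subspace_real compact_sphere)

section \<open>The absorption operator and its fixed points\<close>

locale min_enclosure =
  fixes L :: "'j::finite \<Rightarrow> complex ^ 'n ^ 'n" and W :: "(complex ^ 'n) set"
  assumes unital: "(\<Sum>j\<in>UNIV. dagger (L j) ** L j) = mat 1"
    and minenc: "minimal_enclosure L W"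
begin

definition P where "P = orth_proj W"
definition A where "A = absorption L W"
definition R where "R = orth_proj {x. A *v x = 0}"
definition p where "p = mat 1 - R"
text \<open>The compression of \<open>L j\<close> written with p on the left only; by
  \<open>pLp\<close> a right factor changes nothing.\<close>

definition M where "M j = p ** L j"

lemma subW: "vec.subspace W" and invW: "x \<in> W \<Longrightarrow> L j *v x \<in> W"
  and W_nz: "W \<noteq> {0}" and W_min: "vec.subspace U \<Longrightarrow> (\<And>j x. x \<in> U \<Longrightarrow> L j *v x \<in> U) \<Longrightarrow> U \<subseteq> W \<Longrightarrow> U = {0} \<or> U = W"
  using minenc unfolding minimal_enclosure_def enclosure_iff by blast+

lemmas P = orth_proj[OF subW, folded P_def]

lemma posP: "positive_op P"
  using P(1,2) by (simp add: positive_op_iff proj_norm)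

lemma dual_one: "dual_channel L (mat 1) = mat 1"
  using unital by (simp add: dual_channel_def)

lemma sum_norm_L: "(\<Sum>j\<in>UNIV. (norm (L j *v x))\<^sup>2) = (norm x)\<^sup>2"
  using qform_dual[of L "mat 1" x] by (simp add: dual_one qform_one)

lemma trace_channel: "trace (channel L \<sigma>) = trace \<sigma>"
proof -
  have "trace (L j ** \<sigma> ** dagger (L j)) = trace ((dagger (L j) ** L j) ** \<sigma>)" for j
    using trace_mul_sym[of "L j ** \<sigma>" "dagger (L j)"] by (simp add: matrix_mul_assoc)
  then have "trace (channel L \<sigma>) = trace ((\<Sum>j\<in>UNIV. dagger (L j) ** L j) ** \<sigma>)"
    by (simp add: channel_def matrix_mult_sum_left trace_sum)
  then show ?thesis by (simp add: unital)
qed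

lemma dual_pos: "positive_op X \<Longrightarrow> positive_op (dual_channel L X)"
  using positive_conj[of X "dagger (L _)"] unfolding dual_channel_def by (intro positive_sum) simp

text \<open>For the complement Q = 1 - P, invariance of W gives Q L_j = Q L_j Q. The weight outside
  W therefore cannot increase, that is, P is subharmonic.\<close>

lemma dual_P_ge: "positive_op (dual_channel L P - P)"
proof -
  define Q where "Q = mat 1 - P"
  have Q: "Q ** Q = Q" "dagger Q = Q"
    using P(1,2) by (simp_all add: Q_def matrix_mult_diff_left matrix_mult_diff_right dagger_diff)
  have "qform (dual_channel L Q) x \<le> qform Q x" for x
  proof -
    have "Q *v (L j *v x) = Q *v (L j *v (Q *v x))" for j
    proof -
      have "L j *v (P *v x) \<in> W" using invW P(5) by blast
      then have "Q *v (L j *v (P *v x)) = 0" using P(4) by (simp add: Q_def matrix_vector_mult_diff_rdistrib)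
      then show ?thesis
        by (simp add: Q_def matrix_vector_mult_diff_rdistrib matrix_vector_mult_diff_distrib)
    qed
    then have "qform (dual_channel L Q) x = (\<Sum>j\<in>UNIV. (norm (Q *v (L j *v (Q *v x))))\<^sup>2)"
      by (simp add: qform_dual proj_norm[OF Q])
    also have "\<dots> \<le> (\<Sum>j\<in>UNIV. (norm (L j *v (Q *v x)))\<^sup>2)"
    proof (rule sum_mono)
      fix j
      have "(norm (Q *v (L j *v (Q *v x))))\<^sup>2 = (norm (L j *v (Q *v x)))\<^sup>2 - qform P (L j *v (Q *v x))"
        unfolding proj_norm[OF Q, symmetric] by (simp add: Q_def qform_diff qform_one)
      then show "(norm (Q *v (L j *v (Q *v x))))\<^sup>2 \<le> (norm (L j *v (Q *v x)))\<^sup>2"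
        using posP by (simp add: positive_op_iff)
    qed
    finally show ?thesis by (simp add: sum_norm_L proj_norm[OF Q])
  qed
  moreover have "dual_channel L Q = mat 1 - dual_channel L P"
    unfolding Q_def linear_diff[OF linear_dual_channel] by (simp add: dual_one)
  ultimately have "qform P x \<le> qform (dual_channel L P) x" for x
    by (simp add: Q_def qform_diff)
  then show ?thesis
    using P(2) dagger_dual[OF P(2)] by (simp add: positive_op_iff dagger_diff qform_diff)
qed

definition B where "B n = (dual_channel L ^^ n) P"

lemma B_simps: "B 0 = P" "B (Suc n) = dual_channel L (B n)"
  by (simp_all add: B_def)

lemma B_props: "dagger (B n) = B n" "positive_op (B (Suc n) - B n)" "positive_op (B n - P)" "positive_op (mat 1 - B n)"
proof (induction n)
  case 0
  show "dagger (B 0) = B 0" "positive_op (B (Suc 0) - B 0)" "positive_op (B 0 - P)"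
    using P(2) dual_P_ge by (simp_all add: B_simps positive_op_iff qform_def)
  have "(mat 1 - P) ** (mat 1 - P) = mat 1 - P" "dagger (mat 1 - P) = mat 1 - P"
    using P(1,2) by (simp_all add: matrix_mult_diff_left matrix_mult_diff_right dagger_diff)
  then show "positive_op (mat 1 - B 0)" by (simp add: positive_op_iff proj_norm B_simps)
next
  case (Suc n)
  show "dagger (B (Suc n)) = B (Suc n)" using Suc by (simp add: B_simps dagger_dual)
  show "positive_op (B (Suc (Suc n)) - B (Suc n))"
    using dual_pos[OF Suc(2)] by (simp add: B_simps linear_diff[OF linear_dual_channel])
  show "positive_op (B (Suc n) - P)"
    using Suc(2,3) by (auto simp: positive_op_iff dagger_diff qform_diff P(2)) (smt (verit))
  show "positive_op (mat 1 - B (Suc n))"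
    using dual_pos[OF Suc(4)] by (simp add: B_simps linear_diff[OF linear_dual_channel] dual_one)
qed

text \<open>The iterates increase and stay below 1, so the \<open>lim\<close> in
  \<open>absorption\<close> is a genuine limit.\<close>

lemma B_tendsto: "B \<longlonglongrightarrow> A"
proof -
  have "convergent B"
  proof (rule qform_convergent_imp_convergent)
    show "dagger (B n) = B n" for n by (rule B_props)
    show "convergent (\<lambda>n. qform (B n) x)" for x
    proof (rule Bseq_monoseq_convergent)
      show "monoseq (\<lambda>n. qform (B n) x)"
        using B_props(2) by (intro mono_SucI1 allI) (simp add: positive_op_iff qform_diff)
      have "\<bar>qform (B n) x\<bar> \<le> (norm x)\<^sup>2" for n
        using B_props(3,4)[of n] posP by (auto simp: positive_op_iff qform_diff qform_one abs_le_iff)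
          (smt (verit) zero_le_power2)
      then show "Bseq (\<lambda>n. qform (B n) x)" by (intro BseqI') auto
    qed
  qed
  then show ?thesis by (simp add: convergent_LIMSEQ_iff A_def absorption_def B_def[abs_def] P_def)
qed

lemma A_herm: "dagger A = A"
  by (rule hermitian_closed[OF B_tendsto B_props(1)])

lemma dual_A: "dual_channel L A = A"
proof (rule LIMSEQ_unique)
  show "(\<lambda>n. B (Suc n)) \<longlonglongrightarrow> dual_channel L A"
    unfolding B_simps by (rule continuous_linear_matrix[OF linear_dual_channel B_tendsto])
  show "(\<lambda>n. B (Suc n)) \<longlonglongrightarrow> A" by (rule LIMSEQ_Suc[OF B_tendsto])
qed

lemma A_ge_P: "positive_op (A - P)"
  by (rule positive_closed[OF tendsto_diff[OF B_tendsto tendsto_const] B_props(3)])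

lemma A_le_1: "positive_op (mat 1 - A)"
  by (rule positive_closed[OF tendsto_diff[OF tendsto_const B_tendsto] B_props(4)])

lemma A_pos: "positive_op A"
proof -
  have "qform A x \<ge> 0" for x
    using A_ge_P posP by (smt (verit) positive_op_iff qform_diff)
  then show ?thesis by (simp add: positive_op_iff A_herm)
qed

text \<open>On W the bounds P \<le> A \<le> 1 squeeze the form of A, and a positive operator
  annihilates every zero of its form.\<close>

lemma A_id_W: "x \<in> W \<Longrightarrow> A *v x = x"
proof -
  assume x: "x \<in> W"
  have "qform P x = (norm x)\<^sup>2" using x P by (simp add: proj_norm)
  then have "qform (mat 1 - A) x = 0"
    using A_ge_P A_le_1 by (smt (verit) positive_op_iff qform_diff qform_one)
  then have "(mat 1 - A) *v x = 0" by (rule positive_op_zero_vec[OF A_le_1])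
  then show ?thesis by (simp add: matrix_vector_mult_diff_rdistrib)
qed

lemma AP: "A ** P = P" "P ** A = P"
proof -
  show *: "A ** P = P" using A_id_W P(5) by (simp add: matrix_eq matrix_vector_mul_assoc[symmetric])
  show "P ** A = P" using dagger_mult[of A P] by (simp add: * A_herm P(2))
qed

lemmas R = orth_proj[OF subspace_kernel[of A], folded R_def]
lemmas supp_A = supp_eq_range[where A = A, folded R_def]

lemma p_eq: "orth_proj (supp A) = p"
  by (simp add: p_def supp_A(3))

lemma p: "p ** p = p" "dagger p = p"
  using R(1,2) by (simp_all add: p_def matrix_mult_diff_left matrix_mult_diff_right dagger_diff)

lemma AR: "A ** R = 0" "R ** A = 0"
proof -
  show *: "A ** R = 0" by (rule supp_A(4))
  show "R ** A = 0" using dagger_mult[of A R] by (simp add: * A_herm R(2))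
qed

lemma Ap: "A ** p = A" "p ** A = A"
  using AR by (simp_all add: p_def matrix_mult_diff_left matrix_mult_diff_right)

lemma p_kernel: "A *v x = 0 \<Longrightarrow> p *v x = 0"
  using R(4)[of x] by (simp add: p_def matrix_vector_mult_diff_rdistrib)

lemma pP: "p ** P = P"
  using Ap(2) AP(1) matrix_mul_assoc[of p A P] by simp

text \<open>Harmonicity makes the kernel of A invariant: the forms of A at the images of a kernel
  vector are nonnegative and sum to zero. Compression to the support of A is therefore compatible
  with products of the \<open>L j\<close>.\<close>

lemma pLp: "p ** L j ** p = p ** L j"
proof -
  have "A *v (L j *v (R *v x)) = 0" for x
  proof -
    have "(\<Sum>j\<in>UNIV. qform A (L j *v (R *v x))) = qform A (R *v x)"
      using qform_dual[of L A "R *v x"] by (simp add: dual_A)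
    also have "\<dots> = 0" using R(5)[of x] by (simp add: qform_def)
    finally have "qform A (L j *v (R *v x)) = 0"
      using A_pos by (subst (asm) sum_nonneg_eq_0_iff) (auto simp: positive_op_iff)
    then show ?thesis by (rule positive_op_zero_vec[OF A_pos])
  qed
  then have "p ** L j ** R = 0"
    using p_kernel by (simp add: matrix_eq matrix_vector_mul_assoc[symmetric])
  then show ?thesis by (simp add: p_def matrix_mult_diff_right)
qed

lemma M_eq: "M j = p ** L j ** p" "M j ** p = M j" "p ** M j = M j" "p ** L j = M j"
  using p(1) by (simp_all add: M_def pLp matrix_mul_assoc)

lemma dagger_Lp: "dagger (L j) ** p = dagger (M j)"
  by (simp add: M_def dagger_mult p(2))

text \<open>On operators carried by p the dual channel and its compression agree, so equations
  solved for the compressed maps hold for the original ones.\<close>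

lemma conj_L_eq: "p ** X ** p = X \<Longrightarrow> dagger (L j) ** X ** L j = dagger (M j) ** X ** M j"
proof -
  assume X: "p ** X ** p = X"
  have "dagger (L j) ** X ** L j = (dagger (L j) ** p) ** X ** (p ** L j)"
    by (subst X[symmetric]) (simp add: matrix_mul_assoc)
  then show ?thesis by (simp only: dagger_Lp M_eq(4))
qed

lemma kraus_eq: "dagger X = X \<Longrightarrow> p ** X ** p = X \<Longrightarrow> kraus (dagger (M j)) X = dagger (L j) ** X ** L j"
  by (simp add: kraus_def herm_part_id conj_L_eq)

lemma kraus_range: "p ** kraus (dagger (M j)) X ** p = kraus (dagger (M j)) X"
proof -
  have "p ** dagger (M j) = dagger (M j)" using dagger_mult[of "M j" p] by (simp add: M_eq(2) p(2))
  then show ?thesis by (simp add: kraus_def matrix_mul_assoc) (simp add: matrix_mul_assoc[symmetric] M_eq(2))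
qed

text \<open>Compactness of the unit sphere in the support of A. The gap \<delta> is what keeps
  nearby eigenvectors positive on the range of p.\<close>

lemma A_lower_bound: obtains \<delta> where "\<delta> > 0" "\<And>x. \<delta> * (norm (p *v x))\<^sup>2 \<le> qform A x"
proof -
  have qp: "qform A x = qform A (p *v x)" for x
    using qform_conj[of p A x] by (simp add: p(2) Ap)
  have supp_p: "p *v x \<in> supp A" for x
    using R(1) by (simp add: supp_A(1) p_def matrix_vector_mult_diff_rdistrib matrix_vector_mult_diff_distrib matrix_vector_mul_assoc)
  show ?thesis
  proof (cases "supp A \<inter> sphere 0 1 = {}")
    case True
    have "p *v x = 0" for x
    proof (rule ccontr)
      assume nz: "p *v x \<noteq> 0"
      have "(1 / norm (p *v x)) *\<^sub>R (p *v x) \<in> supp A"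
        by (rule subspace_scale[OF subspace_real[OF supp_A(2)] supp_p])
      moreover have "(1 / norm (p *v x)) *\<^sub>R (p *v x) \<in> sphere 0 1" using nz by simp
      ultimately show False using True by blast
    qed
    then show ?thesis using that[of 1] A_pos by (simp add: positive_op_iff)
  next
    case False
    obtain x0 where x0: "x0 \<in> supp A \<inter> sphere 0 1" "\<And>x. x \<in> supp A \<inter> sphere 0 1 \<Longrightarrow> qform A x0 \<le> qform A x"
      using continuous_attains_inf[OF compact_subspace_sphere[OF supp_A(2)] False continuous_on_qform[of _ A]] by blast
    have "qform A x0 \<noteq> 0"
    proof
      assume "qform A x0 = 0"
      then have "p *v x0 = 0" using p_kernel positive_op_zero_vec[OF A_pos] by blast
      moreover have "p *v x0 = x0" using x0(1) by (simp add: p_def matrix_vector_mult_diff_rdistrib supp_A(1))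
      ultimately show False using x0(1) by simp
    qed
    then have pos: "qform A x0 > 0" using A_pos by (simp add: positive_op_iff order_less_le)
    have "qform A x0 * (norm (p *v x))\<^sup>2 \<le> qform A x" for x
    proof (cases "p *v x = 0")
      case True
      then show ?thesis using A_pos by (simp add: positive_op_iff)
    next
      case False
      define c where "c = norm (p *v x)"
      have c: "c > 0" using False by (simp add: c_def)
      define y where "y = (1 / c) *\<^sub>R (p *v x)"
      have "y \<in> supp A" unfolding y_def by (rule subspace_scale[OF subspace_real[OF supp_A(2)] supp_p])
      moreover have "y \<in> sphere 0 1" using c by (simp add: y_def c_def)
      ultimately have "qform A x0 \<le> qform A y" using x0(2) by blast
      also have "qform A y = qform A x / c\<^sup>2"
        using c qform_scale_vec[of A "complex_of_real (1 / c)" "p *v x"] unfolding of_real_scale y_def qp[of x]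
        by (simp add: power_divide norm_divide)
      finally show ?thesis using c by (simp add: c_def[symmetric] field_simps)
    qed
    then show ?thesis using that pos by blast
  qed
qed

text \<open>A limit point s of the evolution of \<open>outer x\<close> pairs with Y to the value of
  its form at x, and pairs with A - P to 0 because the iterates of P tend to A. The vectors
  composing s thus lie in the kernel of A - P, where p and P agree, so Y is seen there only through
  its corner P Y P.\<close>

lemma fixed_point_zero:
  assumes Y: "dagger Y = Y" "p ** Y ** p = Y" "dual_channel L Y = Y" and PYP: "P ** Y ** P = 0"
  shows "Y = 0"
proof (rule hermitian_zero[OF Y(1)])
  fix x :: "complex ^ 'n"
  define \<sigma> where "\<sigma> n = (channel L ^^ n) (outer x)" for n
  have pos: "positive_op (\<sigma> n)" for n
    by (induction n) (simp_all add: \<sigma>_def positive_outer positive_channel)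
  have tr: "trace (\<sigma> n) = trace (outer x)" for n
    by (induction n) (simp_all add: \<sigma>_def trace_channel)
  have "norm (\<sigma> n) \<le> Re (trace (outer x))" for n using norm_positive_le_trace[OF pos] tr by metis
  then have "bounded (range \<sigma>)" by (auto simp: bounded_iff)
  \<comment> \<open>A subsequence suffices, so a periodic channel causes no trouble.\<close>
  then obtain s r where s: "strict_mono r" "(\<sigma> \<circ> r) \<longlonglongrightarrow> s" using bounded_imp_convergent_subsequence by blast
  have s_pos: "positive_op s" by (rule positive_closed[OF s(2)]) (simp add: pos)
  have duY: "(dual_channel L ^^ n) Y = Y" "(dual_channel L ^^ n) A = A" for n
    by (induction n) (simp_all add: Y(3) dual_A)
  have Ys: "Re (trace (Y ** s)) = qform Y x"
  proof (rule LIMSEQ_unique)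
    show "(\<lambda>n. Re (trace (Y ** (\<sigma> \<circ> r) n))) \<longlonglongrightarrow> Re (trace (Y ** s))" by (rule tendsto_trace[OF s(2)])
    have "Re (trace (Y ** (\<sigma> \<circ> r) n)) = qform Y x" for n
      by (simp add: \<sigma>_def channel_iter_dual duY trace_outer qform_def)
    then show "(\<lambda>n. Re (trace (Y ** (\<sigma> \<circ> r) n))) \<longlonglongrightarrow> qform Y x" by simp
  qed
  have APs: "Re (trace ((A - P) ** s)) = 0"
  proof (rule LIMSEQ_unique)
    show "(\<lambda>n. Re (trace ((A - P) ** (\<sigma> \<circ> r) n))) \<longlonglongrightarrow> Re (trace ((A - P) ** s))" by (rule tendsto_trace[OF s(2)])
    have "Re (trace ((A - P) ** \<sigma> n)) = qform A x - qform (B n) x" for n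
      by (simp add: matrix_mult_diff_left trace_sub \<sigma>_def channel_iter_dual duY B_def[symmetric] trace_outer qform_def)
    moreover have "(\<lambda>n. qform A x - qform (B n) x) \<longlonglongrightarrow> qform A x - qform A x"
      by (intro tendsto_intros tendsto_qform B_tendsto)
    ultimately have "(\<lambda>n. Re (trace ((A - P) ** \<sigma> n))) \<longlonglongrightarrow> 0" by simp
    from LIMSEQ_subseq_LIMSEQ[OF this s(1)]
    show "(\<lambda>n. Re (trace ((A - P) ** (\<sigma> \<circ> r) n))) \<longlonglongrightarrow> 0" by (simp add: o_def)
  qed
  obtain b :: "'n \<Rightarrow> complex ^ 'n" where b: "s = (\<Sum>i\<in>UNIV. outer (b i))" by (rule positive_op_decomposition[OF s_pos])
  have tb: "Re (trace (X ** s)) = (\<Sum>i\<in>UNIV. qform X (b i))" for X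
    by (simp add: b matrix_mult_sum_right trace_sum trace_outer qform_def)
  have "qform Y (b i) = 0" for i
  proof -
    have "qform (A - P) (b i) = 0"
      using APs A_ge_P unfolding tb by (subst (asm) sum_nonneg_eq_0_iff) (auto simp: positive_op_iff)
    then have "(A - P) *v b i = 0" by (rule positive_op_zero_vec[OF A_ge_P])
    then have "A *v b i = P *v b i" by (simp add: matrix_vector_mult_diff_rdistrib)
    then have "A *v (b i - P *v b i) = 0"
      by (simp add: matrix_vector_mult_diff_distrib matrix_vector_mul_assoc AP)
    then have "p *v (b i - P *v b i) = 0" by (rule p_kernel)
    then have pb: "p *v b i = P *v b i"
      by (simp add: matrix_vector_mult_diff_distrib matrix_vector_mul_assoc pP)
    have "qform Y (b i) = qform Y (p *v b i)" using qform_conj[of p Y "b i"] by (simp add: p(2) Y(2))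
    also have "\<dots> = qform (P ** Y ** P) (b i)" using qform_conj[of P Y "b i"] by (simp add: P(2) pb)
    finally show ?thesis by (simp add: PYP qform_def)
  qed
  then show "qform Y x = 0" using Ys tb[of Y] by simp
qed

text \<open>Maximum principle. The vectors of W at which the form of X attains its maximal ratio c
  form an invariant subspace, because the images under the \<open>L j\<close> conserve both the
  total norm and the total form. Minimality makes this subspace all of W, so X and c A have the same
  corner, and \<open>fixed_point_zero\<close> removes the difference.\<close>

lemma fixed_point_multiple:
  assumes X: "dagger X = X" "p ** X ** p = X" "dual_channel L X = X"
  shows "\<exists>c. X = c *\<^sub>R A"
proof -
  have ne: "W \<inter> sphere 0 1 \<noteq> {}"
  proof -
    obtain x where x: "x \<in> W" "x \<noteq> 0" using W_nz subW vec.subspace_0 by blast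
    have "(1 / norm x) *\<^sub>R x \<in> W \<inter> sphere 0 1" using x subspace_scale[OF subspace_real[OF subW]] by simp
    then show ?thesis by blast
  qed
  obtain x0 where x0: "x0 \<in> W \<inter> sphere 0 1" "\<And>x. x \<in> W \<inter> sphere 0 1 \<Longrightarrow> qform X x \<le> qform X x0"
    using continuous_attains_sup[OF compact_subspace_sphere[OF subW] ne continuous_on_qform[of _ X]] by blast
  define c where "c = qform X x0"
  have le: "qform X x \<le> c * (norm x)\<^sup>2" if x: "x \<in> W" for x
  proof (cases "x = 0")
    case True then show ?thesis by (simp add: qform_def)
  next
    case False
    define y where "y = (1 / norm x) *\<^sub>R x"
    have "y \<in> W \<inter> sphere 0 1" using x False subspace_scale[OF subspace_real[OF subW]] by (simp add: y_def)
    then have "qform X y \<le> c" using x0(2) by (simp add: c_def)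
    moreover have "qform X y = qform X x / (norm x)\<^sup>2"
      using qform_scale_vec[of X "complex_of_real (1 / norm x)" x] unfolding of_real_scale y_def
      by (simp add: power_divide norm_divide)
    ultimately show ?thesis using False by (simp add: field_simps)
  qed
  define Z where "Z = P ** (c *\<^sub>R mat 1 - X) ** P"
  have Zq: "qform Z x = c * (norm (P *v x))\<^sup>2 - qform X (P *v x)" for x
    using qform_conj[of P "c *\<^sub>R mat 1 - X" x] by (simp add: Z_def P(2) qform_diff qform_scaleR qform_one)
  have Zpos: "positive_op Z"
    using le P(5) by (simp add: positive_op_iff Zq) (simp add: Z_def dagger_mult dagger_diff dagger_scaleR X(1) P(2) matrix_mul_assoc)
  \<comment> \<open>The maximisers together with 0, written as an intersection of kernels so that
    linearity is immediate.\<close>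
  define U where "U = {x. (mat 1 - P) *v x = 0} \<inter> {x. Z *v x = 0}"
  have U_iff: "x \<in> U \<longleftrightarrow> x \<in> W \<and> qform Z x = 0" for x
    using P(4)[of x] positive_op_zero_vec[OF Zpos, of x]
    by (auto simp: U_def matrix_vector_mult_diff_rdistrib qform_def)
  have "U = {0} \<or> U = W"
  proof (rule W_min)
    show "vec.subspace U" unfolding U_def by (intro vec.subspace_inter subspace_kernel)
    show "U \<subseteq> W" using U_iff by blast
    fix j x assume x: "x \<in> U"
    have xW: "x \<in> W" and q: "qform X x = c * (norm x)\<^sup>2" using x U_iff Zq[of x] P(4)[of x] by auto
    have "(\<Sum>j\<in>UNIV. qform X (L j *v x)) = qform X x" using qform_dual[of L X x] by (simp add: X(3))
    \<comment> \<open>Nonnegative terms with sum zero: each image is a maximiser again.\<close>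
    then have "(\<Sum>j\<in>UNIV. c * (norm (L j *v x))\<^sup>2 - qform X (L j *v x)) = 0"
      by (simp add: sum_subtractf sum_distrib_left[symmetric] sum_norm_L q)
    then have "c * (norm (L j *v x))\<^sup>2 - qform X (L j *v x) = 0"
      using le[OF invW[OF xW]] by (subst (asm) sum_nonneg_eq_0_iff) auto
    then have "qform Z (L j *v x) = 0" using Zq P(4) invW[OF xW, of j] by simp
    then show "L j *v x \<in> U" using U_iff invW[OF xW] by blast
  qed
  moreover have "x0 \<in> U" "x0 \<noteq> 0"
    using x0(1) P(4)[of x0] by (auto simp: U_iff Zq c_def)
  ultimately have UW: "U = W" by blast
  have "Z *v x = 0" for x
  proof -
    have "Z *v (P *v x) = 0" using UW P(5)[of x] unfolding U_def by blast
    moreover have "Z ** P = Z" using P(1) by (simp add: Z_def matrix_mul_assoc[symmetric])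
    ultimately show ?thesis by (simp add: matrix_vector_mul_assoc)
  qed
  then have "Z = 0" by (simp add: matrix_eq)
  moreover have "P ** (X - c *\<^sub>R A) ** P = - Z"
    using P(1) AP by (simp add: Z_def matrix_mult_diff_left matrix_mult_diff_right matrix_mult_scaleR_left matrix_mult_scaleR_right)
  ultimately have PYP: "P ** (X - c *\<^sub>R A) ** P = 0" by simp
  have "X - c *\<^sub>R A = 0"
  proof (rule fixed_point_zero[OF _ _ _ PYP])
    show "dagger (X - c *\<^sub>R A) = X - c *\<^sub>R A" by (simp only: dagger_diff dagger_scaleR X(1) A_herm)
    show "p ** (X - c *\<^sub>R A) ** p = X - c *\<^sub>R A"
      by (simp only: matrix_mult_diff_left matrix_mult_diff_right matrix_mult_scaleR_left matrix_mult_scaleR_right X(2) Ap)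
    show "dual_channel L (X - c *\<^sub>R A) = X - c *\<^sub>R A"
      by (simp only: linear_diff[OF linear_dual_channel] linear_scale[OF linear_dual_channel] dual_A X(3))
  qed
  then show ?thesis by (intro exI[of _ c]) simp
qed

end

text \<open>Polarisation makes the matrix unique. The lemma turns the \<open>THE\<close> in
  \<open>diffusion_matrix\<close> into a usable equation once the second derivative is known to be a
  quadratic form.\<close>

lemma quadratic_form_matrix:
  fixes b :: "real ^ 'd \<Rightarrow> real ^ 'd \<Rightarrow> real"
  assumes b: "\<And>w. linear (\<lambda>u. b u w)" and sym: "\<And>u w. b u w = b w u"
  shows "\<exists>!D :: real ^ 'd ^ 'd. transpose D = D \<and> (\<forall>u. u \<bullet> (D *v u) = b u u)"
proof (rule ex_ex1I)
  define D :: "real ^ 'd ^ 'd" where "D = (\<chi> k l. b (axis k 1) (axis l 1))"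
  have exp: "b u w = (\<Sum>k\<in>UNIV. u $ k * b (axis k 1) w)" for u w
  proof -
    have "b u w = b (\<Sum>k\<in>UNIV. u $ k *\<^sub>R axis k 1) w" by (simp add: basis_expansion[of u, unfolded scalar_mult_eq_scaleR])
    also have "\<dots> = (\<Sum>k\<in>UNIV. b (u $ k *\<^sub>R axis k 1) w)" by (rule linear_sum[OF b])
    finally show ?thesis by (simp add: linear_scale[OF b])
  qed
  have "transpose D = D" by (simp add: D_def transpose_def vec_eq_iff sym)
  moreover have "u \<bullet> (D *v u) = b u u" for u
  proof -
    have "b (axis k 1) u = (\<Sum>l\<in>UNIV. u $ l * b (axis k 1) (axis l 1))" for k
      using exp[of u "axis k 1"] by (simp add: sym)
    then show ?thesis
      by (subst exp) (simp add: inner_vec_def matrix_vector_mult_def D_def mult.commute)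
  qed
  ultimately show "\<exists>D :: real ^ 'd ^ 'd. transpose D = D \<and> (\<forall>u. u \<bullet> (D *v u) = b u u)" by blast
next
  fix D E :: "real ^ 'd ^ 'd"
  assume h: "transpose D = D \<and> (\<forall>u. u \<bullet> (D *v u) = b u u)" "transpose E = E \<and> (\<forall>u. u \<bullet> (E *v u) = b u u)"
  have swap: "y \<bullet> (F *v x) = x \<bullet> (F *v y)" if "transpose F = F" for F :: "real ^ 'd ^ 'd" and x y
    using dot_lmul_matrix[of y F x] that by (metis inner_commute transpose_matrix_vector)
  have "x \<bullet> (D *v y) = x \<bullet> (E *v y)" for x y
  proof -
    have e: "(x + y) \<bullet> (F *v (x + y)) = x \<bullet> (F *v x) + 2 * (x \<bullet> (F *v y)) + y \<bullet> (F *v y)"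
      if "transpose F = F" for F :: "real ^ 'd ^ 'd"
      using swap[OF that, of y x] by (simp add: matrix_vector_right_distrib inner_add_left inner_add_right)
    show ?thesis using e[of D] e[of E] h by auto
  qed
  then have "D *v y = E *v y" for y by (metis vector_eq_ldot)
  then show "D = E" by (simp add: matrix_eq)
qed

section \<open>The spectral radius from a growth bound\<close>

lemma mat_scale: "(mat z ** (X :: complex ^ 'n ^ 'n)) $ i $ j = z * X $ i $ j"
  by (simp add: matrix_matrix_mult_def mat_def if_distrib[of "\<lambda>x. x * _"] cong: if_cong)

lemma mat_mult_mat: "mat z ** (mat w ** (X :: complex ^ 'n ^ 'n)) = mat (z * w) ** X"
  by (simp add: vec_eq_iff mat_scale)

lemma mat_commute: "(Y :: complex ^ 'n ^ 'n) ** (mat z ** (X :: complex ^ 'n ^ 'n)) = mat z ** (Y ** X)"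
proof -
  have "(Y ** Z) $ i $ j = (\<Sum>k\<in>UNIV. Y $ i $ k * Z $ k $ j)" for Z :: "complex ^ 'n ^ 'n" and i j
    by (simp add: matrix_matrix_mult_def)
  then show ?thesis by (simp add: vec_eq_iff mat_scale sum_distrib_left mult_ac)
qed

lemma mat_scaleR: "mat (complex_of_real c) ** (X :: complex ^ 'n ^ 'n) = c *\<^sub>R X"
  by (simp add: vec_eq_iff mat_scale scaleR_conv_of_real[where 'a = complex])

lemma norm_mat_scale: "norm (mat z ** (X :: complex ^ 'n ^ 'n)) = cmod z * norm X"
proof -
  have d: "dagger (mat z :: complex ^ 'n ^ 'n) = mat (cnj z)" by (simp add: vec_eq_iff dagger_def mat_def)
  have "cnj z * z = complex_of_real ((cmod z)\<^sup>2)" by (simp only: complex_norm_square mult.commute)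
  then have "dagger (mat z ** X) ** (mat z ** X) = (cmod z)\<^sup>2 *\<^sub>R (dagger X ** X)"
    by (simp only: dagger_mult d matrix_mul_assoc[symmetric] mat_mult_mat mat_scaleR matrix_mult_scaleR_right)
  then have "(norm (mat z ** X))\<^sup>2 = (cmod z * norm X)\<^sup>2"
    unfolding power2_norm_eq_inner[of "mat z ** X"] inner_matrix
    by (simp add: trace_scaleR power_mult_distrib power2_norm_eq_inner[of X] inner_matrix)
  then show ?thesis by (rule power2_eq_imp_eq) simp_all
qed

context
  fixes F :: "complex ^ 'n ^ 'n \<Rightarrow> complex ^ 'n ^ 'n" and l :: real
  assumes F: "linear F" "\<And>z X. F (mat z ** X) = mat z ** F X" and l: "l > 0"
    and growth: "\<And>\<omega>. positive_op \<omega> \<Longrightarrow> \<exists>C. \<forall>n. norm ((F ^^ n) \<omega>) \<le> C * l ^ n"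
begin

text \<open>Positive operators span: a Hermitian h is the difference of h + |h| 1 and |h| 1, both
  positive, and every operator is h1 - \<i> h2 with h1 and h2 Hermitian.\<close>

lemma growth_all: "\<exists>C. \<forall>n. norm ((F ^^ n) \<sigma>) \<le> C * l ^ n"
proof -
  have lin: "linear (F ^^ n)" for n
  proof (induction n)
    case 0
    show ?case by (simp add: linear_id[unfolded id_def] id_def)
  next
    case (Suc n)
    show ?case unfolding funpow.simps by (rule linear_compose[OF Suc F(1)])
  qed
  have matn: "(F ^^ n) (mat z ** X) = mat z ** (F ^^ n) X" for n z X
    by (induction n) (simp_all add: F(2))
  have diff: "\<exists>C. \<forall>n. norm ((F ^^ n) (X - Y)) \<le> C * l ^ n"
    if X: "\<exists>C. \<forall>n. norm ((F ^^ n) X) \<le> C * l ^ n" and Y: "\<exists>C. \<forall>n. norm ((F ^^ n) Y) \<le> C * l ^ n" for X Y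
  proof -
    obtain C D where "\<forall>n. norm ((F ^^ n) X) \<le> C * l ^ n" "\<forall>n. norm ((F ^^ n) Y) \<le> D * l ^ n" using X Y by blast
    then have "norm ((F ^^ n) X - (F ^^ n) Y) \<le> C * l ^ n + D * l ^ n" for n
      by (intro order_trans[OF norm_triangle_ineq4] add_mono) auto
    then have "\<forall>n. norm ((F ^^ n) (X - Y)) \<le> (C + D) * l ^ n"
      by (simp add: linear_diff[OF lin] distrib_right)
    then show ?thesis by blast
  qed
  have herm: "\<exists>C. \<forall>n. norm ((F ^^ n) h) \<le> C * l ^ n" if h: "dagger h = h" for h
  proof -
    have "positive_op (h + norm h *\<^sub>R mat 1)"
      unfolding positive_op_iff
    proof (intro conjI allI)
      show "dagger (h + norm h *\<^sub>R mat 1) = h + norm h *\<^sub>R mat 1" by (simp add: dagger_add dagger_scaleR h)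
      show "0 \<le> qform (h + norm h *\<^sub>R mat 1) x" for x
        using abs_qform_le[of h x] by (simp add: qform_add qform_scaleR qform_one)
    qed
    moreover have "positive_op (norm h *\<^sub>R mat 1 :: complex ^ 'n ^ 'n)"
      by (simp add: positive_op_iff dagger_scaleR qform_scaleR qform_one)
    ultimately have "\<exists>C. \<forall>n. norm ((F ^^ n) (h + norm h *\<^sub>R mat 1 - norm h *\<^sub>R mat 1)) \<le> C * l ^ n"
      by (intro diff growth)
    then show ?thesis by simp
  qed
  define h1 where "h1 = herm_part \<sigma>"
  define h2 where "h2 = herm_part (mat \<i> ** \<sigma>)"
  have "\<exists>C. \<forall>n. norm ((F ^^ n) (mat \<i> ** h2)) \<le> C * l ^ n"
    using herm[of h2] by (simp add: matn norm_mat_scale h2_def)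
  then have "\<exists>C. \<forall>n. norm ((F ^^ n) (h1 - mat \<i> ** h2)) \<le> C * l ^ n"
    using herm[of h1] by (intro diff) (simp_all add: h1_def)
  moreover have "h1 - mat \<i> ** h2 = \<sigma>"
    by (simp add: vec_eq_iff mat_scale h1_def h2_def herm_part_def dagger_def)
       (simp add: complex_eq_iff field_simps)
  ultimately show ?thesis by simp
qed

text \<open>In finite dimension every spectral value is an eigenvalue. Its powers along an
  eigenvector cannot outgrow l^n, so no spectral value exceeds l in modulus, and y realises l
  itself.\<close>

lemma spectral_radius_eq:
  assumes y: "y \<noteq> 0" "F y = l *\<^sub>R y"
  shows "superop_spectral_radius F = l"
  unfolding superop_spectral_radius_def
proof (rule cSup_eq_maximum)
  have "\<not> inj (\<lambda>\<sigma>. mat (complex_of_real l) ** \<sigma> - F \<sigma>)"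
  proof
    assume "inj (\<lambda>\<sigma>. mat (complex_of_real l) ** \<sigma> - F \<sigma>)"
    then have "y = 0" by (rule injD) (simp add: mat_scaleR y linear_0[OF F(1)])
    then show False using y by simp
  qed
  then have "complex_of_real l \<in> superop_spectrum F" by (auto simp: superop_spectrum_def bij_def)
  then show "l \<in> cmod ` superop_spectrum F" using l by (intro image_eqI[of _ _ "complex_of_real l"]) auto
next
  fix r assume "r \<in> cmod ` superop_spectrum F"
  then obtain z where z: "r = cmod z" "\<not> bij (\<lambda>\<sigma>. mat z ** \<sigma> - F \<sigma>)" by (auto simp: superop_spectrum_def)
  define H where "H = (\<lambda>\<sigma>. mat z ** \<sigma> - F \<sigma>)"
  have lin: "linear H"
    unfolding H_def
    by (rule linearI) (simp_all add: matrix_mult_add_right matrix_mult_scaleR_right linear_add[OF F(1)] linear_scale[OF F(1)] algebra_simps)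
  have "\<not> inj H" using z(2) linear_inj_imp_surj[OF lin] by (auto simp: bij_def H_def[symmetric])
  then obtain \<sigma> where \<sigma>: "\<sigma> \<noteq> 0" "H \<sigma> = 0" using linear_injective_0[OF lin] by blast
  have "(F ^^ n) \<sigma> = mat (z ^ n) ** \<sigma>" for n
  proof (induction n)
    case (Suc n)
    have "F \<sigma> = mat z ** \<sigma>" using \<sigma>(2) by (simp add: H_def)
    then show ?case by (simp add: Suc F(2) mat_mult_mat mult.commute)
  qed simp
  moreover obtain C where C: "\<And>n. norm ((F ^^ n) \<sigma>) \<le> C * l ^ n" using growth_all by blast
  ultimately have b: "cmod z ^ n * norm \<sigma> \<le> C * l ^ n" for n by (metis norm_mat_scale norm_power)
  show "r \<le> l"
  proof (rule ccontr)
    assume "\<not> r \<le> l"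
    then have "1 < cmod z / l" using l z(1) by simp
    then obtain n where n: "C / norm \<sigma> < (cmod z / l) ^ n" using real_arch_pow by blast
    then have "C < (cmod z / l) ^ n * norm \<sigma>" using \<sigma>(1) by (simp add: pos_divide_less_eq)
    then show False using b[of n] l by (simp add: power_divide field_simps)
  qed
qed

end

section \<open>Invariant state, correctors and derivatives of the radius\<close>

context min_enclosure
begin

text \<open>Brouwer's theorem on the compact convex set of states supported on W, which the channel
  maps into itself.\<close>

lemma invariant_state_exists: "\<exists>\<tau>. positive_op \<tau> \<and> trace \<tau> = 1 \<and> channel L \<tau> = \<tau> \<and> P ** \<tau> = \<tau>"
proof -
  define D where "D = {\<sigma>. positive_op \<sigma> \<and> trace \<sigma> = 1 \<and> P ** \<sigma> = \<sigma>}"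
  have PL: "P ** (L j ** \<sigma> ** dagger (L j)) = L j ** \<sigma> ** dagger (L j)" if "P ** \<sigma> = \<sigma>" for j \<sigma>
  proof -
    have "P ** L j ** P = L j ** P"
      using P(4) invW P(5) by (simp add: matrix_eq matrix_vector_mul_assoc[symmetric])
    then have "P ** L j ** (P ** \<sigma>) = L j ** (P ** \<sigma>)" by (simp add: matrix_mul_assoc)
    then show ?thesis by (simp add: that matrix_mul_assoc)
  qed
  have "bounded D"
    unfolding bounded_iff using norm_positive_le_trace by (intro exI[of _ 1]) (force simp: D_def)
  moreover have "closed D"
    unfolding closed_sequential_limits
  proof (intro allI impI)
    fix X \<sigma> assume h: "(\<forall>n. X n \<in> D) \<and> X \<longlonglongrightarrow> \<sigma>"
    then have X: "\<And>n. positive_op (X n)" "\<And>n. trace (X n) = 1" "\<And>n. P ** X n = X n" and lim: "X \<longlonglongrightarrow> \<sigma>"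
      by (auto simp: D_def)
    have "(\<lambda>n. P ** X n) \<longlonglongrightarrow> P ** \<sigma>"
      using continuous_linear_matrix[OF linear_conj[of P "mat 1"] lim] by simp
    then have "X \<longlonglongrightarrow> P ** \<sigma>" unfolding X(3) .
    then have 1: "P ** \<sigma> = \<sigma>" using lim LIMSEQ_unique by blast
    have "(\<lambda>n. Re (trace (mat 1 ** X n))) \<longlonglongrightarrow> Re (trace (mat 1 ** \<sigma>))" by (rule tendsto_trace[OF lim])
    then have "Re (trace \<sigma>) = 1" using LIMSEQ_unique[OF _ tendsto_const[of 1 sequentially]] by (simp add: X(2))
    moreover have pos: "positive_op \<sigma>" by (rule positive_closed[OF lim X(1)])
    ultimately have "trace \<sigma> = 1" using Im_trace_positive[OF pos] by (simp add: complex_eq_iff)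
    then show "\<sigma> \<in> D" using 1 pos by (simp add: D_def)
  qed
  ultimately have comp: "compact D" by (simp add: compact_eq_bounded_closed)
  have conv: "convex D"
    unfolding convex_def D_def
    by (auto simp: positive_op_iff dagger_add dagger_scaleR qform_add qform_scaleR trace_add trace_scaleR
        matrix_mult_add_right matrix_mult_scaleR_right scaleR_conv_of_real[where 'a = complex] simp flip: of_real_add)
  have ne: "D \<noteq> {}"
  proof -
    obtain x where x: "x \<in> W" "x \<noteq> 0" using W_nz subW vec.subspace_0 by blast
    define y where "y = (1 / norm x) *\<^sub>R x"
    have y: "y \<in> W" "norm y = 1" using x subspace_scale[OF subspace_real[OF subW]] by (simp_all add: y_def)
    have "trace (mat 1 ** outer y) = 1" using y(2) by (simp only: trace_outer) (simp add: cinner_self)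
    moreover have "P ** outer y = outer y"
      using P(4)[of y] y(1) by (simp add: matrix_eq matrix_vector_mul_assoc[symmetric] outer_vector vector_scalar_commute)
    ultimately have "outer y \<in> D" by (simp add: D_def positive_outer)
    then show ?thesis by blast
  qed
  have cont: "continuous_on D (channel L)"
    by (intro linear_continuous_on) (simp add: linear_conv_bounded_linear[symmetric] linear_channel)
  have sub: "channel L \<sigma> \<in> D" if "\<sigma> \<in> D" for \<sigma>
    using that by (simp add: D_def positive_channel trace_channel) (simp add: channel_def matrix_mult_sum_right PL)
  obtain \<tau> where "\<tau> \<in> D" "channel L \<tau> = \<tau>"
    using brouwer[OF comp conv ne cont] sub by blast
  then show ?thesis by (auto simp: D_def)
qed

text \<open>Simplicity is the point: a fixed point of the Kraus sum is automatically Hermitian and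
  carried by p, hence fixed by the dual channel and a multiple of A by
  \<open>fixed_point_multiple\<close>. Orthogonality to \<tau> makes the multiple 0.\<close>

lemma tilted_pair_state:
  assumes \<tau>: "positive_op \<tau>" "trace \<tau> = 1" "channel L \<tau> = \<tau>" "P ** \<tau> = \<tau>"
  shows "tilted_pair (\<lambda>j. kraus (dagger (M j))) (\<lambda>j. kraus (M j)) A \<tau>"
proof (rule tilted_pair.intro)
  have herm: "dagger \<tau> = \<tau>" using \<tau>(1) by (simp add: positive_op_iff)
  have p\<tau>: "p ** \<tau> = \<tau>" using \<tau>(4) pP matrix_mul_assoc[of p P \<tau>] by simp
  have \<tau>p: "\<tau> ** p = \<tau>" using dagger_mult[of p \<tau>] by (simp add: p\<tau> herm p(2))
  show "linear (kraus (dagger (M j)))" "linear (kraus (M j))" for j by (rule linear_kraus)+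
  show "kraus (dagger (M j)) x \<bullet> y = x \<bullet> kraus (M j) y" for j x y by (rule kraus_adjoint)
  show "(\<Sum>j\<in>UNIV. kraus (dagger (M j)) A) = A"
    using dual_A by (simp add: kraus_eq A_herm Ap dual_channel_def)
  have "kraus (M j) \<tau> = p ** (L j ** \<tau> ** dagger (L j)) ** p" for j
    by (simp add: kraus_def herm_part_id[OF herm] M_def dagger_mult p(2) matrix_mul_assoc)
  then have "(\<Sum>j\<in>UNIV. kraus (M j) \<tau>) = p ** channel L \<tau> ** p"
    by (simp add: channel_def matrix_mult_sum_left matrix_mult_sum_right)
  then show "(\<Sum>j\<in>UNIV. kraus (M j) \<tau>) = \<tau>" by (simp add: \<tau>(3) p\<tau> \<tau>p)
  have "A ** \<tau> = \<tau>" using \<tau>(4) AP(1) matrix_mul_assoc[of A P \<tau>] by simp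
  then show At: "A \<bullet> \<tau> = 1" by (simp add: inner_hermitian A_herm \<tau>(2))
  fix x assume h: "(\<Sum>j\<in>UNIV. kraus (dagger (M j)) x) = x" "x \<bullet> \<tau> = 0"
  have x1: "dagger x = x" using h(1) by (metis (no_types, lifting) dagger_kraus dagger_sum sum.cong)
  have "p ** (\<Sum>j\<in>UNIV. kraus (dagger (M j)) x) ** p = (\<Sum>j\<in>UNIV. kraus (dagger (M j)) x)"
    by (simp add: matrix_mult_sum_left matrix_mult_sum_right kraus_range)
  then have x2: "p ** x ** p = x" by (simp only: h(1))
  have "dual_channel L x = x" using h(1) by (simp add: kraus_eq x1 x2 dual_channel_def)
  then obtain c where "x = c *\<^sub>R A" using fixed_point_multiple x1 x2 by blast
  then show "x = 0" using h(2) At by simp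
qed

definition \<tau> where "\<tau> = invariant_state_on L W"

text \<open>Uniqueness, needed to evaluate \<open>invariant_state_on\<close>, comes from the dual
  pair: two invariant states differ by a fixed vector orthogonal to A.\<close>

lemma tau: "positive_op \<tau>" "trace \<tau> = 1" "channel L \<tau> = \<tau>" "P ** \<tau> = \<tau>"
proof -
  obtain t where t: "positive_op t" "trace t = 1" "channel L t = t" "P ** t = t" using invariant_state_exists by blast
  interpret tp: tilted_pair "\<lambda>j. kraus (dagger (M j))" "\<lambda>j. kraus (M j)" "\<lambda>_. 0" A t
    by (rule tilted_pair_state[OF t])
  interpret dual: tilted_pair "\<lambda>j. kraus (M j)" "\<lambda>j. kraus (dagger (M j))" "\<lambda>_. 0" t A
    by (rule tp.dual)
  have "\<tau> = t"
    unfolding \<tau>_def invariant_state_on_def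
  proof (rule the_equality)
    show "positive_op t \<and> trace t = 1 \<and> channel L t = t \<and> supp t \<subseteq> W"
      using t supp_subset_iff[OF t(1) subW] by (simp add: P_def)
    fix t' assume h: "positive_op t' \<and> trace t' = 1 \<and> channel L t' = t' \<and> supp t' \<subseteq> W"
    then have t': "positive_op t'" "trace t' = 1" "channel L t' = t'" "P ** t' = t'"
      using supp_subset_iff[of t', OF _ subW] by (simp_all add: P_def)
    interpret tp': tilted_pair "\<lambda>j. kraus (dagger (M j))" "\<lambda>j. kraus (M j)" "\<lambda>_. 0" A t'
      by (rule tilted_pair_state[OF t'])
    have "t' - t = 0"
    proof (rule dual.simple)
      show "(\<Sum>j\<in>UNIV. kraus (M j) (t' - t)) = t' - t"
        by (simp add: linear_diff[OF linear_kraus] sum_subtractf tp.fixtau tp'.fixtau)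
      show "(t' - t) \<bullet> A = 0" using tp.Atau tp'.Atau by (simp add: inner_diff_left inner_commute)
    qed
    then show "t' = t" by simp
  qed
  then show "positive_op \<tau>" "trace \<tau> = 1" "channel L \<tau> = \<tau>" "P ** \<tau> = \<tau>" using t by simp_all
qed

abbreviation K where "K j \<equiv> kraus (dagger (M j))"

text \<open>The range of \<open>L j ** \<tau>\<close> lies in W, where A acts as the identity. The
  step frequencies weighted by A therefore reduce to those in the drift.\<close>

lemma K_A_tau: "K j A \<bullet> \<tau> = Re (trace (L j ** \<tau> ** dagger (L j)))"
proof -
  have LP: "P ** L j ** P = L j ** P"
    using P(4) invW P(5) by (simp add: matrix_eq matrix_vector_mul_assoc[symmetric])
  have "P ** (L j ** (P ** \<tau>)) = (P ** L j ** P) ** \<tau>" by (simp only: matrix_mul_assoc)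
  also have "\<dots> = L j ** (P ** \<tau>)" unfolding LP by (simp only: matrix_mul_assoc)
  finally have PL: "P ** (L j ** \<tau>) = L j ** \<tau>" by (simp only: tau(4))
  have "A ** (L j ** \<tau>) = A ** (P ** (L j ** \<tau>))" by (simp only: PL)
  also have "\<dots> = (A ** P) ** (L j ** \<tau>)" by (rule matrix_mul_assoc)
  also have "\<dots> = L j ** \<tau>" by (simp only: AP PL)
  finally have AL: "A ** (L j ** \<tau>) = L j ** \<tau>" .
  have "K j A \<bullet> \<tau> = Re (trace (dagger (L j) ** A ** L j ** \<tau>))"
    unfolding inner_hermitian[OF dagger_kraus] by (simp add: kraus_eq[OF A_herm] Ap)
  also have "trace (dagger (L j) ** A ** L j ** \<tau>) = trace (dagger (L j) ** (A ** (L j ** \<tau>)))"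
    by (simp add: matrix_mul_assoc)
  also have "\<dots> = trace (L j ** \<tau> ** dagger (L j))" unfolding AL by (rule trace_mul_sym)
  finally show ?thesis .
qed

lemma drift_inner: "u \<bullet> drift s L W = (\<Sum>j\<in>UNIV. (u \<bullet> s j) * (K j A \<bullet> \<tau>))"
  by (simp add: drift_def \<tau>_def[symmetric] inner_sum_right K_A_tau mult.commute)

lemma tilted_channel_eq:
  "tilted_channel s L W u \<sigma> = (\<Sum>j\<in>UNIV. exp (u \<bullet> s j) *\<^sub>R (M j ** \<sigma> ** dagger (M j)))"
  by (simp add: tilted_channel_def A_def[symmetric] p_eq Let_def M_eq(1) dagger_mult p(2) matrix_mul_assoc)

text \<open>X is a strictly positive left eigenvector. Pairing with X multiplies by l at every step,
  and on positive operators carried by p this pairing dominates \<delta> times the trace, so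
  positive operators grow at most like l^n.\<close>

lemma tilted_radius_eq:
  assumes X: "dagger X = X" "p ** X ** p = X" "\<delta> > 0" "\<And>x. \<delta> * (norm (p *v x))\<^sup>2 \<le> qform X x"
    and eig: "(\<Sum>j\<in>UNIV. exp (u \<bullet> s j) *\<^sub>R K j X) = l *\<^sub>R X" and l: "l > 0"
    and y: "y \<noteq> 0" "(\<Sum>j\<in>UNIV. exp (u \<bullet> s j) *\<^sub>R kraus (M j) y) = l *\<^sub>R y"
  shows "tilted_radius s L W u = l"
proof -
  define F where "F = tilted_channel s L W u"
  have F: "F \<sigma> = (\<Sum>j\<in>UNIV. exp (u \<bullet> s j) *\<^sub>R (M j ** \<sigma> ** dagger (M j)))" for \<sigma>
    by (simp add: F_def tilted_channel_eq)
  have lin: "linear F"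
    unfolding F[abs_def] by (intro linear_compose_sum ballI linear_compose_scale_right linear_conj)
  have Fmat: "F (mat z ** \<sigma>) = mat z ** F \<sigma>" for z \<sigma>
    by (simp add: F mat_commute matrix_mult_sum_right matrix_mult_scaleR_right flip: matrix_mul_assoc)
  have Fpos: "positive_op \<omega> \<Longrightarrow> positive_op (F \<omega>)" for \<omega>
    unfolding F by (intro positive_sum positive_scaleR positive_conj) auto
  have Fp: "p ** F \<sigma> ** p = F \<sigma>" for \<sigma>
  proof -
    have "dagger (M j) ** p = dagger (M j)" for j using dagger_mult[of p "M j"] by (simp add: M_eq(3) p(2))
    then have "p ** (M j ** \<sigma> ** dagger (M j)) ** p = M j ** \<sigma> ** dagger (M j)" for j
      by (simp add: matrix_mul_assoc M_eq(3)) (simp flip: matrix_mul_assoc)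
    then show ?thesis
      by (simp add: F matrix_mult_sum_left matrix_mult_sum_right matrix_mult_scaleR_left matrix_mult_scaleR_right)
  qed
  have Ftr: "Re (trace (X ** F \<sigma>)) = l * Re (trace (X ** \<sigma>))" for \<sigma>
  proof -
    have "trace (X ** (M j ** \<sigma> ** dagger (M j))) = trace (K j X ** \<sigma>)" for j
      using trace_mul_sym[of "X ** M j ** \<sigma>" "dagger (M j)"]
      by (simp add: kraus_def herm_part_id X(1) matrix_mul_assoc)
    then have "trace (X ** F \<sigma>) = trace ((\<Sum>j\<in>UNIV. exp (u \<bullet> s j) *\<^sub>R K j X) ** \<sigma>)"
      by (simp add: F matrix_mult_sum_left matrix_mult_sum_right matrix_mult_scaleR_left matrix_mult_scaleR_right trace_sum trace_scaleR)
    then show ?thesis by (simp add: eig matrix_mult_scaleR_left trace_scaleR)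
  qed
  have Xp: "positive_op (X - \<delta> *\<^sub>R p)"
    using X(1,4) by (simp add: positive_op_iff dagger_diff dagger_scaleR p(2) qform_diff qform_scaleR proj_norm[OF p])
  have growth: "\<exists>C. \<forall>n. norm ((F ^^ n) \<omega>) \<le> C * l ^ n" if \<omega>: "positive_op \<omega>" for \<omega>
  proof (intro exI allI)
    fix n
    have pos: "positive_op ((F ^^ n) \<omega>)" for n by (induction n) (simp_all add: \<omega> Fpos)
    have tr: "Re (trace (X ** (F ^^ n) \<omega>)) = l ^ n * Re (trace (X ** \<omega>))" for n
      by (induction n) (simp_all add: Ftr)
    show "norm ((F ^^ n) \<omega>) \<le> (norm \<omega> + \<bar>Re (trace (X ** \<omega>))\<bar> / \<delta>) * l ^ n"
    \<comment> \<open>The initial operator need not be carried by p; the summand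
      \<open>norm \<omega>\<close> of the constant covers n = 0.\<close>
    proof (cases n)
      case 0
      then show ?thesis using X(3) by simp
    next
      case (Suc m)
      have "trace ((F ^^ n) \<omega>) = trace (p ** (F ^^ n) \<omega> ** p)" by (simp add: Suc Fp)
      also have "\<dots> = trace (p ** (F ^^ n) \<omega>)"
        using trace_mul_sym[of "p ** (F ^^ n) \<omega>" p] by (simp add: matrix_mul_assoc p(1))
      finally have t: "trace ((F ^^ n) \<omega>) = trace (p ** (F ^^ n) \<omega>)" .
      have "0 \<le> Re (trace ((X - \<delta> *\<^sub>R p) ** (F ^^ n) \<omega>))" by (rule trace_positive_nonneg[OF Xp pos])
      then have "\<delta> * Re (trace ((F ^^ n) \<omega>)) \<le> l ^ n * Re (trace (X ** \<omega>))"
        by (simp add: matrix_mult_diff_left trace_sub matrix_mult_scaleR_left trace_scaleR tr t)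
      then have "Re (trace ((F ^^ n) \<omega>)) \<le> l ^ n * Re (trace (X ** \<omega>)) / \<delta>"
        using X(3) by (simp add: field_simps)
      also have "\<dots> \<le> l ^ n * (\<bar>Re (trace (X ** \<omega>))\<bar> / \<delta>)" using X(3) l by (simp add: divide_right_mono)
      also have "\<dots> \<le> l ^ n * (norm \<omega> + \<bar>Re (trace (X ** \<omega>))\<bar> / \<delta>)"
        using l by (intro mult_left_mono) simp_all
      also have "\<dots> = (norm \<omega> + \<bar>Re (trace (X ** \<omega>))\<bar> / \<delta>) * l ^ n" by (rule mult.commute)
      finally show ?thesis using norm_positive_le_trace[OF pos, of n] by linarith
    qed
  qed
  \<comment> \<open>Images of Kraus maps are Hermitian, so y is Hermitian too, and on such operators
    the Kraus maps agree with the tilted channel.\<close>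
  have "dagger (l *\<^sub>R y) = l *\<^sub>R y" unfolding y(2)[symmetric] by (simp add: dagger_sum dagger_scaleR)
  then have "dagger y = y" using l by (simp add: dagger_scaleR)
  then have "F y = l *\<^sub>R y" using y(2) by (simp add: F kraus_def herm_part_id)
  from spectral_radius_eq[OF lin Fmat l growth y(1) this] show ?thesis
    by (simp add: tilted_radius_def F_def[symmetric])
qed

text \<open>Near 0 the spectral radius coincides with the differentiable eigenvalue \<open>l\<close>
  and inherits both derivatives.\<close>

lemma tilted_radius_derivatives:
  fixes s :: "'j \<Rightarrow> real ^ 'd"
  shows "deriv (\<lambda>t. tilted_radius s L W (t *\<^sub>R u)) 0 = u \<bullet> drift s L W"
    and "A1 - (\<Sum>j\<in>UNIV. K j A1) = (\<Sum>j\<in>UNIV. (u \<bullet> s j) *\<^sub>R K j A) - (u \<bullet> drift s L W) *\<^sub>R A \<Longrightarrow> A1 \<bullet> \<tau> = 0 \<Longrightarrow>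
      (deriv ^^ 2) (\<lambda>t. tilted_radius s L W (t *\<^sub>R u)) 0
        = (\<Sum>j\<in>UNIV. (u \<bullet> s j)\<^sup>2 * (K j A \<bullet> \<tau>)) + 2 * (\<Sum>j\<in>UNIV. (u \<bullet> s j) * (K j A1 \<bullet> \<tau>))"
proof -
  define a where "a j = u \<bullet> s j" for j
  interpret t: tilted_pair K "\<lambda>j. kraus (M j)" a A \<tau> by (rule tilted_pair_state[OF tau])
  obtain \<delta> l X where e: "\<delta> > 0" "\<And>t. \<bar>t\<bar> < \<delta> \<Longrightarrow> t.S t (X t) = l t *\<^sub>R X t"
    "isCont X 0" "X 0 = A"
    "\<And>t. \<bar>t\<bar> < \<delta> \<Longrightarrow> \<exists>y. y \<noteq> 0 \<and> (\<Sum>j\<in>UNIV. exp (t * a j) *\<^sub>R kraus (M j) y) = l t *\<^sub>R y"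
    "l 0 = 1" "isCont l 0"
    "deriv l 0 = (\<Sum>j\<in>UNIV. a j * (K j A \<bullet> \<tau>))"
    "\<And>A1. A1 - (\<Sum>j\<in>UNIV. K j A1) = (\<Sum>j\<in>UNIV. a j *\<^sub>R K j A) - deriv l 0 *\<^sub>R A \<Longrightarrow> A1 \<bullet> \<tau> = 0 \<Longrightarrow>
       (deriv l has_real_derivative ((\<Sum>j\<in>UNIV. (a j)\<^sup>2 * (K j A \<bullet> \<tau>)) + 2 * (\<Sum>j\<in>UNIV. a j * (K j A1 \<bullet> \<tau>)))) (at 0)"
    by (rule t.eigenvalue_derivatives) blast
  obtain c where c: "c > 0" "\<And>x. c * (norm (p *v x))\<^sup>2 \<le> qform A x" using A_lower_bound by blast
  \<comment> \<open>Half of the gap of A: within this distance X t still dominates c/2 times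
    p.\<close>
  have "\<forall>\<^sub>F t in nhds 0. dist (X t) (X 0) < c / 2"
  proof (rule tendstoD)
    show "(X \<longlongrightarrow> X 0) (nhds 0)" using e(3) by (simp only: isCont_def tendsto_at_iff_tendsto_nhds)
  qed (use c(1) in simp)
  moreover have "\<forall>\<^sub>F t in nhds 0. l t > 0"
  proof (rule order_tendstoD(1))
    show "(l \<longlongrightarrow> l 0) (nhds 0)" using e(7) by (simp only: isCont_def tendsto_at_iff_tendsto_nhds)
  qed (simp add: e(6))
  moreover have "\<forall>\<^sub>F t in nhds 0. \<bar>t\<bar> < \<delta>"
    using e(1) by (auto simp: eventually_nhds_metric dist_real_def intro!: exI[of _ \<delta>])
  ultimately have eq: "\<forall>\<^sub>F t in nhds 0. tilted_radius s L W (t *\<^sub>R u) = l t"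
  proof eventually_elim
    case (elim t)
    have eig: "(\<Sum>j\<in>UNIV. exp (t * a j) *\<^sub>R K j (X t)) = l t *\<^sub>R X t" using e(2)[OF elim(3)] by (simp add: t.S_def)
    have "dagger (l t *\<^sub>R X t) = l t *\<^sub>R X t" "p ** (l t *\<^sub>R X t) ** p = l t *\<^sub>R X t"
      unfolding eig[symmetric]
      by (simp_all add: dagger_sum dagger_scaleR matrix_mult_sum_left matrix_mult_sum_right
          matrix_mult_scaleR_left matrix_mult_scaleR_right kraus_range)
    then have X: "dagger (X t) = X t" "p ** X t ** p = X t"
      using elim(2) by (simp_all add: dagger_scaleR matrix_mult_scaleR_left matrix_mult_scaleR_right)
    obtain y where y: "y \<noteq> 0" "(\<Sum>j\<in>UNIV. exp (t * a j) *\<^sub>R kraus (M j) y) = l t *\<^sub>R y" using e(5)[OF elim(3)] by blast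
    have low: "c / 2 * (norm (p *v x))\<^sup>2 \<le> qform (X t) x" for x
    proof -
      have "qform (X t) x = qform (X t) (p *v x)" using qform_conj[of p "X t" x] by (simp add: X(2) p(2))
      moreover have "qform (X t) (p *v x) = qform A (p *v x) + qform (X t - A) (p *v x)" by (simp add: qform_diff)
      moreover have "qform A (p *v x) \<ge> c * (norm (p *v x))\<^sup>2"
        using c(2)[of "p *v x"] by (simp add: matrix_vector_mul_assoc p(1))
      moreover have "qform (X t - A) (p *v x) \<ge> - (c / 2 * (norm (p *v x))\<^sup>2)"
      proof -
        have "\<bar>qform (X t - A) (p *v x)\<bar> \<le> norm (X t - A) * (norm (p *v x))\<^sup>2" by (rule abs_qform_le)
        also have "\<dots> \<le> c / 2 * (norm (p *v x))\<^sup>2"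
          using elim(1) by (intro mult_right_mono) (simp_all add: dist_norm e(4))
        finally show ?thesis by linarith
      qed
      ultimately show ?thesis by simp
    qed
    show ?case
      by (rule tilted_radius_eq[OF X _ low _ elim(2) y(1)]) (use c(1) eig y(2) in \<open>simp_all add: a_def\<close>)
  qed
  have d0: "deriv l 0 = u \<bullet> drift s L W" by (simp add: e(8) drift_inner a_def)
  show "deriv (\<lambda>t. tilted_radius s L W (t *\<^sub>R u)) 0 = u \<bullet> drift s L W"
    unfolding deriv_cong_ev[OF eq refl] by (rule d0)
  assume A1: "A1 - (\<Sum>j\<in>UNIV. K j A1) = (\<Sum>j\<in>UNIV. (u \<bullet> s j) *\<^sub>R K j A) - (u \<bullet> drift s L W) *\<^sub>R A" "A1 \<bullet> \<tau> = 0"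
  \<comment> \<open>The second derivative requires the first derivatives to agree on a neighbourhood
    of 0.\<close>
  have "\<forall>\<^sub>F t in nhds 0. deriv (\<lambda>t. tilted_radius s L W (t *\<^sub>R u)) t = deriv l t"
    by (rule eventually_mono[OF eventually_eventually[THEN iffD2, OF eq]]) (rule deriv_cong_ev, simp_all)
  then have "(deriv ^^ 2) (\<lambda>t. tilted_radius s L W (t *\<^sub>R u)) 0 = deriv (deriv l) 0"
    by (simp add: numeral_2_eq_2) (rule deriv_cong_ev, simp_all)
  moreover have "(deriv l has_real_derivative (\<Sum>j\<in>UNIV. (u \<bullet> s j)\<^sup>2 * (K j A \<bullet> \<tau>)) + 2 * (\<Sum>j\<in>UNIV. (u \<bullet> s j) * (K j A1 \<bullet> \<tau>))) (at 0)"
    using e(9)[OF _ A1(2)] A1(1) unfolding d0 a_def by blast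
  then have "deriv (deriv l) 0 = (\<Sum>j\<in>UNIV. (u \<bullet> s j)\<^sup>2 * (K j A \<bullet> \<tau>)) + 2 * (\<Sum>j\<in>UNIV. (u \<bullet> s j) * (K j A1 \<bullet> \<tau>))"
    by (rule DERIV_imp_deriv)
  ultimately show "(deriv ^^ 2) (\<lambda>t. tilted_radius s L W (t *\<^sub>R u)) 0
        = (\<Sum>j\<in>UNIV. (u \<bullet> s j)\<^sup>2 * (K j A \<bullet> \<tau>)) + 2 * (\<Sum>j\<in>UNIV. (u \<bullet> s j) * (K j A1 \<bullet> \<tau>))" by simp
qed

text \<open>Inverting the bordered operator, rather than choosing solutions one at a time, makes the
  solution linear in the right-hand side. The bilinear form in \<open>corrector_equations\<close>
  depends on this.\<close>

lemma poisson_solution: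
  obtains G where "linear G" "\<And>y. y \<bullet> \<tau> = 0 \<Longrightarrow> G y \<bullet> \<tau> = 0 \<and> G y - (\<Sum>j\<in>UNIV. K j (G y)) = y"
proof -
  interpret t: tilted_pair K "\<lambda>j. kraus (M j)" "\<lambda>_. 0" A \<tau> by (rule tilted_pair_state[OF tau])
  define N where "N = t.N 0 1"
  have lin: "linear N" and inj: "inj N" unfolding N_def by (rule t.linear_N t.inj_N)+
  define G where "G = inv N"
  have NG: "N (G y) = y" for y
    unfolding G_def by (rule surj_f_inv_f[OF linear_inj_imp_surj[OF lin inj]])
  have "linear G"
  proof (rule linearI)
    show "G (x + y) = G x + G y" for x y by (rule injD[OF inj]) (simp add: NG linear_add[OF lin])
    show "G (c *\<^sub>R x) = c *\<^sub>R G x" for c x by (rule injD[OF inj]) (simp add: NG linear_scale[OF lin])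
  qed
  moreover have "G y \<bullet> \<tau> = 0 \<and> G y - (\<Sum>j\<in>UNIV. K j (G y)) = y" if "y \<bullet> \<tau> = 0" for y
  proof -
    have "N x \<bullet> \<tau> = x \<bullet> \<tau>" for x
      by (simp add: N_def t.N_def inner_add_left inner_diff_left t.S_tau t.Atau)
    then have "G y \<bullet> \<tau> = 0" using NG[of y] that by metis
    then show ?thesis using NG[of y] by (simp add: N_def t.N_def t.S_0)
  qed
  ultimately show ?thesis using that by blast
qed

text \<open>X is a sum of Kraus images plus Y, so it is Hermitian and carried by p because Y is. On
  such operators the Kraus maps are the plain conjugations by \<open>L j\<close>.\<close>

lemma K_fixed_hermitian:
  assumes "X - (\<Sum>j\<in>UNIV. K j X) = Y" "dagger Y = Y" "p ** Y ** p = Y"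
  shows "dagger X = X" "p ** X ** p = X" "(\<Sum>j\<in>UNIV. K j X) = dual_channel L X"
proof -
  have X: "X = (\<Sum>j\<in>UNIV. K j X) + Y" by (simp add: assms(1)[symmetric])
  show 1: "dagger X = X" by (subst (1 2) X) (simp add: dagger_add dagger_sum assms(2))
  show 2: "p ** X ** p = X"
    by (subst (1 2) X) (simp add: matrix_mult_add_left matrix_mult_add_right matrix_mult_sum_left matrix_mult_sum_right kraus_range assms(3))
  show "(\<Sum>j\<in>UNIV. K j X) = dual_channel L X" by (simp add: kraus_eq 1 2 dual_channel_def)
qed

text \<open>A Poisson equation is solvable once its right-hand side is orthogonal to \<tau>. For A2
  this fixes the coefficient of A as the second derivative of the spectral radius, which is how D
  enters the expansion.\<close>

lemma corrector_equations:
  fixes s :: "'j \<Rightarrow> real ^ 'd"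
  defines "D \<equiv> diffusion_matrix s L W" and "m \<equiv> drift s L W"
  shows "transpose D = D"
    and "\<exists>A1 A2. A1 - dual_channel L A1 = (\<Sum>j\<in>UNIV. (u \<bullet> s j) *\<^sub>R (dagger (L j) ** A ** L j)) - (u \<bullet> m) *\<^sub>R A
      \<and> A2 - dual_channel L A2 = (\<Sum>j\<in>UNIV. (u \<bullet> s j)\<^sup>2 *\<^sub>R (dagger (L j) ** A ** L j))
         + 2 *\<^sub>R (\<Sum>j\<in>UNIV. (u \<bullet> s j) *\<^sub>R (dagger (L j) ** A1 ** L j))
         - (u \<bullet> (D *v u) + (u \<bullet> m)\<^sup>2) *\<^sub>R A - (2 * (u \<bullet> m)) *\<^sub>R A1"
proof -
  obtain G where G: "linear G" "\<And>y. y \<bullet> \<tau> = 0 \<Longrightarrow> G y \<bullet> \<tau> = 0 \<and> G y - (\<Sum>j\<in>UNIV. K j (G y)) = y"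
    by (rule poisson_solution) blast
  interpret t: tilted_pair K "\<lambda>j. kraus (M j)" "\<lambda>_. 0" A \<tau> by (rule tilted_pair_state[OF tau])
  define Y where "Y u = (\<Sum>j\<in>UNIV. (u \<bullet> s j) *\<^sub>R K j A) - (u \<bullet> m) *\<^sub>R A" for u
  define A1 where "A1 u = G (Y u)" for u
  have Y\<tau>: "Y u \<bullet> \<tau> = 0" for u
    by (simp add: Y_def inner_diff_left inner_sum_left t.Atau m_def drift_inner)
  have A1: "A1 u - (\<Sum>j\<in>UNIV. K j (A1 u)) = Y u" "A1 u \<bullet> \<tau> = 0" for u
    using G(2)[OF Y\<tau>[of u]] by (simp_all add: A1_def)
  have linY: "linear Y"
    by (rule linearI) (simp_all add: Y_def inner_add_left scaleR_left_distrib sum.distrib scaleR_diff_right scaleR_sum_right)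
  have linA1: "linear A1" using linear_compose[OF linY G(1)] by (simp add: A1_def[abs_def] o_def)
  define v where "v u = (\<Sum>j\<in>UNIV. (u \<bullet> s j)\<^sup>2 * (K j A \<bullet> \<tau>)) + 2 * (\<Sum>j\<in>UNIV. (u \<bullet> s j) * (K j (A1 u) \<bullet> \<tau>))" for u
  \<comment> \<open>Polarisation of v u - (u \<bullet> m)^2. It is linear in u because A1
    is.\<close>
  define b where "b u w = (\<Sum>j\<in>UNIV. (u \<bullet> s j) * (w \<bullet> s j) * (K j A \<bullet> \<tau>)) + (\<Sum>j\<in>UNIV. (u \<bullet> s j) * (K j (A1 w) \<bullet> \<tau>))
    + (\<Sum>j\<in>UNIV. (w \<bullet> s j) * (K j (A1 u) \<bullet> \<tau>)) - (u \<bullet> m) * (w \<bullet> m)" for u w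
  have bq: "b u u = v u - (u \<bullet> m)\<^sup>2" for u by (simp add: b_def v_def power2_eq_square)
  have "linear (\<lambda>u. b u w)" for w
    unfolding b_def
    by (rule linearI)
       (simp_all add: linear_add[OF linA1] linear_add[OF linear_kraus] linear_scale[OF linA1] linear_scale[OF linear_kraus]
          inner_add_left algebra_simps sum.distrib sum_distrib_left)
  moreover have "b u w = b w u" for u w by (simp add: b_def mult.commute)
  ultimately have ex1: "\<exists>!D :: real ^ 'd ^ 'd. transpose D = D \<and> (\<forall>u. u \<bullet> (D *v u) = b u u)"
    by (rule quadratic_form_matrix)
  have "(deriv ^^ 2) (\<lambda>t. tilted_radius s L W (t *\<^sub>R u)) 0 - (deriv (\<lambda>t. tilted_radius s L W (t *\<^sub>R u)) 0)\<^sup>2 = b u u" for u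
    using tilted_radius_derivatives(1)[of s u] tilted_radius_derivatives(2)[of "A1 u" u s] A1[of u]
    by (simp add: bq v_def Y_def m_def)
  then have "D = (THE D. transpose D = D \<and> (\<forall>u. u \<bullet> (D *v u) = b u u))"
    by (simp add: D_def diffusion_matrix_def)
  then have D: "transpose D = D \<and> (\<forall>u. u \<bullet> (D *v u) = b u u)" using theI'[OF ex1] by simp
  then show "transpose D = D" by blast
  have vD: "v u = u \<bullet> (D *v u) + (u \<bullet> m)\<^sup>2" using D bq by simp
  \<comment> \<open>Arranged so that the pairing with \<tau> vanishes: A pairs to 1, A1 to 0, and
    the first two sums to \<open>v u\<close>.\<close>
  define Y2 where "Y2 = (\<Sum>j\<in>UNIV. (u \<bullet> s j)\<^sup>2 *\<^sub>R K j A) + 2 *\<^sub>R (\<Sum>j\<in>UNIV. (u \<bullet> s j) *\<^sub>R K j (A1 u)) - v u *\<^sub>R A - (2 * (u \<bullet> m)) *\<^sub>R A1 u"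
  have "Y2 \<bullet> \<tau> = 0"
    by (simp add: Y2_def inner_diff_left inner_add_left inner_sum_left t.Atau A1 v_def)
  then have A2: "G Y2 - (\<Sum>j\<in>UNIV. K j (G Y2)) = Y2" using G(2) by blast
  have Yh: "dagger (Y u) = Y u" "p ** Y u ** p = Y u"
    by (simp_all add: Y_def dagger_diff dagger_sum dagger_scaleR A_herm matrix_mult_diff_left matrix_mult_diff_right
      matrix_mult_sum_left matrix_mult_sum_right matrix_mult_scaleR_left matrix_mult_scaleR_right kraus_range Ap)
  note h1 = K_fixed_hermitian[OF A1(1)[of u] Yh]
  have Y2h: "dagger Y2 = Y2" "p ** Y2 ** p = Y2"
    by (simp_all add: Y2_def dagger_diff dagger_add dagger_sum dagger_scaleR A_herm h1(1,2) matrix_mult_diff_left matrix_mult_diff_right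
      matrix_mult_add_left matrix_mult_add_right
      matrix_mult_sum_left matrix_mult_sum_right matrix_mult_scaleR_left matrix_mult_scaleR_right kraus_range Ap)
  note h2 = K_fixed_hermitian[OF A2 Y2h]
  have KA: "K j A = dagger (L j) ** A ** L j" for j by (simp add: kraus_eq A_herm Ap)
  have KA1: "K j (A1 u) = dagger (L j) ** A1 u ** L j" for j by (simp add: kraus_eq h1(1,2))
  show "\<exists>A1 A2. A1 - dual_channel L A1 = (\<Sum>j\<in>UNIV. (u \<bullet> s j) *\<^sub>R (dagger (L j) ** A ** L j)) - (u \<bullet> m) *\<^sub>R A
      \<and> A2 - dual_channel L A2 = (\<Sum>j\<in>UNIV. (u \<bullet> s j)\<^sup>2 *\<^sub>R (dagger (L j) ** A ** L j))
         + 2 *\<^sub>R (\<Sum>j\<in>UNIV. (u \<bullet> s j) *\<^sub>R (dagger (L j) ** A1 ** L j))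
         - (u \<bullet> (D *v u) + (u \<bullet> m)\<^sup>2) *\<^sub>R A - (2 * (u \<bullet> m)) *\<^sub>R A1"
  proof (intro exI conjI)
    show "A1 u - dual_channel L (A1 u) = (\<Sum>j\<in>UNIV. (u \<bullet> s j) *\<^sub>R (dagger (L j) ** A ** L j)) - (u \<bullet> m) *\<^sub>R A"
      using A1(1)[of u] unfolding h1(3) Y_def KA .
    show "G Y2 - dual_channel L (G Y2) = (\<Sum>j\<in>UNIV. (u \<bullet> s j)\<^sup>2 *\<^sub>R (dagger (L j) ** A ** L j))
         + 2 *\<^sub>R (\<Sum>j\<in>UNIV. (u \<bullet> s j) *\<^sub>R (dagger (L j) ** A1 u ** L j))
         - (u \<bullet> (D *v u) + (u \<bullet> m)\<^sup>2) *\<^sub>R A - (2 * (u \<bullet> m)) *\<^sub>R A1 u"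
      using A2 unfolding h2(3) unfolding Y2_def KA KA1 vD .
  qed
qed

end

section \<open>The trajectory measure\<close>

lemma word_op_snoc: "word_op L (js @ [j]) = L j ** word_op L js"
  by (induction js) (simp_all add: matrix_mul_assoc)

locale walk_law =
  fixes V :: "(real ^ 'd) set" and L :: "'j::finite \<Rightarrow> complex ^ 'n ^ 'n" and \<rho> :: "real ^ 'd \<Rightarrow> complex ^ 'n ^ 'n"
  assumes cV: "countable V" and V0: "0 \<in> V" and unital: "(\<Sum>j\<in>UNIV. dagger (L j) ** L j) = mat 1"
    and init: "initial_state V \<rho>"
begin

text \<open>Unnormalised state after the word \<open>js\<close> from the start \<open>k\<close>; its
  trace \<open>q\<close> is the cylinder probability.\<close>

definition sg where "sg k js = word_op L js ** \<rho> k ** dagger (word_op L js)"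
definition q where "q k js = Re (trace (sg k js))"

lemma sg_snoc: "sg k (js @ [j]) = L j ** sg k js ** dagger (L j)"
  by (simp add: sg_def word_op_snoc dagger_mult matrix_mul_assoc)

lemma sg_pos: "k \<in> V \<Longrightarrow> positive_op (sg k js)"
  unfolding sg_def using init by (intro positive_conj) (simp add: initial_state_def)

lemma q_nonneg: "k \<in> V \<Longrightarrow> 0 \<le> q k js"
  unfolding q_def by (intro trace_positive_ge_0 sg_pos)

text \<open>Kolmogorov consistency, from cyclicity of the trace and the normalisation of the
  \<open>L j\<close>.\<close>

lemma q_sum: "(\<Sum>j\<in>UNIV. q k (js @ [j])) = q k js"
proof -
  have "trace (L j ** \<sigma> ** dagger (L j)) = trace ((dagger (L j) ** L j) ** \<sigma>)" for j \<sigma>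
    using trace_mul_sym[of "L j ** \<sigma>" "dagger (L j)"] by (simp add: matrix_mul_assoc)
  then have "(\<Sum>j\<in>UNIV. q k (js @ [j])) = Re (trace ((\<Sum>j\<in>UNIV. dagger (L j) ** L j) ** sg k js))"
    by (simp add: q_def sg_snoc matrix_mult_sum_left trace_sum)
  then show ?thesis by (simp add: unital q_def)
qed

lemma q_snoc_le: "k \<in> V \<Longrightarrow> q k (js @ [j]) \<le> q k js"
  unfolding q_sum[of k js, symmetric] by (intro member_le_sum) (auto simp: q_nonneg)

lemma q_Nil: "q k [] = Re (trace (\<rho> k))"
  by (simp add: q_def sg_def)

text \<open>Conditional law of the next letter. On a prefix of weight 0 the default law is harmless,
  as all extensions have weight 0 as well.\<close>

definition step where
  "step k js = (if q k js > 0 then embed_pmf (\<lambda>j. q k (js @ [j]) / q k js) else return_pmf undefined)"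

lemma pmf_step: assumes k: "k \<in> V" shows "q k js * pmf (step k js) j = q k (js @ [j])"
proof (cases "q k js > 0")
  case True
  have "(\<integral>\<^sup>+j. ennreal (q k (js @ [j]) / q k js) \<partial>count_space UNIV) = (\<Sum>j\<in>UNIV. ennreal (q k (js @ [j]) / q k js))"
    by (rule nn_integral_count_space_finite) simp
  also have "\<dots> = ennreal (\<Sum>j\<in>UNIV. q k (js @ [j]) / q k js)"
    using True q_nonneg[OF k] by (intro sum_ennreal) simp
  also have "(\<Sum>j\<in>UNIV. q k (js @ [j]) / q k js) = 1"
    using True by (simp add: sum_divide_distrib[symmetric] q_sum)
  finally have "pmf (step k js) j = q k (js @ [j]) / q k js"
    using True q_nonneg[OF k] by (simp add: step_def pmf_embed_pmf)
  then show ?thesis using True by simp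
next
  case False
  then have "q k js = 0" using q_nonneg[OF k, of js] by simp
  then show ?thesis using q_snoc_le[OF k, of js j] q_nonneg[OF k, of "js @ [j]"] by simp
qed

abbreviation "S \<equiv> (\<Pi>\<^sub>M i\<in>UNIV. count_space UNIV) :: (nat \<Rightarrow> 'j) measure"

text \<open>Ionescu-Tulcea with the kernels \<open>step\<close>. Multiplying by
  \<open>q k []\<close> instead of dividing by it also covers starting points of weight 0.\<close>

lemma conditional_law_exists:
  assumes k: "k \<in> V"
  shows "\<exists>Q. prob_space Q \<and> sets Q = sets S \<and>
    (\<forall>js. ennreal (q k []) * emeasure Q {w. \<forall>i<length js. w i = js ! i} = ennreal (q k js))"
proof -
  interpret IT: Ionescu_Tulcea "\<lambda>i \<omega>. measure_pmf (step k (map \<omega> [0..<i]))" "\<lambda>_. count_space (UNIV :: 'j set)"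
  proof
    show "(\<lambda>\<omega>. measure_pmf (step k (map \<omega> [0..<i]))) \<in> measurable (PiM {0..<i} (\<lambda>_. count_space UNIV)) (subprob_algebra (count_space UNIV))" for i
      by (subst count_space_PiM_finite) (auto simp: countable_finite measure_pmf_in_subprob_algebra)
  qed
  define u :: "nat \<Rightarrow> 'j" where "u = (\<lambda>_. undefined)"
  define x where "x js = (\<lambda>i\<in>{0..<length js}. js ! i)" for js :: "'j list"
  have xs: "{x js} \<in> sets (PiM {0..<length js} (\<lambda>_. count_space (UNIV :: 'j set)))" for js
    by (subst count_space_PiM_finite) (auto simp: countable_finite x_def)
  have u0: "u \<in> space (PiM {0..<0} (\<lambda>_. count_space (UNIV :: 'j set)))" by (simp add: u_def space_PiM)
  \<comment> \<open>Reverse induction, because the construction appends letters at the end. A word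
    corresponds to a single point of the finite product.\<close>
  have C: "ennreal (q k []) * emeasure (IT.C 0 (length js) u) {x js} = ennreal (q k js)" for js
  proof (induction js rule: rev_induct)
    case Nil
    have xe: "x [] = (\<lambda>_. undefined)" by (simp add: x_def fun_eq_iff)
    have "{\<lambda>_::nat. undefined :: 'j} \<in> sets (PiM {} (\<lambda>_. count_space (UNIV :: 'j set)))" using xs[of "[]"] by (simp add: xe)
    then show ?case by (simp add: xe u_def emeasure_return)
  next
    case (snoc j js)
    let ?n = "length js"
    have spC: "space (IT.C 0 ?n u) = space (PiM {0..<?n} (\<lambda>_. count_space UNIV))" using IT.space_C[OF u0, of ?n] by simp
    have setsC: "sets (IT.C 0 ?n u) = sets (PiM {0..<?n} (\<lambda>_. count_space UNIV))" using IT.sets_C[OF u0, of ?n] by simp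
    have ne: "space (IT.C 0 ?n u) \<noteq> {}" unfolding spC by (simp add: space_PiM PiE_eq_empty_iff)
    have eP: "IT.eP ?n \<in> measurable (IT.C 0 ?n u) (subprob_algebra (PiM {0..<Suc ?n} (\<lambda>_. count_space UNIV)))"
      using IT.measurable_eP[of ?n] by (simp add: measurable_cong_sets[OF setsC refl])
    have xs': "{x (js @ [j])} \<in> sets (PiM {0..<Suc ?n} (\<lambda>_. count_space UNIV))" using xs[of "js @ [j]"] by simp
    have "emeasure (IT.C 0 (length (js @ [j])) u) {x (js @ [j])} = (\<integral>\<^sup>+\<omega>. emeasure (IT.eP ?n \<omega>) {x (js @ [j])} \<partial>IT.C 0 ?n u)"
      using emeasure_bind[OF ne eP xs'] by simp
    also have "\<dots> = (\<integral>\<^sup>+\<omega>. ennreal (pmf (step k js) j) * indicator {x js} \<omega> \<partial>IT.C 0 ?n u)"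
    proof (rule nn_integral_cong)
      fix \<omega> assume "\<omega> \<in> space (IT.C 0 ?n u)"
      then have w: "\<omega> \<in> space (PiM {0..<?n} (\<lambda>_. count_space UNIV))" by (simp only: spC)
      then have ext: "\<omega> \<in> extensional {0..<?n}" by (simp add: space_PiM PiE_iff)
      have "emeasure (IT.eP ?n \<omega>) {x (js @ [j])} = emeasure (measure_pmf (step k (map \<omega> [0..<?n]))) ((\<lambda>y. fun_upd \<omega> ?n y) -` {x (js @ [j])} \<inter> UNIV)"
        using IT.emeasure_eP[OF w xs'] by simp
      also have "\<dots> = ennreal (pmf (step k js) j) * indicator {x js} \<omega>"
      proof (cases "\<omega> = x js")
        case True
        have m: "map \<omega> [0..<?n] = js" by (rule nth_equalityI) (simp_all add: True x_def)
        have "(\<lambda>y. fun_upd \<omega> ?n y) -` {x (js @ [j])} = {j}"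
        proof (intro set_eqI iffI)
          fix y assume "y \<in> (\<lambda>y. fun_upd \<omega> ?n y) -` {x (js @ [j])}"
          then have "(fun_upd \<omega> ?n y) ?n = x (js @ [j]) ?n" by simp
          then show "y \<in> {j}" by (simp add: x_def)
        next
          fix y assume "y \<in> {j}"
          then have "fun_upd \<omega> ?n y = x (js @ [j])" by (auto simp: fun_eq_iff True x_def nth_append)
          then show "y \<in> (\<lambda>y. fun_upd \<omega> ?n y) -` {x (js @ [j])}" by simp
        qed
        then show ?thesis using True m by (simp add: emeasure_pmf_single)
      next
        case False
        have "(\<lambda>y. fun_upd \<omega> ?n y) -` {x (js @ [j])} = {}"
        proof (rule ccontr)
          assume "(\<lambda>y. fun_upd \<omega> ?n y) -` {x (js @ [j])} \<noteq> {}"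
          then obtain y where y: "fun_upd \<omega> ?n y = x (js @ [j])" by auto
          have "\<omega> i = x js i" for i
          proof (cases "i < ?n")
            case True
            then have "\<omega> i = (fun_upd \<omega> ?n y) i" by simp
            then show ?thesis unfolding y using True by (simp add: x_def nth_append)
          next
            case False
            then show ?thesis using ext by (simp add: x_def extensional_def)
          qed
          then show False using \<open>\<omega> \<noteq> x js\<close> by blast
        qed
        then show ?thesis using False by simp
      qed
      finally show "emeasure (IT.eP ?n \<omega>) {x (js @ [j])} = ennreal (pmf (step k js) j) * indicator {x js} \<omega>" .
    qed
    also have "\<dots> = ennreal (pmf (step k js) j) * emeasure (IT.C 0 ?n u) {x js}"
      by (rule nn_integral_cmult_indicator) (simp only: setsC xs)
    finally have "ennreal (q k []) * emeasure (IT.C 0 (length (js @ [j])) u) {x (js @ [j])}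
        = ennreal (pmf (step k js) j) * (ennreal (q k []) * emeasure (IT.C 0 ?n u) {x js})" by (simp only: mult_ac)
    also have "\<dots> = ennreal (pmf (step k js) j) * ennreal (q k js)" by (simp only: snoc)
    also have "\<dots> = ennreal (q k js * pmf (step k js) j)" using q_nonneg[OF k] by (simp add: ennreal_mult mult.commute)
    finally show ?case by (simp only: pmf_step[OF k])
  qed
  have lim: "emeasure IT.PF.lim {w. \<forall>i<length js. w i = js ! i} = emeasure (IT.C 0 (length js) u) {x js}" for js
  proof -
    have e: "{w. \<forall>i<length js. w i = js ! i} = prod_emb UNIV (\<lambda>_. count_space UNIV) {0..<length js} {x js}"
    proof -
      have "restrict w {0..<length js} = x js \<longleftrightarrow> (\<forall>i<length js. w i = js ! i)" for w
      proof
        assume h: "restrict w {0..<length js} = x js"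
        show "\<forall>i<length js. w i = js ! i"
        proof (intro allI impI)
          fix i assume "i < length js"
          then show "w i = js ! i" using fun_cong[OF h, of i] by (simp add: x_def)
        qed
      qed (auto simp: x_def fun_eq_iff)
      then show ?thesis by (auto simp: prod_emb_def)
    qed
    have "{x js} \<subseteq> (\<Pi>\<^sub>E i\<in>{0..<length js}. space (count_space UNIV))" by (auto simp: x_def)
    then have e2: "prod_emb {0..<length js} (\<lambda>_. count_space UNIV) {0..<length js} {x js} = {x js}" by (rule prod_emb_id)
    have "emeasure IT.PF.lim {w. \<forall>i<length js. w i = js ! i} = emeasure (IT.CI {0..<length js}) {x js}"
      unfolding e by (rule IT.lim[OF _ xs]) simp
    also have "\<dots> = emeasure (IT.C 0 (length js) u) {x js}"
      using IT.emeasure_CI[OF _ xs[of js], of "length js"] by (simp add: e2 u_def)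
    finally show ?thesis .
  qed
  have sl: "sets IT.PF.lim = sets S" by (rule IT.PF.sets_lim)
  have "prob_space IT.PF.lim"
  proof
    have xe: "x [] = u" by (simp add: x_def u_def fun_eq_iff)
    have "{u} \<in> sets (PiM {0..<0} (\<lambda>_. count_space (UNIV :: 'j set)))" using xs[of "[]"] unfolding xe by simp
    then have "emeasure (IT.C 0 0 u) {u} = 1" by (simp add: emeasure_return)
    then show "emeasure IT.PF.lim (space IT.PF.lim) = 1"
      using lim[of "[]"] sets_eq_imp_space_eq[OF sl] by (simp add: xe space_PiM)
  qed
  then show ?thesis using C lim sl by (intro exI[of _ IT.PF.lim]) simp
qed

lemma initial_pmf_exists: "\<exists>K. \<forall>k. pmf K k = (if k \<in> V then q k [] else 0)"
proof -
  have hs: "((\<lambda>k. q k []) has_sum 1) V"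
    using has_sum_Re[of "\<lambda>k. trace (\<rho> k)" V 1] init by (simp add: initial_state_def q_Nil)
  then have abs: "Infinite_Set_Sum.abs_summable_on (\<lambda>k. q k []) V"
    unfolding abs_summable_equivalent[symmetric] summable_on_iff_abs_summable_on_real[symmetric]
    by (rule has_sum_imp_summable)
  then have "(\<integral>\<^sup>+k. ennreal (q k []) \<partial>count_space V) = ennreal (infsetsum (\<lambda>k. q k []) V)"
    by (rule nn_integral_conv_infsetsum) (rule q_nonneg)
  also have "infsetsum (\<lambda>k. q k []) V = 1"
    using infsetsum_infsum[OF abs] infsumI[OF hs] by simp
  finally have "(\<integral>\<^sup>+k. ennreal (q k []) * indicator V k \<partial>count_space UNIV) = 1"
    by (simp add: nn_integral_count_space_indicator)
  moreover have "ennreal (q k []) * indicator V k = ennreal (if k \<in> V then q k [] else 0)" for k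
    by (simp add: indicator_def)
  ultimately have "(\<integral>\<^sup>+k. ennreal (if k \<in> V then q k [] else 0) \<partial>count_space UNIV) = 1" by simp
  then have "pmf (embed_pmf (\<lambda>k. if k \<in> V then q k [] else 0)) k = (if k \<in> V then q k [] else 0)" for k
    using q_nonneg by (intro pmf_embed_pmf) auto
  then show ?thesis by blast
qed

lemma space_traj: "space (traj_space V) = V \<times> (UNIV :: (nat \<Rightarrow> 'j) set)"
  by (simp add: traj_space_def space_pair_measure space_PiM)

lemma fst_measurable: "fst \<in> measurable (traj_space V) (count_space V)"
  unfolding traj_space_def by (rule measurable_fst)

lemma coord_measurable: "(\<lambda>\<omega>. snd \<omega> i) \<in> measurable (traj_space V) (count_space (UNIV :: 'j set))"
  unfolding traj_space_def by (rule measurable_compose[OF measurable_snd measurable_component_singleton]) simp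

lemma cylinder_sets: assumes "k \<in> V" shows "cylinder k js \<in> sets (traj_space V :: ((real ^ 'd) \<times> (nat \<Rightarrow> 'j)) measure)"
proof -
  have "cylinder k js = {\<omega> \<in> space (traj_space V). fst \<omega> = k \<and> (\<forall>i\<in>{..<length js}. snd \<omega> i = js ! i)}"
    using assms by (auto simp: cylinder_def space_traj)
  also have "\<dots> \<in> sets (traj_space V)"
  proof (intro sets.sets_Collect_conj sets.sets_Collect_finite_All)
    have "fst -` {k} \<inter> space (traj_space V) \<in> sets (traj_space V :: ((real ^ 'd) \<times> (nat \<Rightarrow> 'j)) measure)"
      by (rule measurable_sets[OF fst_measurable]) (use assms in simp)
    also have "fst -` {k} \<inter> space (traj_space V) = {\<omega> \<in> space (traj_space V). fst \<omega> = k}" by auto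
    finally show "{\<omega> \<in> space (traj_space V). fst \<omega> = k} \<in> sets (traj_space V :: ((real ^ 'd) \<times> (nat \<Rightarrow> 'j)) measure)" .
    show "{\<omega> \<in> space (traj_space V). snd \<omega> i = js ! i} \<in> sets (traj_space V)" for i
    proof -
      have "(\<lambda>\<omega>. snd \<omega> i) -` {js ! i} \<inter> space (traj_space V) \<in> sets (traj_space V)"
        by (rule measurable_sets[OF coord_measurable]) simp
      also have "(\<lambda>\<omega>. snd \<omega> i) -` {js ! i} \<inter> space (traj_space V) = {\<omega> \<in> space (traj_space V). snd \<omega> i = js ! i}" by auto
      finally show ?thesis .
    qed
  qed simp
  finally show ?thesis .
qed

text \<open>The mixture of the conditional laws over the initial distribution.\<close>

lemma trajectory_law_exists:
  "\<exists>T. prob_space T \<and> sets T = sets (traj_space V :: ((real ^ 'd) \<times> (nat \<Rightarrow> 'j)) measure) \<and> (\<forall>k\<in>V. \<forall>js. measure T (cylinder k js) = q k js)"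
proof -
  obtain K where K: "\<And>k. pmf K k = (if k \<in> V then q k [] else 0)" using initial_pmf_exists by blast
  define Q where "Q k = (SOME Q. prob_space Q \<and> sets Q = sets S \<and>
    (\<forall>js. ennreal (q k []) * emeasure Q {w. \<forall>i<length js. w i = js ! i} = ennreal (q k js)))" for k
  have Q: "prob_space (Q k)" "sets (Q k) = sets S"
    "ennreal (q k []) * emeasure (Q k) {w. \<forall>i<length js. w i = js ! i} = ennreal (q k js)" if "k \<in> V" for k js
    using someI_ex[OF conditional_law_exists[OF that]] unfolding Q_def by blast+
  \<comment> \<open>Points outside V carry no initial mass; sending them to 0 makes \<open>R\<close>
    a probability kernel on the whole space.\<close>
  define v where "v k = (if k \<in> V then k else 0)" for k
  have v: "v k \<in> V" "k \<in> V \<Longrightarrow> v k = k" for k using V0 by (auto simp: v_def)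
  define R where "R k = distr (Q (v k)) (traj_space V) (\<lambda>w. (v k, w))" for k
  have meas: "(\<lambda>w. (v k, w)) \<in> measurable (Q (v k)) (traj_space V)" for k
    unfolding traj_space_def measurable_cong_sets[OF Q(2)[OF v(1)] refl]
    by (intro measurable_Pair measurable_const measurable_ident_sets[OF refl]) (simp add: v)
  have Rp: "prob_space (R k)" for k
    unfolding R_def by (rule prob_space.prob_space_distr[OF Q(1)[OF v(1)] meas])
  have RS: "sets (R k) = sets (traj_space V)" for k by (simp add: R_def)
  have Rm: "R \<in> measurable (measure_pmf K) (subprob_algebra (traj_space V))"
    using Rp RS by (simp add: space_subprob_algebra prob_space_imp_subprob_space)
  define T where "T = measure_pmf K \<bind> R"
  have "prob_space T"
    unfolding T_def by (rule measure_pmf.prob_space_bind[OF _ Rm]) (simp add: Rp)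
  moreover have "sets T = sets (traj_space V)" unfolding T_def by (rule sets_bind) (simp_all add: RS)
  moreover have "measure T (cylinder k js) = q k js" if k: "k \<in> V" for k js
  proof -
    have "emeasure T (cylinder k js) = (\<integral>\<^sup>+x. emeasure (R x) (cylinder k js) \<partial>measure_pmf K)"
      unfolding T_def by (rule emeasure_bind[OF _ Rm cylinder_sets[OF k]]) simp
    also have "\<dots> = (\<integral>\<^sup>+x. emeasure (Q k) {w. \<forall>i<length js. w i = js ! i} * indicator {k} x \<partial>measure_pmf K)"
    proof (rule nn_integral_cong_AE, rule AE_pmfI)
      fix x assume "x \<in> set_pmf K"
      then have x: "x \<in> V" using K[of x] by (auto simp: set_pmf_iff split: if_splits)
      have "emeasure (R x) (cylinder k js) = emeasure (Q x) ((\<lambda>w. (x, w)) -` cylinder k js \<inter> space (Q x))"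
        unfolding R_def using emeasure_distr[OF meas[of x] cylinder_sets[OF k]] v(2)[OF x] by simp
      also have "space (Q x) = UNIV" using sets_eq_imp_space_eq[OF Q(2)[OF x]] by (simp add: space_PiM)
      also have "(\<lambda>w. (x, w)) -` cylinder k js \<inter> UNIV = (if x = k then {w. \<forall>i<length js. w i = js ! i} else {})"
        by (auto simp: cylinder_def)
      finally show "emeasure (R x) (cylinder k js) = emeasure (Q k) {w. \<forall>i<length js. w i = js ! i} * indicator {k} x"
        by simp
    qed
    also have "\<dots> = ennreal (q k js)"
    proof -
      have "(\<integral>\<^sup>+x. emeasure (Q k) {w. \<forall>i<length js. w i = js ! i} * indicator {k} x \<partial>measure_pmf K)
        = emeasure (Q k) {w. \<forall>i<length js. w i = js ! i} * emeasure (measure_pmf K) {k}"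
        by (rule nn_integral_cmult_indicator) simp
      then show ?thesis using Q(3)[OF k, of js] k by (simp add: emeasure_pmf_single K mult.commute)
    qed
    finally show ?thesis using q_nonneg[OF k] by (simp add: measure_def)
  qed
  ultimately show ?thesis by blast
qed

text \<open>Two cylinders are nested or disjoint, so together with the empty set they form an
  intersection-stable generator.\<close>

lemma trajectory_law_unique:
  fixes M N :: "((real ^ 'd) \<times> (nat \<Rightarrow> 'j)) measure"
  assumes M: "prob_space M" "sets M = sets (traj_space V)" and N: "prob_space N" "sets N = sets (traj_space V)"
    and eq: "\<And>k js. k \<in> V \<Longrightarrow> measure M (cylinder k js) = measure N (cylinder k js)"
  shows "M = N"
proof -
  interpret M: prob_space M by fact
  interpret N: prob_space N by fact
  let ?\<Omega> = "V \<times> (UNIV :: (nat \<Rightarrow> 'j) set)"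
  define E :: "((real ^ 'd) \<times> (nat \<Rightarrow> 'j)) set set" where "E = insert {} {cylinder k js | k js. k \<in> V}"
  have ES: "E \<subseteq> Pow ?\<Omega>" by (auto simp: E_def cylinder_def)
  interpret sa: sigma_algebra ?\<Omega> "sigma_sets ?\<Omega> E" by (rule sigma_algebra_sigma_sets[OF ES])
  have gen: "sets (traj_space V) = sigma_sets ?\<Omega> E"
  proof
    show "sigma_sets ?\<Omega> E \<subseteq> sets (traj_space V)"
      using sets.sigma_sets_subset[of E "traj_space V"] cylinder_sets by (auto simp: E_def space_traj)
    have cE: "cylinder k js \<in> sigma_sets ?\<Omega> E" if "k \<in> V" for k js using that by (auto simp: E_def)
    have f: "fst \<in> measurable (sigma ?\<Omega> E) (count_space V)"
    proof (subst measurable_count_space_eq_countable[OF cV], intro conjI ballI)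
      fix k assume k: "k \<in> V"
      have "fst -` {k} \<inter> space (sigma ?\<Omega> E) = cylinder k []" using k ES by (auto simp: cylinder_def space_measure_of)
      then show "fst -` {k} \<inter> space (sigma ?\<Omega> E) \<in> sets (sigma ?\<Omega> E)" using cE[OF k] ES by simp
    qed (use ES in \<open>auto simp: space_measure_of\<close>)
    have g: "(\<lambda>\<omega>. snd \<omega> i) \<in> measurable (sigma ?\<Omega> E) (count_space UNIV)" for i
    proof (subst measurable_count_space_eq_countable[OF countable_finite[OF finite]], intro conjI ballI)
      fix j :: 'j
      have "(\<lambda>\<omega>. snd \<omega> i) -` {j} \<inter> space (sigma ?\<Omega> E) = (\<Union>k\<in>V. \<Union>js\<in>{js. length js = Suc i \<and> js ! i = j}. cylinder k js)"
      proof (intro set_eqI iffI)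
        fix \<omega> assume w: "\<omega> \<in> (\<lambda>\<omega>. snd \<omega> i) -` {j} \<inter> space (sigma ?\<Omega> E)"
        have "\<omega> \<in> cylinder (fst \<omega>) (map (snd \<omega>) [0..<Suc i])" by (cases \<omega>) (auto simp: cylinder_def simp del: upt_Suc)
        moreover have "fst \<omega> \<in> V" "map (snd \<omega>) [0..<Suc i] ! i = j" using w ES by (auto simp: space_measure_of simp del: upt_Suc)
        ultimately show "\<omega> \<in> (\<Union>k\<in>V. \<Union>js\<in>{js. length js = Suc i \<and> js ! i = j}. cylinder k js)"
          by (intro UN_I[of "fst \<omega>"] UN_I[of "map (snd \<omega>) [0..<Suc i]"]) (auto simp del: upt_Suc)
      qed (use ES in \<open>auto simp: cylinder_def space_measure_of\<close>)
      also have "\<dots> \<in> sigma_sets ?\<Omega> E"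
        by (intro sa.countable_UN' cV cE) (auto intro: cE)
      finally show "(\<lambda>\<omega>. snd \<omega> i) -` {j} \<inter> space (sigma ?\<Omega> E) \<in> sets (sigma ?\<Omega> E)" using ES by simp
    qed simp
    have "(\<lambda>\<omega>. (fst \<omega>, snd \<omega>)) \<in> measurable (sigma ?\<Omega> E) (traj_space V)"
      unfolding traj_space_def
      by (intro measurable_Pair f measurable_PiM_single') (auto intro: g simp: space_PiM)
    then have id: "(\<lambda>\<omega>. \<omega>) \<in> measurable (sigma ?\<Omega> E) (traj_space V)" by simp
    show "sets (traj_space V) \<subseteq> sigma_sets ?\<Omega> E"
    proof
      fix X assume X: "X \<in> sets (traj_space V :: ((real ^ 'd) \<times> (nat \<Rightarrow> 'j)) measure)"
      have "(\<lambda>\<omega>. \<omega>) -` X \<inter> space (sigma ?\<Omega> E) \<in> sets (sigma ?\<Omega> E)" by (rule measurable_sets[OF id X])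
      then show "X \<in> sigma_sets ?\<Omega> E" using sets.sets_into_space[OF X] ES by (simp add: space_traj space_measure_of Int_absorb2)
    qed
  qed
  \<comment> \<open>Length-zero cylinders enumerate the starting points and exhaust the
    space.\<close>
  define A where "A n = cylinder (from_nat_into V n) ([] :: 'j list)" for n
  show ?thesis
  proof (rule measure_eqI_generator_eq[OF _ ES _ M(2)[unfolded gen] N(2)[unfolded gen]])
    show "Int_stable E"
    proof (rule Int_stableI)
      have pfx: "cylinder k js \<inter> cylinder k' is \<in> E" if "k \<in> V" "length js \<le> length is" for k k' and js "is" :: "'j list"
      proof (cases "cylinder k js \<inter> cylinder k' is = {}")
        case False
        then obtain w where w: "(k, w) \<in> cylinder k js" "(k, w) \<in> cylinder k' is" by (auto simp: cylinder_def)
        then have "cylinder k js \<inter> cylinder k' is = cylinder k is"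
          using that(2) by (auto simp: cylinder_def)
        then show ?thesis using that(1) by (auto simp: E_def)
      qed (simp add: E_def)
      fix X Y assume "X \<in> E" "Y \<in> E"
      then consider "X = {} \<or> Y = {}" | k js k' "is" where "X = cylinder k js" "Y = cylinder k' is" "k \<in> V" "k' \<in> V"
        unfolding E_def by blast
      then show "X \<inter> Y \<in> E"
      proof cases
        case 1
        then show ?thesis by (auto simp: E_def)
      next
        case 2
        then show ?thesis using pfx[of k js "is" k'] pfx[of k' "is" js k] by (cases "length js \<le> length is") (auto simp: Int_commute)
      qed
    qed
    show "emeasure M X = emeasure N X" if XE: "X \<in> E" for X
    proof -
      consider "X = {}" | k js where "X = cylinder k js" "k \<in> V" using XE unfolding E_def by blast
      then show ?thesis by cases (simp_all add: eq M.emeasure_eq_measure N.emeasure_eq_measure)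
    qed
    have ne: "V \<noteq> {}" using V0 by auto
    show "range A \<subseteq> E" using from_nat_into[OF ne] by (auto simp: A_def E_def)
    show "(\<Union>i. A i) = ?\<Omega>"
    proof (intro set_eqI iffI)
      fix \<omega> assume w: "\<omega> \<in> ?\<Omega>"
      then obtain n where "from_nat_into V n = fst \<omega>" using from_nat_into_surj[OF cV] by (metis mem_Times_iff)
      then have "\<omega> \<in> A n" by (cases \<omega>) (simp add: A_def cylinder_def)
      then show "\<omega> \<in> (\<Union>i. A i)" by blast
    next
      fix \<omega> assume "\<omega> \<in> (\<Union>i. A i)"
      then obtain n where "\<omega> \<in> A n" by blast
      then show "\<omega> \<in> ?\<Omega>" using from_nat_into[OF ne, of n] by (cases \<omega>) (simp add: A_def cylinder_def)
    qed
    show "emeasure M (A i) \<noteq> \<infinity>" for i by (simp add: M.emeasure_eq_measure)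
  qed
qed

definition T where "T = traj_measure V L \<rho>"

lemma T: "prob_space T" "sets T = sets (traj_space V)" "k \<in> V \<Longrightarrow> measure T (cylinder k js) = q k js"
proof -
  obtain T' :: "((real ^ 'd) \<times> (nat \<Rightarrow> 'j)) measure" where T': "prob_space T'" "sets T' = sets (traj_space V)" "\<And>k js. k \<in> V \<Longrightarrow> measure T' (cylinder k js) = q k js"
    using trajectory_law_exists by blast
  have "T = T'"
    unfolding T_def traj_measure_def
  proof (rule the_equality)
    show "prob_space T' \<and> sets T' = sets (traj_space V) \<and> (\<forall>k\<in>V. \<forall>js. measure T' (cylinder k js) = Re (trace (word_op L js ** \<rho> k ** dagger (word_op L js))))"
      using T' by (simp add: q_def sg_def)
    show "M = T'" if "prob_space M \<and> sets M = sets (traj_space V) \<and> (\<forall>k\<in>V. \<forall>js. measure M (cylinder k js) = Re (trace (word_op L js ** \<rho> k ** dagger (word_op L js))))" for M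
    proof (rule trajectory_law_unique[OF _ _ T'(1,2)])
      show "prob_space M" "sets M = sets (traj_space V)" using that by blast+
      show "measure M (cylinder k js) = measure T' (cylinder k js)" if "k \<in> V" for k js
        using T'(3)[OF that] \<open>prob_space M \<and> _\<close> that by (simp add: q_def sg_def)
    qed
  qed
  then show "prob_space T" "sets T = sets (traj_space V)" "k \<in> V \<Longrightarrow> measure T (cylinder k js) = q k js" using T' by simp_all
qed

end

text \<open>The second moments of a bounded martingale increase to a finite limit, and Kolmogorov's
  maximal inequality turns their small increments into a small oscillation. The martingale property
  is stated through bounded functions of the prefix as tests, so no conditional expectation
  occurs.\<close>

lemma bounded_martingale_convergent:
  fixes M :: "'a measure" and pre :: "nat \<Rightarrow> 'a \<Rightarrow> 'b" and y :: "nat \<Rightarrow> 'b \<Rightarrow> real"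
  assumes "prob_space M"
    and pre: "\<And>n. pre n \<in> measurable M (count_space UNIV)"
    and mono: "\<And>n m. n \<le> m \<Longrightarrow> \<exists>g. \<forall>\<omega>. pre n \<omega> = g (pre m \<omega>)"
    and bnd: "\<And>n b. \<bar>y n b\<bar> \<le> C"
    and mart: "\<And>n F B. (\<And>b. \<bar>F b\<bar> \<le> B) \<Longrightarrow>
      (\<integral>\<omega>. F (pre n \<omega>) * y (Suc n) (pre (Suc n) \<omega>) \<partial>M) = (\<integral>\<omega>. F (pre n \<omega>) * y n (pre n \<omega>) \<partial>M)"
  shows "AE \<omega> in M. convergent (\<lambda>n. y n (pre n \<omega>))"
proof -
  interpret prob_space M by fact
  define Y where "Y n \<omega> = y n (pre n \<omega>)" for n \<omega>
  have meas: "(\<lambda>\<omega>. F (pre n \<omega>)) \<in> borel_measurable M" for F :: "'b \<Rightarrow> real" and n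
    by (rule measurable_compose[OF pre]) simp
  have Ym [measurable]: "Y n \<in> borel_measurable M" for n unfolding Y_def by (rule meas)
  have Yb: "\<bar>Y n \<omega>\<bar> \<le> C" for n \<omega> by (simp add: Y_def bnd)
  have C0: "0 \<le> C" using Yb[of 0 undefined] by linarith
  have int: "integrable M f" if "f \<in> borel_measurable M" "\<And>\<omega>. \<bar>f \<omega>\<bar> \<le> B" for f :: "'a \<Rightarrow> real" and B
    by (rule integrable_const_bound[where B = B]) (use that in auto)
  have ext: "(\<integral>\<omega>. F (pre n \<omega>) * Y m \<omega> \<partial>M) = (\<integral>\<omega>. F (pre n \<omega>) * Y n \<omega> \<partial>M)"
    if "n \<le> m" "\<And>b. \<bar>F b\<bar> \<le> B" for n m F B
    using that(1)
  proof (induction rule: dec_induct)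
    case (step m)
    obtain g where g: "\<And>\<omega>. pre n \<omega> = g (pre m \<omega>)" using mono[OF step(1)] by blast
    have "(\<integral>\<omega>. F (g (pre m \<omega>)) * y (Suc m) (pre (Suc m) \<omega>) \<partial>M) = (\<integral>\<omega>. F (g (pre m \<omega>)) * y m (pre m \<omega>) \<partial>M)"
      by (rule mart[of "\<lambda>b. F (g b)"]) (rule that(2))
    then show ?case using step(3) by (simp add: Y_def g)
  qed simp
  define s where "s n = (\<integral>\<omega>. (Y n \<omega>)\<^sup>2 \<partial>M)" for n
  have sq: "(Y n \<omega>)\<^sup>2 \<le> C\<^sup>2" for n \<omega> using Yb[of n \<omega>] C0 by (simp add: abs_le_square_iff[symmetric])
  have iY: "integrable M (Y n)" for n by (rule int[OF Ym Yb])
  have YY: "\<bar>Y n \<omega> * Y m \<omega>\<bar> \<le> C * C" for n m \<omega> unfolding abs_mult by (intro mult_mono Yb C0) simp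
  have iYY: "integrable M (\<lambda>\<omega>. Y n \<omega> * Y m \<omega>)" for n m by (rule int[OF _ YY]) measurable
  have diff2: "(\<integral>\<omega>. (Y N \<omega> - Y n \<omega>)\<^sup>2 \<partial>M) = s N - s n" if "n \<le> N" for n N
  proof -
    have "(\<integral>\<omega>. Y n \<omega> * Y N \<omega> \<partial>M) = (\<integral>\<omega>. Y n \<omega> * Y n \<omega> \<partial>M)"
      using ext[OF that, of "y n" C] bnd by (simp add: Y_def)
    moreover have "(\<integral>\<omega>. (Y N \<omega> - Y n \<omega>)\<^sup>2 \<partial>M) = (\<integral>\<omega>. Y N \<omega> * Y N \<omega> - 2 * (Y n \<omega> * Y N \<omega>) + Y n \<omega> * Y n \<omega> \<partial>M)"
      by (intro Bochner_Integration.integral_cong) (simp_all add: power2_eq_square algebra_simps)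
    ultimately show ?thesis using iYY by (simp add: s_def power2_eq_square)
  qed
  have "s n \<le> s N" if "n \<le> N" for n N
    using diff2[OF that] Bochner_Integration.integral_nonneg[of M "\<lambda>\<omega>. (Y N \<omega> - Y n \<omega>)\<^sup>2"] by simp
  then have s_inc: "incseq s" by (simp add: incseq_def)
  have sC: "s n \<le> C\<^sup>2" for n
  proof -
    have "s n \<le> (\<integral>\<omega>. C\<^sup>2 \<partial>M)" unfolding s_def
      by (intro integral_mono) (use iYY[of n n] sq in \<open>simp_all add: power2_eq_square\<close>)
    then show ?thesis by (simp add: prob_space)
  qed
  obtain slim where slim: "s \<longlonglongrightarrow> slim" "\<And>n. s n \<le> slim" using incseq_convergent[OF s_inc, of "C\<^sup>2"] sC by blast
  have maximal: "\<epsilon>\<^sup>2 * prob {\<omega> \<in> space M. \<exists>k\<in>{n..N}. \<epsilon> \<le> \<bar>Y k \<omega> - Y n \<omega>\<bar>} \<le> slim - s n"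
    if \<epsilon>: "\<epsilon> > 0" and nN: "n \<le> N" for \<epsilon> n N
  proof -
    \<comment> \<open>Indicator that k is the first time from n on at which the deviation from Y n
      reaches \<epsilon>.\<close>
    define I where "I k \<omega> = (if \<epsilon> \<le> \<bar>Y k \<omega> - Y n \<omega>\<bar> \<and> (\<forall>i\<in>{n..<k}. \<bar>Y i \<omega> - Y n \<omega>\<bar> < \<epsilon>) then 1 else 0 :: real)" for k \<omega>
    have [measurable]: "I k \<in> borel_measurable M" for k unfolding I_def by measurable
    have I01: "0 \<le> I k \<omega>" "I k \<omega> \<le> 1" for k \<omega> by (auto simp: I_def)
    have Ib: "\<bar>I k \<omega> * f\<bar> \<le> \<bar>f\<bar>" for k \<omega> f using I01[of k \<omega>] by (auto simp: I_def)
    have D2: "(Y N \<omega> - Y k \<omega>)\<^sup>2 \<le> (2 * C)\<^sup>2" for N k \<omega>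
    proof -
      have "\<bar>Y N \<omega> - Y k \<omega>\<bar> \<le> \<bar>2 * C\<bar>" using Yb[of N \<omega>] Yb[of k \<omega>] by linarith
      then show ?thesis by (simp only: abs_le_square_iff)
    qed
    have iI: "integrable M (\<lambda>\<omega>. I k \<omega> * (Y N \<omega> - Y l \<omega>)\<^sup>2)" for k N l
      by (rule int[of _ "(2 * C)\<^sup>2"], measurable) (rule order_trans[OF Ib], simp only: abs_power2 D2)
    have step: "\<epsilon>\<^sup>2 * (\<integral>\<omega>. I k \<omega> \<partial>M) \<le> (\<integral>\<omega>. I k \<omega> * (Y N \<omega> - Y n \<omega>)\<^sup>2 \<partial>M)" if k: "k \<in> {n..N}" for k
    proof -
      \<comment> \<open>Recovers earlier prefixes from the one at time k, so that the first-exit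
        indicator is an admissible test function at time k.\<close>
      define g where "g i = (SOME g. \<forall>\<omega>. pre i \<omega> = g (pre k \<omega>))" for i
      have g: "pre i \<omega> = g i (pre k \<omega>)" if "i \<le> k" for i \<omega>
        using someI_ex[OF mono[OF that]] unfolding g_def by (rule spec)
      define F where "F b = (if \<epsilon> \<le> \<bar>y k b - y n (g n b)\<bar> \<and> (\<forall>i\<in>{n..<k}. \<bar>y i (g i b) - y n (g n b)\<bar> < \<epsilon>) then 1 else 0) * (y k b - y n (g n b))" for b
      have Fb: "\<bar>F b\<bar> \<le> 2 * C" for b
      proof -
        have "\<bar>y k b - y n (g n b)\<bar> \<le> 2 * C" using bnd[of k b] bnd[of n "g n b"] by linarith
        then show ?thesis using C0 by (simp add: F_def)
      qed
      have FI: "F (pre k \<omega>) = I k \<omega> * (Y k \<omega> - Y n \<omega>)" for \<omega>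
      proof -
        have "y n (g n (pre k \<omega>)) = Y n \<omega>" using g[of n \<omega>] k by (simp add: Y_def)
        moreover have "y i (g i (pre k \<omega>)) = Y i \<omega>" if "i \<in> {n..<k}" for i using g[of i \<omega>] that by (simp add: Y_def)
        moreover have "y k (pre k \<omega>) = Y k \<omega>" by (simp add: Y_def)
        ultimately show ?thesis by (simp add: F_def I_def)
      qed
      have "(\<integral>\<omega>. F (pre k \<omega>) * Y N \<omega> \<partial>M) = (\<integral>\<omega>. F (pre k \<omega>) * Y k \<omega> \<partial>M)"
        by (rule ext[OF _ Fb]) (use k in simp)
      moreover have "integrable M (\<lambda>\<omega>. F (pre k \<omega>) * Y N \<omega>)" for N
      proof (rule int)
        show "(\<lambda>\<omega>. F (pre k \<omega>) * Y N \<omega>) \<in> borel_measurable M" using meas[of F k] by measurable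
        show "\<bar>F (pre k \<omega>) * Y N \<omega>\<bar> \<le> 2 * C * C" for \<omega> unfolding abs_mult by (intro mult_mono Fb Yb) (use C0 in auto)
      qed
      \<comment> \<open>Increments after k are orthogonal to whatever is determined at time
        k.\<close>
      ultimately have cross: "(\<integral>\<omega>. F (pre k \<omega>) * (Y N \<omega> - Y k \<omega>) \<partial>M) = 0" "integrable M (\<lambda>\<omega>. F (pre k \<omega>) * (Y N \<omega> - Y k \<omega>))"
        by (simp_all add: right_diff_distrib)
      have "\<epsilon>\<^sup>2 * (\<integral>\<omega>. I k \<omega> \<partial>M) = (\<integral>\<omega>. \<epsilon>\<^sup>2 * I k \<omega> \<partial>M)" by simp
      also have "\<dots> \<le> (\<integral>\<omega>. I k \<omega> * (Y N \<omega> - Y k \<omega>)\<^sup>2 + I k \<omega> * (Y k \<omega> - Y n \<omega>)\<^sup>2 \<partial>M)"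
      proof (rule integral_mono)
        show "integrable M (\<lambda>\<omega>. \<epsilon>\<^sup>2 * I k \<omega>)" by (rule int[of _ "\<epsilon>\<^sup>2"], measurable) (simp add: I_def)
        show "integrable M (\<lambda>\<omega>. I k \<omega> * (Y N \<omega> - Y k \<omega>)\<^sup>2 + I k \<omega> * (Y k \<omega> - Y n \<omega>)\<^sup>2)" by (intro Bochner_Integration.integrable_add iI)
        fix \<omega>
        show "\<epsilon>\<^sup>2 * I k \<omega> \<le> I k \<omega> * (Y N \<omega> - Y k \<omega>)\<^sup>2 + I k \<omega> * (Y k \<omega> - Y n \<omega>)\<^sup>2"
        proof (cases "\<epsilon> \<le> \<bar>Y k \<omega> - Y n \<omega>\<bar>")
          case True
          then have "\<epsilon>\<^sup>2 \<le> (Y k \<omega> - Y n \<omega>)\<^sup>2" using \<epsilon> by (simp add: abs_le_square_iff[symmetric])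
          then have "\<epsilon>\<^sup>2 \<le> (Y N \<omega> - Y k \<omega>)\<^sup>2 + (Y k \<omega> - Y n \<omega>)\<^sup>2" by (rule add_increasing[OF zero_le_power2])
          then show ?thesis by (simp add: I_def)
        qed (simp add: I_def)
      qed
      also have "\<dots> = (\<integral>\<omega>. I k \<omega> * (Y N \<omega> - Y k \<omega>)\<^sup>2 + I k \<omega> * (Y k \<omega> - Y n \<omega>)\<^sup>2 \<partial>M) + 2 * (\<integral>\<omega>. F (pre k \<omega>) * (Y N \<omega> - Y k \<omega>) \<partial>M)"
        by (simp add: cross)
      also have "\<dots> = (\<integral>\<omega>. I k \<omega> * (Y N \<omega> - Y k \<omega>)\<^sup>2 + I k \<omega> * (Y k \<omega> - Y n \<omega>)\<^sup>2 + 2 * (F (pre k \<omega>) * (Y N \<omega> - Y k \<omega>)) \<partial>M)"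
        using iI cross(2) by simp
      also have "\<dots> = (\<integral>\<omega>. I k \<omega> * (Y N \<omega> - Y n \<omega>)\<^sup>2 \<partial>M)"
        unfolding FI by (intro Bochner_Integration.integral_cong) (simp_all add: power2_eq_square algebra_simps)
      finally show ?thesis .
    qed
    \<comment> \<open>A first exit happens at most once, so these indicators add up to the indicator
      of some exit.\<close>
    have sumI: "(\<Sum>k\<in>{n..N}. I k \<omega>) = (if \<exists>k\<in>{n..N}. \<epsilon> \<le> \<bar>Y k \<omega> - Y n \<omega>\<bar> then 1 else 0)" for \<omega>
    proof (cases "\<exists>k\<in>{n..N}. \<epsilon> \<le> \<bar>Y k \<omega> - Y n \<omega>\<bar>")
      case True
      define k0 where "k0 = (LEAST k. n \<le> k \<and> \<epsilon> \<le> \<bar>Y k \<omega> - Y n \<omega>\<bar>)"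
      obtain k1 where k1: "k1 \<in> {n..N}" "\<epsilon> \<le> \<bar>Y k1 \<omega> - Y n \<omega>\<bar>" using True by blast
      have k0: "n \<le> k0" "\<epsilon> \<le> \<bar>Y k0 \<omega> - Y n \<omega>\<bar>"
        using LeastI[of "\<lambda>k. n \<le> k \<and> \<epsilon> \<le> \<bar>Y k \<omega> - Y n \<omega>\<bar>" k1] k1 by (auto simp: k0_def)
      have least: "\<bar>Y i \<omega> - Y n \<omega>\<bar> < \<epsilon>" if "n \<le> i" "i < k0" for i
        using not_less_Least[of i "\<lambda>k. n \<le> k \<and> \<epsilon> \<le> \<bar>Y k \<omega> - Y n \<omega>\<bar>"] that by (auto simp: k0_def)
      have "k0 \<le> k1" unfolding k0_def by (rule Least_le) (use k1 in simp)
      then have k0N: "k0 \<in> {n..N}" using k0 k1 by simp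
      have "I k \<omega> = (if k = k0 then 1 else 0)" if "k \<in> {n..N}" for k
      proof (cases k k0 rule: linorder_cases)
        case less
        then show ?thesis using least[of k] that by (auto simp: I_def)
      next
        case equal
        then show ?thesis using least k0 by (auto simp: I_def)
      next
        case greater
        then have "k0 \<in> {n..<k}" using k0 by simp
        then show ?thesis using k0(2) greater by (force simp: I_def)
      qed
      then have "(\<Sum>k\<in>{n..N}. I k \<omega>) = (\<Sum>k\<in>{n..N}. if k = k0 then 1 else 0)" by (intro sum.cong) auto
      then show ?thesis using True k0N by simp
    qed (auto simp: I_def)
    let ?G = "{\<omega> \<in> space M. \<exists>k\<in>{n..N}. \<epsilon> \<le> \<bar>Y k \<omega> - Y n \<omega>\<bar>}"
    have [measurable]: "?G \<in> sets M" by measurable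
    have iIk: "integrable M (I k)" for k by (rule int[of _ 1]) (auto simp: I_def)
    have "prob ?G = (\<integral>\<omega>. (\<Sum>k\<in>{n..N}. I k \<omega>) \<partial>M)"
    proof -
      have "(\<integral>\<omega>. (\<Sum>k\<in>{n..N}. I k \<omega>) \<partial>M) = (\<integral>\<omega>. indicator ?G \<omega> \<partial>M)"
        unfolding sumI by (intro Bochner_Integration.integral_cong) (auto simp: indicator_def)
      then show ?thesis by simp
    qed
    also have "\<dots> = (\<Sum>k\<in>{n..N}. \<integral>\<omega>. I k \<omega> \<partial>M)" by (rule Bochner_Integration.integral_sum[OF iIk])
    finally have "\<epsilon>\<^sup>2 * prob ?G = (\<Sum>k\<in>{n..N}. \<epsilon>\<^sup>2 * (\<integral>\<omega>. I k \<omega> \<partial>M))" by (simp add: sum_distrib_left)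
    also have "\<dots> \<le> (\<Sum>k\<in>{n..N}. \<integral>\<omega>. I k \<omega> * (Y N \<omega> - Y n \<omega>)\<^sup>2 \<partial>M)" by (rule sum_mono[OF step])
    also have "\<dots> = (\<integral>\<omega>. (\<Sum>k\<in>{n..N}. I k \<omega> * (Y N \<omega> - Y n \<omega>)\<^sup>2) \<partial>M)"
      by (rule Bochner_Integration.integral_sum[OF iI, symmetric])
    also have "\<dots> \<le> (\<integral>\<omega>. (Y N \<omega> - Y n \<omega>)\<^sup>2 \<partial>M)"
    proof (rule integral_mono)
      show "integrable M (\<lambda>\<omega>. \<Sum>k\<in>{n..N}. I k \<omega> * (Y N \<omega> - Y n \<omega>)\<^sup>2)" by (intro Bochner_Integration.integrable_sum iI)
      show "integrable M (\<lambda>\<omega>. (Y N \<omega> - Y n \<omega>)\<^sup>2)"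
        by (rule int[of _ "(2 * C)\<^sup>2"], measurable) (simp only: abs_power2 D2)
      show "(\<Sum>k\<in>{n..N}. I k \<omega> * (Y N \<omega> - Y n \<omega>)\<^sup>2) \<le> (Y N \<omega> - Y n \<omega>)\<^sup>2" for \<omega>
        unfolding sum_distrib_right[symmetric] sumI by simp
    qed
    also have "\<dots> = s N - s n" by (rule diff2[OF nN])
    finally show ?thesis using slim(2)[of N] by linarith
  qed
  have osc: "AE \<omega> in M. \<exists>n. \<forall>k\<ge>n. \<bar>Y k \<omega> - Y n \<omega>\<bar> < \<epsilon>" if \<epsilon>: "\<epsilon> > 0" for \<epsilon>
  proof -
    define H where "H n = {\<omega> \<in> space M. \<exists>k\<ge>n. \<epsilon> \<le> \<bar>Y k \<omega> - Y n \<omega>\<bar>}" for n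
    have [measurable]: "H n \<in> sets M" for n unfolding H_def by measurable
    \<comment> \<open>The maximal inequality is uniform in the window length, so the window can grow
      to infinity before n does.\<close>
    have Hb: "prob (H n) \<le> (slim - s n) / \<epsilon>\<^sup>2" for n
    proof -
      define G where "G N = {\<omega> \<in> space M. \<exists>k\<in>{n..N}. \<epsilon> \<le> \<bar>Y k \<omega> - Y n \<omega>\<bar>}" for N
      have [measurable]: "G N \<in> sets M" for N unfolding G_def by measurable
      have "(\<lambda>N. prob (G N)) \<longlonglongrightarrow> prob (\<Union>N. G N)"
      proof (rule finite_Lim_measure_incseq)
        show "incseq G" by (fastforce simp: incseq_def G_def)
      qed auto
      moreover have "(\<Union>N. G N) = H n" by (fastforce simp: G_def H_def)
      ultimately have "(\<lambda>N. prob (G N)) \<longlonglongrightarrow> prob (H n)" by simp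
      moreover have "prob (G N) \<le> (slim - s n) / \<epsilon>\<^sup>2" if "N \<ge> n" for N
        using maximal[OF \<epsilon> that] \<epsilon> by (simp add: G_def field_simps)
      ultimately show ?thesis by (intro LIMSEQ_le_const2) auto
    qed
    have "prob (\<Inter>n. H n) \<le> (slim - s n) / \<epsilon>\<^sup>2" for n
      by (rule order_trans[OF finite_measure_mono Hb]) auto
    moreover have "(\<lambda>n. (slim - s n) / \<epsilon>\<^sup>2) \<longlonglongrightarrow> (slim - slim) / \<epsilon>\<^sup>2"
      by (intro tendsto_intros slim(1)) (use \<epsilon> in simp)
    ultimately have "prob (\<Inter>n. H n) \<le> 0" by (intro LIMSEQ_le_const[of "\<lambda>n. (slim - s n) / \<epsilon>\<^sup>2" 0]) auto
    then have "prob (\<Inter>n. H n) = 0" using measure_nonneg[of M "\<Inter>n. H n"] by linarith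
    then have "AE \<omega> in M. \<omega> \<notin> (\<Inter>n. H n)"
      by (intro AE_not_in) (simp add: null_sets_def emeasure_eq_measure)
    then show ?thesis
    proof (rule AE_mp, intro AE_I2 impI)
      fix \<omega> assume w: "\<omega> \<in> space M" "\<omega> \<notin> (\<Inter>n. H n)"
      then obtain n where "\<omega> \<notin> H n" by blast
      then have "\<not> (\<exists>k\<ge>n. \<epsilon> \<le> \<bar>Y k \<omega> - Y n \<omega>\<bar>)" using w(1) by (simp add: H_def)
      then show "\<exists>n. \<forall>k\<ge>n. \<bar>Y k \<omega> - Y n \<omega>\<bar> < \<epsilon>" by (meson not_le)
    qed
  qed
  have "AE \<omega> in M. \<forall>i. \<exists>n. \<forall>k\<ge>n. \<bar>Y k \<omega> - Y n \<omega>\<bar> < 1 / real (Suc i)"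
    unfolding AE_all_countable using osc by simp
  then show ?thesis
  proof (rule AE_mp, intro AE_I2 impI)
    fix \<omega> assume h: "\<forall>i. \<exists>n. \<forall>k\<ge>n. \<bar>Y k \<omega> - Y n \<omega>\<bar> < 1 / real (Suc i)"
    have "Cauchy (\<lambda>n. Y n \<omega>)"
      unfolding Cauchy_altdef2
    proof (intro allI impI)
      fix e :: real assume "e > 0"
      then obtain i where i: "1 / real (Suc i) < e" using nat_approx_posE by blast
      obtain n where "\<forall>k\<ge>n. \<bar>Y k \<omega> - Y n \<omega>\<bar> < 1 / real (Suc i)" using h by blast
      then show "\<exists>N. \<forall>n\<ge>N. dist (Y n \<omega>) (Y N \<omega>) < e" using i by (intro exI[of _ n]) (auto simp: dist_real_def intro: less_trans)
    qed
    then show "convergent (\<lambda>n. y n (pre n \<omega>))" by (simp add: Cauchy_convergent_iff Y_def)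
  qed
qed

text \<open>Positive factors disappear under normalisation, and a positive operator of trace zero is
  zero. Normalising at every step thus gives the same state as normalising once at the end.\<close>

lemma normalize_conj:
  assumes "positive_op \<sigma>"
  shows "normalize_op (B ** normalize_op \<sigma> ** dagger B) = normalize_op (B ** \<sigma> ** dagger B)"
proof (cases "Re (trace \<sigma>) = 0")
  case True
  then have "\<sigma> = 0" using norm_positive_le_trace[OF assms] by simp
  then show ?thesis by (simp add: normalize_op_def)
next
  case False
  then have pos: "Re (trace \<sigma>) > 0" using trace_positive_ge_0[OF assms] by simp
  define c where "c = 1 / Re (trace \<sigma>)"
  have c: "c > 0" using pos by (simp add: c_def)
  have "B ** normalize_op \<sigma> ** dagger B = c *\<^sub>R (B ** \<sigma> ** dagger B)"
    by (simp add: normalize_op_def c_def matrix_mult_scaleR_left matrix_mult_scaleR_right)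
  moreover have "normalize_op (c *\<^sub>R X) = normalize_op X" for X :: "complex ^ 'a ^ 'a"
    using c by (simp add: normalize_op_def trace_scaleR)
  ultimately show ?thesis by simp
qed

section \<open>One-step conditioning on the prefix\<close>

context walk_law
begin

definition pre where "pre n \<omega> = (fst \<omega>, map (snd \<omega>) [0..<n])" for \<omega> :: "(real ^ 'd) \<times> (nat \<Rightarrow> 'j)"
text \<open>The trajectory state as a function of start and word, so that every quantity below is an
  observable of the prefix.\<close>

definition st where "st b = normalize_op (sg (fst b) (snd b))" for b :: "(real ^ 'd) \<times> 'j list"

interpretation T: prob_space T by (rule T)

lemma space_T: "space T = V \<times> UNIV"
  using sets_eq_imp_space_eq[OF T(2)] by (simp add: space_traj)

lemma pre_Suc: "pre (Suc n) \<omega> = (fst (pre n \<omega>), snd (pre n \<omega>) @ [snd \<omega> n])"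
  by (simp add: pre_def)

lemma pre_mono: "n \<le> m \<Longrightarrow> \<exists>g. \<forall>\<omega>. pre n \<omega> = g (pre m \<omega>)"
  by (intro exI[of _ "\<lambda>(k, js). (k, take n js)"]) (simp add: pre_def take_map)

lemma traj_state_eq: "fst \<omega> \<in> V \<Longrightarrow> traj_state L \<rho> n \<omega> = st (pre n \<omega>)"
proof (induction n)
  case 0
  then show ?case by (simp add: pre_def st_def sg_def)
next
  case (Suc n)
  have f: "fst (pre n \<omega>) \<in> V" using Suc.prems by (simp add: pre_def)
  have "st (pre (Suc n) \<omega>) = normalize_op (L (snd \<omega> n) ** sg (fst (pre n \<omega>)) (snd (pre n \<omega>)) ** dagger (L (snd \<omega> n)))"
    by (simp add: pre_Suc st_def sg_snoc)
  also have "\<dots> = normalize_op (L (snd \<omega> n) ** st (pre n \<omega>) ** dagger (L (snd \<omega> n)))"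
    unfolding st_def by (rule normalize_conj[OF sg_pos[OF f], symmetric])
  finally show ?case using Suc by simp
qed

lemma st_pos: "fst b \<in> V \<Longrightarrow> positive_op (st b)"
  unfolding st_def normalize_op_def
  using q_nonneg[of "fst b" "snd b"] by (intro positive_scaleR sg_pos) (simp_all add: q_def)

lemma st_trace: "fst b \<in> V \<Longrightarrow> Re (trace (st b)) \<le> 1"
  using q_nonneg[of "fst b" "snd b"] by (simp add: st_def normalize_op_def trace_scaleR q_def)

lemma abs_trace_st: assumes "fst b \<in> V" shows "\<bar>Re (trace (X ** st b))\<bar> \<le> norm X"
proof -
  have "\<bar>Re (trace (X ** st b))\<bar> \<le> norm X * norm (st b)" by (rule abs_trace_le)
  also have "\<dots> \<le> norm X * 1"
    using norm_positive_le_trace[OF st_pos[OF assms]] st_trace[OF assms] by (intro mult_left_mono) auto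
  finally show ?thesis by simp
qed

lemma pre_vimage:
  assumes "fst b \<in> V" "length (snd b) = n"
  shows "pre n -` {b} \<inter> space T = cylinder (fst b) (snd b)"
proof (rule set_eqI)
  fix \<omega> :: "(real ^ 'd) \<times> (nat \<Rightarrow> 'j)"
  have "map (snd \<omega>) [0..<n] = snd b \<longleftrightarrow> (\<forall>i<length (snd b). snd \<omega> i = snd b ! i)"
    using assms(2) by (simp add: list_eq_iff_nth_eq)
  then show "\<omega> \<in> pre n -` {b} \<inter> space T \<longleftrightarrow> \<omega> \<in> cylinder (fst b) (snd b)"
    using assms(1) by (cases \<omega>; cases b) (auto simp: pre_def cylinder_def space_T)
qed

lemma pre_measurable: "pre n \<in> measurable T (count_space UNIV)"
proof -
  let ?A = "V \<times> (UNIV :: 'j list set)"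
  have cA: "countable ?A" using cV by (intro countable_SIGMA) auto
  have "pre n \<in> measurable T (count_space ?A)"
  proof (subst measurable_count_space_eq_countable[OF cA], intro conjI ballI)
    show "pre n \<in> space T \<rightarrow> ?A" by (auto simp: space_T pre_def)
    fix b assume b: "b \<in> ?A"
    show "pre n -` {b} \<inter> space T \<in> sets T"
    proof (cases "length (snd b) = n")
      case True
      have "pre n -` {b} \<inter> space T = cylinder (fst b) (snd b)"
        using b True by (intro pre_vimage) auto
      then show ?thesis using cylinder_sets[of "fst b" "snd b"] b T(2) by auto
    next
      case False
      then have "pre n -` {b} \<inter> space T = {}" by (auto simp: pre_def)
      then show ?thesis by simp
    qed
  qed
  then show ?thesis by (rule measurable_compose) auto
qed

lemma coord_T: "(\<lambda>\<omega>. snd \<omega> n) \<in> measurable T (count_space UNIV)"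
  using coord_measurable by (simp add: measurable_cong_sets[OF T(2) refl])

definition r where "r j b = (if fst b \<in> V then q (fst b) (snd b @ [j]) / q (fst b) (snd b) else 0)" for b :: "(real ^ 'd) \<times> 'j list"

lemma r_nonneg: "0 \<le> r j b"
  by (simp add: r_def q_nonneg)

lemma r_q: "k \<in> V \<Longrightarrow> r j (k, js) * q k js = q k (js @ [j])"
  using q_snoc_le[of k js j] q_nonneg[of k "js @ [j]"] by (auto simp: r_def)

text \<open>The prefix takes countably many values almost surely, so conditioning on it is a
  comparison of atoms: the two weighted push-forwards to the prefixes agree at every point.\<close>

lemma next_letter:
  fixes g :: "(real ^ 'd) \<times> 'j list \<Rightarrow> 'c::{banach, second_countable_topology}"
  shows "(\<integral>\<omega>. indicator {\<omega>. snd \<omega> n = j} \<omega> *\<^sub>R g (pre n \<omega>) \<partial>T) = (\<integral>\<omega>. r j (pre n \<omega>) *\<^sub>R g (pre n \<omega>) \<partial>T)"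
proof -
  have A: "{\<omega> \<in> space T. snd \<omega> n = j} \<in> sets T"
  proof -
    have "(\<lambda>\<omega>. snd \<omega> n) -` {j} \<inter> space T \<in> sets T" by (rule measurable_sets[OF coord_T]) simp
    also have "(\<lambda>\<omega>. snd \<omega> n) -` {j} \<inter> space T = {\<omega> \<in> space T. snd \<omega> n = j}" by auto
    finally show ?thesis .
  qed
  define f1 :: "(real ^ 'd) \<times> (nat \<Rightarrow> 'j) \<Rightarrow> real" where "f1 = indicator {\<omega> \<in> space T. snd \<omega> n = j}"
  define f2 where "f2 \<omega> = r j (pre n \<omega>)" for \<omega>
  have f1m [measurable]: "f1 \<in> borel_measurable T" unfolding f1_def by (rule borel_measurable_indicator[OF A])
  have f2m [measurable]: "f2 \<in> borel_measurable T" unfolding f2_def by (rule measurable_compose[OF pre_measurable]) simp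
  have gm [measurable]: "(\<lambda>\<omega>. g (pre n \<omega>)) \<in> borel_measurable T" by (rule measurable_compose[OF pre_measurable]) simp
  define M1 where "M1 = distr (density T (\<lambda>\<omega>. ennreal (f1 \<omega>))) (count_space UNIV) (pre n)"
  define M2 where "M2 = distr (density T (\<lambda>\<omega>. ennreal (f2 \<omega>))) (count_space UNIV) (pre n)"
  have pm: "pre n \<in> measurable (density T h) (count_space UNIV)" for h using pre_measurable by simp
  have "M1 = M2"
  proof (rule measure_eqI_countable_AE)
    show "sets M1 = UNIV" "sets M2 = UNIV" by (simp_all add: M1_def M2_def)
    let ?A = "V \<times> (UNIV :: 'j list set)"
    show "countable ?A" using cV by (intro countable_SIGMA) auto
    show "AE x in M1. x \<in> ?A" "AE x in M2. x \<in> ?A"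
      unfolding M1_def M2_def by (subst AE_distr_iff[OF pm], simp, rule AE_I2, simp add: space_T pre_def, force)+
    fix b assume b: "b \<in> ?A"
    have em: "emeasure (distr (density T (\<lambda>\<omega>. ennreal (f \<omega>))) (count_space UNIV) (pre n)) {b}
        = (\<integral>\<^sup>+\<omega>. ennreal (f \<omega>) * indicator (pre n -` {b} \<inter> space T) \<omega> \<partial>T)" if [measurable]: "f \<in> borel_measurable T" for f :: "_ \<Rightarrow> real"
      by (subst emeasure_distr[OF pm], simp, subst emeasure_density) (auto intro!: measurable_sets[OF pre_measurable])
    show "emeasure M1 {b} = emeasure M2 {b}"
    proof (cases "length (snd b) = n")
      case True
      have k: "fst b \<in> V" using b by auto
      have cyl: "pre n -` {b} \<inter> space T = cylinder (fst b) (snd b)"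
        using k True by (rule pre_vimage)
      have cyl2: "{\<omega> \<in> space T. snd \<omega> n = j} \<inter> cylinder (fst b) (snd b) = cylinder (fst b) (snd b @ [j])"
        using k True by (auto simp: cylinder_def space_T nth_append less_Suc_eq)
      have cs: "cylinder (fst b) js \<in> sets T" for js using cylinder_sets[OF k] T(2) by simp
      have "emeasure M1 {b} = (\<integral>\<^sup>+\<omega>. indicator (cylinder (fst b) (snd b @ [j])) \<omega> \<partial>T)"
        unfolding M1_def by (subst em, simp) (intro nn_integral_cong, auto simp: cyl cyl2[symmetric] f1_def indicator_def)
      also have "\<dots> = ennreal (q (fst b) (snd b @ [j]))" using cs by (simp add: T.emeasure_eq_measure T(3)[OF k])
      also have "\<dots> = ennreal (r j b) * ennreal (q (fst b) (snd b))"
        using r_q[OF k, of j "snd b"] r_nonneg q_nonneg[OF k] by (simp add: ennreal_mult[symmetric])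
      also have "\<dots> = (\<integral>\<^sup>+\<omega>. ennreal (r j b) * indicator (cylinder (fst b) (snd b)) \<omega> \<partial>T)"
        using cs by (simp add: nn_integral_cmult_indicator T.emeasure_eq_measure T(3)[OF k])
      also have "\<dots> = emeasure M2 {b}"
        unfolding M2_def by (subst em, simp) (intro nn_integral_cong, auto simp: cyl[symmetric] f2_def indicator_def)
      finally show ?thesis .
    next
      case False
      then have "pre n -` {b} \<inter> space T = {}" by (auto simp: pre_def)
      then show ?thesis unfolding M1_def M2_def by (simp add: em)
    qed
  qed
  have "(\<integral>\<omega>. indicator {\<omega>. snd \<omega> n = j} \<omega> *\<^sub>R g (pre n \<omega>) \<partial>T) = (\<integral>\<omega>. f1 \<omega> *\<^sub>R g (pre n \<omega>) \<partial>T)"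
    by (intro Bochner_Integration.integral_cong refl) (auto simp: f1_def indicator_def)
  also have "\<dots> = (\<integral>b. g b \<partial>M1)"
    unfolding M1_def by (subst integral_distr[OF pm], simp, subst integral_density[OF gm f1m]) (auto simp: f1_def)
  also have "\<dots> = (\<integral>\<omega>. f2 \<omega> *\<^sub>R g (pre n \<omega>) \<partial>T)"
    unfolding \<open>M1 = M2\<close> M2_def by (subst integral_distr[OF pm], simp, subst integral_density[OF gm f2m]) (auto simp: f2_def r_nonneg)
  finally show ?thesis by (simp add: f2_def)
qed

text \<open>The transition probability cancels the normalisation of the new state. Where it vanishes
  the new unnormalised state is zero, and so are both sides.\<close>

lemma r_st:
  assumes k: "fst b \<in> V"
  shows "r j b * Re (trace (X ** st (fst b, snd b @ [j]))) = Re (trace ((dagger (L j) ** X ** L j) ** st b))"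
proof (cases "q (fst b) (snd b @ [j]) = 0")
  case True
  have "norm (sg (fst b) (snd b @ [j])) \<le> 0"
    using norm_positive_le_trace[OF sg_pos[OF k, of "snd b @ [j]"]] True by (simp add: q_def)
  then have z: "sg (fst b) (snd b @ [j]) = 0" by simp
  have "trace ((dagger (L j) ** X ** L j) ** sg (fst b) (snd b)) = trace (X ** sg (fst b) (snd b @ [j]))"
    using trace_mul_sym[of "dagger (L j)" "X ** L j ** sg (fst b) (snd b)"] by (simp add: sg_snoc matrix_mul_assoc)
  also have "\<dots> = 0" by (simp add: z trace_def)
  finally show ?thesis using True
    by (simp add: r_def st_def normalize_op_def matrix_mult_scaleR_right trace_scaleR)
next
  case False
  have "trace ((dagger (L j) ** X ** L j) ** sg (fst b) (snd b)) = trace (X ** sg (fst b) (snd b @ [j]))"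
    using trace_mul_sym[of "dagger (L j)" "X ** L j ** sg (fst b) (snd b)"] by (simp add: sg_snoc matrix_mul_assoc)
  then show ?thesis using False k
    by (simp add: r_def st_def normalize_op_def matrix_mult_scaleR_right trace_scaleR q_def[symmetric])
qed

lemma pre_fun_measurable: "(\<lambda>\<omega>. F (pre n \<omega>)) \<in> borel_measurable T"
  for F :: "(real ^ 'd) \<times> 'j list \<Rightarrow> 'c::topological_space"
  by (rule measurable_compose[OF pre_measurable]) simp

lemma pre_fun_integrable:
  fixes F :: "(real ^ 'd) \<times> 'j list \<Rightarrow> 'c::{banach, second_countable_topology}"
  assumes "\<And>b. fst b \<in> V \<Longrightarrow> norm (F b) \<le> B"
  shows "integrable T (\<lambda>\<omega>. F (pre n \<omega>))"
  by (rule T.integrable_const_bound[where B = B, OF AE_I2 pre_fun_measurable])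
     (use assms in \<open>auto simp: space_T pre_def\<close>)

text \<open>One step in the Heisenberg picture: averaging over the letter at time n trades the state
  after the letter for the state before it and conjugates the observable by \<open>L j\<close>. The
  martingale property, the characteristic functions and the mean all come from this
  recursion.\<close>

lemma one_step:
  fixes F :: "(real ^ 'd) \<times> 'j list \<Rightarrow> complex" and h :: "'j \<Rightarrow> complex"
  assumes F: "\<And>b. fst b \<in> V \<Longrightarrow> cmod (F b) \<le> B"
  shows "(\<integral>\<omega>. F (pre n \<omega>) * h (snd \<omega> n) * complex_of_real (Re (trace (X ** st (pre (Suc n) \<omega>)))) \<partial>T)
    = (\<integral>\<omega>. F (pre n \<omega>) * (\<Sum>j\<in>UNIV. h j * complex_of_real (Re (trace ((dagger (L j) ** X ** L j) ** st (pre n \<omega>))))) \<partial>T)"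
proof -
  define g where "g j b = F b * h j * complex_of_real (Re (trace (X ** st (fst b, snd b @ [j]))))" for j b
  define k where "k j b = F b * (h j * complex_of_real (Re (trace ((dagger (L j) ** X ** L j) ** st b))))" for j b
  have B: "B \<ge> 0" using F[of "(0, [])"] V0 norm_ge_zero[of "F (0, [])"] by (simp del: norm_ge_zero)
  have gb: "cmod (g j b) \<le> B * cmod (h j) * norm X" if "fst b \<in> V" for j b
    unfolding g_def norm_mult norm_of_real
    by (intro mult_mono F abs_trace_st) (use that B in auto)
  have kb: "cmod (k j b) \<le> B * (cmod (h j) * norm (dagger (L j) ** X ** L j))" if "fst b \<in> V" for j b
    unfolding k_def norm_mult norm_of_real
    by (intro mult_mono F abs_trace_st) (use that B in auto)
  have gi: "integrable T (\<lambda>\<omega>. indicator {\<omega>. snd \<omega> n = j} \<omega> *\<^sub>R g j (pre n \<omega>))" for j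
  proof -
    \<comment> \<open>Integrability is obtained by viewing the integrand as a function of the prefix
      of length n + 1, whose last letter is the one at time n.\<close>
    have "integrable T (\<lambda>\<omega>. (if last (snd (pre (Suc n) \<omega>)) = j then g j (fst (pre (Suc n) \<omega>), butlast (snd (pre (Suc n) \<omega>))) else 0))"
      by (rule pre_fun_integrable[where F = "\<lambda>b. if last (snd b) = j then g j (fst b, butlast (snd b)) else 0" and B = "B * cmod (h j) * norm X"])
         (use gb B in auto)
    then show ?thesis
      by (rule Bochner_Integration.integrable_cong[OF refl, THEN iffD1, rotated]) (simp add: pre_Suc indicator_def)
  qed
  have "(\<integral>\<omega>. F (pre n \<omega>) * h (snd \<omega> n) * complex_of_real (Re (trace (X ** st (pre (Suc n) \<omega>)))) \<partial>T)
      = (\<integral>\<omega>. (\<Sum>j\<in>UNIV. indicator {\<omega>. snd \<omega> n = j} \<omega> *\<^sub>R g j (pre n \<omega>)) \<partial>T)"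
  proof (intro Bochner_Integration.integral_cong refl)
    fix \<omega>
    have "(\<Sum>j\<in>UNIV. indicator {\<omega>. snd \<omega> n = j} \<omega> *\<^sub>R g j (pre n \<omega>)) = (\<Sum>j\<in>UNIV. if j = snd \<omega> n then g j (pre n \<omega>) else 0)"
      by (intro sum.cong) (auto simp: indicator_def)
    then show "F (pre n \<omega>) * h (snd \<omega> n) * complex_of_real (Re (trace (X ** st (pre (Suc n) \<omega>))))
      = (\<Sum>j\<in>UNIV. indicator {\<omega>. snd \<omega> n = j} \<omega> *\<^sub>R g j (pre n \<omega>))"
      by (simp add: g_def pre_Suc)
  qed
  also have "\<dots> = (\<Sum>j\<in>UNIV. \<integral>\<omega>. indicator {\<omega>. snd \<omega> n = j} \<omega> *\<^sub>R g j (pre n \<omega>) \<partial>T)"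
    by (rule Bochner_Integration.integral_sum[OF gi])
  also have "\<dots> = (\<Sum>j\<in>UNIV. \<integral>\<omega>. k j (pre n \<omega>) \<partial>T)"
  proof (rule sum.cong[OF refl])
    fix j
    have "(\<integral>\<omega>. indicator {\<omega>. snd \<omega> n = j} \<omega> *\<^sub>R g j (pre n \<omega>) \<partial>T) = (\<integral>\<omega>. r j (pre n \<omega>) *\<^sub>R g j (pre n \<omega>) \<partial>T)"
      by (rule next_letter)
    also have "\<dots> = (\<integral>\<omega>. k j (pre n \<omega>) \<partial>T)"
    proof (intro Bochner_Integration.integral_cong refl)
      fix \<omega> assume "\<omega> \<in> space T"
      then have f: "fst (pre n \<omega>) \<in> V" by (auto simp: space_T pre_def)
      show "r j (pre n \<omega>) *\<^sub>R g j (pre n \<omega>) = k j (pre n \<omega>)"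
        unfolding k_def g_def r_st[OF f, symmetric] by (simp add: scaleR_conv_of_real)
    qed
    finally show "(\<integral>\<omega>. indicator {\<omega>. snd \<omega> n = j} \<omega> *\<^sub>R g j (pre n \<omega>) \<partial>T) = (\<integral>\<omega>. k j (pre n \<omega>) \<partial>T)" .
  qed
  also have "\<dots> = (\<integral>\<omega>. (\<Sum>j\<in>UNIV. k j (pre n \<omega>)) \<partial>T)"
    by (rule Bochner_Integration.integral_sum[symmetric]) (rule pre_fun_integrable[OF kb])
  finally show ?thesis by (simp add: k_def sum_distrib_left)
qed

end

section \<open>The Doob transform by the absorption operator\<close>

locale absorbed_walk = walk_law V L \<rho> + min_enclosure L W
  for V :: "(real ^ 'd) set" and L :: "'j::finite \<Rightarrow> complex ^ 'n ^ 'n" and \<rho> and W +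
  assumes pos: "0 < (\<Sum>\<^sub>\<infinity>k\<in>V. Re (trace (absorption L W ** \<rho> k)))"
begin

interpretation T: prob_space T by (rule T)

text \<open>Set to 0 off V so that the bounds hold for every argument, as
  \<open>bounded_martingale_convergent\<close> asks.\<close>

definition y where "y n b = (if fst b \<in> V then Re (trace (A ** st b)) else 0)" for n :: nat and b :: "(real ^ 'd) \<times> 'j list"

lemma mart_eq: "fst \<omega> \<in> V \<Longrightarrow> absorption_mart L \<rho> W n \<omega> = y n (pre n \<omega>)"
  by (simp add: absorption_mart_def A_def[symmetric] traj_state_eq y_def) (simp add: pre_def)

lemma y_range: "0 \<le> y n b" "\<bar>y n b\<bar> \<le> norm A"
  using trace_positive_nonneg[OF A_pos st_pos[of b]] abs_trace_st[of b A] by (auto simp: y_def)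

text \<open>One step conjugates A by the \<open>L j\<close>, and these conjugates sum to A.\<close>

lemma y_martingale:
  fixes F :: "(real ^ 'd) \<times> 'j list \<Rightarrow> complex"
  assumes F: "\<And>b. fst b \<in> V \<Longrightarrow> cmod (F b) \<le> bd"
  shows "(\<integral>\<omega>. F (pre n \<omega>) * complex_of_real (y (Suc n) (pre (Suc n) \<omega>)) \<partial>T) = (\<integral>\<omega>. F (pre n \<omega>) * complex_of_real (y n (pre n \<omega>)) \<partial>T)"
proof -
  have "(\<integral>\<omega>. F (pre n \<omega>) * complex_of_real (y (Suc n) (pre (Suc n) \<omega>)) \<partial>T)
     = (\<integral>\<omega>. F (pre n \<omega>) * 1 * complex_of_real (Re (trace (A ** st (pre (Suc n) \<omega>)))) \<partial>T)"
    by (intro Bochner_Integration.integral_cong refl) (auto simp: y_def pre_def space_T)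
  also have "\<dots> = (\<integral>\<omega>. F (pre n \<omega>) * (\<Sum>j\<in>UNIV. 1 * complex_of_real (Re (trace ((dagger (L j) ** A ** L j) ** st (pre n \<omega>))))) \<partial>T)"
    by (rule one_step[where h = "\<lambda>_. 1", OF F])
  also have "\<dots> = (\<integral>\<omega>. F (pre n \<omega>) * complex_of_real (y n (pre n \<omega>)) \<partial>T)"
  proof (intro Bochner_Integration.integral_cong refl)
    fix \<omega> assume "\<omega> \<in> space T"
    then have "y n (pre n \<omega>) = Re (trace (A ** st (pre n \<omega>)))" by (auto simp: y_def pre_def space_T)
    also have "A ** st (pre n \<omega>) = (\<Sum>j\<in>UNIV. (dagger (L j) ** A ** L j) ** st (pre n \<omega>))"
      using dual_A by (simp add: dual_channel_def matrix_mult_sum_left[symmetric])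
    finally have "y n (pre n \<omega>) = (\<Sum>j\<in>UNIV. Re (trace ((dagger (L j) ** A ** L j) ** st (pre n \<omega>))))"
      by (simp add: trace_sum)
    then show "F (pre n \<omega>) * (\<Sum>j\<in>UNIV. 1 * complex_of_real (Re (trace ((dagger (L j) ** A ** L j) ** st (pre n \<omega>))))) = F (pre n \<omega>) * complex_of_real (y n (pre n \<omega>))"
      by simp
  qed
  finally show ?thesis .
qed

lemma y_martingale_ge:
  fixes F :: "(real ^ 'd) \<times> 'j list \<Rightarrow> complex"
  assumes F: "\<And>b. fst b \<in> V \<Longrightarrow> cmod (F b) \<le> bd" and "n \<le> m"
  shows "(\<integral>\<omega>. F (pre n \<omega>) * complex_of_real (y m (pre m \<omega>)) \<partial>T) = (\<integral>\<omega>. F (pre n \<omega>) * complex_of_real (y n (pre n \<omega>)) \<partial>T)"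
  using assms(2)
proof (induction rule: dec_induct)
  case (step m)
  have g: "pre n \<omega> = (fst (pre m \<omega>), take n (snd (pre m \<omega>)))" for \<omega>
    using step(1) by (simp add: pre_def take_map)
  have "(\<integral>\<omega>. F (fst (pre m \<omega>), take n (snd (pre m \<omega>))) * complex_of_real (y (Suc m) (pre (Suc m) \<omega>)) \<partial>T)
    = (\<integral>\<omega>. F (fst (pre m \<omega>), take n (snd (pre m \<omega>))) * complex_of_real (y m (pre m \<omega>)) \<partial>T)"
    by (rule y_martingale[of "\<lambda>b. F (fst b, take n (snd b))" bd]) (use F in simp)
  then show ?case using step(3) by (simp add: g[symmetric])
qed simp

lemma y_converges: "AE \<omega> in T. convergent (\<lambda>n. y n (pre n \<omega>))"
proof (rule bounded_martingale_convergent[OF T(1) pre_measurable pre_mono y_range(2)])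
  fix n and F :: "(real ^ 'd) \<times> 'j list \<Rightarrow> real" and bd assume F: "\<And>b. \<bar>F b\<bar> \<le> bd"
  have "(\<integral>\<omega>. complex_of_real (F (pre n \<omega>)) * complex_of_real (y (Suc n) (pre (Suc n) \<omega>)) \<partial>T)
    = (\<integral>\<omega>. complex_of_real (F (pre n \<omega>)) * complex_of_real (y n (pre n \<omega>)) \<partial>T)"
    by (rule y_martingale[where bd = bd]) (simp add: F)
  then show "(\<integral>\<omega>. F (pre n \<omega>) * y (Suc n) (pre (Suc n) \<omega>) \<partial>T) = (\<integral>\<omega>. F (pre n \<omega>) * y n (pre n \<omega>) \<partial>T)"
    by (simp only: of_real_mult[symmetric] integral_complex_of_real of_real_eq_iff)
qed

definition c where "c = (\<integral>\<omega>. y 0 (pre 0 \<omega>) \<partial>T)"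

lemma c_eq: "(\<integral>\<omega>. absorption_mart L \<rho> W 0 \<omega> \<partial>T) = c"
  unfolding c_def by (intro Bochner_Integration.integral_cong refl mart_eq) (auto simp: space_T)

text \<open>Some starting point has positive absorption weight, and its length-zero cylinder alone
  already contributes a positive amount.\<close>

lemma c_pos: "c > 0"
proof -
  obtain k where k: "k \<in> V" "Re (trace (A ** \<rho> k)) \<noteq> 0"
  proof -
    have "\<exists>k\<in>V. Re (trace (A ** \<rho> k)) \<noteq> 0"
    proof (rule ccontr)
      assume "\<not> (\<exists>k\<in>V. Re (trace (A ** \<rho> k)) \<noteq> 0)"
      then have "(\<Sum>\<^sub>\<infinity>k\<in>V. Re (trace (A ** \<rho> k))) = 0" by (intro infsum_0) auto
      then show False using pos by (simp add: A_def)
    qed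
    then show ?thesis using that by blast
  qed
  have \<rho>k: "positive_op (\<rho> k)" using init k by (simp add: initial_state_def)
  have Ak: "Re (trace (A ** \<rho> k)) > 0" using trace_positive_nonneg[OF A_pos \<rho>k] k(2) by simp
  have qk: "q k [] > 0"
  proof -
    have "\<bar>Re (trace (A ** \<rho> k))\<bar> \<le> norm A * norm (\<rho> k)" by (rule abs_trace_le)
    then have "\<rho> k \<noteq> 0" using Ak by auto
    then have "0 < norm (\<rho> k)" by simp
    also have "\<dots> \<le> q k []" using norm_positive_le_trace[OF \<rho>k] by (simp only: q_Nil)
    finally show ?thesis .
  qed
  have cs: "cylinder k [] \<in> sets T" using cylinder_sets[OF k(1)] T(2) by simp
  define \<alpha> where "\<alpha> = y 0 (k, [])"
  have al: "\<alpha> > 0"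
    using Ak qk k(1) by (simp add: \<alpha>_def y_def st_def normalize_op_def sg_def q_Nil matrix_mult_scaleR_right trace_scaleR)
  have "0 < \<alpha> * q k []" using al qk by simp
  also have "\<dots> = (\<integral>\<omega>. \<alpha> * indicator (cylinder k []) \<omega> \<partial>T)" using T(3)[OF k(1), of "[]"] cs by simp
  also have "\<dots> \<le> c" unfolding c_def
  proof (rule integral_mono)
    show "integrable T (\<lambda>\<omega>. \<alpha> * indicator (cylinder k []) \<omega>)" using cs by (simp add: T.emeasure_eq_measure)
    show "integrable T (\<lambda>\<omega>. y 0 (pre 0 \<omega>))" by (rule pre_fun_integrable[where B = "norm A"]) (unfold real_norm_def, rule y_range)
    fix \<omega>
    show "\<alpha> * indicator (cylinder k []) \<omega> \<le> y 0 (pre 0 \<omega>)"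
      using y_range(1)[of 0 "pre 0 \<omega>"] by (auto simp: indicator_def cylinder_def pre_def \<alpha>_def)
  qed
  finally show ?thesis .
qed

definition P' where "P' = absorbed_measure V L \<rho> W"

definition Yinf where "Yinf \<omega> = lim (\<lambda>n. y n (pre n \<omega>))"

lemma Yinf_measurable: "Yinf \<in> borel_measurable T"
  unfolding Yinf_def by (rule borel_measurable_lim_metric[OF pre_fun_measurable])

lemma Yinf_AE: "AE \<omega> in T. (\<lambda>n. y n (pre n \<omega>)) \<longlonglongrightarrow> Yinf \<omega>" "AE \<omega> in T. 0 \<le> Yinf \<omega>"
proof -
  show *: "AE \<omega> in T. (\<lambda>n. y n (pre n \<omega>)) \<longlonglongrightarrow> Yinf \<omega>"
    using y_converges by (rule AE_mp) (simp add: convergent_LIMSEQ_iff Yinf_def)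
  show "AE \<omega> in T. 0 \<le> Yinf \<omega>"
    by (rule AE_mp[OF *]) (auto intro!: LIMSEQ_le_const y_range)
qed

lemma P'_eq: "P' = density T (\<lambda>\<omega>. ennreal (Yinf \<omega> / c))"
proof -
  have "P' = density T (\<lambda>\<omega>. ennreal (lim (\<lambda>n. absorption_mart L \<rho> W n \<omega>) / c))"
    unfolding P'_def absorbed_measure_def T_def[symmetric] c_eq ..
  also have "\<dots> = density T (\<lambda>\<omega>. ennreal (Yinf \<omega> / c))"
  proof (rule density_cong)
    have e: "lim (\<lambda>n. absorption_mart L \<rho> W n \<omega>) = Yinf \<omega>" if "\<omega> \<in> space T" for \<omega>
      using that mart_eq by (auto simp: Yinf_def space_T)
    show "AE \<omega> in T. ennreal (lim (\<lambda>n. absorption_mart L \<rho> W n \<omega>) / c) = ennreal (Yinf \<omega> / c)"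
      by (rule AE_I2) (simp add: e)
    show m: "(\<lambda>\<omega>. ennreal (Yinf \<omega> / c)) \<in> borel_measurable T" using Yinf_measurable by measurable
    show "(\<lambda>\<omega>. ennreal (lim (\<lambda>n. absorption_mart L \<rho> W n \<omega>) / c)) \<in> borel_measurable T"
      by (subst measurable_cong[OF arg_cong[where f = "\<lambda>x. ennreal (x / c)", OF e]]) (simp_all add: m)
  qed
  finally show ?thesis .
qed

text \<open>For an observable of the first n letters the limiting density may be replaced by its
  value at time n: the integrals against \<open>y m\<close> are constant for m \<ge> n, and
  dominated convergence carries this to the limit.\<close>

lemma P'_integral:
  fixes F :: "(real ^ 'd) \<times> 'j list \<Rightarrow> complex"
  assumes F: "\<And>b. fst b \<in> V \<Longrightarrow> cmod (F b) \<le> bd"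
  shows "(\<integral>\<omega>. F (pre n \<omega>) \<partial>P') = (\<integral>\<omega>. F (pre n \<omega>) * complex_of_real (y n (pre n \<omega>)) \<partial>T) / complex_of_real c"
proof -
  have bd: "bd \<ge> 0" using F[of "(0, [])"] V0 norm_ge_zero[of "F (0, [])"] by (simp del: norm_ge_zero)
  have conv: "(\<lambda>m. \<integral>\<omega>. F (pre n \<omega>) * complex_of_real (y m (pre m \<omega>)) \<partial>T) \<longlonglongrightarrow> (\<integral>\<omega>. F (pre n \<omega>) * complex_of_real (Yinf \<omega>) \<partial>T)"
  proof (rule integral_dominated_convergence[where w = "\<lambda>_. bd * norm A"])
    show "(\<lambda>\<omega>. F (pre n \<omega>) * complex_of_real (Yinf \<omega>)) \<in> borel_measurable T"
      using pre_fun_measurable[of F n] Yinf_measurable by measurable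
    show "(\<lambda>\<omega>. F (pre n \<omega>) * complex_of_real (y m (pre m \<omega>))) \<in> borel_measurable T" for m
      using pre_fun_measurable[of F n] pre_fun_measurable[of "y m" m] by measurable
    show "AE \<omega> in T. (\<lambda>m. F (pre n \<omega>) * complex_of_real (y m (pre m \<omega>))) \<longlonglongrightarrow> F (pre n \<omega>) * complex_of_real (Yinf \<omega>)"
      by (rule AE_mp[OF Yinf_AE(1)]) (auto intro!: tendsto_intros)
    show "AE \<omega> in T. norm (F (pre n \<omega>) * complex_of_real (y m (pre m \<omega>))) \<le> bd * norm A" for m
    proof (rule AE_I2)
      fix \<omega> assume w: "\<omega> \<in> space T"
      show "norm (F (pre n \<omega>) * complex_of_real (y m (pre m \<omega>))) \<le> bd * norm A"
        unfolding norm_mult norm_of_real by (intro mult_mono F y_range bd) (use w in \<open>auto simp: space_T pre_def\<close>)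
    qed
  qed simp
  have ev: "\<forall>\<^sub>F m in sequentially. (\<integral>\<omega>. F (pre n \<omega>) * complex_of_real (y m (pre m \<omega>)) \<partial>T) = (\<integral>\<omega>. F (pre n \<omega>) * complex_of_real (y n (pre n \<omega>)) \<partial>T)"
    using y_martingale_ge[where F = F and bd = bd and n = n, OF F] unfolding eventually_sequentially by blast
  have lim: "(\<integral>\<omega>. F (pre n \<omega>) * complex_of_real (Yinf \<omega>) \<partial>T) = (\<integral>\<omega>. F (pre n \<omega>) * complex_of_real (y n (pre n \<omega>)) \<partial>T)"
    by (rule LIMSEQ_unique[OF conv tendsto_eventually[OF ev]])
  have "(\<integral>\<omega>. F (pre n \<omega>) \<partial>P') = (\<integral>\<omega>. (Yinf \<omega> / c) *\<^sub>R F (pre n \<omega>) \<partial>T)"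
    unfolding P'_eq
  proof (rule integral_density[OF pre_fun_measurable])
    show "(\<lambda>\<omega>. Yinf \<omega> / c) \<in> borel_measurable T" using Yinf_measurable by measurable
    show "AE \<omega> in T. 0 \<le> Yinf \<omega> / c" by (rule AE_mp[OF Yinf_AE(2)]) (use c_pos in auto)
  qed
  also have "\<dots> = (\<integral>\<omega>. F (pre n \<omega>) * complex_of_real (Yinf \<omega>) / complex_of_real c \<partial>T)"
    by (intro Bochner_Integration.integral_cong refl) (simp add: scaleR_conv_of_real)
  also have "\<dots> = (\<integral>\<omega>. F (pre n \<omega>) * complex_of_real (Yinf \<omega>) \<partial>T) / complex_of_real c" by simp
  finally show ?thesis by (simp add: lim)
qed

text \<open>The constant observable at n = 0: its weighted integral is exactly the normalising
  constant c.\<close>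

lemma P'_prob: "prob_space P'"
proof
  have "(\<integral>\<omega>. (1::complex) \<partial>P') = (\<integral>\<omega>. 1 * complex_of_real (y 0 (pre 0 \<omega>)) \<partial>T) / complex_of_real c"
    by (rule P'_integral[where F = "\<lambda>_. 1" and bd = 1 and n = 0]) simp
  also have "\<dots> = 1" using c_pos by (simp add: c_def[symmetric])
  finally have m: "measure P' (space P') = 1" by (simp add: scaleR_conv_of_real)
  then have "emeasure P' (space P') \<noteq> top" by (auto simp: measure_def)
  then show "emeasure P' (space P') = 1" by (simp add: emeasure_eq_ennreal_measure m)
qed

lemma sets_P': "sets P' = sets T" by (simp add: P'_eq)
end

section \<open>Corrector expansion of the characteristic function\<close>

lemma iexp_remainders:
  "cmod (iexp x - 1) \<le> \<bar>x\<bar>" "cmod (iexp x - (1 + \<i> * x)) \<le> x\<^sup>2 / 2"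
  "cmod (iexp x - (1 + \<i> * x - x\<^sup>2 / 2)) \<le> \<bar>x\<bar> ^ 3 / 6"
  using iexp_approx1[of x 0] iexp_approx1[of x 1] iexp_approx1[of x 2]
  by (simp_all add: eval_nat_numeral algebra_simps)

text \<open>With the correctors included, one step multiplies \<psi> t n by E t up to O(t^3), since
  orders 1 and 2 cancel by \<open>e1\<close> and \<open>e2\<close>. To the same order E t is
  exp(\<i> t m - t^2 Q / 2), and n steps at t = 1 / sqrt n accumulate an error of order n t^3 =
  t.\<close>

lemma corrector_limit:
  fixes \<Phi> :: "real \<Rightarrow> nat \<Rightarrow> 'x::real_normed_vector \<Rightarrow> complex" and K :: "'j::finite \<Rightarrow> 'x \<Rightarrow> 'x"
    and \<alpha> :: "'j \<Rightarrow> real"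
  assumes lin: "\<And>t n. linear (\<Phi> t n)" and bd: "\<And>t n X. cmod (\<Phi> t n X) \<le> norm X"
    and rec: "\<And>t n X. \<Phi> t (Suc n) X = (\<Sum>j\<in>UNIV. iexp (t * \<alpha> j) * \<Phi> t n (K j X))"
    and e0: "(\<Sum>j\<in>UNIV. K j A) = A"
    and e1: "A1 - (\<Sum>j\<in>UNIV. K j A1) = (\<Sum>j\<in>UNIV. \<alpha> j *\<^sub>R K j A) - m *\<^sub>R A"
    and e2: "A2 - (\<Sum>j\<in>UNIV. K j A2) = (\<Sum>j\<in>UNIV. (\<alpha> j)\<^sup>2 *\<^sub>R K j A) + 2 *\<^sub>R (\<Sum>j\<in>UNIV. \<alpha> j *\<^sub>R K j A1)
       - (Q + m\<^sup>2) *\<^sub>R A - (2 * m) *\<^sub>R A1"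
    and init: "\<And>t. \<Phi> t 0 A = c0"
  shows "(\<lambda>n. iexp (- (sqrt (real n) * m)) * \<Phi> (1 / sqrt (real n)) n A) \<longlonglongrightarrow> complex_of_real (exp (- Q / 2)) * c0"
proof -
  define \<psi> where "\<psi> t n = \<Phi> t n A + \<i> * t * \<Phi> t n A1 - t\<^sup>2 / 2 * \<Phi> t n A2" for t n
  \<comment> \<open>Second-order Taylor polynomial of \<open>G t\<close> below; the summand with m
    squared comes from squaring the linear term.\<close>
  define E where "E t = 1 + \<i> * t * m - t\<^sup>2 / 2 * (Q + m\<^sup>2)" for t :: real
  note S = linear_sum[OF lin] and sc = linear_scale[OF lin] and ad = linear_add[OF lin] and df = linear_diff[OF lin]
  define C1 where "C1 = (\<Sum>j\<in>UNIV. \<bar>\<alpha> j\<bar> ^ 3 / 6 * norm (K j A) + (\<alpha> j)\<^sup>2 / 2 * norm (K j A1) + \<bar>\<alpha> j\<bar> / 2 * norm (K j A2))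
     + \<bar>m\<bar> / 2 * norm A2 + \<bar>Q + m\<^sup>2\<bar> / 2 * norm A1 + \<bar>Q + m\<^sup>2\<bar> / 4 * norm A2"
  have step: "cmod (\<psi> t (Suc n) - E t * \<psi> t n) \<le> C1 * \<bar>t\<bar> ^ 3" if t: "\<bar>t\<bar> \<le> 1" for t n
  proof -
    \<comment> \<open>Remainders of order 1, 2 and 3, used with A2, A1 and A in that order, so that
      with the powers of t in front every product is of third order.\<close>
    define r1 where "r1 j = iexp (t * \<alpha> j) - 1" for j
    define r2 where "r2 j = iexp (t * \<alpha> j) - (1 + \<i> * complex_of_real (t * \<alpha> j))" for j
    define r3 where "r3 j = iexp (t * \<alpha> j) - (1 + \<i> * complex_of_real (t * \<alpha> j) - (t * \<alpha> j)\<^sup>2 / 2)" for j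
    define Rem where "Rem = (\<Sum>j\<in>UNIV. r3 j * \<Phi> t n (K j A) + \<i> * t * (r2 j * \<Phi> t n (K j A1)) - t\<^sup>2 / 2 * (r1 j * \<Phi> t n (K j A2)))"
    \<comment> \<open>The negative of the terms of order 3 and 4 in the product of E t and \<psi> t
      n, which are left over after matching orders up to 2.\<close>
    define Tail where "Tail = \<i> * t ^ 3 * m / 2 * \<Phi> t n A2 + \<i> * t ^ 3 / 2 * (Q + m\<^sup>2) * \<Phi> t n A1 - t ^ 4 / 4 * (Q + m\<^sup>2) * \<Phi> t n A2"
    have s0: "(\<Sum>j\<in>UNIV. \<Phi> t n (K j A)) = \<Phi> t n A" unfolding S[symmetric] e0 ..
    have s1: "(\<Sum>j\<in>UNIV. \<Phi> t n (K j A1)) = \<Phi> t n A1 - ((\<Sum>j\<in>UNIV. \<alpha> j * \<Phi> t n (K j A)) - m * \<Phi> t n A)"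
    proof -
      have "\<Phi> t n (A1 - (\<Sum>j\<in>UNIV. K j A1)) = \<Phi> t n ((\<Sum>j\<in>UNIV. \<alpha> j *\<^sub>R K j A) - m *\<^sub>R A)" by (simp only: e1)
      then show ?thesis by (simp add: df S sc scaleR_conv_of_real algebra_simps)
    qed
    have s2: "(\<Sum>j\<in>UNIV. \<Phi> t n (K j A2)) = \<Phi> t n A2 - ((\<Sum>j\<in>UNIV. (\<alpha> j)\<^sup>2 * \<Phi> t n (K j A)) + 2 * (\<Sum>j\<in>UNIV. \<alpha> j * \<Phi> t n (K j A1))
       - (Q + m\<^sup>2) * \<Phi> t n A - 2 * m * \<Phi> t n A1)"
    proof -
      have "\<Phi> t n (A2 - (\<Sum>j\<in>UNIV. K j A2)) = \<Phi> t n ((\<Sum>j\<in>UNIV. (\<alpha> j)\<^sup>2 *\<^sub>R K j A) + 2 *\<^sub>R (\<Sum>j\<in>UNIV. \<alpha> j *\<^sub>R K j A1)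
       - (Q + m\<^sup>2) *\<^sub>R A - (2 * m) *\<^sub>R A1)" by (simp only: e2)
      then show ?thesis by (simp add: df ad S sc scaleR_conv_of_real algebra_simps)
    qed
    have "\<psi> t (Suc n) = (\<Sum>j\<in>UNIV. iexp (t * \<alpha> j) * \<Phi> t n (K j A) + \<i> * t * (iexp (t * \<alpha> j) * \<Phi> t n (K j A1)) - t\<^sup>2 / 2 * (iexp (t * \<alpha> j) * \<Phi> t n (K j A2)))"
      unfolding \<psi>_def rec by (simp only: sum.distrib sum_subtractf sum_distrib_left of_real_divide of_real_power of_real_numeral)
    also have "\<dots> = (\<Sum>j\<in>UNIV. (r3 j * \<Phi> t n (K j A) + \<i> * t * (r2 j * \<Phi> t n (K j A1)) - t\<^sup>2 / 2 * (r1 j * \<Phi> t n (K j A2)))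
        + (\<Phi> t n (K j A) + \<i> * t * (\<alpha> j * \<Phi> t n (K j A)) - t\<^sup>2 / 2 * ((\<alpha> j)\<^sup>2 * \<Phi> t n (K j A))
          + \<i> * t * \<Phi> t n (K j A1) - t\<^sup>2 * (\<alpha> j * \<Phi> t n (K j A1)) - t\<^sup>2 / 2 * \<Phi> t n (K j A2)))"
    proof (rule sum.cong[OF refl])
      fix j
      define z where "z = iexp (t * \<alpha> j)"
      have ii: "\<i> * (\<i> * x) = - x" for x :: complex by (simp add: mult.assoc[symmetric])
      show "iexp (t * \<alpha> j) * \<Phi> t n (K j A) + \<i> * t * (iexp (t * \<alpha> j) * \<Phi> t n (K j A1)) - t\<^sup>2 / 2 * (iexp (t * \<alpha> j) * \<Phi> t n (K j A2))
        = (r3 j * \<Phi> t n (K j A) + \<i> * t * (r2 j * \<Phi> t n (K j A1)) - t\<^sup>2 / 2 * (r1 j * \<Phi> t n (K j A2)))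
        + (\<Phi> t n (K j A) + \<i> * t * (\<alpha> j * \<Phi> t n (K j A)) - t\<^sup>2 / 2 * ((\<alpha> j)\<^sup>2 * \<Phi> t n (K j A))
          + \<i> * t * \<Phi> t n (K j A1) - t\<^sup>2 * (\<alpha> j * \<Phi> t n (K j A1)) - t\<^sup>2 / 2 * \<Phi> t n (K j A2))"
        unfolding r1_def r2_def r3_def z_def[symmetric]
        by (simp add: ii power2_eq_square algebra_simps)
    qed
    also have "\<dots> = Rem + (\<Phi> t n A + \<i> * t * (\<Sum>j\<in>UNIV. \<alpha> j * \<Phi> t n (K j A)) - t\<^sup>2 / 2 * (\<Sum>j\<in>UNIV. (\<alpha> j)\<^sup>2 * \<Phi> t n (K j A))
          + \<i> * t * (\<Sum>j\<in>UNIV. \<Phi> t n (K j A1)) - t\<^sup>2 * (\<Sum>j\<in>UNIV. \<alpha> j * \<Phi> t n (K j A1)) - t\<^sup>2 / 2 * (\<Sum>j\<in>UNIV. \<Phi> t n (K j A2)))"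
      unfolding Rem_def s0[symmetric] by (simp only: sum.distrib sum_subtractf sum_distrib_left of_real_divide of_real_power of_real_numeral)
    also have "\<dots> = E t * \<psi> t n + (Rem + Tail)"
    proof -
      have ii: "\<i> * (\<i> * x) = - x" for x :: complex by (simp add: mult.assoc[symmetric])
      show ?thesis unfolding s1 s2 E_def \<psi>_def Tail_def
        by (simp add: ii algebra_simps power2_eq_square power3_eq_cube power4_eq_xxxx add_divide_distrib diff_divide_distrib)
    qed
    finally have "\<psi> t (Suc n) - E t * \<psi> t n = Rem + Tail" by simp
    moreover have "cmod Rem \<le> \<bar>t\<bar> ^ 3 * (\<Sum>j\<in>UNIV. \<bar>\<alpha> j\<bar> ^ 3 / 6 * norm (K j A) + (\<alpha> j)\<^sup>2 / 2 * norm (K j A1) + \<bar>\<alpha> j\<bar> / 2 * norm (K j A2))"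
      unfolding Rem_def sum_distrib_left
    proof (rule sum_norm_le)
      fix j
      have "cmod (r3 j * \<Phi> t n (K j A)) \<le> (\<bar>t * \<alpha> j\<bar> ^ 3 / 6) * norm (K j A)"
        unfolding norm_mult r3_def by (intro mult_mono bd iexp_remainders(3)) simp_all
      moreover have "cmod (\<i> * t * (r2 j * \<Phi> t n (K j A1))) \<le> \<bar>t\<bar> * ((t * \<alpha> j)\<^sup>2 / 2 * norm (K j A1))"
        unfolding norm_mult r2_def norm_of_real norm_ii mult_1 by (intro mult_left_mono mult_mono bd iexp_remainders(2)) simp_all
      moreover have "cmod (t\<^sup>2 / 2 * (r1 j * \<Phi> t n (K j A2))) \<le> t\<^sup>2 / 2 * (\<bar>t * \<alpha> j\<bar> * norm (K j A2))"
      proof -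
        have "cmod (r1 j * \<Phi> t n (K j A2)) \<le> \<bar>t * \<alpha> j\<bar> * norm (K j A2)"
          unfolding norm_mult r1_def by (intro mult_mono bd iexp_remainders(1)) simp_all
        moreover have "cmod (t\<^sup>2 / 2 * (r1 j * \<Phi> t n (K j A2))) = t\<^sup>2 / 2 * cmod (r1 j * \<Phi> t n (K j A2))"
          by (simp add: norm_mult norm_divide norm_power)
        ultimately show ?thesis by (simp add: mult_left_mono)
      qed
      ultimately have "cmod (r3 j * \<Phi> t n (K j A) + \<i> * t * (r2 j * \<Phi> t n (K j A1)) - t\<^sup>2 / 2 * (r1 j * \<Phi> t n (K j A2)))
        \<le> (\<bar>t * \<alpha> j\<bar> ^ 3 / 6) * norm (K j A) + \<bar>t\<bar> * ((t * \<alpha> j)\<^sup>2 / 2 * norm (K j A1)) + t\<^sup>2 / 2 * (\<bar>t * \<alpha> j\<bar> * norm (K j A2))"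
        by (intro order_trans[OF norm_triangle_ineq4] add_mono order_trans[OF norm_triangle_ineq])
      also have "\<dots> = \<bar>t\<bar> ^ 3 * (\<bar>\<alpha> j\<bar> ^ 3 / 6 * norm (K j A) + (\<alpha> j)\<^sup>2 / 2 * norm (K j A1) + \<bar>\<alpha> j\<bar> / 2 * norm (K j A2))"
      proof -
        have "(t * \<alpha> j)\<^sup>2 = \<bar>t\<bar>\<^sup>2 * (\<alpha> j)\<^sup>2" "t\<^sup>2 = \<bar>t\<bar>\<^sup>2" by (simp_all add: power_mult_distrib)
        then show ?thesis by (simp only: abs_mult) (simp add: power_mult_distrib power3_eq_cube power2_eq_square algebra_simps)
      qed
      finally show "cmod (r3 j * \<Phi> t n (K j A) + \<i> * t * (r2 j * \<Phi> t n (K j A1)) - t\<^sup>2 / 2 * (r1 j * \<Phi> t n (K j A2)))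
        \<le> \<bar>t\<bar> ^ 3 * (\<bar>\<alpha> j\<bar> ^ 3 / 6 * norm (K j A) + (\<alpha> j)\<^sup>2 / 2 * norm (K j A1) + \<bar>\<alpha> j\<bar> / 2 * norm (K j A2))" .
    qed
    moreover have "cmod Tail \<le> \<bar>t\<bar> ^ 3 * (\<bar>m\<bar> / 2 * norm A2 + \<bar>Q + m\<^sup>2\<bar> / 2 * norm A1 + \<bar>Q + m\<^sup>2\<bar> / 4 * norm A2)"
    proof -
      have a: "cmod (\<i> * t ^ 3 * m / 2 * \<Phi> t n A2) \<le> \<bar>t\<bar> ^ 3 * (\<bar>m\<bar> / 2 * norm A2)"
        using mult_left_mono[OF bd[of t n A2], of "\<bar>t\<bar> ^ 3 * (\<bar>m\<bar> / 2)"] by (simp add: norm_mult norm_divide norm_power)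
      have QQ: "cmod (complex_of_real Q + (complex_of_real m)\<^sup>2) = \<bar>Q + m\<^sup>2\<bar>"
        by (simp only: of_real_power[symmetric] of_real_add[symmetric] norm_of_real)
      have b: "cmod (\<i> * t ^ 3 / 2 * (Q + m\<^sup>2) * \<Phi> t n A1) \<le> \<bar>t\<bar> ^ 3 * (\<bar>Q + m\<^sup>2\<bar> / 2 * norm A1)"
        using mult_left_mono[OF bd[of t n A1], of "\<bar>t\<bar> ^ 3 * (\<bar>Q + m\<^sup>2\<bar> / 2)"] by (simp add: norm_mult norm_divide norm_power QQ)
      \<comment> \<open>The fourth-order term is absorbed into the third order, which is where |t|
        \<le> 1 enters.\<close>
      have "\<bar>t\<bar> ^ 4 \<le> \<bar>t\<bar> ^ 3" using t by (intro power_decreasing) auto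
      then have "\<bar>t\<bar> ^ 4 * (\<bar>Q + m\<^sup>2\<bar> / 4 * cmod (\<Phi> t n A2)) \<le> \<bar>t\<bar> ^ 3 * (\<bar>Q + m\<^sup>2\<bar> / 4 * norm A2)"
        by (intro mult_mono bd) auto
      moreover have "cmod (t ^ 4 / 4 * (Q + m\<^sup>2) * \<Phi> t n A2) = \<bar>t\<bar> ^ 4 * (\<bar>Q + m\<^sup>2\<bar> / 4 * cmod (\<Phi> t n A2))"
        by (simp only: norm_mult norm_of_real abs_mult abs_divide power_abs abs_numeral)
      ultimately have d: "cmod (t ^ 4 / 4 * (Q + m\<^sup>2) * \<Phi> t n A2) \<le> \<bar>t\<bar> ^ 3 * (\<bar>Q + m\<^sup>2\<bar> / 4 * norm A2)" by (simp only:)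
      have "cmod Tail \<le> \<bar>t\<bar> ^ 3 * (\<bar>m\<bar> / 2 * norm A2) + \<bar>t\<bar> ^ 3 * (\<bar>Q + m\<^sup>2\<bar> / 2 * norm A1) + \<bar>t\<bar> ^ 3 * (\<bar>Q + m\<^sup>2\<bar> / 4 * norm A2)"
        unfolding Tail_def
        by (intro order_trans[OF norm_triangle_ineq4] add_mono order_trans[OF norm_triangle_ineq] a b d)
      then show ?thesis by (simp only: distrib_left)
    qed
    ultimately show ?thesis
      using norm_triangle_ineq[of Rem Tail] by (simp add: C1_def algebra_simps)
  qed
  define G where "G t = exp (\<i> * t * m - t\<^sup>2 * Q / 2)" for t :: real
  define C2 where "C2 = exp (\<bar>Q\<bar> / 2) * (\<bar>m\<bar> + \<bar>Q\<bar> / 2) ^ 3 / 2 + \<bar>m * Q\<bar> / 2 + Q\<^sup>2 / 8"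
  have EG: "cmod (E t - G t) \<le> C2 * \<bar>t\<bar> ^ 3" if t: "\<bar>t\<bar> \<le> 1" for t
  proof -
    define z where "z = \<i> * t * m - t\<^sup>2 * Q / 2"
    have t2: "t\<^sup>2 \<le> \<bar>t\<bar>" "t\<^sup>2 \<le> 1" using t power_decreasing[of 1 2 "\<bar>t\<bar>"] power_le_one[of "\<bar>t\<bar>" 2] by simp_all
    have "cmod z \<le> cmod (\<i> * t * m) + cmod (complex_of_real (t\<^sup>2 * Q / 2))"
      unfolding z_def by (rule order_trans[OF norm_triangle_ineq4]) simp
    also have "\<dots> = \<bar>t\<bar> * \<bar>m\<bar> + t\<^sup>2 * \<bar>Q\<bar> / 2" by (simp only: norm_of_real) (simp add: norm_mult abs_mult)
    also have "\<dots> \<le> \<bar>t\<bar> * (\<bar>m\<bar> + \<bar>Q\<bar> / 2)"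
      using mult_right_mono[OF t2(1), of "\<bar>Q\<bar> / 2"] by (simp add: distrib_left)
    finally have zb: "cmod z \<le> \<bar>t\<bar> * (\<bar>m\<bar> + \<bar>Q\<bar> / 2)" .
    have "Re z = - (t\<^sup>2 * Q / 2)"
    proof -
      have "z = \<i> * complex_of_real (t * m) - complex_of_real (t\<^sup>2 * Q / 2)" by (simp add: z_def)
      then show ?thesis by (simp only: minus_complex.sel Re_complex_of_real) simp
    qed
    then have Rz: "\<bar>Re z\<bar> \<le> \<bar>Q\<bar> / 2"
      using mult_right_mono[OF t2(2), of "\<bar>Q\<bar> / 2"] by (simp add: abs_mult)
    \<comment> \<open>The complex Taylor bound carries a factor exp |Re z|, controlled by
      \<open>Rz\<close> uniformly in t.\<close>
    have "cmod (exp z - (\<Sum>i\<le>2. z ^ i / fact i)) \<le> exp \<bar>Re z\<bar> * cmod z ^ Suc 2 / fact 2" by (rule Taylor_exp)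
    also have "\<dots> \<le> exp (\<bar>Q\<bar> / 2) * (\<bar>t\<bar> * (\<bar>m\<bar> + \<bar>Q\<bar> / 2)) ^ Suc 2 / fact 2"
      using Rz zb by (intro divide_right_mono mult_mono power_mono) auto
    also have "\<dots> = exp (\<bar>Q\<bar> / 2) * (\<bar>m\<bar> + \<bar>Q\<bar> / 2) ^ 3 / 2 * \<bar>t\<bar> ^ 3"
    proof -
      have "Suc 2 = (3::nat)" by simp
      then show ?thesis by (simp only: power_mult_distrib fact_2) simp
    qed
    also have "(\<Sum>i\<le>2. z ^ i / fact i) = 1 + z + z\<^sup>2 / 2" by (simp add: numeral_2_eq_2)
    also have "1 + z + z\<^sup>2 / 2 = E t + (t ^ 4 * Q\<^sup>2 / 8 - \<i> * t ^ 3 * (m * Q) / 2)"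
    proof -
      have ii: "\<i> * (\<i> * x) = - x" for x :: complex by (simp add: mult.assoc[symmetric])
      show ?thesis unfolding z_def E_def
        by (simp add: ii power2_eq_square power3_eq_cube power4_eq_xxxx algebra_simps add_divide_distrib diff_divide_distrib)
    qed
    finally have 1: "cmod (exp z - (E t + (t ^ 4 * Q\<^sup>2 / 8 - \<i> * t ^ 3 * (m * Q) / 2))) \<le> exp (\<bar>Q\<bar> / 2) * (\<bar>m\<bar> + \<bar>Q\<bar> / 2) ^ 3 / 2 * \<bar>t\<bar> ^ 3" .
    have 2: "cmod (t ^ 4 * Q\<^sup>2 / 8 - \<i> * t ^ 3 * (m * Q) / 2) \<le> Q\<^sup>2 / 8 * \<bar>t\<bar> ^ 3 + \<bar>m * Q\<bar> / 2 * \<bar>t\<bar> ^ 3"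
    proof -
      have "cmod (t ^ 4 * Q\<^sup>2 / 8) = Q\<^sup>2 / 8 * \<bar>t\<bar> ^ 4" by (simp add: norm_mult norm_divide norm_power)
      also have "\<dots> \<le> Q\<^sup>2 / 8 * \<bar>t\<bar> ^ 3" using t by (intro mult_left_mono power_decreasing) auto
      finally have a: "cmod (t ^ 4 * Q\<^sup>2 / 8) \<le> Q\<^sup>2 / 8 * \<bar>t\<bar> ^ 3" .
      have b: "cmod (\<i> * t ^ 3 * (m * Q) / 2) = \<bar>m * Q\<bar> / 2 * \<bar>t\<bar> ^ 3" by (simp add: norm_mult norm_divide norm_power abs_mult)
      show ?thesis using a b by (intro order_trans[OF norm_triangle_ineq4] add_mono) simp_all
    qed
    have "G t = exp z" by (simp add: G_def z_def)
    then have "E t - G t = - (exp z - (E t + (t ^ 4 * Q\<^sup>2 / 8 - \<i> * t ^ 3 * (m * Q) / 2))) - (t ^ 4 * Q\<^sup>2 / 8 - \<i> * t ^ 3 * (m * Q) / 2)" by simp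
    then have "cmod (E t - G t) \<le> cmod (exp z - (E t + (t ^ 4 * Q\<^sup>2 / 8 - \<i> * t ^ 3 * (m * Q) / 2))) + cmod (t ^ 4 * Q\<^sup>2 / 8 - \<i> * t ^ 3 * (m * Q) / 2)"
      by (metis norm_minus_cancel norm_triangle_ineq4)
    then show ?thesis using 1 2 by (simp add: C2_def distrib_right)
  qed
  define C3 where "C3 = norm A + norm A1 + norm A2"
  have near: "cmod (\<psi> t n - \<Phi> t n A) \<le> C3 * \<bar>t\<bar>" if t: "\<bar>t\<bar> \<le> 1" for t n
  proof -
    have t2: "t\<^sup>2 \<le> \<bar>t\<bar>" using t power_decreasing[of 1 2 "\<bar>t\<bar>"] by simp
    have "cmod (\<psi> t n - \<Phi> t n A) \<le> cmod (\<i> * t * \<Phi> t n A1) + cmod (t\<^sup>2 / 2 * \<Phi> t n A2)"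
      unfolding \<psi>_def by (rule order_trans[OF _ norm_triangle_ineq4]) simp
    also have "cmod (\<i> * t * \<Phi> t n A1) \<le> \<bar>t\<bar> * norm A1" using bd[of t n A1] by (simp add: norm_mult mult_left_mono)
    also have "cmod (t\<^sup>2 / 2 * \<Phi> t n A2) \<le> \<bar>t\<bar> * norm A2"
    proof -
      have "cmod (t\<^sup>2 / 2 * \<Phi> t n A2) = t\<^sup>2 / 2 * cmod (\<Phi> t n A2)" by (simp add: norm_mult norm_divide norm_power)
      also have "\<dots> \<le> \<bar>t\<bar> * norm A2" using t2 bd by (intro mult_mono) auto
      finally show ?thesis .
    qed
    also have "\<bar>t\<bar> * norm A1 + \<bar>t\<bar> * norm A2 \<le> C3 * \<bar>t\<bar>" by (simp add: C3_def algebra_simps)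
    finally show ?thesis by simp
  qed
  have \<psi>b: "cmod (\<psi> t n) \<le> C3 + C3" if t: "\<bar>t\<bar> \<le> 1" for t n
  proof -
    have C3: "C3 \<ge> 0" "norm A \<le> C3" by (simp_all add: C3_def)
    have "cmod (\<psi> t n) \<le> cmod (\<Phi> t n A) + cmod (\<psi> t n - \<Phi> t n A)" using norm_triangle_ineq[of "\<Phi> t n A" "\<psi> t n - \<Phi> t n A"] by simp
    also have "\<dots> \<le> C3 + C3 * \<bar>t\<bar>" using bd[of t n A] C3 near[OF t, of n] by linarith
    also have "\<dots> \<le> C3 + C3" using t C3 mult_left_mono[of "\<bar>t\<bar>" 1 C3] by simp
    finally show ?thesis .
  qed
  define C4 where "C4 = C1 + C2 * (C3 + C3)"
  have stepG: "cmod (\<psi> t (Suc n) - G t * \<psi> t n) \<le> C4 * \<bar>t\<bar> ^ 3" if t: "\<bar>t\<bar> \<le> 1" for t n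
  proof -
    have "\<psi> t (Suc n) - G t * \<psi> t n = (\<psi> t (Suc n) - E t * \<psi> t n) + (E t - G t) * \<psi> t n" by (simp add: algebra_simps)
    also have "cmod \<dots> \<le> C1 * \<bar>t\<bar> ^ 3 + (C2 * \<bar>t\<bar> ^ 3) * (C3 + C3)"
    proof (intro order_trans[OF norm_triangle_ineq] add_mono step[OF t])
      show "cmod ((E t - G t) * \<psi> t n) \<le> (C2 * \<bar>t\<bar> ^ 3) * (C3 + C3)"
        unfolding norm_mult using EG[OF t] \<psi>b[OF t]
        by (intro mult_mono) (auto intro: order_trans[OF norm_ge_zero])
    qed
    finally show ?thesis by (simp add: C4_def algebra_simps)
  qed
  have C4: "C4 \<ge> 0"
    using stepG[of 1 0] by (simp add: order_trans[OF norm_ge_zero])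
  \<comment> \<open>One contribution from the n steps, and one each for passing between \<psi> and
    \<Phi> at time n and at time 0.\<close>
  define C5 where "C5 = C4 * exp (\<bar>Q\<bar>) + C3 + exp (- Q / 2) * C3"
  have main: "cmod (iexp (- (sqrt (real n) * m)) * \<Phi> (1 / sqrt (real n)) n A - exp (- Q / 2) * c0) \<le> C5 * (1 / sqrt (real n))"
    if n: "n \<ge> 1" for n
  proof -
    define t where "t = 1 / sqrt (real n)"
    have t0: "t > 0" "t \<le> 1" and tn: "t\<^sup>2 * real n = 1" "t * real n = sqrt (real n)"
      using n by (simp_all add: t_def power_divide real_div_sqrt)
    have t1: "\<bar>t\<bar> \<le> 1" using t0 by simp
    have Gn: "cmod (G t) = exp (- (t\<^sup>2 * Q / 2))"
    proof -
      have "\<i> * t * m - t\<^sup>2 * Q / 2 = \<i> * complex_of_real (t * m) - complex_of_real (t\<^sup>2 * Q / 2)" by simp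
      then have "Re (\<i> * t * m - t\<^sup>2 * Q / 2) = - (t\<^sup>2 * Q / 2)" by (simp only: minus_complex.sel Re_complex_of_real) simp
      then show ?thesis by (simp only: G_def norm_exp_eq_Re)
    qed
    have Gk: "cmod (G t) ^ k = exp (- (t\<^sup>2 * real k * Q / 2))" for k
      unfolding Gn exp_of_nat_mult[symmetric] by (simp add: mult_ac)
    \<comment> \<open>Q has no known sign here, so G t may exceed 1 in modulus; as t^2 k \<le> 1 its
      powers stay bounded all the same. The sign is derived from this very limit in
      \<open>diffusion_psd\<close>.\<close>
    have GkQ: "cmod (G t) ^ k \<le> exp (\<bar>Q\<bar> / 2)" if "k \<le> n" for k
    proof -
      have "t\<^sup>2 * real k \<le> 1" unfolding tn(1)[symmetric] using that by (intro mult_left_mono) auto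
      then have "t\<^sup>2 * real k * \<bar>Q\<bar> \<le> 1 * \<bar>Q\<bar>" by (intro mult_right_mono) auto
      moreover have "- (t\<^sup>2 * real k * Q) \<le> t\<^sup>2 * real k * \<bar>Q\<bar>"
        using mult_left_mono[of "- Q" "\<bar>Q\<bar>" "t\<^sup>2 * real k"] by simp
      ultimately show ?thesis unfolding Gk by simp
    qed
    have dk: "cmod (\<psi> t k - G t ^ k * \<psi> t 0) \<le> real k * (C4 * \<bar>t\<bar> ^ 3 * exp (\<bar>Q\<bar>))" if "k \<le> n" for k
    proof -
      \<comment> \<open>Discrete variation of constants: the error of step i is carried to time k by
        the remaining powers of G t.\<close>
      have tele: "\<psi> t k - G t ^ k * \<psi> t 0 = (\<Sum>i<k. G t ^ (k - Suc i) * (\<psi> t (Suc i) - G t * \<psi> t i))"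
      proof (induction k)
        case (Suc k)
        have "(\<Sum>i<k. G t ^ (Suc k - Suc i) * (\<psi> t (Suc i) - G t * \<psi> t i)) = G t * (\<Sum>i<k. G t ^ (k - Suc i) * (\<psi> t (Suc i) - G t * \<psi> t i))"
          unfolding sum_distrib_left
        proof (rule sum.cong[OF refl])
          fix i assume "i \<in> {..<k}"
          then have "Suc k - Suc i = Suc (k - Suc i)" by simp
          then show "G t ^ (Suc k - Suc i) * (\<psi> t (Suc i) - G t * \<psi> t i) = G t * (G t ^ (k - Suc i) * (\<psi> t (Suc i) - G t * \<psi> t i))" by simp
        qed
        then show ?case unfolding sum.lessThan_Suc Suc[symmetric] by (simp add: algebra_simps)
      qed simp
      have "cmod (G t ^ (k - Suc i) * (\<psi> t (Suc i) - G t * \<psi> t i)) \<le> C4 * \<bar>t\<bar> ^ 3 * exp (\<bar>Q\<bar>)" for i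
      proof -
        have "cmod (G t ^ (k - Suc i)) \<le> exp \<bar>Q\<bar>"
          unfolding norm_power using that by (intro order_trans[OF GkQ]) auto
        then have "cmod (G t ^ (k - Suc i)) * cmod (\<psi> t (Suc i) - G t * \<psi> t i) \<le> exp \<bar>Q\<bar> * (C4 * \<bar>t\<bar> ^ 3)"
          by (intro mult_mono stepG[OF t1]) auto
        then show ?thesis by (simp only: norm_mult mult.commute)
      qed
      then have "cmod (\<Sum>i<k. G t ^ (k - Suc i) * (\<psi> t (Suc i) - G t * \<psi> t i)) \<le> (\<Sum>i<k. C4 * \<bar>t\<bar> ^ 3 * exp (\<bar>Q\<bar>))"
        by (intro sum_norm_le)
      then show ?thesis unfolding tele by simp
    qed
    have d1: "cmod (\<psi> t n - G t ^ n * \<psi> t 0) \<le> C4 * exp (\<bar>Q\<bar>) * t"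
    proof -
      have e: "real n * (C4 * \<bar>t\<bar> ^ 3 * exp (\<bar>Q\<bar>)) = (t\<^sup>2 * real n) * (C4 * exp (\<bar>Q\<bar>) * t)"
        using t0 by (simp add: power3_eq_cube power2_eq_square)
      show ?thesis using dk[OF order_refl] by (simp only: e tn mult_1)
    qed
    define w where "w = iexp (- (sqrt (real n) * m))"
    have w1: "cmod w = 1" by (simp add: w_def)
    \<comment> \<open>At the scale t^2 n = 1 the n-th power of G t is explicit, and the phase w
      cancels the drift without remainder.\<close>
    have wG: "w * G t ^ n = exp (- Q / 2)"
    proof -
      have "real n * (\<i> * t * m - t\<^sup>2 * Q / 2) = \<i> * complex_of_real (t * real n * m) - complex_of_real (t\<^sup>2 * real n * Q / 2)"
        by (simp add: algebra_simps)
      also have "\<dots> = \<i> * complex_of_real (sqrt (real n) * m) - complex_of_real (Q / 2)" by (simp only: tn mult_1)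
      finally have "G t ^ n = exp (\<i> * complex_of_real (sqrt (real n) * m) - complex_of_real (Q / 2))"
        by (simp only: G_def exp_of_nat_mult[symmetric] of_real_of_nat_eq)
      then have "w * G t ^ n = exp (- complex_of_real (Q / 2))" by (simp add: w_def exp_add[symmetric])
      then show ?thesis by (simp add: exp_of_real[symmetric])
    qed
    have "w * \<Phi> t n A - exp (- Q / 2) * c0 = w * (\<psi> t n - G t ^ n * \<psi> t 0) - w * (\<psi> t n - \<Phi> t n A) + exp (- Q / 2) * (\<psi> t 0 - \<Phi> t 0 A)"
      by (simp only: right_diff_distrib mult.assoc[symmetric] wG init) simp
    also have "cmod \<dots> \<le> C4 * exp (\<bar>Q\<bar>) * t + C3 * t + exp (- Q / 2) * (C3 * t)"
    proof (intro order_trans[OF norm_triangle_ineq] add_mono order_trans[OF norm_triangle_ineq4])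
      show "cmod (w * (\<psi> t n - G t ^ n * \<psi> t 0)) \<le> C4 * exp \<bar>Q\<bar> * t" using d1 by (simp add: norm_mult w1)
      show "cmod (w * (\<psi> t n - \<Phi> t n A)) \<le> C3 * t" using near[OF t1, of n] t0 by (simp add: norm_mult w1)
      show "cmod (exp (- Q / 2) * (\<psi> t 0 - \<Phi> t 0 A)) \<le> exp (- Q / 2) * (C3 * t)"
        using near[OF t1, of 0] t0 unfolding norm_mult norm_of_real by simp
    qed
    also have "\<dots> = C5 * t" by (simp add: C5_def algebra_simps)
    finally show ?thesis by (simp add: w_def t_def)
  qed
  have "(\<lambda>n. C5 * (1 / sqrt (real n))) \<longlonglongrightarrow> C5 * 0"
  proof (intro tendsto_mult_left)
    have "(\<lambda>n. sqrt (1 / real n)) \<longlonglongrightarrow> sqrt 0" by (intro tendsto_real_sqrt lim_1_over_n)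
    then show "(\<lambda>n. 1 / sqrt (real n)) \<longlonglongrightarrow> 0" by (simp add: real_sqrt_divide)
  qed
  then have lim: "(\<lambda>n. C5 * (1 / sqrt (real n))) \<longlonglongrightarrow> 0" by simp
  have "(\<lambda>n. iexp (- (sqrt (real n) * m)) * \<Phi> (1 / sqrt (real n)) n A - exp (- Q / 2) * c0) \<longlonglongrightarrow> 0"
    by (rule Lim_null_comparison[OF _ lim]) (use main in \<open>auto simp: eventually_sequentially intro!: exI[of _ 1]\<close>)
  then show ?thesis by (simp only: LIM_zero_iff)
qed

definition displacement :: "('j \<Rightarrow> real ^ 'd) \<Rightarrow> (real ^ 'd) \<times> 'j list \<Rightarrow> real ^ 'd" where
  "displacement s b = sum_list (map s (snd b))"

section \<open>The central limit theorem and the mean displacement\<close>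

context absorbed_walk
begin

lemma position_diff: "position s n \<omega> - position s 0 \<omega> = displacement s (pre n \<omega>)"
  by (induction n) (simp_all add: displacement_def pre_def algebra_simps)

lemma position_step: "position s n \<omega> - position s 0 \<omega> = (\<Sum>i<n. s (snd \<omega> i))"
  by (induction n) (simp_all add: algebra_simps)

text \<open>Characteristic function of the displacement weighted by the observable X. At X = A it is
  c times the characteristic function under \<open>P'\<close>, and \<open>\<Phi>_Suc\<close> makes
  it evolve by the imaginary tilt of the dual channel.\<close>

definition \<Phi> where
  "\<Phi> s w n X = (\<integral>\<omega>. iexp (w \<bullet> displacement s (pre n \<omega>)) * complex_of_real (Re (trace (X ** st (pre n \<omega>)))) \<partial>T)"

lemma \<Phi>_integrable: "integrable T (\<lambda>\<omega>. iexp (w \<bullet> displacement s (pre n \<omega>)) * complex_of_real (Re (trace (X ** st (pre n \<omega>)))))"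
  by (rule pre_fun_integrable[where F = "\<lambda>b. iexp (w \<bullet> displacement s b) * complex_of_real (Re (trace (X ** st b)))" and B = "norm X"])
     (simp add: norm_mult abs_trace_st)

lemma \<Phi>_linear: "linear (\<Phi> s w n)"
proof (rule linearI)
  fix X Z :: "complex ^ 'n ^ 'n" and a :: real
  have "\<Phi> s w n (X + Z) = (\<integral>\<omega>. iexp (w \<bullet> displacement s (pre n \<omega>)) * complex_of_real (Re (trace (X ** st (pre n \<omega>))))
     + iexp (w \<bullet> displacement s (pre n \<omega>)) * complex_of_real (Re (trace (Z ** st (pre n \<omega>)))) \<partial>T)"
    unfolding \<Phi>_def by (intro Bochner_Integration.integral_cong refl) (simp add: matrix_mult_add_left trace_add distrib_left)
  then show "\<Phi> s w n (X + Z) = \<Phi> s w n X + \<Phi> s w n Z"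
    using \<Phi>_integrable by (simp add: \<Phi>_def)
  have "\<Phi> s w n (a *\<^sub>R X) = (\<integral>\<omega>. complex_of_real a * (iexp (w \<bullet> displacement s (pre n \<omega>)) * complex_of_real (Re (trace (X ** st (pre n \<omega>))))) \<partial>T)"
    unfolding \<Phi>_def by (intro Bochner_Integration.integral_cong refl) (simp add: matrix_mult_scaleR_left trace_scaleR)
  then show "\<Phi> s w n (a *\<^sub>R X) = a *\<^sub>R \<Phi> s w n X"
    by (simp add: \<Phi>_def scaleR_conv_of_real)
qed

lemma \<Phi>_bound: "cmod (\<Phi> s w n X) \<le> norm X"
proof -
  interpret T: prob_space T by (rule T)
  have "cmod (\<Phi> s w n X) \<le> (\<integral>\<omega>. cmod (iexp (w \<bullet> displacement s (pre n \<omega>)) * complex_of_real (Re (trace (X ** st (pre n \<omega>))))) \<partial>T)"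
    unfolding \<Phi>_def by (rule integral_norm_bound)
  also have "\<dots> \<le> (\<integral>\<omega>. norm X \<partial>T)"
  proof (rule integral_mono)
    show "integrable T (\<lambda>\<omega>. cmod (iexp (w \<bullet> displacement s (pre n \<omega>)) * complex_of_real (Re (trace (X ** st (pre n \<omega>))))))"
      by (rule integrable_norm[OF \<Phi>_integrable])
    fix \<omega> assume "\<omega> \<in> space T"
    then have "fst (pre n \<omega>) \<in> V" by (auto simp: space_T pre_def)
    then show "cmod (iexp (w \<bullet> displacement s (pre n \<omega>)) * complex_of_real (Re (trace (X ** st (pre n \<omega>))))) \<le> norm X"
      by (simp add: norm_mult abs_trace_st)
  qed simp
  finally show ?thesis by (simp add: T.prob_space)
qed

lemma \<Phi>_Suc: "\<Phi> s w (Suc n) X = (\<Sum>j\<in>UNIV. iexp (w \<bullet> s j) * \<Phi> s w n (dagger (L j) ** X ** L j))"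
proof -
  let ?F = "\<lambda>b. iexp (w \<bullet> displacement s b)"
  have "\<Phi> s w (Suc n) X = (\<integral>\<omega>. ?F (pre n \<omega>) * iexp (w \<bullet> s (snd \<omega> n)) * complex_of_real (Re (trace (X ** st (pre (Suc n) \<omega>)))) \<partial>T)"
    unfolding \<Phi>_def
    by (intro Bochner_Integration.integral_cong refl)
       (simp add: displacement_def pre_Suc inner_add_right exp_add distrib_left)
  also have "\<dots> = (\<integral>\<omega>. ?F (pre n \<omega>) * (\<Sum>j\<in>UNIV. iexp (w \<bullet> s j) * complex_of_real (Re (trace ((dagger (L j) ** X ** L j) ** st (pre n \<omega>))))) \<partial>T)"
    by (rule one_step[where h = "\<lambda>j. iexp (w \<bullet> s j)" and F = ?F and B = 1]) simp
  also have "\<dots> = (\<integral>\<omega>. (\<Sum>j\<in>UNIV. iexp (w \<bullet> s j) * (?F (pre n \<omega>) * complex_of_real (Re (trace ((dagger (L j) ** X ** L j) ** st (pre n \<omega>)))))) \<partial>T)"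
    by (intro Bochner_Integration.integral_cong refl) (simp only: sum_distrib_left mult_ac)
  also have "\<dots> = (\<Sum>j\<in>UNIV. \<integral>\<omega>. iexp (w \<bullet> s j) * (?F (pre n \<omega>) * complex_of_real (Re (trace ((dagger (L j) ** X ** L j) ** st (pre n \<omega>))))) \<partial>T)"
    by (rule Bochner_Integration.integral_sum) (intro integrable_mult_right \<Phi>_integrable)
  also have "\<dots> = (\<Sum>j\<in>UNIV. iexp (w \<bullet> s j) * \<Phi> s w n (dagger (L j) ** X ** L j))"
    unfolding \<Phi>_def by (intro sum.cong refl integral_mult_right_zero)
  finally show ?thesis .
qed

lemma \<Phi>_A: "(\<integral>\<omega>. F (pre n \<omega>) * complex_of_real (y n (pre n \<omega>)) \<partial>T) = (\<integral>\<omega>. F (pre n \<omega>) * complex_of_real (Re (trace (A ** st (pre n \<omega>)))) \<partial>T)"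
  by (intro Bochner_Integration.integral_cong refl) (auto simp: y_def space_T pre_def)

lemma \<Phi>_init: "\<Phi> s w 0 A = complex_of_real c"
proof -
  have "\<Phi> s w 0 A = (\<integral>\<omega>. complex_of_real (y 0 (pre 0 \<omega>)) \<partial>T)"
    unfolding \<Phi>_def by (intro Bochner_Integration.integral_cong refl) (auto simp: y_def space_T pre_def displacement_def)
  then show ?thesis by (simp add: c_def)
qed

lemma char_P': "(\<integral>\<omega>. iexp (w \<bullet> displacement s (pre n \<omega>)) \<partial>P') = \<Phi> s w n A / complex_of_real c"
  unfolding \<Phi>_def \<Phi>_A[where F = "\<lambda>b. iexp (w \<bullet> displacement s b)", symmetric]
  by (rule P'_integral[where F = "\<lambda>b. iexp (w \<bullet> displacement s b)" and bd = 1]) simp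

lemma P'_measurable: "(\<lambda>\<omega>. F (pre n \<omega>)) \<in> borel_measurable P'"
  for F :: "(real ^ 'd) \<times> 'j list \<Rightarrow> 'c::topological_space"
  using pre_fun_measurable[of F n] by (simp add: measurable_cong_sets[OF sets_P' refl])

definition scaled :: "('j \<Rightarrow> real ^ 'd) \<Rightarrow> nat \<Rightarrow> (real ^ 'd) \<times> (nat \<Rightarrow> 'j) \<Rightarrow> real ^ 'd" where
  "scaled s n \<omega> = (1 / sqrt (real n)) *\<^sub>R ((position s n \<omega> - position s 0 \<omega>) - real n *\<^sub>R drift s L W)"

lemma scaled_measurable: "scaled s n \<in> borel_measurable P'"
  unfolding scaled_def[abs_def] position_diff
  by (rule P'_measurable[where F = "\<lambda>b. (1 / sqrt (real n)) *\<^sub>R (displacement s b - real n *\<^sub>R drift s L W)"])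

text \<open>The abstract limit is applied along the ray t u; dividing by c turns averages under
  \<open>T\<close> weighted by A into averages under \<open>P'\<close>.\<close>

lemma char_scaled_limit:
  "(\<lambda>n. \<integral>x. iexp (u \<bullet> x) \<partial>distr P' borel (scaled s n)) \<longlonglongrightarrow> complex_of_real (exp (- (u \<bullet> (diffusion_matrix s L W *v u)) / 2))"
proof -
  define m where "m = u \<bullet> drift s L W"
  define Q where "Q = u \<bullet> (diffusion_matrix s L W *v u)"
  obtain A1 A2 where e: "A1 - dual_channel L A1 = (\<Sum>j\<in>UNIV. (u \<bullet> s j) *\<^sub>R (dagger (L j) ** A ** L j)) - m *\<^sub>R A"
    "A2 - dual_channel L A2 = (\<Sum>j\<in>UNIV. (u \<bullet> s j)\<^sup>2 *\<^sub>R (dagger (L j) ** A ** L j))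
         + 2 *\<^sub>R (\<Sum>j\<in>UNIV. (u \<bullet> s j) *\<^sub>R (dagger (L j) ** A1 ** L j)) - (Q + m\<^sup>2) *\<^sub>R A - (2 * m) *\<^sub>R A1"
    using corrector_equations(2)[of u s] unfolding m_def Q_def by blast
  have "(\<lambda>n. iexp (- (sqrt (real n) * m)) * \<Phi> s ((1 / sqrt (real n)) *\<^sub>R u) n A) \<longlonglongrightarrow> complex_of_real (exp (- Q / 2)) * complex_of_real c"
  proof (rule corrector_limit[where \<Phi> = "\<lambda>t. \<Phi> s (t *\<^sub>R u)" and K = "\<lambda>j X. dagger (L j) ** X ** L j" and \<alpha> = "\<lambda>j. u \<bullet> s j"])
    show "\<Phi> s (t *\<^sub>R u) (Suc n) X = (\<Sum>j\<in>UNIV. iexp (t * (u \<bullet> s j)) * \<Phi> s (t *\<^sub>R u) n (dagger (L j) ** X ** L j))" for t n X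
      by (simp add: \<Phi>_Suc)
    show "(\<Sum>j\<in>UNIV. dagger (L j) ** A ** L j) = A" using dual_A by (simp add: dual_channel_def)
  qed (use e in \<open>simp_all add: \<Phi>_linear \<Phi>_bound \<Phi>_init dual_channel_def\<close>)
  then have "(\<lambda>n. iexp (- (sqrt (real n) * m)) * \<Phi> s ((1 / sqrt (real n)) *\<^sub>R u) n A / complex_of_real c) \<longlonglongrightarrow> complex_of_real (exp (- Q / 2)) * complex_of_real c / complex_of_real c"
    by (intro tendsto_divide tendsto_const) (use c_pos in auto)
  moreover have "(\<integral>x. iexp (u \<bullet> x) \<partial>distr P' borel (scaled s n)) = iexp (- (sqrt (real n) * m)) * \<Phi> s ((1 / sqrt (real n)) *\<^sub>R u) n A / complex_of_real c" for n
  proof -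
    have "(\<integral>x. iexp (u \<bullet> x) \<partial>distr P' borel (scaled s n)) = (\<integral>\<omega>. iexp (u \<bullet> scaled s n \<omega>) \<partial>P')"
      by (rule integral_distr[OF scaled_measurable]) measurable
    also have "\<dots> = (\<integral>\<omega>. iexp (- (sqrt (real n) * m)) * iexp (((1 / sqrt (real n)) *\<^sub>R u) \<bullet> displacement s (pre n \<omega>)) \<partial>P')"
    proof (intro Bochner_Integration.integral_cong refl)
      fix \<omega>
      have "real n * m / sqrt (real n) = sqrt (real n) * m"
        by (simp only: times_divide_eq_left[symmetric] real_div_sqrt of_nat_0_le_iff)
      then have "u \<bullet> scaled s n \<omega> = - (sqrt (real n) * m) + ((1 / sqrt (real n)) *\<^sub>R u) \<bullet> displacement s (pre n \<omega>)"
        unfolding scaled_def position_diff by (simp add: inner_diff_right m_def diff_divide_distrib)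
      then show "iexp (u \<bullet> scaled s n \<omega>) = iexp (- (sqrt (real n) * m)) * iexp (((1 / sqrt (real n)) *\<^sub>R u) \<bullet> displacement s (pre n \<omega>))"
        by (simp only: of_real_add distrib_left exp_add)
    qed
    also have "\<dots> = iexp (- (sqrt (real n) * m)) * (\<integral>\<omega>. iexp (((1 / sqrt (real n)) *\<^sub>R u) \<bullet> displacement s (pre n \<omega>)) \<partial>P')"
      by (rule integral_mult_right_zero)
    finally show ?thesis unfolding char_P' by simp
  qed
  ultimately show ?thesis using c_pos by (simp add: Q_def)
qed

lemma prob_space_scaled: "prob_space (distr P' borel (scaled s n))" for s :: "'j \<Rightarrow> real ^ 'd"
  by (rule prob_space.prob_space_distr[OF P'_prob scaled_measurable])

text \<open>Characteristic functions have modulus at most 1, hence so has their limit, and this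
  forces the exponent to be nonpositive. No variance interpretation of the second derivative is
  needed.\<close>

lemma diffusion_psd: "0 \<le> u \<bullet> (diffusion_matrix s L W *v u)" for s :: "'j \<Rightarrow> real ^ 'd"
proof -
  have "cmod (\<integral>x. iexp (u \<bullet> x) \<partial>distr P' borel (scaled s n)) \<le> 1" for n
  proof -
    interpret N: prob_space "distr P' borel (scaled s n)" by (rule prob_space_scaled)
    have "cmod (\<integral>x. iexp (u \<bullet> x) \<partial>distr P' borel (scaled s n)) \<le> (\<integral>x. cmod (iexp (u \<bullet> x)) \<partial>distr P' borel (scaled s n))"
      by (rule integral_norm_bound)
    also have "\<dots> = 1" using N.prob_space by simp
    finally show ?thesis .
  qed
  then have "cmod (complex_of_real (exp (- (u \<bullet> (diffusion_matrix s L W *v u)) / 2))) \<le> 1"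
    using tendsto_norm[OF char_scaled_limit[where u = u and s = s]] by (intro LIMSEQ_le_const2) auto
  then show ?thesis by simp
qed

lemma central_limit: "weakly_converges (\<lambda>n. distr P' borel (scaled s n)) (gaussian (diffusion_matrix s L W))"
proof (rule levy_continuity_vec)
  note g = char_gaussian[OF corrector_equations(1)[of s] diffusion_psd]
  show "prob_space (distr P' borel (scaled s n))" for n by (rule prob_space_scaled)
  show "prob_space (gaussian (diffusion_matrix s L W))" "sets (gaussian (diffusion_matrix s L W)) = sets borel" by (rule g)+
  show "(\<lambda>n. \<integral>x. iexp (u \<bullet> x) \<partial>distr P' borel (scaled s n)) \<longlonglongrightarrow> (\<integral>x. iexp (u \<bullet> x) \<partial>gaussian (diffusion_matrix s L W))" for u
    unfolding g(3) using char_scaled_limit[where u = u and s = s] by (simp add: exp_of_real)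
qed simp

lemma letter_integrable: "integrable P' (\<lambda>\<omega>. s (snd \<omega> k))" for s :: "'j \<Rightarrow> real ^ 'd"
proof -
  interpret P': prob_space P' by (rule P'_prob)
  have "(\<lambda>\<omega>. s (last (snd (pre (Suc k) \<omega>)))) \<in> borel_measurable P'" by (rule P'_measurable)
  then have "(\<lambda>\<omega>. s (snd \<omega> k)) \<in> borel_measurable P'" by (simp add: pre_Suc)
  then show ?thesis
    by (rule P'.integrable_const_bound[where B = "\<Sum>j\<in>UNIV. norm (s j)", rotated])
       (rule AE_I2, rule member_le_sum[where f = "\<lambda>j. norm (s j)"], auto)
qed

text \<open>At frequency 0 the functional \<Phi> merely averages observables. The equation for A1
  turns the k-th mean increment into m plus a difference of consecutive averages of A1 over c, so
  the sum telescopes to a bounded term.\<close>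

lemma mean_drift:
  fixes s :: "'j \<Rightarrow> real ^ 'd"
  shows "\<exists>C. \<forall>n. \<bar>u \<bullet> (\<integral>\<omega>. (position s n \<omega> - position s 0 \<omega>) \<partial>P') - real n * (u \<bullet> drift s L W)\<bar> \<le> C"
proof -
  interpret P': prob_space P' by (rule P'_prob)
  define m where "m = u \<bullet> drift s L W"
  obtain A1 where e: "A1 - dual_channel L A1 = (\<Sum>j\<in>UNIV. (u \<bullet> s j) *\<^sub>R (dagger (L j) ** A ** L j)) - m *\<^sub>R A"
    using corrector_equations(2)[of u s] unfolding m_def by blast
  define \<phi> where "\<phi> n = \<Phi> s 0 n" for n
  note lin = \<Phi>_linear[of s 0, folded \<phi>_def]
  have \<phi>S: "\<phi> (Suc n) X = \<phi> n (dual_channel L X)" for n X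
    unfolding \<phi>_def \<Phi>_Suc dual_channel_def by (simp add: linear_sum[OF \<Phi>_linear])
  have \<phi>A: "\<phi> n A = c" for n
  proof (induction n)
    case 0
    show ?case by (simp add: \<phi>_def \<Phi>_init)
  next
    case (Suc n)
    then show ?case by (simp add: \<phi>S dual_A)
  qed
  have one: "complex_of_real (u \<bullet> (\<integral>\<omega>. s (snd \<omega> k) \<partial>P')) = (\<phi> k A1 - \<phi> (Suc k) A1) / c + m" for k
  proof -
    have "complex_of_real (u \<bullet> (\<integral>\<omega>. s (snd \<omega> k) \<partial>P')) = (\<integral>\<omega>. complex_of_real (u \<bullet> s (snd \<omega> k)) \<partial>P')"
      by (simp add: integral_inner_right[OF letter_integrable])
    \<comment> \<open>The letter with index k belongs to the prefix of length k + 1, hence the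
      density is taken at that time.\<close>
    also have "\<dots> = (\<integral>\<omega>. complex_of_real (u \<bullet> s (last (snd (pre (Suc k) \<omega>)))) \<partial>P')" by (simp add: pre_Suc)
    also have "\<dots> = (\<integral>\<omega>. complex_of_real (u \<bullet> s (last (snd (pre (Suc k) \<omega>)))) * complex_of_real (y (Suc k) (pre (Suc k) \<omega>)) \<partial>T) / c"
    proof (rule P'_integral[where F = "\<lambda>b. complex_of_real (u \<bullet> s (last (snd b)))" and bd = "\<Sum>j\<in>UNIV. \<bar>u \<bullet> s j\<bar>"])
      show "cmod (complex_of_real (u \<bullet> s (last (snd b)))) \<le> (\<Sum>j\<in>UNIV. \<bar>u \<bullet> s j\<bar>)" for b :: "(real ^ 'd) \<times> 'j list"
        unfolding norm_of_real by (rule member_le_sum) auto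
    qed
    also have "(\<integral>\<omega>. complex_of_real (u \<bullet> s (last (snd (pre (Suc k) \<omega>)))) * complex_of_real (y (Suc k) (pre (Suc k) \<omega>)) \<partial>T)
      = (\<integral>\<omega>. 1 * complex_of_real (u \<bullet> s (snd \<omega> k)) * complex_of_real (Re (trace (A ** st (pre (Suc k) \<omega>)))) \<partial>T)"
      by (intro Bochner_Integration.integral_cong refl) (auto simp: y_def space_T pre_def)
    also have "\<dots> = (\<integral>\<omega>. 1 * (\<Sum>j\<in>UNIV. complex_of_real (u \<bullet> s j) * complex_of_real (Re (trace ((dagger (L j) ** A ** L j) ** st (pre k \<omega>))))) \<partial>T)"
      by (rule one_step[where h = "\<lambda>j. complex_of_real (u \<bullet> s j)" and F = "\<lambda>_. 1" and B = 1]) simp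
    also have "\<dots> = \<phi> k (\<Sum>j\<in>UNIV. (u \<bullet> s j) *\<^sub>R (dagger (L j) ** A ** L j))"
      unfolding \<phi>_def \<Phi>_def
      by (intro Bochner_Integration.integral_cong refl)
         (simp add: matrix_mult_sum_left matrix_mult_scaleR_left trace_sum trace_scaleR)
    also have "(\<Sum>j\<in>UNIV. (u \<bullet> s j) *\<^sub>R (dagger (L j) ** A ** L j)) = A1 - dual_channel L A1 + m *\<^sub>R A"
      by (simp add: e)
    also have "\<phi> k (A1 - dual_channel L A1 + m *\<^sub>R A) = \<phi> k A1 - \<phi> (Suc k) A1 + m * c"
      unfolding linear_add[OF lin] linear_diff[OF lin] linear_scale[OF lin] \<phi>S \<phi>A by (simp add: scaleR_conv_of_real)
    finally show ?thesis using c_pos by (simp add: add_divide_distrib)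
  qed
  have "\<bar>u \<bullet> (\<integral>\<omega>. (position s n \<omega> - position s 0 \<omega>) \<partial>P') - real n * m\<bar> \<le> 2 * norm A1 / c" for n
  proof -
    have "(\<integral>\<omega>. (position s n \<omega> - position s 0 \<omega>) \<partial>P') = (\<Sum>k<n. \<integral>\<omega>. s (snd \<omega> k) \<partial>P')"
      unfolding position_step by (rule Bochner_Integration.integral_sum) (rule letter_integrable)
    then have "complex_of_real (u \<bullet> (\<integral>\<omega>. (position s n \<omega> - position s 0 \<omega>) \<partial>P')) = (\<Sum>k<n. (\<phi> k A1 - \<phi> (Suc k) A1) / c + m)"
      by (simp only: inner_sum_right of_real_sum one)
    also have "\<dots> = (\<phi> 0 A1 - \<phi> n A1) / c + n * m"
      by (simp add: sum.distrib sum_divide_distrib[symmetric] sum_lessThan_telescope'[of "\<lambda>k. \<phi> k A1"])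
    finally have "complex_of_real (u \<bullet> (\<integral>\<omega>. (position s n \<omega> - position s 0 \<omega>) \<partial>P') - real n * m) = (\<phi> 0 A1 - \<phi> n A1) / c" by simp
    from arg_cong[OF this, of cmod]
    have "\<bar>u \<bullet> (\<integral>\<omega>. (position s n \<omega> - position s 0 \<omega>) \<partial>P') - real n * m\<bar> = cmod (\<phi> 0 A1 - \<phi> n A1) / c"
      using c_pos by (simp only: norm_of_real norm_divide abs_of_pos)
    also have "\<dots> \<le> (norm A1 + norm A1) / c"
      using c_pos by (intro divide_right_mono order_trans[OF norm_triangle_ineq4] add_mono) (auto simp: \<phi>_def \<Phi>_bound)
    finally show ?thesis by simp
  qed
  then show ?thesis unfolding m_def by blast
qed

text \<open>Coordinatewise from \<open>mean_drift\<close> along unit vectors; the finitely many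
  constants add up to a bound for the norm.\<close>

lemma mean_asymptotics:
  fixes s :: "'j \<Rightarrow> real ^ 'd"
  shows "(\<lambda>n. norm ((1 / real n) *\<^sub>R (\<integral>\<omega>. (position s n \<omega> - position s 0 \<omega>) \<partial>P') - drift s L W)) \<in> O(\<lambda>n. 1 / real n)"
proof -
  define E where "E n = (\<integral>\<omega>. (position s n \<omega> - position s 0 \<omega>) \<partial>P') - real n *\<^sub>R drift s L W" for n
  have "\<exists>C. \<forall>n. \<bar>E n $ i\<bar> \<le> C" for i
    using mean_drift[of "axis i 1" s] by (simp add: E_def inner_axis' inner_axis)
  then obtain C where C: "\<And>i n. \<bar>E n $ i\<bar> \<le> C i" by metis
  have En: "norm (E n) \<le> (\<Sum>i\<in>UNIV. C i)" for n
    by (rule order_trans[OF norm_le_l1_cart]) (intro sum_mono C)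
  show ?thesis
  proof (rule bigoI[where c = "\<Sum>i\<in>UNIV. C i"])
    show "\<forall>\<^sub>F n in sequentially. norm (norm ((1 / real n) *\<^sub>R (\<integral>\<omega>. (position s n \<omega> - position s 0 \<omega>) \<partial>P') - drift s L W))
      \<le> (\<Sum>i\<in>UNIV. C i) * norm (1 / real n)"
      using eventually_gt_at_top[of 0]
    proof eventually_elim
      case (elim n)
      then have "(1 / real n) *\<^sub>R (\<integral>\<omega>. (position s n \<omega> - position s 0 \<omega>) \<partial>P') - drift s L W = (1 / real n) *\<^sub>R E n"
        by (simp add: E_def scaleR_right_diff_distrib)
      then show ?case using En[of n] elim by (simp add: divide_right_mono)
    qed
  qed
qed

end

lemma countable_locally_finite_lattice:
  assumes "locally_finite_lattice V"
  shows "countable V"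
proof -
  have "V = (\<Union>n. V \<inter> cball 0 (real n))"
  proof -
    have "\<exists>n. x \<in> cball 0 (real n)" for x :: "real ^ 'a"
      using real_arch_simple[of "norm x"] by simp
    then show ?thesis by blast
  qed
  moreover have "countable (\<Union>n. V \<inter> cball 0 (real n))"
    using assms by (intro countable_UN[OF countableI_type] countable_finite) (auto simp: locally_finite_lattice_def)
  ultimately show ?thesis by simp
qed

theorem theorem3p5:
  fixes V :: "(real ^ 'd) set"
    and s :: "'j::finite \<Rightarrow> real ^ 'd"
    and L :: "'j \<Rightarrow> complex ^ 'n ^ 'n"
    and \<rho> :: "real ^ 'd \<Rightarrow> complex ^ 'n ^ 'n"
    and W :: "(complex ^ 'n) set"
  assumes "locally_finite_lattice V"
    and "positively_generated V s"
    and "range s \<noteq> {0}"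
    and "(\<Sum>j\<in>UNIV. dagger (L j) ** L j) = mat 1"
    and "initial_state V \<rho>"
    and "minimal_enclosure L W"
    and "0 < (\<Sum>\<^sub>\<infinity>k\<in>V. Re (trace (absorption L W ** \<rho> k)))"
  shows "weakly_converges
           (\<lambda>n. distr (absorbed_measure V L \<rho> W) borel
              (\<lambda>\<omega>. (1 / sqrt (real n)) *\<^sub>R
                 ((position s n \<omega> - position s 0 \<omega>) - real n *\<^sub>R drift s L W)))
           (gaussian (diffusion_matrix s L W))
       \<and> (\<lambda>n. norm ((1 / real n) *\<^sub>R
            (\<integral>\<omega>. (position s n \<omega> - position s 0 \<omega>) \<partial>absorbed_measure V L \<rho> W) - drift s L W))
         \<in> O(\<lambda>n. 1 / real n)"
proof -
  have "0 \<in> V" using assms(1) by (simp add: locally_finite_lattice_def)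
  then interpret absorbed_walk V L \<rho> W
    using countable_locally_finite_lattice[OF assms(1)] assms(4-7) by unfold_locales
  show ?thesis
    using central_limit[of s] mean_asymptotics[of s] unfolding scaled_def[abs_def] P'_def by blast
qed

end
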